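(* Let $K$ be a totally real number field, let $\mathcal{N}$ be a nonzero integral ideal of $K$, let $k\geq 3$ be an integer, and let $\mathscr{M}_k(\mathcal{N})$ be the space of adelic Hilbert modular forms over $K$ of parallel weight $(k,\dots,k)$, level $\mathcal{N}$ and trivial character. Fix a real number $\epsilon\in\left(0,\frac{5k-7}{10}\right]$. Let $f\in\mathscr{M}_k(\mathcal{N})$, with Fourier coefficients $C(\mathfrak{m},f)$, and suppose that $$|C(\mathfrak{m},f)|\ll_{f,\epsilon} N(\mathfrak{m})^{k-1-\epsilon},$$ that is, there is a constant $c>0$ (depending only on $f$ and $\epsilon$) such that $|C(\mathfrak{m},f)|\leq c\,N(\mathfrak{m})^{k-1-\epsilon}$ for every nonzero integral ideal $\mathfrak{m}$ of $K$. Then $f$ is a cusp form.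
   Context: Let $K$ be a totally real number field of degree $n$ over $\mathbb{Q}$, with ring of integers $\mathcal{O}$, different $\mathfrak{d}$, and group of totally positive units $\mathcal{O}^\times_+$. Let $\mathbb{H}$ be the complex upper half plane. $N(\cdot)$ denotes the absolute norm of ideals. For $\xi\in K$, $\xi\gg 0$ means that $\xi$ is totally positive. The $n$ real embeddings of $K$ are denoted $\xi\mapsto \xi^{(j)}$, $j=1,\dots,n$; for $\tau\in\mathbb{H}^n$ put $\mathrm{tr}(\xi\tau)=\sum_j \xi^{(j)}\tau_j$. Congruence subgroups. For a fractional ideal $\mathcal{I}$ of $K$ and an integral ideal $\mathcal{N}$, let $$\Gamma_0(\mathcal{N},\mathcal{I})=\left\{A=\begin{pmatrix}a&b\\c&d\end{pmatrix}: a,d\in\mathcal{O},\ b\in\mathcal{I}^{-1}\mathfrak{d}^{-1},\ c\in\mathcal{N}\mathcal{I}\mathfrak{d},\ \det A\in\mathcal{O}^\times_+\right\}.$$ Slash action. Here the weight is parallel, $(k,\dots,k)$ with $k$ an integer. For $A=\begin{pmatrix}a&b\\c&d\end{pmatrix}\in GL_2(K)$ with totally positive determinant and $g:\mathbb{H}^n\to\mathbb{C}$, put $$(g\mid A)(\tau)=\left(\prod_{j=1}^n (\det A)^{(j)}\right)^{k/2}\prod_{j=1}^n (c^{(j)}\tau_j+d^{(j)})^{-k}\; g(A\tau),\qquad (A\tau)_j=\frac{a^{(j)}\tau_j+b^{(j)}}{c^{(j)}\tau_j+d^{(j)}}.$$ Classical forms. For $\Gamma=\Gamma_0(\mathcal{N},\mathcal{I})$,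 the space $M_k(\Gamma)$ of classical Hilbert modular forms of weight $(k,\dots,k)$ and trivial character consists of the holomorphic functions $g:\mathbb{H}^n\to\mathbb{C}$ with $g\mid A=g$ for all $A\in\Gamma$ (and, if $n=1$, holomorphic at all cusps in the usual sense). Such a $g$ is a cusp form if for every $A\in GL_2(K)$ with totally positive determinant the constant term of the Fourier expansion of $g\mid A$ is zero. Adelic forms. Fix fractional ideals $\mathcal{I}_1,\dots,\mathcal{I}_h$ representing the strict (narrow) ideal classes of $K$, where $h$ is the strict class number, and put $\Gamma_\lambda=\Gamma_0(\mathcal{N},\mathcal{I}_\lambda)$. The space of adelic Hilbert modular forms of weight $(k,\dots,k)$, level $\mathcal{N}$ and trivial character is $$\mathscr{M}_k(\mathcal{N})=\prod_{\lambda=1}^h M_k(\Gamma_\lambda),$$ so an element is a tuple $f=(f_1,\dots,f_h)$ with $f_\lambda\in M_k(\Gamma_\lambda)$ (these tuples are identified in the standard way with functions on $GL_2(K_{\mathbb{A}})$). The form $f$ is a cusp form if every $f_\lambda$ is a cusp form. Fourier coefficients. Each $f_\lambda$ has a Fourier expansion $$f_\lambda(\tau)=a_\lambda(0)+\sum_{0\ll\xi\in\mathcal{I}_\lambda}a_\lambda(\xi)e^{2\pi i\,\mathrm{tr}(\xi\tau)}.$$ For a nonzero integral ideal $\mathfrak{m}$ there is a unique $\lambda$ for which $\mathfrak{m}=\xi\mathcal{I}_\lambda^{-1}$ with some totally positive $\xi\in\mathcal{I}_\lambda$, and the $\mathfrak{m}$-th Fourier coefficient of $f$ is $$C(\mathfrak{m},f)=N(\mathfrak{m})^{k/2}\,a_\lambda(\xi)\,\left(\prod_{j=1}^n\xi^{(j)}\right)^{-k/2}.$$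 This is independent of the choice of $\xi$. (In Shimura's general normalization there is an additional factor $\xi^{-im}=\prod_j(\xi^{(j)})^{-im_j}$, where $m\in\mathbb{R}^n$ is a fixed vector with $a^{im}=1$ for all $a\in\mathcal{O}^\times_+$; it has absolute value $1$, so it does not affect $|C(\mathfrak{m},f)|$, and here it is taken to be $1$, i.e. $m=0$.) *)

theory Defs
  imports "HOL-Analysis.Analysis" "HOL-Computational_Algebra.Computational_Algebra"
begin

text \<open>
  The number field \<open>K\<close> is a whole type \<open>'a::field_char_0\<close>. Its real embeddings
  \<open>\<xi> \<mapsto> \<xi>\<^sup>(\<^sup>j\<^sup>)\<close> are given by an enumeration \<open>emb :: 'n::finite \<Rightarrow> 'a \<Rightarrow> real\<close>, so that for totally
  real \<open>K\<close> the degree \<open>n\<close> is \<open>CARD('n)\<close>, and points of \<open>\<complex>\<^sup>n\<close> have type \<open>complex^'n\<close>.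
\<close>

section \<open>Totally real number fields\<close>

definition field_embedding :: "('a::field \<Rightarrow> 'b::field) \<Rightarrow> bool" where
  "field_embedding \<phi> \<longleftrightarrow> \<phi> 1 = 1 \<and> (\<forall>x y. \<phi> (x + y) = \<phi> x + \<phi> y) \<and> (\<forall>x y. \<phi> (x * y) = \<phi> x * \<phi> y)"

global_interpretation rat_vs: vector_space "\<lambda>(q::rat) (x::'a::field_char_0). of_rat q * x"
  defines rat_span = rat_vs.span
  by unfold_locales (simp_all add: algebra_simps of_rat_add of_rat_mult)

text \<open>The whole type is a totally real number field, and \<open>emb\<close> lists each real embedding once.\<close>

definition totally_real_number_field :: "('n::finite \<Rightarrow> 'a::field_char_0 \<Rightarrow> real) \<Rightarrow> bool" where
  "totally_real_number_field emb \<longleftrightarrow>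
     (\<exists>B::'a set. finite B \<and> rat_span B = UNIV) \<and>
     (\<forall>\<phi>::'a \<Rightarrow> complex. field_embedding \<phi> \<longrightarrow> range \<phi> \<subseteq> \<real>) \<and>
     bij_betw emb UNIV {\<phi>. field_embedding \<phi>}"

definition totally_positive :: "('n::finite \<Rightarrow> 'a \<Rightarrow> real) \<Rightarrow> 'a \<Rightarrow> bool" where
  "totally_positive emb \<xi> \<longleftrightarrow> (\<forall>j. emb j \<xi> > 0)"

definition ring_of_integers :: "'a::field_char_0 set" where
  "ring_of_integers = {x. algebraic_int x}"

definition totally_positive_units :: "('n::finite \<Rightarrow> 'a::field_char_0 \<Rightarrow> real) \<Rightarrow> 'a set" where
  "totally_positive_units emb =
     {u \<in> ring_of_integers. (\<exists>v\<in>ring_of_integers. u * v = 1) \<and> totally_positive emb u}"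

section \<open>Ideals\<close>

text \<open>Fractional ideals are nonzero by definition.\<close>

definition fractional_ideal :: "'a::field_char_0 set \<Rightarrow> bool" where
  "fractional_ideal J \<longleftrightarrow>
     0 \<in> J \<and> (\<forall>x\<in>J. \<forall>y\<in>J. x + y \<in> J) \<and> (\<forall>r\<in>ring_of_integers. \<forall>x\<in>J. r * x \<in> J) \<and>
     J \<noteq> {0} \<and> (\<exists>r\<in>ring_of_integers. r \<noteq> 0 \<and> (\<forall>x\<in>J. r * x \<in> ring_of_integers))"

definition nonzero_integral_ideal :: "'a::field_char_0 set \<Rightarrow> bool" where
  "nonzero_integral_ideal J \<longleftrightarrow> fractional_ideal J \<and> J \<subseteq> ring_of_integers"

definition ideal_mult :: "'a::field_char_0 set \<Rightarrow> 'a set \<Rightarrow> 'a set" where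
  "ideal_mult I J = {\<Sum>i<m. x i * y i | (m::nat) x y. \<forall>i<m. x i \<in> I \<and> y i \<in> J}"

definition ideal_inverse :: "'a::field_char_0 set \<Rightarrow> 'a set" where
  "ideal_inverse J = {x. \<forall>y\<in>J. x * y \<in> ring_of_integers}"

definition ideal_scale :: "'a::field_char_0 \<Rightarrow> 'a set \<Rightarrow> 'a set" where
  "ideal_scale \<xi> J = (\<lambda>x. \<xi> * x) ` J"

text \<open>The absolute norm: the number of residue classes modulo an integral ideal.\<close>

definition ideal_norm :: "'a::field_char_0 set \<Rightarrow> nat" where
  "ideal_norm J = card (ring_of_integers // {(x, y). x \<in> ring_of_integers \<and> y \<in> ring_of_integers \<and> x - y \<in> J})"

text \<open>
  The different is the inverse of the dual of the ring of integers under the trace form;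
  for totally real \<open>K\<close> the trace is the sum of the real embeddings.
\<close>

definition different :: "('n::finite \<Rightarrow> 'a::field_char_0 \<Rightarrow> real) \<Rightarrow> 'a set" where
  "different emb = ideal_inverse {x. \<forall>y\<in>ring_of_integers. (\<Sum>j\<in>UNIV. emb j (x * y)) \<in> \<int>}"

text \<open>
  \<open>I 1, \<dots>, I h\<close> represent the strict ideal classes, each exactly once
  (so \<open>h\<close> is the strict class number).
\<close>

definition strict_class_reps ::
  "('n::finite \<Rightarrow> 'a::field_char_0 \<Rightarrow> real) \<Rightarrow> nat \<Rightarrow> (nat \<Rightarrow> 'a set) \<Rightarrow> bool" where
  "strict_class_reps emb h I \<longleftrightarrow>
     (\<forall>l\<in>{1..h}. fractional_ideal (I l)) \<and>
     (\<forall>J. fractional_ideal J \<longrightarrow>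
        (\<exists>!l. l \<in> {1..h} \<and> (\<exists>\<xi>. totally_positive emb \<xi> \<and> J = ideal_scale \<xi> (I l))))"

section \<open>Classical Hilbert modular forms\<close>

definition Gamma0 ::
  "('n::finite \<Rightarrow> 'a::field_char_0 \<Rightarrow> real) \<Rightarrow> 'a set \<Rightarrow> 'a set \<Rightarrow> ('a^2^2) set" where
  "Gamma0 emb N I =
     {A. A$1$1 \<in> ring_of_integers \<and> A$2$2 \<in> ring_of_integers \<and>
         A$1$2 \<in> ideal_mult (ideal_inverse I) (ideal_inverse (different emb)) \<and>
         A$2$1 \<in> ideal_mult (ideal_mult N I) (different emb) \<and>
         det A \<in> totally_positive_units emb}"

definition GL2_plus :: "('n::finite \<Rightarrow> 'a::field_char_0 \<Rightarrow> real) \<Rightarrow> ('a^2^2) set" where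
  "GL2_plus emb = {A. totally_positive emb (det A)}"

definition upper_half_space :: "(complex^'n::finite) set" where
  "upper_half_space = {\<tau>. \<forall>j. Im (\<tau>$j) > 0}"

definition moebius ::
  "('n::finite \<Rightarrow> 'a::field_char_0 \<Rightarrow> real) \<Rightarrow> 'a^2^2 \<Rightarrow> complex^'n \<Rightarrow> complex^'n" where
  "moebius emb A \<tau> =
     (\<chi> j. (of_real (emb j (A$1$1)) * \<tau>$j + of_real (emb j (A$1$2))) /
            (of_real (emb j (A$2$1)) * \<tau>$j + of_real (emb j (A$2$2))))"

definition slash ::
  "('n::finite \<Rightarrow> 'a::field_char_0 \<Rightarrow> real) \<Rightarrow> int \<Rightarrow> (complex^'n \<Rightarrow> complex) \<Rightarrow> 'a^2^2 \<Rightarrow>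
     complex^'n \<Rightarrow> complex" where
  "slash emb k g A \<tau> =
     of_real ((\<Prod>j\<in>UNIV. emb j (det A)) powr (of_int k / 2)) *
     (\<Prod>j\<in>UNIV. (of_real (emb j (A$2$1)) * \<tau>$j + of_real (emb j (A$2$2))) powi (- k)) *
     g (moebius emb A \<tau>)"

text \<open>Holomorphy in several variables: the real derivative exists everywhere and is complex linear.\<close>

definition holomorphic_on_upper_half_space :: "(complex^'n::finite \<Rightarrow> complex) \<Rightarrow> bool" where
  "holomorphic_on_upper_half_space g \<longleftrightarrow>
     (\<forall>\<tau>\<in>upper_half_space. \<exists>D. (g has_derivative D) (at \<tau>) \<and> (\<forall>c v. D (c *s v) = c * D v))"

text \<open>
  \<open>g(\<tau>) = a(0) + \<Sum> a(\<xi>) exp(2 \<pi> i tr(\<xi>\<tau>))\<close> on the upper half space, with \<open>\<xi>\<close> running through the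
  totally positive elements of \<open>L\<close>. The values \<open>a(0)\<close> and \<open>a(\<xi>)\<close> at these \<open>\<xi>\<close> are determined by
  \<open>g\<close>; the other values of \<open>a\<close> play no role.
\<close>

definition has_fourier_expansion ::
  "('n::finite \<Rightarrow> 'a::field_char_0 \<Rightarrow> real) \<Rightarrow> 'a set \<Rightarrow> (complex^'n \<Rightarrow> complex) \<Rightarrow> ('a \<Rightarrow> complex) \<Rightarrow> bool" where
  "has_fourier_expansion emb L g a \<longleftrightarrow>
     (\<forall>\<tau>\<in>upper_half_space.
        ((\<lambda>\<xi>. a \<xi> * exp (2 * of_real pi * \<i> * (\<Sum>j\<in>UNIV. of_real (emb j \<xi>) * \<tau>$j)))
          has_sum (g \<tau> - a 0)) {\<xi> \<in> L. totally_positive emb \<xi>})"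

definition fourier_coeff ::
  "('n::finite \<Rightarrow> 'a::field_char_0 \<Rightarrow> real) \<Rightarrow> 'a set \<Rightarrow> (complex^'n \<Rightarrow> complex) \<Rightarrow> 'a \<Rightarrow> complex" where
  "fourier_coeff emb L g = (SOME a. has_fourier_expansion emb L g a)"

text \<open>
  For \<open>n = 1\<close>, holomorphy at the cusps means that every \<open>g | A\<close> has an expansion without
  negative frequencies. The lattice of frequencies of \<open>g | A\<close> depends on \<open>A\<close>, but is always
  contained in some fractional ideal.
\<close>

definition modular_forms ::
  "('n::finite \<Rightarrow> 'a::field_char_0 \<Rightarrow> real) \<Rightarrow> int \<Rightarrow> ('a^2^2) set \<Rightarrow> (complex^'n \<Rightarrow> complex) set" where
  "modular_forms emb k \<Gamma> =
     {g. holomorphic_on_upper_half_space g \<and>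
         (\<forall>A\<in>\<Gamma>. \<forall>\<tau>\<in>upper_half_space. slash emb k g A \<tau> = g \<tau>) \<and>
         (CARD('n) = 1 \<longrightarrow>
            (\<forall>A\<in>GL2_plus emb. \<exists>L a. fractional_ideal L \<and> has_fourier_expansion emb L (slash emb k g A) a))}"

definition cusp_forms ::
  "('n::finite \<Rightarrow> 'a::field_char_0 \<Rightarrow> real) \<Rightarrow> int \<Rightarrow> ('a^2^2) set \<Rightarrow> (complex^'n \<Rightarrow> complex) set" where
  "cusp_forms emb k \<Gamma> =
     {g \<in> modular_forms emb k \<Gamma>.
        \<forall>A\<in>GL2_plus emb. \<exists>L a. fractional_ideal L \<and>
          has_fourier_expansion emb L (slash emb k g A) a \<and> a 0 = 0}"

section \<open>Adelic Hilbert modular forms\<close>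

definition adelic_modular_forms ::
  "('n::finite \<Rightarrow> 'a::field_char_0 \<Rightarrow> real) \<Rightarrow> nat \<Rightarrow> (nat \<Rightarrow> 'a set) \<Rightarrow> int \<Rightarrow> 'a set \<Rightarrow>
     (nat \<Rightarrow> complex^'n \<Rightarrow> complex) set" where
  "adelic_modular_forms emb h I k N = (\<Pi>\<^sub>E l\<in>{1..h}. modular_forms emb k (Gamma0 emb N (I l)))"

definition adelic_cusp_forms ::
  "('n::finite \<Rightarrow> 'a::field_char_0 \<Rightarrow> real) \<Rightarrow> nat \<Rightarrow> (nat \<Rightarrow> 'a set) \<Rightarrow> int \<Rightarrow> 'a set \<Rightarrow>
     (nat \<Rightarrow> complex^'n \<Rightarrow> complex) set" where
  "adelic_cusp_forms emb h I k N =
     {f \<in> adelic_modular_forms emb h I k N.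
        \<forall>l\<in>{1..h}. f l \<in> cusp_forms emb k (Gamma0 emb N (I l))}"

text \<open>
  The coefficient \<open>C(m, f)\<close>: the class index is uniquely determined by \<open>m\<close>, and the value does
  not depend on the choice of \<open>\<xi>\<close>.
\<close>

definition adelic_fourier_coeff ::
  "('n::finite \<Rightarrow> 'a::field_char_0 \<Rightarrow> real) \<Rightarrow> nat \<Rightarrow> (nat \<Rightarrow> 'a set) \<Rightarrow> int \<Rightarrow> 'a set \<Rightarrow>
     (nat \<Rightarrow> complex^'n \<Rightarrow> complex) \<Rightarrow> complex" where
  "adelic_fourier_coeff emb h I k m f =
     (let rep = (\<lambda>l \<xi>. \<xi> \<in> I l \<and> totally_positive emb \<xi> \<and> m = ideal_scale \<xi> (ideal_inverse (I l)));
          l = (THE l. l \<in> {1..h} \<and> (\<exists>\<xi>. rep l \<xi>));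
          \<xi> = (SOME \<xi>. rep l \<xi>)
      in of_real (real (ideal_norm m) powr (of_int k / 2)) * fourier_coeff emb (I l) (f l) \<xi> *
         of_real ((\<Prod>j\<in>UNIV. emb j \<xi>) powr (- (of_int k / 2))))"

end

theory Submission
  imports Defs "HOL-Complex_Analysis.Complex_Analysis" "HOL-Computational_Algebra.Field_as_Ring"
begin

text \<open>
  If the coefficients are small, the form grows slowly at the boundary, and this forces its constant terms
  to vanish. Let \<open>s = k - 1 - \<epsilon>\<close>. The norm of the ideal \<open>\<xi> I\<^sup>-\<^sup>1\<close> is comparable with the norm
  of \<open>\<xi>\<close>, so the hypothesis says \<open>a(\<xi>) = O(N(\<xi>)\<^sup>s)\<close> for every component (lemma
  \<open>fourier_coefficient_bound\<close>). Summing the Fourier series over lattice points gives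
  \<open>O(\<delta> powr -(n * (k - \<epsilon>)))\<close> on the region where all imaginary parts are at least \<open>\<delta>\<close>
  (\<open>growth_of_expansion\<close>). Take a matrix whose lower left entry does not vanish. It sends the point
  with all coordinates \<open>i Y\<close> to a point with imaginary parts of order \<open>1 / Y\<close>, and its automorphy
  factor contributes \<open>Y powr -(n * k)\<close>. Hence the transformed form is \<open>O(Y powr -(n * \<epsilon>))\<close> there
  (\<open>decay_at_cusp\<close>), whereas it tends to its constant term as \<open>Y\<close> grows
  (\<open>constant_term_zero\<close>). A matrix with vanishing lower left entry is first multiplied by an element
  of the congruence subgroup, which leaves the transformed form unchanged (\<open>move_cusp_from_infinity\<close>).

  Most of the work is to provide the expansions. The invertibility of fractional ideals identifies
  the trace dual of the lattice of translations with the ideal of frequencies (\<open>translation_lattice\<close>).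
  A unit that is large at one embedding only (\<open>dominant_unit\<close>) gives the Koecher principle (\<open>koecher\<close>).
  The expansion itself (\<open>tube_fourier_expansion\<close>) comes from mean values over the torus: they do not depend
  on the imaginary part, so the coefficients decay geometrically, and a continuous function on the torus
  without Fourier coefficients vanishes (\<open>vanishing_coefficients_imp_zero\<close>).
\<close>

no_notation fps_nth (infixl \<open>$\<close> 75)

section \<open>Algebraic integers form a ring\<close>

lemma linear_system_elimination:
  fixes v :: "'i \<Rightarrow> 'a::idom" and U C :: "nat \<Rightarrow> 'a set"
  assumes UC: "\<And>d u c. u \<in> U d \<Longrightarrow> c \<in> C d \<Longrightarrow> u - c \<in> U d"
    and UU: "\<And>d e u w. u \<in> U d \<Longrightarrow> w \<in> U e \<Longrightarrow> u * w \<in> U (d + e)"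
    and UmC: "\<And>d e u c. u \<in> U d \<Longrightarrow> c \<in> C e \<Longrightarrow> u * c \<in> C (d + e)"
    and CC: "\<And>d e b c. b \<in> C d \<Longrightarrow> c \<in> C e \<Longrightarrow> b * c \<in> C (d + e)"
    and CpC: "\<And>d b c. b \<in> C d \<Longrightarrow> c \<in> C d \<Longrightarrow> b + c \<in> C d"
    and "finite S" "u \<in> U d" "\<And>i j. i \<in> S \<Longrightarrow> j \<in> S \<Longrightarrow> c i j \<in> C d"
    and "\<And>i. i \<in> S \<Longrightarrow> u * v i = (\<Sum>j\<in>S. c i j * v j)"
  shows "\<exists>e. \<exists>w\<in>U e. \<forall>i\<in>S. w * v i = 0"
  using assms(6-9)
proof (induction S arbitrary: u d c rule: finite_induct)
  case empty
  then show ?case by auto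
next
  case (insert m S)
  define t where "t = u - c m m"
  have t: "t \<in> U d" unfolding t_def using UC insert.prems by auto
  have eqm: "t * v m = (\<Sum>j\<in>S. c m j * v j)"
    using insert.prems(3)[of m] insert.hyps by (simp add: t_def algebra_simps)
  have eqi: "u * t * v i = (\<Sum>j\<in>S. (t * c i j + c i m * c m j) * v j)" if "i \<in> S" for i
  proof -
    have "u * t * v i = t * (u * v i)" by (simp add: algebra_simps)
    also have "u * v i = c i m * v m + (\<Sum>j\<in>S. c i j * v j)"
      using insert.prems(3)[of i] insert.hyps that by simp
    also have "t * (c i m * v m + (\<Sum>j\<in>S. c i j * v j))
        = c i m * (t * v m) + (\<Sum>j\<in>S. t * c i j * v j)"
      by (simp add: algebra_simps sum_distrib_left)
    also have "\<dots> = (\<Sum>j\<in>S. (t * c i j + c i m * c m j) * v j)"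
      unfolding eqm by (simp add: sum_distrib_left sum.distrib distrib_right mult.assoc add.commute)
    finally show ?thesis .
  qed
  have "\<exists>e. \<exists>w\<in>U e. \<forall>i\<in>S. w * v i = 0"
  proof (rule insert.IH[OF _ _ eqi])
    show "u * t \<in> U (d + d)" using UU insert.prems t by auto
    show "t * c i j + c i m * c m j \<in> C (d + d)" if "i \<in> S" "j \<in> S" for i j
      using CpC UmC CC t insert.prems that by auto
  qed
  then obtain e w where w: "w \<in> U e" "\<forall>i\<in>S. w * v i = 0" by auto
  have "w * t * v m = (\<Sum>j\<in>S. c m j * (w * v j))"
    unfolding mult.assoc eqm by (simp add: sum_distrib_left mult_ac)
  then have "w * t * v m = 0" using w by simp
  moreover have "w * t * v i = 0" if "i \<in> S" for i
    using w that by auto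
  ultimately show ?case using UU[OF w(1) t] by blast
qed

definition int_matrix_action :: "'a::field_char_0 \<Rightarrow> 'i set \<Rightarrow> ('i \<Rightarrow> 'a) \<Rightarrow> bool" where
  "int_matrix_action x S v \<longleftrightarrow>
     (\<exists>c. (\<forall>i j. c i j \<in> \<int>) \<and> (\<forall>i\<in>S. x * v i = (\<Sum>j\<in>S. c i j * v j)))"

lemma int_matrix_action_imp_algebraic_int:
  assumes "int_matrix_action x S v" "finite S" "i \<in> S" "v i \<noteq> 0"
  shows "algebraic_int x"
proof -
  obtain c where c: "\<And>i j. c i j \<in> \<int>" "\<And>i. i \<in> S \<Longrightarrow> x * v i = (\<Sum>j\<in>S. c i j * v j)"
    using assms(1) unfolding int_matrix_action_def by blast
  define P where "P = {p::'a poly. \<forall>i. coeff p i \<in> \<int>}"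
  define U where "U d = {poly p x | p. p \<in> P \<and> degree p \<le> d \<and> coeff p d = 1}" for d
  define C where "C d = {poly p x | p. p \<in> P \<and> (p = 0 \<or> degree p < d)}" for d
  have Pm: "p * q \<in> P" if "p \<in> P" "q \<in> P" for p q
    using that unfolding P_def by (auto simp: coeff_mult intro!: Ints_sum Ints_mult)
  have Pa: "p + q \<in> P" "p - q \<in> P" if "p \<in> P" "q \<in> P" for p q
    using that unfolding P_def by auto
  have "\<exists>e. \<exists>w\<in>U e. \<forall>i\<in>S. w * v i = 0"
  proof (rule linear_system_elimination[where C = C and d = 1, OF _ _ _ _ _ assms(2) _ _ c(2)])
    fix d u b assume "u \<in> U d" "b \<in> C d"
    then obtain p q where pq: "p \<in> P" "degree p \<le> d" "coeff p d = 1" "u = poly p x"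
      "q \<in> P" "q = 0 \<or> degree q < d" "b = poly q x" unfolding U_def C_def by blast
    have "p - q \<in> P" using Pa pq by auto
    moreover have "degree (p - q) \<le> d" using pq by (auto intro!: degree_diff_le)
    moreover have "coeff (p - q) d = 1" using pq by (auto simp: coeff_eq_0)
    moreover have "u - b = poly (p - q) x" using pq by simp
    ultimately show "u - b \<in> U d" unfolding U_def by blast
  next
    fix d e u w assume "u \<in> U d" "w \<in> U e"
    then obtain p q where pq: "p \<in> P" "degree p \<le> d" "coeff p d = 1" "u = poly p x"
      "q \<in> P" "degree q \<le> e" "coeff q e = 1" "w = poly q x" unfolding U_def by blast
    have d: "degree p = d" "degree q = e" using pq by (metis le_antisym le_degree zero_neq_one)+
    have "p * q \<in> P" using Pm pq by auto
    moreover have "degree (p * q) \<le> d + e" using degree_mult_le[of p q] d by simp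
    moreover have "coeff (p * q) (d + e) = 1" using coeff_mult_degree_sum[of p q] d pq by simp
    moreover have "u * w = poly (p * q) x" using pq by simp
    ultimately show "u * w \<in> U (d + e)" unfolding U_def by blast
  next
    fix d e u b assume "u \<in> U d" "b \<in> C e"
    then obtain p q where pq: "p \<in> P" "degree p \<le> d" "u = poly p x"
      "q \<in> P" "q = 0 \<or> degree q < e" "b = poly q x" unfolding U_def C_def by blast
    have "p * q \<in> P" using Pm pq by auto
    moreover have "p * q = 0 \<or> degree (p * q) < d + e"
      using degree_mult_le[of p q] pq by (cases "q = 0") auto
    moreover have "u * b = poly (p * q) x" using pq by simp
    ultimately show "u * b \<in> C (d + e)" unfolding C_def by blast
  next
    fix d e u b assume "u \<in> C d" "b \<in> C e"
    then obtain p q where pq: "p \<in> P" "p = 0 \<or> degree p < d" "u = poly p x"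
      "q \<in> P" "q = 0 \<or> degree q < e" "b = poly q x" unfolding C_def by blast
    have "p * q \<in> P" using Pm pq by auto
    moreover have "p * q = 0 \<or> degree (p * q) < d + e"
      using degree_mult_le[of p q] pq by (cases "q = 0"; cases "p = 0") auto
    moreover have "u * b = poly (p * q) x" using pq by simp
    ultimately show "u * b \<in> C (d + e)" unfolding C_def by blast
  next
    fix d u b assume "u \<in> C d" "b \<in> C d"
    then obtain p q where pq: "p \<in> P" "p = 0 \<or> degree p < d" "u = poly p x"
      "q \<in> P" "q = 0 \<or> degree q < d" "b = poly q x" unfolding C_def by blast
    have "p + q \<in> P" using Pa pq by auto
    moreover have "p + q = 0 \<or> degree (p + q) < d"
      using pq degree_add_less[of p d q] by (cases "q = 0"; cases "p = 0") auto
    moreover have "u + b = poly (p + q) x" using pq by simp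
    ultimately show "u + b \<in> C d" unfolding C_def by blast
  next
    have "[:0, 1:] \<in> P" unfolding P_def by (auto simp: coeff_pCons split: nat.splits)
    then show "x \<in> U 1" unfolding U_def by (intro CollectI exI[of _ "[:0, 1:]"]) auto
  next
    fix i j
    have "[:c i j:] \<in> P" using c(1) unfolding P_def by (auto simp: coeff_pCons split: nat.splits)
    then show "c i j \<in> C 1" unfolding C_def by (intro CollectI exI[of _ "[:c i j:]"]) auto
  qed
  then obtain e p where p: "p \<in> P" "degree p \<le> e" "coeff p e = 1" "poly p x * v i = 0"
    unfolding U_def using assms(3) by blast
  have "degree p = e" using p by (metis le_antisym le_degree zero_neq_one)
  then show ?thesis using p assms(4) unfolding P_def by (intro algebraic_int.intros[of p]) auto
qed

lemma int_matrix_action_add: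
  assumes "int_matrix_action x S v" "int_matrix_action y S v"
  shows "int_matrix_action (x + y) S v"
proof -
  obtain c d where "\<forall>i j. c i j \<in> \<int>" "\<forall>i\<in>S. x * v i = (\<Sum>j\<in>S. c i j * v j)"
    "\<forall>i j. d i j \<in> \<int>" "\<forall>i\<in>S. y * v i = (\<Sum>j\<in>S. d i j * v j)"
    using assms unfolding int_matrix_action_def by blast
  then show ?thesis unfolding int_matrix_action_def
    by (intro exI[of _ "\<lambda>i j. c i j + d i j"]) (auto simp: algebra_simps sum.distrib)
qed

lemma int_matrix_action_mult:
  assumes "int_matrix_action x S v" "int_matrix_action y S v"
  shows "int_matrix_action (x * y) S v"
proof -
  obtain c d where cd: "\<forall>i j. c i j \<in> \<int>" "\<forall>i\<in>S. x * v i = (\<Sum>j\<in>S. c i j * v j)"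
    "\<forall>i j. d i j \<in> \<int>" "\<forall>i\<in>S. y * v i = (\<Sum>j\<in>S. d i j * v j)"
    using assms unfolding int_matrix_action_def by blast
  have "x * y * v i = (\<Sum>j\<in>S. (\<Sum>k\<in>S. d i k * c k j) * v j)" if "i \<in> S" for i
  proof -
    have "x * y * v i = x * (\<Sum>k\<in>S. d i k * v k)" using cd that by (simp add: mult.assoc)
    also have "\<dots> = (\<Sum>k\<in>S. d i k * (x * v k))" by (simp add: sum_distrib_left algebra_simps)
    also have "\<dots> = (\<Sum>k\<in>S. \<Sum>j\<in>S. d i k * c k j * v j)"
      using cd by (simp add: sum_distrib_left mult.assoc)
    also have "\<dots> = (\<Sum>j\<in>S. \<Sum>k\<in>S. d i k * c k j * v j)" by (rule sum.swap)
    finally show ?thesis by (simp add: sum_distrib_right)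
  qed
  then show ?thesis unfolding int_matrix_action_def using cd
    by (intro exI[of _ "\<lambda>i j. \<Sum>k\<in>S. d i k * c k j"]) auto
qed

lemma int_matrix_action_powers:
  assumes "algebraic_int x"
  shows "\<exists>m>0. int_matrix_action x {..<m::nat} (\<lambda>i. x ^ i)"
proof -
  obtain p where p: "lead_coeff p = 1" "\<forall>i. coeff p i \<in> \<int>" "poly p x = 0"
    using assms by (auto simp: algebraic_int.simps)
  define m where "m = degree p"
  have m: "m > 0" using p unfolding m_def by (intro Nat.gr0I) (auto elim!: degree_eq_zeroE)
  have xm: "x ^ m = (\<Sum>j<m. - coeff p j * x ^ j)"
  proof -
    have "0 = (\<Sum>j\<le>m. coeff p j * x ^ j)" using p by (simp add: poly_altdef m_def)
    also have "{..m} = insert m {..<m}" by auto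
    finally have "0 = x ^ m + (\<Sum>j<m. coeff p j * x ^ j)" using p by (simp add: m_def)
    then show ?thesis by (simp add: sum_negf eq_neg_iff_add_eq_0)
  qed
  have "x * x ^ i = (\<Sum>j<m. (if i + 1 < m then (if j = i + 1 then 1 else 0) else - coeff p j) * x ^ j)"
    if "i < m" for i
  proof (cases "i + 1 < m")
    case True
    have "(\<Sum>j<m. (if j = i + 1 then 1 else 0) * x ^ j) = (\<Sum>j<m. if j = i + 1 then x ^ j else 0)"
      by (intro sum.cong) auto
    then show ?thesis using True by simp
  next
    case False
    then have "x * x ^ i = x ^ m" using that by (metis Suc_eq_plus1 Suc_lessI power_Suc)
    then show ?thesis using False xm by simp
  qed
  then show ?thesis using m p(2) unfolding int_matrix_action_def
    by (intro exI[of _ m] conjI exI[of _ "\<lambda>i j. if i + 1 < m then (if j = i + 1 then 1 else 0) else - coeff p j"])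
      auto
qed

lemma int_matrix_action_Times:
  assumes "int_matrix_action x S v" "finite S" "finite T"
  shows "int_matrix_action x (S \<times> T) (\<lambda>(s, t). v s * w t)"
    and "int_matrix_action x (T \<times> S) (\<lambda>(t, s). w t * v s)"
proof -
  obtain c where c: "\<forall>i j. c i j \<in> \<int>" "\<forall>i\<in>S. x * v i = (\<Sum>j\<in>S. c i j * v j)"
    using assms unfolding int_matrix_action_def by blast
  have *: "x * (v s * w t) = (\<Sum>s'\<in>S. \<Sum>t'\<in>T. (if t' = t then c s s' else 0) * (v s' * w t'))"
    if "s \<in> S" "t \<in> T" for s t
  proof -
    have "(\<Sum>t'\<in>T. (if t' = t then c s s' else 0) * (v s' * w t')) = c s s' * (v s' * w t)" for s'
      using that assms(3) by (subst sum.mono_neutral_right[of T "{t}"]) auto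
    moreover have "x * (v s * w t) = (\<Sum>s'\<in>S. c s s' * v s') * w t"
      using c(2) that by (metis mult.assoc)
    ultimately show ?thesis by (simp add: sum_distrib_right mult.assoc)
  qed
  show "int_matrix_action x (S \<times> T) (\<lambda>(s, t). v s * w t)"
    unfolding int_matrix_action_def
    using * c(1) by (intro exI[of _ "\<lambda>(s,t) (s',t'). if t' = t then c s s' else 0"])
      (auto simp: sum.cartesian_product')
  have "x * (w t * v s) = (\<Sum>t'\<in>T. \<Sum>s'\<in>S. (if t' = t then c s s' else 0) * (w t' * v s'))"
    if "s \<in> S" "t \<in> T" for s t
    using *[OF that] by (subst sum.swap) (simp add: mult_ac)
  then show "int_matrix_action x (T \<times> S) (\<lambda>(t, s). w t * v s)"
    unfolding int_matrix_action_def
    using c(1) by (intro exI[of _ "\<lambda>(t,s) (t',s'). if t' = t then c s s' else 0"])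
      (auto simp: sum.cartesian_product')
qed

lemma algebraic_int_add_mult:
  fixes x y :: "'a::field_char_0"
  assumes "algebraic_int x" "algebraic_int y"
  shows "algebraic_int (x + y)" "algebraic_int (x * y)"
proof -
  obtain m n where mn: "m > 0" "int_matrix_action x {..<m::nat} (\<lambda>i. x ^ i)"
    "n > 0" "int_matrix_action y {..<n::nat} (\<lambda>i. y ^ i)"
    using int_matrix_action_powers assms by blast
  let ?S = "{..<m} \<times> {..<n}" and ?v = "\<lambda>(i, j). x ^ i * y ^ j"
  have "int_matrix_action x ?S ?v" "int_matrix_action y ?S ?v"
    using mn int_matrix_action_Times by blast+
  then have "int_matrix_action (x + y) ?S ?v" "int_matrix_action (x * y) ?S ?v"
    using int_matrix_action_add int_matrix_action_mult by blast+
  moreover have "(0,0) \<in> ?S" "finite ?S" "?v (0,0) \<noteq> 0" using mn by auto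
  ultimately show "algebraic_int (x + y)" "algebraic_int (x * y)"
    using int_matrix_action_imp_algebraic_int by metis+
qed

lemma algebraic_int_sum:
  "(\<And>i. i \<in> A \<Longrightarrow> algebraic_int (f i)) \<Longrightarrow> algebraic_int (sum f A :: 'a::field_char_0)"
  by (induction A rule: infinite_finite_induct) (auto intro: algebraic_int_add_mult)

lemma algebraic_int_prod:
  "(\<And>i. i \<in> A \<Longrightarrow> algebraic_int (f i)) \<Longrightarrow> algebraic_int (prod f A :: 'a::field_char_0)"
  by (induction A rule: infinite_finite_induct) (auto intro: algebraic_int_add_mult)

section \<open>Embeddings of a totally real field\<close>

lemma field_embedding_simps:
  assumes "field_embedding \<phi>"
  shows "\<phi> 0 = 0" "\<phi> 1 = 1" "\<phi> (x + y) = \<phi> x + \<phi> y" "\<phi> (x * y) = \<phi> x * \<phi> y"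
    "\<phi> (- x) = - \<phi> x" "\<phi> (x - y) = \<phi> x - \<phi> y" "\<phi> (sum f A) = (\<Sum>i\<in>A. \<phi> (f i))"
    "\<phi> (prod f A) = (\<Prod>i\<in>A. \<phi> (f i))" "\<phi> (x ^ k) = \<phi> x ^ k" "\<phi> (of_nat k) = of_nat k"
    "\<phi> (of_int m) = of_int m" "\<phi> (inverse x) = inverse (\<phi> x)" "\<phi> (x / y) = \<phi> x / \<phi> y"
    "\<phi> x = 0 \<longleftrightarrow> x = 0"
proof -
  note h = assms[unfolded field_embedding_def]
  have a: "\<phi> (x + y) = \<phi> x + \<phi> y" and m: "\<phi> (x * y) = \<phi> x * \<phi> y" and o: "\<phi> 1 = 1" for x y
    using h by auto
  show z: "\<phi> 0 = 0" using a[of 0 0] by (metis add.right_neutral add_left_cancel)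
  show "\<phi> 1 = 1" "\<phi> (x + y) = \<phi> x + \<phi> y" "\<phi> (x * y) = \<phi> x * \<phi> y" by (fact o a m)+
  show mi: "\<phi> (- x) = - \<phi> x" for x using a[of x "- x"] z by (simp add: eq_neg_iff_add_eq_0 add.commute)
  show "\<phi> (x - y) = \<phi> x - \<phi> y" using a[of x "- y"] mi[of y] by simp
  show "\<phi> (sum f A) = (\<Sum>i\<in>A. \<phi> (f i))"
    by (induction A rule: infinite_finite_induct) (auto simp: z a)
  show "\<phi> (prod f A) = (\<Prod>i\<in>A. \<phi> (f i))"
    by (induction A rule: infinite_finite_induct) (auto simp: o m)
  show "\<phi> (x ^ k) = \<phi> x ^ k" by (induction k) (auto simp: o m)
  show n: "\<phi> (of_nat k) = of_nat k" for k by (induction k) (auto simp: o a z)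
  show "\<phi> (of_int m) = of_int m" by (cases m rule: int_cases2) (auto simp: n mi)
  have nz: "\<phi> x = 0 \<longleftrightarrow> x = 0" for x
    using m[of x "inverse x"] o z by (cases "x = 0") auto
  then show "\<phi> x = 0 \<longleftrightarrow> x = 0" .
  show i: "\<phi> (inverse x) = inverse (\<phi> x)" for x
  proof (cases "x = 0")
    case False
    have "\<phi> (inverse x) * \<phi> x = 1" using m[of "inverse x" x] False o by simp
    then show ?thesis by (metis inverse_unique mult.commute)
  qed (simp add: z)
  show "\<phi> (x / y) = \<phi> x / \<phi> y" by (simp add: divide_inverse m i)
qed

lemma field_embedding_of_rat:
  fixes \<phi> :: "'a::field_char_0 \<Rightarrow> 'b::field_char_0"
  assumes "field_embedding \<phi>"
  shows "\<phi> (of_rat q) = of_rat q"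
  by (cases q) (simp add: of_rat_rat field_embedding_simps[OF assms])

lemma field_embedding_algebraic_int_iff:
  fixes \<phi> :: "'a::field_char_0 \<Rightarrow> 'b::field_char_0"
  assumes "field_embedding \<phi>"
  shows "algebraic_int (\<phi> x) \<longleftrightarrow> algebraic_int x"
proof -
  have "poly (map_poly of_int p) (\<phi> x) = \<phi> (poly (map_poly of_int p) x)" for p
    by (simp add: poly_altdef degree_map_poly coeff_map_poly field_embedding_simps[OF assms])
  then show ?thesis
    by (simp add: algebraic_int_altdef_ipoly field_embedding_simps[OF assms])
qed

locale totally_real_field =
  fixes emb :: "'n::finite \<Rightarrow> 'a::field_char_0 \<Rightarrow> real"
  assumes totally_real: "totally_real_number_field emb"
begin

lemma field_embedding_emb: "field_embedding (emb j)"
  using totally_real unfolding totally_real_number_field_def by (auto simp: bij_betw_def)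

lemmas emb_simps [simp] = field_embedding_simps[OF field_embedding_emb]
  field_embedding_of_rat[OF field_embedding_emb]
  field_embedding_algebraic_int_iff[OF field_embedding_emb]

lemma emb_eq_iff [simp]: "emb j x = emb j y \<longleftrightarrow> x = y"
  using emb_simps(14)[of j "x - y"] by (simp del: emb_simps(14))

lemma inj_emb: "inj emb"
  using totally_real unfolding totally_real_number_field_def by (auto simp: bij_betw_def)

lemma emb_surj:
  fixes \<phi> :: "'a \<Rightarrow> complex"
  assumes "field_embedding \<phi>"
  shows "\<exists>j. \<phi> = (\<lambda>x. of_real (emb j x))"
proof -
  have r: "range \<phi> \<subseteq> \<real>" and b: "range emb = {\<phi>. field_embedding \<phi>}"
    using totally_real assms unfolding totally_real_number_field_def by (auto simp: bij_betw_def)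
  have im: "Im (\<phi> x) = 0" for x using r by (auto simp: image_subset_iff complex_is_Real_iff)
  then have eq: "\<phi> x = of_real (Re (\<phi> x))" for x by (simp add: complex_eq_iff)
  have "field_embedding (\<lambda>x. Re (\<phi> x))"
    unfolding field_embedding_def by (simp add: field_embedding_simps[OF assms] im)
  then have "(\<lambda>x. Re (\<phi> x)) \<in> range emb" using b by simp
  then obtain j where "emb j = (\<lambda>x. Re (\<phi> x))" by (metis imageE)
  then show ?thesis using eq by (intro exI[of _ j]) auto
qed

lemma finite_rat_spanning: "\<exists>B::'a set. finite B \<and> rat_span B = UNIV"
  using totally_real unfolding totally_real_number_field_def by blast

definition rat_linear :: "('a \<Rightarrow> complex) \<Rightarrow> bool" where
  "rat_linear w \<longleftrightarrow> (\<forall>x y. w (x + y) = w x + w y) \<and> (\<forall>q x. w (of_rat q * x) = of_rat q * w x)"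

lemma rat_linear_sum:
  assumes "rat_linear w"
  shows "w (sum f A) = (\<Sum>i\<in>A. w (f i))"
proof -
  have "w 0 = 0" using assms unfolding rat_linear_def by (metis mult_zero_left of_rat_0)
  then show ?thesis using assms unfolding rat_linear_def
    by (induction A rule: infinite_finite_induct) auto
qed

lemma map_poly_of_rat_mult:
  "map_poly of_rat (p * q) = (map_poly of_rat p * map_poly of_rat q :: 'b::field_char_0 poly)"
  by (auto simp: poly_eq_iff coeff_map_poly coeff_mult of_rat_sum of_rat_mult)

lemma map_poly_of_rat_add:
  "map_poly of_rat (p + q) = (map_poly of_rat p + map_poly of_rat q :: 'b::field_char_0 poly)"
  by (auto simp: poly_eq_iff coeff_map_poly of_rat_add)

lemma map_poly_of_rat_pderiv:
  "map_poly of_rat (pderiv p) = (pderiv (map_poly of_rat p) :: 'b::field_char_0 poly)"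
  by (auto simp: poly_eq_iff coeff_map_poly coeff_pderiv of_rat_mult of_rat_add)

lemma rational_annihilator:
  fixes x :: 'a
  shows "\<exists>p::rat poly. p \<noteq> 0 \<and> poly (map_poly of_rat p) x = 0"
proof -
  obtain B :: "'a set" where B: "finite B" "rat_span B = UNIV" using finite_rat_spanning by blast
  let ?I = "{..card B}"
  show ?thesis
  proof (cases "inj_on (\<lambda>i. x ^ i) ?I")
    case False
    then obtain i k where ik: "x ^ i = x ^ k" "i \<noteq> k" by (auto simp: inj_on_def)
    have "map_poly of_rat (monom 1 i - monom 1 k :: rat poly) = (monom 1 i - monom 1 k :: 'a poly)"
      by (auto simp: poly_eq_iff coeff_map_poly of_rat_diff)
    moreover have "coeff (monom 1 i - monom 1 k :: rat poly) i \<noteq> 0" using ik by auto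
    ultimately show ?thesis using ik
      by (intro exI[of _ "monom 1 i - monom 1 k"]) (auto simp: poly_monom simp del: coeff_diff)
  next
    case True
    let ?S = "(\<lambda>i. x ^ i) ` ?I"
    have "card ?S = Suc (card B)" using True by (simp add: card_image)
    then have "rat_vs.dependent ?S"
      using rat_vs.independent_span_bound[OF B(1), of ?S] B(2) by (auto simp: rat_span_def)
    then obtain u where u: "\<exists>v\<in>?S. u v \<noteq> 0" "(\<Sum>v\<in>?S. of_rat (u v) * v) = 0"
      using rat_vs.dependent_finite[of ?S] by auto
    define p :: "rat poly" where "p = (\<Sum>i\<le>card B. monom (u (x ^ i)) i)"
    have cp: "coeff p i = (if i \<le> card B then u (x ^ i) else 0)" for i
      unfolding p_def by (simp add: coeff_sum coeff_monom sum.delta')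
    then have "p \<noteq> 0" using u(1) by (metis atMost_iff coeff_0 imageE)
    have "degree p \<le> card B" by (intro degree_le) (auto simp: cp)
    have "poly (map_poly of_rat p) x = (\<Sum>i\<le>card B. coeff (map_poly of_rat p) i * x ^ i)"
      unfolding poly_altdef using \<open>degree p \<le> card B\<close>
      by (intro sum.mono_neutral_left) (auto simp: degree_map_poly coeff_eq_0)
    also have "\<dots> = (\<Sum>i\<le>card B. of_rat (u (x ^ i)) * x ^ i)"
      by (intro sum.cong) (auto simp: coeff_map_poly cp)
    also have "\<dots> = 0" using u(2) True by (simp add: sum.reindex)
    finally show ?thesis using \<open>p \<noteq> 0\<close> by blast
  qed
qed

lemma separable_annihilator:
  fixes x :: 'a
  shows "\<exists>p::rat poly. p \<noteq> 0 \<and> poly (map_poly of_rat p) x = 0 \<and> coprime p (pderiv p)"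
proof -
  let ?P = "\<lambda>p::rat poly. p \<noteq> 0 \<and> poly (map_poly of_rat p) x = 0"
  obtain p0 where "?P p0" using rational_annihilator[of x] by blast
  then have "\<exists>p. ?P p \<and> (\<forall>q. ?P q \<longrightarrow> degree p \<le> degree q)" by (rule ex_has_least_nat)
  then obtain p where p: "?P p" and min: "\<And>q. ?P q \<Longrightarrow> degree p \<le> degree q" by auto
  have dp: "degree p > 0"
  proof (rule Nat.gr0I)
    assume "degree p = 0"
    then obtain c where "p = [:c:]" by (rule degree_eq_zeroE)
    then show False using p by (simp add: map_poly_pCons)
  qed
  have "coprime p (pderiv p)"
  proof (rule ccontr)
    define g where "g = gcd p (pderiv p)"
    assume "\<not> coprime p (pderiv p)"
    then have ng: "\<not> is_unit g" unfolding g_def is_unit_gcd .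
    have g0: "g \<noteq> 0" using p by (simp add: g_def)
    then have dg: "degree g > 0" using ng is_unit_iff_degree[OF g0] by simp
    have pd: "pderiv p \<noteq> 0" using dp by (simp add: pderiv_eq_0_iff)
    have "degree g \<le> degree (pderiv p)" using pd unfolding g_def by (intro dvd_imp_degree_le gcd_dvd2)
    then have lt: "degree g < degree p" using dp by (simp add: degree_pderiv)
    have "g dvd p" unfolding g_def by (rule gcd_dvd1)
    then obtain q where q: "p = g * q" by (rule dvdE)
    have q0: "q \<noteq> 0" using q p by (metis mult_zero_right)
    have dq: "degree q < degree p" using degree_mult_eq[OF g0 q0] unfolding q[symmetric] using dg by simp
    have "poly (map_poly of_rat g) x * poly (map_poly of_rat q) x = 0"
      using p unfolding q map_poly_of_rat_mult by simp
    then have "?P g \<or> ?P q" using g0 q0 by simp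
    then show False using min[of g] min[of q] lt dq by linarith
  qed
  then show ?thesis using p by blast
qed

primrec shift_prod :: "'a \<Rightarrow> complex list \<Rightarrow> ('a \<Rightarrow> complex) \<Rightarrow> ('a \<Rightarrow> complex)" where
  "shift_prod x [] w = w"
| "shift_prod x (\<rho> # rs) w = shift_prod x rs (\<lambda>y. w (x * y) - \<rho> * w y)"

lemma shift_prod_poly:
  assumes "degree p \<le> N" "p = (\<Prod>\<rho>\<leftarrow>rs. [:-\<rho>, 1:])"
  shows "shift_prod x rs w y = (\<Sum>i\<le>N. coeff p i * w (x ^ i * y))"
  using assms
proof (induction rs arbitrary: w p N)
  case Nil
  have "coeff 1 i * w (x ^ i * y) = (if i = 0 then w y else 0)" for i by auto
  then show ?case using Nil by simp
next
  case (Cons \<rho> rs)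
  let ?q = "\<Prod>\<rho>\<leftarrow>rs. [:-\<rho>, 1:]"
  have p: "p = pCons 0 ?q - smult \<rho> ?q" using Cons.prems by simp
  have q0: "?q \<noteq> 0" by (auto simp: prod_list_zero_iff)
  then have dp: "degree p = Suc (degree ?q)" using Cons.prems(2) by (simp add: degree_mult_eq del: mult_pCons_left)
  then obtain M where M: "N = Suc M" "degree ?q \<le> M" using Cons.prems(1) by (cases N) auto
  have cq: "coeff ?q N = 0" using M by (intro coeff_eq_0) auto
  have "shift_prod x (\<rho> # rs) w y = (\<Sum>i\<le>M. coeff ?q i * (w (x * (x ^ i * y)) - \<rho> * w (x ^ i * y)))"
    using Cons.IH[OF M(2) refl] by simp
  also have "\<dots> = (\<Sum>i\<le>M. coeff ?q i * w (x ^ Suc i * y)) - (\<Sum>i\<le>M. \<rho> * coeff ?q i * w (x ^ i * y))"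
    by (simp add: sum_subtractf algebra_simps)
  also have "(\<Sum>i\<le>M. coeff ?q i * w (x ^ Suc i * y)) = (\<Sum>i\<le>N. coeff (pCons 0 ?q) i * w (x ^ i * y))"
    unfolding M(1) by (subst sum.atMost_Suc_shift) simp
  also have "(\<Sum>i\<le>M. \<rho> * coeff ?q i * w (x ^ i * y)) = (\<Sum>i\<le>N. \<rho> * coeff ?q i * w (x ^ i * y))"
    using cq M(1) by simp
  finally show ?case unfolding p by (simp add: sum_subtractf left_diff_distrib)
qed

lemma eigenfunction_decomposition:
  assumes V: "\<And>v. V v \<Longrightarrow> V (\<lambda>y. v (x * y))" "\<And>u v. V u \<Longrightarrow> V v \<Longrightarrow> V (\<lambda>y. u y + v y)"
    "\<And>c v. V v \<Longrightarrow> V (\<lambda>y. c * v y)"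
    and "distinct rs" "V w" "\<And>y. shift_prod x rs w y = 0"
  shows "\<exists>u. (\<forall>\<rho>\<in>set rs. V (u \<rho>) \<and> (\<forall>y. u \<rho> (x * y) = \<rho> * u \<rho> y)) \<and>
     (\<forall>y. w y = (\<Sum>\<rho>\<in>set rs. u \<rho> y))"
  using assms(4-6)
proof (induction rs arbitrary: w)
  case Nil
  then show ?case by auto
next
  case (Cons \<sigma> rs)
  let ?w = "\<lambda>y. w (x * y) - \<sigma> * w y"
  have "V (\<lambda>y. w (x * y) + (- \<sigma>) * w y)" using V Cons.prems by blast
  then have "V ?w" by simp
  then obtain u where u: "\<And>\<rho>. \<rho> \<in> set rs \<Longrightarrow> V (u \<rho>)"
    "\<And>\<rho> y. \<rho> \<in> set rs \<Longrightarrow> u \<rho> (x * y) = \<rho> * u \<rho> y"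
    "\<And>y. ?w y = (\<Sum>\<rho>\<in>set rs. u \<rho> y)"
    using Cons.IH[of ?w] Cons.prems by auto
  define u' where "u' \<rho> = (\<lambda>y. 1 / (\<rho> - \<sigma>) * u \<rho> y)" for \<rho>
  have Vs: "V (\<lambda>y. w y + (\<Sum>\<rho>\<in>S. (-1) * u' \<rho> y))" if "S \<subseteq> set rs" for S
  proof -
    have "finite S" using that finite_subset by blast
    then show ?thesis using that
    proof (induction S)
      case empty
      then show ?case using Cons.prems by simp
    next
      case (insert \<rho> S)
      have "V (u' \<rho>)" unfolding u'_def by (rule V(3), rule u(1)) (use insert.prems in auto)
      then have "V (\<lambda>y. (w y + (\<Sum>\<rho>\<in>S. (-1) * u' \<rho> y)) + (-1) * u' \<rho> y)"
        by (intro V(2)[OF insert.IH] V(3)) (use insert.prems in auto)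
      moreover have "(\<lambda>y. (w y + (\<Sum>\<rho>\<in>S. (-1) * u' \<rho> y)) + (-1) * u' \<rho> y)
          = (\<lambda>y. w y + (\<Sum>\<rho>\<in>insert \<rho> S. (-1) * u' \<rho> y))"
        using insert.hyps by (auto simp: fun_eq_iff)
      ultimately show ?case by simp
    qed
  qed
  define v where "v = (\<lambda>y. w y + (\<Sum>\<rho>\<in>set rs. (-1) * u' \<rho> y))"
  have "v (x * y) = \<sigma> * v y" for y
  proof -
    have "v (x * y) - \<sigma> * v y = ?w y - (\<Sum>\<rho>\<in>set rs. u' \<rho> (x * y) - \<sigma> * u' \<rho> y)"
      unfolding v_def by (simp add: sum_subtractf sum_negf sum_distrib_left algebra_simps)
    also have "(\<Sum>\<rho>\<in>set rs. u' \<rho> (x * y) - \<sigma> * u' \<rho> y) = (\<Sum>\<rho>\<in>set rs. u \<rho> y)"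
    proof (rule sum.cong)
      fix \<rho> assume r: "\<rho> \<in> set rs"
      then have "\<rho> \<noteq> \<sigma>" using Cons.prems by auto
      have "u' \<rho> (x * y) - \<sigma> * u' \<rho> y = (\<rho> - \<sigma>) * (1 / (\<rho> - \<sigma>) * u \<rho> y)"
        unfolding u'_def u(2)[OF r] by (simp only: left_diff_distrib mult.left_commute mult.assoc)
      then show "u' \<rho> (x * y) - \<sigma> * u' \<rho> y = u \<rho> y" using \<open>\<rho> \<noteq> \<sigma>\<close> by simp
    qed simp
    finally show ?thesis using u(3) by simp
  qed
  note v_eigen = this
  have Vv: "V v" unfolding v_def by (rule Vs) simp
  have Vu: "V (u' \<rho>)" if "\<rho> \<in> set rs" for \<rho>
    unfolding u'_def by (rule V(3), rule u(1)) (use that in auto)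
  have u_eigen: "u' \<rho> (x * y) = \<rho> * u' \<rho> y" if "\<rho> \<in> set rs" for \<rho> y
    unfolding u'_def u(2)[OF that] by simp
  let ?U = "\<lambda>\<rho>. if \<rho> = \<sigma> then v else u' \<rho>"
  have "\<sigma> \<notin> set rs" using Cons.prems by auto
  then have "(\<Sum>\<rho>\<in>set rs. ?U \<rho> y) = (\<Sum>\<rho>\<in>set rs. u' \<rho> y)" for y
    by (intro sum.cong) auto
  then have "(\<Sum>\<rho>\<in>set (\<sigma> # rs). ?U \<rho> y) = v y + (\<Sum>\<rho>\<in>set rs. u' \<rho> y)" for y
    using \<open>\<sigma> \<notin> set rs\<close> by simp
  then have "w y = (\<Sum>\<rho>\<in>set (\<sigma> # rs). ?U \<rho> y)" for y
    unfolding v_def by (simp add: sum_negf)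
  moreover have "V (?U \<rho>) \<and> (\<forall>y. ?U \<rho> (x * y) = \<rho> * ?U \<rho> y)" if "\<rho> \<in> set (\<sigma> # rs)" for \<rho>
  proof (cases "\<rho> = \<sigma>")
    case True
    then show ?thesis using Vv v_eigen by simp
  next
    case False
    then show ?thesis using that Vu[of \<rho>] u_eigen[of \<rho>] by simp
  qed
  ultimately show ?case by (intro exI[of _ ?U] conjI ballI allI) blast+
qed

lemma rat_linear_shift_prod_zero:
  "\<exists>rs. distinct rs \<and> (\<forall>w y. rat_linear w \<longrightarrow> shift_prod x rs w y = 0)"
proof -
  obtain p :: "rat poly" where p: "p \<noteq> 0" "poly (map_poly of_rat p) x = 0" "coprime p (pderiv p)"
    using separable_annihilator[of x] by blast
  let ?P = "map_poly of_rat p :: complex poly"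
  obtain a b where "bezout_coefficients p (pderiv p) = (a, b)"
    by (cases "bezout_coefficients p (pderiv p)")
  then have "a * p + b * pderiv p = gcd p (pderiv p)" by (rule bezout_coefficients)
  also have "\<dots> = 1" using p(3) by (simp add: coprime_iff_gcd_eq_1)
  finally have "map_poly of_rat (a * p + b * pderiv p) = (1 :: complex poly)"
    by (simp add: poly_eq_iff coeff_map_poly)
  then have ab: "map_poly of_rat a * ?P + map_poly of_rat b * pderiv ?P = 1"
    by (simp only: map_poly_of_rat_add map_poly_of_rat_mult map_poly_of_rat_pderiv)
  have "rsquarefree ?P" unfolding rsquarefree_roots
  proof (intro allI notI)
    fix z assume "poly ?P z = 0 \<and> poly (pderiv ?P) z = 0"
    then have "poly (map_poly of_rat a * ?P + map_poly of_rat b * pderiv ?P) z = 0" by simp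
    then show False unfolding ab by simp
  qed
  then have dec: "smult (lead_coeff ?P) (\<Prod>z|poly ?P z = 0. [:-z, 1:]) = ?P"
    by (rule complex_poly_decompose_rsquarefree)
  have "coeff ?P (degree p) \<noteq> 0" using p(1) by (simp add: coeff_map_poly)
  then have P0: "?P \<noteq> 0" by auto
  then have "finite {z. poly ?P z = 0}" by (rule poly_roots_finite)
  then obtain rs where rs: "set rs = {z. poly ?P z = 0}" "distinct rs"
    using finite_distinct_list by blast
  define q where "q = (\<Prod>\<rho>\<leftarrow>rs. [:-\<rho>, 1:])"
  define L where "L = lead_coeff ?P"
  have L0: "L \<noteq> 0" using P0 by (simp add: L_def)
  have "smult L (\<Prod>z\<in>set rs. [:-z, 1:]) = ?P" using dec unfolding rs(1) L_def .
  then have q: "?P = smult L q"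
    unfolding q_def prod.distinct_set_conv_list[OF rs(2), symmetric] by simp
  have cP: "coeff ?P i = L * coeff q i" for i unfolding q by simp
  have dN: "degree ?P = degree p" by (simp add: degree_map_poly)
  have dq: "degree q \<le> degree p" using L0 unfolding dN[symmetric] q by simp
  have "shift_prod x rs w y = 0" if w: "rat_linear w" for w y
  proof -
    let ?N = "degree p"
    have "L * shift_prod x rs w y = (\<Sum>i\<le>?N. coeff ?P i * w (x ^ i * y))"
      unfolding shift_prod_poly[OF dq q_def] sum_distrib_left cP by (simp add: mult.assoc)
    also have "\<dots> = (\<Sum>i\<le>?N. w (of_rat (coeff p i) * (x ^ i * y)))"
      using w unfolding rat_linear_def by (simp add: coeff_map_poly)
    also have "\<dots> = w ((\<Sum>i\<le>?N. of_rat (coeff p i) * x ^ i) * y)"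
      by (simp add: rat_linear_sum[OF w, symmetric] sum_distrib_right mult.assoc)
    also have "(\<Sum>i\<le>?N. of_rat (coeff p i) * x ^ i) = 0"
      using p(2) by (simp add: poly_altdef degree_map_poly coeff_map_poly)
    also have "w (0 * y) = 0" using rat_linear_sum[OF w, of _ "{}"] by simp
    finally show ?thesis using L0 by simp
  qed
  then show ?thesis using rs by blast
qed

definition emb_combination :: "('a \<Rightarrow> complex) \<Rightarrow> bool" where
  "emb_combination w \<longleftrightarrow> (\<exists>c. \<forall>y. w y = (\<Sum>j\<in>UNIV. c j * of_real (emb j y)))"

lemma emb_combination_sum:
  "(\<And>i. i \<in> A \<Longrightarrow> emb_combination (f i)) \<Longrightarrow> emb_combination (\<lambda>y. \<Sum>i\<in>A. f i y)"
proof (induction A rule: infinite_finite_induct)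
  case (insert a A)
  then obtain c d where "\<forall>y. f a y = (\<Sum>j\<in>UNIV. c j * of_real (emb j y))"
    "\<forall>y. (\<Sum>i\<in>A. f i y) = (\<Sum>j\<in>UNIV. d j * of_real (emb j y))"
    unfolding emb_combination_def by (metis insertCI)
  then show ?case using insert.hyps unfolding emb_combination_def
    by (intro exI[of _ "\<lambda>j. c j + d j"]) (auto simp: algebra_simps sum.distrib)
qed (auto simp: emb_combination_def intro: exI[of _ "\<lambda>_. 0"])

lemma common_eigenfunction_emb:
  assumes w: "rat_linear w" and B: "rat_span B = (UNIV :: 'a set)"
    and ev: "\<And>b. b \<in> B \<Longrightarrow> \<exists>c. \<forall>y. w (b * y) = c * w y"
  shows "emb_combination w"
proof (cases "\<forall>y. w y = 0")
  case True
  then show ?thesis unfolding emb_combination_def by (intro exI[of _ "\<lambda>_. 0"]) auto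
next
  case False
  then obtain y0 where y0: "w y0 \<noteq> 0" by blast
  have add: "w (x + y) = w x + w y" and sc: "w (of_rat q * x) = of_rat q * w x" for x y q
    using w unfolding rat_linear_def by blast+
  have ex: "\<exists>c. \<forall>y. w (z * y) = c * w y" for z
  proof -
    have "z \<in> rat_vs.span B" using B by (simp add: rat_span_def)
    then show ?thesis
    proof (induction rule: rat_vs.span_induct_alt)
      case base
      show ?case using sc[of 0] by (intro exI[of _ 0]) auto
    next
      case (step q b z)
      obtain c d where "\<And>y. w (b * y) = c * w y" "\<And>y. w (z * y) = d * w y"
        using ev[OF step(1)] step(2) by blast
      then have "w ((of_rat q * b + z) * y) = (of_rat q * c + d) * w y" for y
        by (simp add: distrib_right add mult.assoc sc)
      then show ?case by blast
    qed
  qed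
  define \<phi> where "\<phi> z = w (z * y0) / w y0" for z
  have ph: "w (z * y) = \<phi> z * w y" for z y
  proof -
    obtain c where c: "\<And>y. w (z * y) = c * w y" using ex by blast
    then have "\<phi> z = c" unfolding \<phi>_def using y0 by simp
    then show ?thesis using c by simp
  qed
  have "field_embedding \<phi>" unfolding field_embedding_def
  proof (intro conjI allI)
    show "\<phi> 1 = 1" unfolding \<phi>_def using y0 by simp
    show "\<phi> (x + y) = \<phi> x + \<phi> y" for x y
      unfolding \<phi>_def by (simp add: distrib_right add add_divide_distrib)
    show "\<phi> (x * y) = \<phi> x * \<phi> y" for x y
      using ph[of x "y * y0"] ph[of y y0] y0 unfolding \<phi>_def[of "x * y"] by (simp add: mult.assoc)
  qed
  then obtain j where j: "\<phi> = (\<lambda>x. of_real (emb j x))" using emb_surj by blast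
  have "w y = (\<Sum>i\<in>UNIV. (if i = j then w 1 else 0) * of_real (emb i y))" for y
  proof -
    have "(\<Sum>i\<in>UNIV. (if i = j then w 1 else 0) * of_real (emb i y))
        = (\<Sum>i\<in>UNIV. if i = j then w 1 * of_real (emb i y) else 0)"
      by (intro sum.cong) auto
    then show ?thesis using ph[of y 1] j by simp
  qed
  then show ?thesis unfolding emb_combination_def
    by (intro exI[of _ "\<lambda>i. if i = j then w 1 else 0"]) blast
qed

lemma rat_linear_emb_combination:
  assumes "rat_linear w"
  shows "emb_combination w"
proof -
  obtain B :: "'a set" where B: "finite B" "rat_span B = UNIV" using finite_rat_spanning by blast
  have "emb_combination w" if "finite D" "D \<subseteq> B" "rat_linear w"
    "\<And>b. b \<in> B - D \<Longrightarrow> \<exists>c. \<forall>y. w (b * y) = c * w y" for D w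
    using that
  proof (induction D arbitrary: w rule: finite_induct)
    case empty
    then show ?case using common_eigenfunction_emb[OF _ B(2)] by auto
  next
    case (insert x D)
    obtain \<beta> where be: "\<And>b y. b \<in> B - insert x D \<Longrightarrow> w (b * y) = \<beta> b * w y"
      using insert.prems(3) by metis
    define V where "V v \<longleftrightarrow> rat_linear v \<and> (\<forall>b\<in>B - insert x D. \<forall>y. v (b * y) = \<beta> b * v y)" for v
    obtain rs where rs: "distinct rs" "\<And>w y. rat_linear w \<Longrightarrow> shift_prod x rs w y = 0"
      using rat_linear_shift_prod_zero[of x] by blast
    have "\<exists>u. (\<forall>\<rho>\<in>set rs. V (u \<rho>) \<and> (\<forall>y. u \<rho> (x * y) = \<rho> * u \<rho> y)) \<and>
       (\<forall>y. w y = (\<Sum>\<rho>\<in>set rs. u \<rho> y))"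
    proof (rule eigenfunction_decomposition)
      show "V (\<lambda>y. v (x * y))" if "V v" for v
        using that unfolding V_def rat_linear_def by (simp add: distrib_left mult.left_commute[of x])
      show "V (\<lambda>y. u y + v y)" if "V u" "V v" for u v
        using that unfolding V_def rat_linear_def by (simp add: distrib_left)
      show "V (\<lambda>y. c * v y)" if "V v" for c v
        using that unfolding V_def rat_linear_def by (simp add: distrib_left mult.left_commute)
      show "V w" unfolding V_def using insert.prems be by blast
    qed (use rs insert.prems in auto)
    then obtain u where u: "\<And>\<rho>. \<rho> \<in> set rs \<Longrightarrow> V (u \<rho>)"
      "\<And>\<rho> y. \<rho> \<in> set rs \<Longrightarrow> u \<rho> (x * y) = \<rho> * u \<rho> y" "\<And>y. w y = (\<Sum>\<rho>\<in>set rs. u \<rho> y)"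
      by blast
    have "emb_combination (u \<rho>)" if r: "\<rho> \<in> set rs" for \<rho>
    proof (rule insert.IH)
      show "\<exists>c. \<forall>y. u \<rho> (b * y) = c * u \<rho> y" if "b \<in> B - D" for b
        using u(1,2)[OF r] that unfolding V_def by (cases "b = x") blast+
    qed (use u(1)[OF r] insert.prems in \<open>auto simp: V_def\<close>)
    then have "emb_combination (\<lambda>y. \<Sum>\<rho>\<in>set rs. u \<rho> y)" by (rule emb_combination_sum)
    moreover have "w = (\<lambda>y. \<Sum>\<rho>\<in>set rs. u \<rho> y)" using u(3) by blast
    ultimately show ?case by simp
  qed
  from this[OF B(1)] show ?thesis using assms by blast
qed

lemma emb_independent:
  fixes c :: "'n \<Rightarrow> real"
  assumes "\<And>x. (\<Sum>j\<in>UNIV. c j * emb j x) = 0"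
  shows "c j = 0"
proof -
  have "\<forall>j\<in>S. c j = 0" if "finite S" "\<And>x. (\<Sum>j\<in>S. c j * emb j x) = 0" for S and c :: "'n \<Rightarrow> real"
    using that
  proof (induction S arbitrary: c rule: finite_induct)
    case (insert k S)
    have z: "c j = 0" if j: "j \<in> S" for j
    proof -
      have "j \<noteq> k" using j insert.hyps by auto
      then have "emb j \<noteq> emb k" using inj_emb by (simp add: inj_eq)
      then obtain a where a: "emb j a \<noteq> emb k a" by (auto simp: fun_eq_iff)
      have "(\<Sum>i\<in>S. (c i * (emb i a - emb k a)) * emb i x) = 0" for x
      proof -
        have e1: "c k * (emb k a * emb k x) + (\<Sum>i\<in>S. c i * (emb i a * emb i x)) = 0"
          using insert.prems[of "a * x"] insert.hyps by simp
        have e2: "c k * emb k x + (\<Sum>i\<in>S. c i * emb i x) = 0"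
          using insert.prems[of x] insert.hyps by simp
        have "(\<Sum>i\<in>S. (c i * (emb i a - emb k a)) * emb i x)
            = (\<Sum>i\<in>S. c i * (emb i a * emb i x)) - emb k a * (\<Sum>i\<in>S. c i * emb i x)"
          by (simp add: sum_distrib_left sum_subtractf[symmetric] algebra_simps)
        also have "\<dots> = 0" using e1 e2 by algebra
        finally show ?thesis .
      qed
      then have "\<forall>j\<in>S. c j * (emb j a - emb k a) = 0" by (rule insert.IH)
      then have "c j * (emb j a - emb k a) = 0" using j by simp
      then show ?thesis using a by simp
    qed
    then have "c k = 0" using insert.prems[of 1] insert.hyps by simp
    then show ?case using z by simp
  qed simp
  from this[of UNIV c] show ?thesis using assms by simp
qed

end

lemma algebraic_imp_int_multiple:
  fixes x :: "'a::field_char_0"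
  assumes "algebraic x"
  shows "\<exists>d::int. d > 0 \<and> algebraic_int (of_int d * x)"
proof -
  obtain p where p: "p \<noteq> 0" "poly (map_poly of_int p) x = 0"
    using assms by (rule algebraicE')
  define n where "n = degree p"
  define a where "a = lead_coeff p"
  have a0: "a \<noteq> 0" using p by (simp add: a_def)
  have n0: "n > 0"
  proof (rule Nat.gr0I)
    assume "n = 0"
    then obtain c where "p = [:c:]" unfolding n_def by (rule degree_eq_zeroE)
    then show False using p by (simp add: map_poly_pCons)
  qed
  let ?y = "of_int a * x"
  define q :: "'a poly" where "q = monom 1 n + (\<Sum>i<n. monom (of_int (coeff p i * a ^ (n - 1 - i))) i)"
  have cq: "coeff q i = (if i = n then 1 else if i < n then of_int (coeff p i * a ^ (n - 1 - i)) else 0)" for i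
    unfolding q_def by (auto simp: coeff_sum coeff_monom sum.delta)
  have dq: "degree q = n"
    by (intro antisym degree_le le_degree) (auto simp: cq)
  have "poly (map_poly of_int p) x = (\<Sum>i\<le>n. of_int (coeff p i) * x ^ i)"
    by (simp add: poly_altdef degree_map_poly coeff_map_poly n_def)
  then have s0: "of_int a * x ^ n + (\<Sum>i<n. of_int (coeff p i) * x ^ i) = 0"
    using p(2) by (simp add: lessThan_Suc_atMost[symmetric] a_def n_def add.commute)
  have "poly q ?y = ?y ^ n + (\<Sum>i<n. of_int (coeff p i * a ^ (n - 1 - i)) * ?y ^ i)"
    unfolding q_def by (simp add: poly_sum poly_monom)
  also have "?y ^ n = of_int a ^ (n - 1) * (of_int a * x ^ n)"
    using n0 by (simp add: power_mult_distrib power_eq_if[of _ n])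
  also have "(\<Sum>i<n. of_int (coeff p i * a ^ (n - 1 - i)) * ?y ^ i)
      = of_int a ^ (n - 1) * (\<Sum>i<n. of_int (coeff p i) * x ^ i)"
    unfolding sum_distrib_left
  proof (rule sum.cong)
    fix i assume "i \<in> {..<n}"
    then have "of_int a ^ (n - 1) = (of_int a ^ (n - 1 - i) * of_int a ^ i :: 'a)"
      by (simp flip: power_add)
    then show "of_int (coeff p i * a ^ (n - 1 - i)) * ?y ^ i
        = of_int a ^ (n - 1) * (of_int (coeff p i) * x ^ i)"
      by (simp add: power_mult_distrib)
  qed simp
  also have "of_int a ^ (n - 1) * (of_int a * x ^ n) + of_int a ^ (n - 1) * (\<Sum>i<n. of_int (coeff p i) * x ^ i)
      = of_int a ^ (n - 1) * (of_int a * x ^ n + (\<Sum>i<n. of_int (coeff p i) * x ^ i))"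
    by (simp add: distrib_left)
  finally have "poly q ?y = 0" using s0 by simp
  then have y: "algebraic_int ?y"
    by (intro algebraic_int.intros[of q]) (auto simp: cq dq)
  show ?thesis
  proof (cases "a > 0")
    case True
    then show ?thesis using y by blast
  next
    case False
    have "algebraic_int (of_int (- a) * x)" using algebraic_int_minus[OF y] by simp
    then show ?thesis using False a0 by (intro exI[of _ "- a"]) auto
  qed
qed

context totally_real_field begin

section \<open>Trace, norm and bases\<close>

lemma algebraic_field: "algebraic (x :: 'a)"
proof -
  obtain p :: "rat poly" where p: "p \<noteq> 0" "poly (map_poly of_rat p) x = 0"
    using rational_annihilator by blast
  have "coeff (map_poly of_rat p :: 'a poly) (degree p) \<noteq> 0" using p(1) by (simp add: coeff_map_poly)
  then have "(map_poly of_rat p :: 'a poly) \<noteq> 0" by auto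
  moreover have "\<forall>i. coeff (map_poly of_rat p :: 'a poly) i \<in> \<rat>" by (simp add: coeff_map_poly)
  ultimately show ?thesis using p(2) unfolding algebraic_altdef by blast
qed

definition rat_basis :: "('n \<Rightarrow> 'a) \<Rightarrow> bool" where
  "rat_basis \<beta> \<longleftrightarrow> (\<forall>x. \<exists>q::'n \<Rightarrow> rat. x = (\<Sum>i\<in>UNIV. of_rat (q i) * \<beta> i)) \<and>
     (\<forall>c::'n \<Rightarrow> real. (\<forall>j. (\<Sum>i\<in>UNIV. c i * emb j (\<beta> i)) = 0) \<longrightarrow> (\<forall>i. c i = 0))"

lemma rat_basis_exists: "\<exists>\<beta>. rat_basis \<beta>"
proof -
  obtain B0 :: "'a set" where B0: "finite B0" "rat_span B0 = UNIV" using finite_rat_spanning by blast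
  obtain B where B: "B \<subseteq> B0" "rat_vs.independent B" "B0 \<subseteq> rat_vs.span B"
    using rat_vs.maximal_independent_subset by blast
  have fB: "finite B" using B(1) B0(1) by (rule finite_subset)
  have "rat_vs.span B0 \<subseteq> rat_vs.span B" using B(3) by (intro rat_vs.span_minimal rat_vs.subspace_span)
  then have sB: "x \<in> rat_vs.span B" for x using B0(2) by (auto simp: rat_span_def)
  let ?r = "rat_vs.representation B"
  have "rat_linear (\<lambda>x. of_rat (?r x b))" for b
    unfolding rat_linear_def
    by (simp add: rat_vs.representation_add[OF B(2) sB sB] rat_vs.representation_scale[OF B(2) sB]
        of_rat_add of_rat_mult)
  then have "emb_combination (\<lambda>x. of_rat (?r x b))" for b by (rule rat_linear_emb_combination)
  then have "\<forall>b. \<exists>c. \<forall>x. complex_of_rat (?r x b) = (\<Sum>j\<in>UNIV. c j * of_real (emb j x))"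
    unfolding emb_combination_def by (rule allI)
  from choice[OF this]
  obtain c where c: "\<And>b x. complex_of_rat (?r x b) = (\<Sum>j\<in>UNIV. c b j * of_real (emb j x))"
    by blast
  define r where "r b j = Re (c b j)" for b j
  have r: "(\<Sum>j\<in>UNIV. r b j * emb j x) = of_rat (?r x b)" for b x
  proof -
    have "Re (complex_of_rat (?r x b)) = (\<Sum>j\<in>UNIV. r b j * emb j x)"
      unfolding c by (simp add: r_def)
    moreover have "complex_of_rat q = of_real (of_rat q)" for q
      by (cases q) (simp add: of_rat_rat)
    ultimately show ?thesis by simp
  qed
  have rB: "?r b b' = (if b' = b then 1 else 0)" if "b \<in> B" for b b'
    using rat_vs.representation_basis[OF B(2) that] by simp
  have expand: "x = (\<Sum>b\<in>B. of_rat (?r x b) * b)" for x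
    using rat_vs.sum_representation_eq[OF B(2) sB fB order_refl, of x] by simp
  define vec where "vec x = (\<chi> j. emb j x)" for x :: 'a
  have inj_vec: "inj_on vec B"
    unfolding vec_def by (intro inj_onI) (auto simp: vec_eq_iff)
  have zero: "u b = 0" if "\<And>j. (\<Sum>b\<in>B. u b * emb j b) = 0" "b \<in> B" for u :: "'a \<Rightarrow> real" and b
  proof -
    have "0 = (\<Sum>j\<in>UNIV. r b j * (\<Sum>b'\<in>B. u b' * emb j b'))" using that(1) by simp
    also have "\<dots> = (\<Sum>j\<in>UNIV. \<Sum>b'\<in>B. u b' * (r b j * emb j b'))"
      by (simp add: sum_distrib_left mult_ac)
    also have "\<dots> = (\<Sum>b'\<in>B. \<Sum>j\<in>UNIV. u b' * (r b j * emb j b'))" by (rule sum.swap)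
    also have "\<dots> = (\<Sum>b'\<in>B. u b' * of_rat (?r b' b))"
      by (simp only: sum_distrib_left[symmetric] r)
    also have "\<dots> = (\<Sum>b'\<in>B. if b' = b then u b' else 0)"
      by (intro sum.cong) (auto simp: rB)
    also have "\<dots> = u b" using fB that(2) by simp
    finally show ?thesis by simp
  qed
  have ind: "independent (vec ` B)"
  proof
    assume "dependent (vec ` B)"
    then obtain u where u: "\<exists>v\<in>vec ` B. u v \<noteq> 0" "(\<Sum>v\<in>vec ` B. u v *\<^sub>R v) = 0"
      using real_vector.dependent_finite[of "vec ` B"] fB by auto
    have "(\<Sum>b\<in>B. u (vec b) *\<^sub>R vec b) = 0" using u(2) inj_vec by (simp add: sum.reindex)
    then have "(\<Sum>b\<in>B. u (vec b) *\<^sub>R vec b) $ j = 0" for j by simp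
    then have "(\<Sum>b\<in>B. u (vec b) * emb j b) = 0" for j by (simp add: vec_def)
    then show False using zero[of "\<lambda>b. u (vec b)"] u(1) by blast
  qed
  have span: "span (vec ` B) = UNIV"
  proof (rule ccontr)
    assume "span (vec ` B) \<noteq> UNIV"
    then obtain a where a: "a \<noteq> 0" "\<And>v. v \<in> span (vec ` B) \<Longrightarrow> a \<bullet> v = 0"
      using span_not_UNIV_orthogonal by blast
    have "(\<Sum>j\<in>UNIV. a $ j * emb j b) = 0" if "b \<in> B" for b
      using a(2)[of "vec b"] that by (simp add: span_base inner_vec_def vec_def)
    then have aB: "(\<Sum>j\<in>UNIV. q * (a $ j * emb j b)) = 0" if "b \<in> B" for b q
      using that by (simp flip: sum_distrib_left)
    have "(\<Sum>j\<in>UNIV. a $ j * emb j x) = 0" for x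
    proof -
      have "emb j x = (\<Sum>b\<in>B. of_rat (?r x b) * emb j b)" for j
        by (subst expand[of x]) simp
      then have "(\<Sum>j\<in>UNIV. a $ j * emb j x) = (\<Sum>j\<in>UNIV. \<Sum>b\<in>B. of_rat (?r x b) * (a $ j * emb j b))"
        by (simp add: sum_distrib_left mult_ac)
      also have "\<dots> = (\<Sum>b\<in>B. \<Sum>j\<in>UNIV. of_rat (?r x b) * (a $ j * emb j b))" by (rule sum.swap)
      also have "\<dots> = 0" using aB by simp
      finally show ?thesis .
    qed
    then have "a $ j = 0" for j by (rule emb_independent)
    then show False using a(1) by (simp add: vec_eq_iff)
  qed
  have "card B = card (vec ` B)" using inj_vec by (simp add: card_image)
  also have "\<dots> = dim (span (vec ` B))" by (rule real_vector.dim_span_eq_card_independent[OF ind, symmetric])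
  also have "\<dots> = CARD('n)" unfolding span by simp
  finally obtain \<beta> :: "'n \<Rightarrow> 'a" where be: "bij_betw \<beta> UNIV B"
    using finite_same_card_bij[of "UNIV :: 'n set" B] fB by auto
  have sumB: "(\<Sum>b\<in>B. g b) = (\<Sum>i\<in>UNIV. g (\<beta> i))" for g :: "'a \<Rightarrow> 'z::comm_monoid_add"
    using sum.reindex_bij_betw[OF be, of g] by simp
  have "rat_basis \<beta>" unfolding rat_basis_def
  proof (intro conjI allI impI)
    fix x
    have "x = (\<Sum>i\<in>UNIV. of_rat (?r x (\<beta> i)) * \<beta> i)"
      using expand[of x] unfolding sumB .
    then show "\<exists>q::'n \<Rightarrow> rat. x = (\<Sum>i\<in>UNIV. of_rat (q i) * \<beta> i)"
      by (intro exI[of _ "\<lambda>i. ?r x (\<beta> i)"])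
  next
    fix d :: "'n \<Rightarrow> real" and i
    assume d: "\<forall>j. (\<Sum>i\<in>UNIV. d i * emb j (\<beta> i)) = 0"
    let ?u = "\<lambda>b. d (inv_into UNIV \<beta> b)"
    have inv: "inv_into UNIV \<beta> (\<beta> i) = i" for i
      using be by (simp add: bij_betw_def)
    have s: "(\<Sum>b\<in>B. ?u b * emb j b) = 0" for j unfolding sumB inv using d by simp
    have "\<beta> i \<in> B" using be by (auto simp: bij_betw_def)
    with s have "?u (\<beta> i) = 0" by (rule zero)
    then show "d i = 0" by (simp add: inv)
  qed
  then show ?thesis by blast
qed

lemma rat_basis_independent:
  assumes "rat_basis \<beta>" "\<And>j. (\<Sum>i\<in>UNIV. c i * emb j (\<beta> i)) = 0"
  shows "c i = 0"
  using conjunct2[OF assms(1)[unfolded rat_basis_def], THEN spec, of c] assms(2) by simp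

lemma rat_basis_scale:
  assumes "rat_basis \<beta>" "\<And>i. d i \<noteq> (0::rat)" "x \<noteq> 0"
  shows "rat_basis (\<lambda>i. x * (of_rat (d i) * \<beta> i))"
  unfolding rat_basis_def
proof (intro conjI allI impI)
  fix y
  obtain q :: "'n \<Rightarrow> rat" where q: "y / x = (\<Sum>i\<in>UNIV. of_rat (q i) * \<beta> i)"
    using assms(1) unfolding rat_basis_def by blast
  have e: "of_rat (q i / d i) * (x * (of_rat (d i) * \<beta> i)) = x * (of_rat (q i) * \<beta> i)" for i
    using assms(2)[of i] by (simp add: of_rat_divide)
  have "y = x * (y / x)" using assms(3) by simp
  also have "\<dots> = (\<Sum>i\<in>UNIV. of_rat (q i / d i) * (x * (of_rat (d i) * \<beta> i)))"
    unfolding q sum_distrib_left e ..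
  finally show "\<exists>q. y = (\<Sum>i\<in>UNIV. of_rat (q i) * (x * (of_rat (d i) * \<beta> i)))"
    by (intro exI[of _ "\<lambda>i. q i / d i"])
next
  fix c :: "'n \<Rightarrow> real" and i
  assume c: "\<forall>j. (\<Sum>i\<in>UNIV. c i * emb j (x * (of_rat (d i) * \<beta> i))) = 0"
  have "(\<Sum>i\<in>UNIV. (c i * of_rat (d i)) * emb j (\<beta> i)) = 0" for j
  proof -
    have "emb j x * (\<Sum>i\<in>UNIV. (c i * of_rat (d i)) * emb j (\<beta> i)) = 0"
      using c by (simp add: sum_distrib_left mult_ac)
    then show ?thesis using assms(3) by simp
  qed
  then have "c i * of_rat (d i) = 0" by (rule rat_basis_independent[OF assms(1)])
  then show "c i = 0" using assms(2) by simp
qed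

lemma integral_basis_exists: "\<exists>\<beta>. rat_basis \<beta> \<and> (\<forall>i. algebraic_int (\<beta> i))"
proof -
  obtain \<beta> where be: "rat_basis \<beta>" using rat_basis_exists by blast
  have "\<forall>i. \<exists>d::int. d > 0 \<and> algebraic_int (of_int d * \<beta> i)"
    by (intro allI algebraic_imp_int_multiple algebraic_field)
  from choice[OF this] obtain d :: "'n \<Rightarrow> int"
    where d: "\<And>i. d i > 0" "\<And>i. algebraic_int (of_int (d i) * \<beta> i)" by blast
  have "rat_basis (\<lambda>i. 1 * (of_rat (of_int (d i)) * \<beta> i))"
  proof (rule rat_basis_scale[OF be])
    show "of_int (d i) \<noteq> (0::rat)" for i using d(1)[of i] by simp
  qed simp
  then show ?thesis using d(2) by (intro exI[of _ "\<lambda>i. of_int (d i) * \<beta> i"]) simp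
qed

definition tr :: "'a \<Rightarrow> real" where "tr x = (\<Sum>j\<in>UNIV. emb j x)"
definition nm :: "'a \<Rightarrow> real" where "nm x = (\<Prod>j\<in>UNIV. emb j x)"

lemma tr_simps [simp]: "tr 0 = 0" "tr (x + y) = tr x + tr y" "tr (x - y) = tr x - tr y" "tr (- x) = - tr x"
  by (simp_all add: tr_def sum.distrib sum_subtractf sum_negf)

lemma tr_sum: "tr (sum f A) = (\<Sum>i\<in>A. tr (f i))"
  by (induction A rule: infinite_finite_induct) auto

lemma tr_of_rat_mult: "tr (of_rat q * x) = of_rat q * tr x"
  by (simp add: tr_def sum_distrib_left)

lemma tr_of_int_mult: "tr (of_int m * x) = of_int m * tr x"
  by (simp add: tr_def sum_distrib_left)

lemma nm_mult [simp]: "nm (x * y) = nm x * nm y" by (simp add: nm_def prod.distrib)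
lemma nm_1 [simp]: "nm 1 = 1" by (simp add: nm_def)
lemma nm_inverse [simp]: "nm (inverse x) = inverse (nm x)" by (simp add: nm_def prod_inversef[symmetric])
lemma nm_divide [simp]: "nm (x / y) = nm x / nm y" by (simp add: divide_inverse)
lemma nm_eq_0_iff [simp]: "nm x = 0 \<longleftrightarrow> x = 0" by (auto simp: nm_def)

lemma tr_nm_rational: "tr x \<in> \<rat>" "nm x \<in> \<rat>"
proof -
  obtain \<beta> where be: "rat_basis \<beta>" using rat_basis_exists by blast
  then have "\<forall>i. \<exists>q::'n \<Rightarrow> rat. x * \<beta> i = (\<Sum>l\<in>UNIV. of_rat (q l) * \<beta> l)"
    unfolding rat_basis_def by blast
  from choice[OF this] obtain q :: "'n \<Rightarrow> 'n \<Rightarrow> rat"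
    where q: "\<And>i. x * \<beta> i = (\<Sum>l\<in>UNIV. of_rat (q i l) * \<beta> l)" by blast
  define E :: "real^'n^'n" where "E = (\<chi> j i. emb j (\<beta> i))"
  define M :: "real^'n^'n" where "M = (\<chi> l i. of_rat (q i l))"
  define D :: "real^'n^'n" where "D = (\<chi> j k. if j = k then emb j x else 0)"
  have "\<forall>v. E *v v = 0 \<longrightarrow> v = 0"
  proof (intro allI impI)
    fix v assume v: "E *v v = 0"
    have "(\<Sum>i\<in>UNIV. v $ i * emb j (\<beta> i)) = 0" for j
    proof -
      have "(E *v v) $ j = 0" using v by simp
      then show ?thesis by (simp add: E_def matrix_vector_mult_def mult.commute)
    qed
    then have "v $ i = 0" for i by (rule rat_basis_independent[OF be])
    then show "v = 0" by (simp add: vec_eq_iff)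
  qed
  from iffD2[OF matrix_left_invertible_ker this] obtain F where F: "F ** E = mat 1" by (rule exE)
  then have EF: "E ** F = mat 1" by (rule matrix_left_right_inverse1)
  have EM: "E ** M = D ** E"
  proof -
    have "(\<Sum>k\<in>UNIV. emb j (\<beta> k) * of_rat (q i k)) = emb j x * emb j (\<beta> i)" for j i
      using arg_cong[OF q[of i], of "emb j"] by (simp add: mult.commute)
    moreover have "(\<Sum>k\<in>UNIV. (if j = k then emb j x else 0) * emb k (\<beta> i)) = emb j x * emb j (\<beta> i)" for j i
    proof -
      have "(\<Sum>k\<in>UNIV. (if j = k then emb j x else 0) * emb k (\<beta> i))
          = (\<Sum>k\<in>UNIV. if j = k then emb j x * emb k (\<beta> i) else 0)"
        by (intro sum.cong) auto
      then show ?thesis by simp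
    qed
    ultimately show ?thesis
      by (simp add: E_def M_def D_def matrix_matrix_mult_def vec_eq_iff)
  qed
  have D: "D = (E ** M) ** F"
    unfolding EM by (simp add: matrix_mul_assoc[symmetric] EF)
  have "trace D = trace M"
    unfolding D by (subst trace_mul_sym) (simp add: matrix_mul_assoc F)
  moreover have "trace D = tr x" by (simp add: trace_def D_def tr_def)
  moreover have "trace M \<in> \<rat>" by (auto simp: trace_def M_def intro!: Rats_sum)
  ultimately show "tr x \<in> \<rat>" by simp
  have "det E * det F = 1" using EF by (simp flip: det_mul)
  then have "det D = det M" unfolding D det_mul by (simp add: algebra_simps)
  moreover have "det D = nm x"
    unfolding nm_def by (subst det_diagonal) (auto simp: D_def)
  moreover have "det M \<in> \<rat>"
    unfolding det_def M_def by (intro Rats_sum Rats_mult Rats_prod) (auto simp: sign_def)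
  ultimately show "nm x \<in> \<rat>" by simp
qed

lemma tr_nm_algebraic_int:
  assumes "algebraic_int x"
  shows "tr x \<in> \<int>" "nm x \<in> \<int>"
proof -
  have "algebraic_int (tr x)" "algebraic_int (nm x)"
    unfolding tr_def nm_def using assms by (intro algebraic_int_sum algebraic_int_prod; simp)+
  then show "tr x \<in> \<int>" "nm x \<in> \<int>" using rational_algebraic_int_is_int tr_nm_rational by blast+
qed

lemma nm_dvd:
  assumes "algebraic_int x" "nm x = of_int m"
  shows "algebraic_int (of_int m / x)"
proof (cases "x = 0")
  case False
  obtain j :: 'n where True by blast
  have "emb j (of_int m / x) = nm x / emb j x" using assms(2) by simp
  also have "\<dots> = (\<Prod>i\<in>UNIV - {j}. emb i x)"
    unfolding nm_def using False by (subst prod.remove[of UNIV j]) auto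
  finally have eq: "emb j (of_int m / x) = (\<Prod>i\<in>UNIV - {j}. emb i x)" .
  have al: "algebraic_int (\<Prod>i\<in>UNIV - {j}. emb i x)"
    by (intro algebraic_int_prod) (simp add: assms(1))
  have "algebraic_int (emb j (of_int m / x))" unfolding eq by (rule al)
  then show ?thesis by (rule iffD1[OF field_embedding_algebraic_int_iff[OF field_embedding_emb]])
qed simp

lemma tr_nondegenerate:
  assumes "rat_basis \<beta>" "\<And>l. tr (x * \<beta> l) = 0"
  shows "x = 0"
proof (rule ccontr)
  assume "x \<noteq> 0"
  obtain q :: "'n \<Rightarrow> rat" where q: "inverse x = (\<Sum>l\<in>UNIV. of_rat (q l) * \<beta> l)"
    using assms(1) unfolding rat_basis_def by blast
  have "tr (x * inverse x) = (\<Sum>l\<in>UNIV. of_rat (q l) * tr (x * \<beta> l))"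
    unfolding q sum_distrib_left tr_sum by (simp add: mult.left_commute[of x] tr_of_rat_mult)
  also have "\<dots> = 0" using assms(2) by simp
  finally have "tr 1 = 0" using \<open>x \<noteq> 0\<close> by simp
  then show False by (simp add: tr_def)
qed

lemma dual_basis_exists:
  assumes be: "rat_basis \<beta>"
  shows "\<exists>\<gamma>. \<forall>i l. tr (\<gamma> i * \<beta> l) = (if i = l then 1 else 0)"
proof -
  have ex: "\<exists>t. tr x = of_rat t" for x using tr_nm_rational(1)[of x] by (auto simp: Rats_def)
  define t where "t i l = (SOME t. tr (\<beta> i * \<beta> l) = of_rat t)" for i l
  have t: "tr (\<beta> i * \<beta> l) = of_rat (t i l)" for i l
    unfolding t_def by (rule someI_ex, rule ex)
  define T :: "rat^'n^'n" where "T = (\<chi> l i. t i l)"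
  have T: "tr ((\<Sum>i\<in>UNIV. of_rat (v $ i) * \<beta> i) * \<beta> l) = of_rat ((T *v v) $ l)" for v l
  proof -
    have "tr ((\<Sum>i\<in>UNIV. of_rat (v $ i) * \<beta> i) * \<beta> l) = (\<Sum>i\<in>UNIV. of_rat (v $ i) * of_rat (t i l))"
      by (simp add: sum_distrib_right tr_sum mult.assoc tr_of_rat_mult t)
    then show ?thesis
      by (simp add: T_def matrix_vector_mult_def of_rat_sum of_rat_mult mult.commute)
  qed
  have "\<forall>v. T *v v = 0 \<longrightarrow> v = 0"
  proof (intro allI impI)
    fix v assume v: "T *v v = 0"
    have "(\<Sum>i\<in>UNIV. of_rat (v $ i) * \<beta> i) = 0"
      by (rule tr_nondegenerate[OF be]) (simp add: T v)
    then have "emb j (\<Sum>i\<in>UNIV. of_rat (v $ i) * \<beta> i) = emb j 0" for j by (simp only:)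
    then have "(\<Sum>i\<in>UNIV. of_rat (v $ i) * emb j (\<beta> i)) = 0" for j by simp
    then have "of_rat (v $ i) = (0::real)" for i by (rule rat_basis_independent[OF be])
    then show "v = 0" by (simp add: vec_eq_iff)
  qed
  from iffD2[OF matrix_left_invertible_ker this] obtain F where "F ** T = mat 1" by (rule exE)
  then have TF: "T ** F = mat 1" by (rule matrix_left_right_inverse1)
  define \<gamma> where "\<gamma> i = (\<Sum>k\<in>UNIV. of_rat ((F *v axis i 1) $ k) * \<beta> k)" for i
  have "tr (\<gamma> i * \<beta> l) = (if i = l then 1 else 0)" for i l
  proof -
    have "tr (\<gamma> i * \<beta> l) = of_rat ((T *v (F *v axis i 1)) $ l)" unfolding \<gamma>_def T ..
    also have "T *v (F *v axis i 1) = axis i 1" by (simp add: matrix_vector_mul_assoc TF)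
    finally show ?thesis by (simp add: axis_def)
  qed
  then show ?thesis by blast
qed

lemma dual_basis_expansion:
  assumes "rat_basis \<beta>" "\<And>i l. tr (\<gamma> i * \<beta> l) = (if i = l then 1 else 0)"
    and "\<And>l. tr (x * \<beta> l) = of_int (m l)"
  shows "x = (\<Sum>i\<in>UNIV. of_int (m i) * \<gamma> i)"
proof -
  have "tr ((x - (\<Sum>i\<in>UNIV. of_int (m i) * \<gamma> i)) * \<beta> l) = 0" for l
  proof -
    have "tr ((\<Sum>i\<in>UNIV. of_int (m i) * \<gamma> i) * \<beta> l) = (\<Sum>i\<in>UNIV. of_int (m i) * tr (\<gamma> i * \<beta> l))"
      by (simp add: sum_distrib_right tr_sum mult.assoc tr_of_int_mult)
    also have "\<dots> = (\<Sum>i\<in>UNIV. if i = l then of_int (m i) else 0)"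
      by (intro sum.cong) (auto simp: assms(2))
    finally show ?thesis using assms(3) by (simp add: left_diff_distrib)
  qed
  then have "x - (\<Sum>i\<in>UNIV. of_int (m i) * \<gamma> i) = 0" by (rule tr_nondegenerate[OF assms(1)])
  then show ?thesis by simp
qed

definition int_span :: "('n \<Rightarrow> 'a) \<Rightarrow> 'a set" where
  "int_span b = {(\<Sum>i\<in>UNIV. of_int (m i) * b i) | m. True}"

lemma int_span_sum: "(\<And>i. i \<in> A \<Longrightarrow> f i \<in> int_span b) \<Longrightarrow> sum f A \<in> int_span b"
proof (induction A rule: infinite_finite_induct)
  case (insert a A)
  then obtain m m' where "f a = (\<Sum>i\<in>UNIV. of_int (m i) * b i)" "sum f A = (\<Sum>i\<in>UNIV. of_int (m' i) * b i)"
    unfolding int_span_def by blast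
  then have "sum f (insert a A) = (\<Sum>i\<in>UNIV. of_int (m i + m' i) * b i)"
    using insert.hyps by (simp add: distrib_right sum.distrib)
  then show ?case unfolding int_span_def by (intro CollectI exI[of _ "\<lambda>i. m i + m' i"] conjI TrueI)
qed (auto simp: int_span_def intro!: exI[of _ "\<lambda>_. 0"])

lemma int_span_of_int_mult: "x \<in> int_span b \<Longrightarrow> of_int k * x \<in> int_span b"
proof -
  assume "x \<in> int_span b"
  then obtain m where "x = (\<Sum>i\<in>UNIV. of_int (m i) * b i)" unfolding int_span_def by blast
  then have "of_int k * x = (\<Sum>i\<in>UNIV. of_int (k * m i) * b i)" by (simp add: sum_distrib_left mult.assoc)
  then show ?thesis unfolding int_span_def by (intro CollectI exI[of _ "\<lambda>i. k * m i"] conjI TrueI)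
qed

lemma common_denominator:
  assumes "rat_basis b" "finite A"
  shows "\<exists>M::int. M > 0 \<and> (\<forall>x\<in>A. of_int M * x \<in> int_span b)"
  using assms(2)
proof (induction A rule: finite_induct)
  case empty
  then show ?case by (intro exI[of _ 1]) simp
next
  case (insert x A)
  obtain q :: "'n \<Rightarrow> rat" where q: "x = (\<Sum>i\<in>UNIV. of_rat (q i) * b i)"
    using assms(1) unfolding rat_basis_def by blast
  have "\<exists>D::int. D > 0 \<and> (\<forall>i\<in>S. of_int D * q i \<in> \<int>)" if "finite S" for S
    using that
  proof (induction S rule: finite_induct)
    case empty
    then show ?case by (intro exI[of _ 1]) simp
  next
    case (insert k S)
    then obtain D where D: "D > 0" "\<And>i. i \<in> S \<Longrightarrow> of_int D * q i \<in> \<int>" by blast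
    obtain a d where ad: "q k = of_int a / of_int d" "d > 0"
      by (cases "q k") (auto simp: Fract_of_int_quotient)
    have "of_int (D * d) * q i \<in> \<int>" if "i \<in> insert k S" for i
    proof (cases "i = k")
      case True
      have "of_int (D * d) * q k = of_int (D * a)" using ad by simp
      then show ?thesis using True by (metis Ints_of_int)
    next
      case False
      then have "of_int D * q i \<in> \<int>" using D(2) that by simp
      then have "of_int d * (of_int D * q i) \<in> \<int>" by (rule Ints_mult[OF Ints_of_int])
      then show ?thesis by (simp add: mult_ac)
    qed
    then show ?case using D(1) ad(2) by (intro exI[of _ "D * d"]) auto
  qed
  from this[of UNIV] obtain D :: int where D: "D > 0" "\<And>i. of_int D * q i \<in> \<int>" by auto
  define m where "m i = \<lfloor>of_int D * q i\<rfloor>" for i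
  have m: "of_int D * q i = of_int (m i)" for i using D(2)[of i] by (auto simp: m_def elim!: Ints_cases)
  have "of_int D * x = (\<Sum>i\<in>UNIV. of_rat (of_int D * q i) * b i)"
    unfolding q by (simp add: sum_distrib_left of_rat_mult mult.assoc)
  also have "\<dots> = (\<Sum>i\<in>UNIV. of_int (m i) * b i)" unfolding m by simp
  finally have Dx: "of_int D * x \<in> int_span b"
    unfolding int_span_def by (intro CollectI exI[of _ m] conjI TrueI)
  obtain M where M: "M > 0" "\<And>y. y \<in> A \<Longrightarrow> of_int M * y \<in> int_span b" using insert.IH by blast
  have "of_int (M * D) * y \<in> int_span b" if "y \<in> insert x A" for y
  proof (cases "y = x")
    case True
    then show ?thesis using int_span_of_int_mult[OF Dx, of M] by (simp add: mult.assoc)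
  next
    case False
    then show ?thesis using int_span_of_int_mult[OF M(2), of y D] that by (simp add: mult_ac)
  qed
  then show ?case using M(1) D(1) by (intro exI[of _ "M * D"]) auto
qed

lemma finite_residues:
  assumes b: "rat_basis b" and r: "r \<noteq> 0"
  shows "\<exists>\<phi> :: 'a \<Rightarrow> 'n \<Rightarrow> int. finite (range \<phi>) \<and>
     (\<forall>x y. algebraic_int (r * x) \<longrightarrow> algebraic_int (r * y) \<longrightarrow> \<phi> x = \<phi> y \<longrightarrow> x - y \<in> int_span b)"
proof -
  obtain \<beta> where be: "rat_basis \<beta>" "\<And>i. algebraic_int (\<beta> i)" using integral_basis_exists by blast
  obtain \<gamma> where ga: "\<And>i l. tr (\<gamma> i * \<beta> l) = (if i = l then 1 else 0)"
    using dual_basis_exists[OF be(1)] by blast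
  obtain M :: int where M: "M > 0" "\<And>i. of_int M * (\<gamma> i / r) \<in> int_span b"
    using common_denominator[OF b, of "range (\<lambda>i. \<gamma> i / r)"] by auto
  define \<phi> where "\<phi> x = (\<lambda>l. \<lfloor>tr (r * x * \<beta> l)\<rfloor> mod M)" for x
  have "\<phi> x \<in> (UNIV \<rightarrow>\<^sub>E {0..<M})" for x using M(1) by (auto simp: \<phi>_def)
  then have "range \<phi> \<subseteq> (UNIV \<rightarrow>\<^sub>E {0..<M})" by blast
  then have "finite (range \<phi>)" by (rule finite_subset) (simp add: finite_PiE)
  moreover have "x - y \<in> int_span b"
    if xy: "algebraic_int (r * x)" "algebraic_int (r * y)" "\<phi> x = \<phi> y" for x y
  proof -
    have int: "of_int \<lfloor>tr (r * z * \<beta> l)\<rfloor> = tr (r * z * \<beta> l)" if "algebraic_int (r * z)" for z l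
      using tr_nm_algebraic_int(1)[OF algebraic_int_add_mult(2)[OF that be(2)[of l]]]
      by (auto elim!: Ints_cases)
    have "\<exists>k. \<lfloor>tr (r * x * \<beta> l)\<rfloor> - \<lfloor>tr (r * y * \<beta> l)\<rfloor> = M * k" for l
    proof -
      have "\<lfloor>tr (r * x * \<beta> l)\<rfloor> mod M = \<lfloor>tr (r * y * \<beta> l)\<rfloor> mod M"
        using fun_cong[OF xy(3), of l] by (simp add: \<phi>_def)
      then show ?thesis unfolding mod_eq_dvd_iff dvd_def .
    qed
    then have "\<forall>l. \<exists>k. \<lfloor>tr (r * x * \<beta> l)\<rfloor> - \<lfloor>tr (r * y * \<beta> l)\<rfloor> = M * k" by (rule allI)
    from choice[OF this] obtain k
      where k: "\<And>l. \<lfloor>tr (r * x * \<beta> l)\<rfloor> - \<lfloor>tr (r * y * \<beta> l)\<rfloor> = M * k l" by blast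
    have "tr (r * (x - y) * \<beta> l) = of_int (M * k l)" for l
      unfolding k[symmetric] by (simp add: int xy left_diff_distrib right_diff_distrib)
    then have "r * (x - y) = (\<Sum>i\<in>UNIV. of_int (M * k i) * \<gamma> i)"
      by (rule dual_basis_expansion[OF be(1) ga])
    then have "x - y = (\<Sum>i\<in>UNIV. of_int (M * k i) * \<gamma> i) / r" using r by (simp add: field_simps)
    also have "\<dots> = (\<Sum>i\<in>UNIV. of_int (k i) * (of_int M * (\<gamma> i / r)))"
      by (simp add: sum_divide_distrib mult_ac)
    also have "\<dots> \<in> int_span b" by (intro int_span_sum int_span_of_int_mult M(2))
    finally show ?thesis .
  qed
  ultimately show ?thesis by blast
qed

end

section \<open>Fractional ideals are invertible\<close>

lemma mem_ring_of_integers [simp]: "x \<in> ring_of_integers \<longleftrightarrow> algebraic_int x"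
  by (simp add: ring_of_integers_def)

lemma algebraic_int_diff:
  "algebraic_int x \<Longrightarrow> algebraic_int y \<Longrightarrow> algebraic_int (x - y :: 'a::field_char_0)"
  using algebraic_int_add_mult(1)[of x "- y"] by simp

lemma algebraic_int_power: "algebraic_int x \<Longrightarrow> algebraic_int (x ^ k :: 'a::field_char_0)"
  by (induction k) (auto intro: algebraic_int_add_mult)

lemma fractional_idealD:
  assumes "fractional_ideal J"
  shows "0 \<in> J" "\<And>x y. x \<in> J \<Longrightarrow> y \<in> J \<Longrightarrow> x + y \<in> J"
    "\<And>r x. algebraic_int r \<Longrightarrow> x \<in> J \<Longrightarrow> r * x \<in> J"
    "\<And>r x. algebraic_int r \<Longrightarrow> x \<in> J \<Longrightarrow> x * r \<in> J"
    "\<exists>x\<in>J. x \<noteq> 0" "\<exists>r. algebraic_int r \<and> r \<noteq> 0 \<and> (\<forall>x\<in>J. algebraic_int (r * x))"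
    "\<And>x. x \<in> J \<Longrightarrow> - x \<in> J" "\<And>x y. x \<in> J \<Longrightarrow> y \<in> J \<Longrightarrow> x - y \<in> J"
proof -
  note d = assms[unfolded fractional_ideal_def]
  show z: "0 \<in> J" using d by simp
  show a: "x + y \<in> J" if "x \<in> J" "y \<in> J" for x y using d that by simp
  show m: "r * x \<in> J" if "algebraic_int r" "x \<in> J" for r x using d that by simp
  show "x * r \<in> J" if "algebraic_int r" "x \<in> J" for r x using m[OF that] by (simp add: mult.commute)
  show "\<exists>x\<in>J. x \<noteq> 0" using d by blast
  show "\<exists>r. algebraic_int r \<and> r \<noteq> 0 \<and> (\<forall>x\<in>J. algebraic_int (r * x))" using d by auto
  show n: "- x \<in> J" if "x \<in> J" for x using m[of "- 1" x] that by simp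
  show "x - y \<in> J" if "x \<in> J" "y \<in> J" for x y using a[of x "- y"] n that by simp
qed

lemma fractional_idealI:
  assumes "0 \<in> J" "\<And>x y. x \<in> J \<Longrightarrow> y \<in> J \<Longrightarrow> x + y \<in> J"
    "\<And>r x. algebraic_int r \<Longrightarrow> x \<in> J \<Longrightarrow> r * x \<in> J"
    "x0 \<in> J" "x0 \<noteq> 0" "algebraic_int r0" "r0 \<noteq> 0" "\<And>x. x \<in> J \<Longrightarrow> algebraic_int (r0 * x)"
  shows "fractional_ideal J"
  unfolding fractional_ideal_def
proof (intro conjI ballI)
  show "J \<noteq> {0}" using assms(4,5) by blast
  show "\<exists>r\<in>ring_of_integers. r \<noteq> 0 \<and> (\<forall>x\<in>J. r * x \<in> ring_of_integers)"
    using assms(6-8) by (intro bexI[of _ r0]) auto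
qed (use assms(1-3) in auto)

lemma fractional_ideal_sum:
  fixes J :: "'a::field_char_0 set"
  assumes "fractional_ideal J" "\<And>i. i \<in> A \<Longrightarrow> f i \<in> J"
  shows "sum f A \<in> J"
  using assms(2) by (induction A rule: infinite_finite_induct) (auto intro: fractional_idealD(1,2)[OF assms(1)])

lemma fractional_ideal_ring_of_integers: "fractional_ideal ring_of_integers"
  by (rule fractional_idealI[of _ 1 1]) (auto intro: algebraic_int_add_mult)

lemma fractional_ideal_scale:
  fixes J :: "'a::field_char_0 set"
  assumes "fractional_ideal J" "x \<noteq> 0" "algebraic_int d" "d \<noteq> 0" "algebraic_int (d * x)"
  shows "fractional_ideal (ideal_scale x J)"
proof -
  obtain y r where y: "y \<in> J" "y \<noteq> 0" and r: "algebraic_int r" "r \<noteq> 0" "\<And>x. x \<in> J \<Longrightarrow> algebraic_int (r * x)"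
    using fractional_idealD(5,6)[OF assms(1)] by blast
  show ?thesis
  proof (rule fractional_idealI[of _ "x * y" "d * r"])
    show "0 \<in> ideal_scale x J" unfolding ideal_scale_def
      using fractional_idealD(1)[OF assms(1)] by (intro image_eqI[of _ _ 0]) auto
    fix u v assume "u \<in> ideal_scale x J" "v \<in> ideal_scale x J"
    then obtain a b where "u = x * a" "v = x * b" "a \<in> J" "b \<in> J" unfolding ideal_scale_def by blast
    then show "u + v \<in> ideal_scale x J" unfolding ideal_scale_def
      using fractional_idealD(2)[OF assms(1)] by (intro image_eqI[of _ _ "a + b"]) (auto simp: distrib_left)
  next
    fix s u :: 'a assume s: "algebraic_int s" and "u \<in> ideal_scale x J"
    then obtain a where "u = x * a" "a \<in> J" unfolding ideal_scale_def by blast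
    then show "s * u \<in> ideal_scale x J" unfolding ideal_scale_def
      using fractional_idealD(3)[OF assms(1) s] by (intro image_eqI[of _ _ "s * a"]) (auto simp: mult_ac)
  next
    show "x * y \<in> ideal_scale x J" unfolding ideal_scale_def using y by blast
    show "x * y \<noteq> 0" "algebraic_int (d * r)" "d * r \<noteq> 0"
      using assms y r by (auto intro: algebraic_int_add_mult)
    fix u assume "u \<in> ideal_scale x J"
    then obtain a where a: "u = x * a" "a \<in> J" unfolding ideal_scale_def by blast
    have "algebraic_int ((d * x) * (r * a))" using assms(5) r(3)[OF a(2)] by (rule algebraic_int_add_mult)
    then show "algebraic_int (d * r * u)" unfolding a(1) by (simp only: mult_ac)
  qed
qed

lemma ideal_scale_mem: "y \<in> J \<Longrightarrow> x * y \<in> ideal_scale x J"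
  unfolding ideal_scale_def by (rule imageI)

lemma ideal_mult_mem: "x \<in> I \<Longrightarrow> y \<in> J \<Longrightarrow> x * y \<in> ideal_mult I J"
  unfolding ideal_mult_def
  by (intro CollectI exI[of _ "1::nat"] exI[of _ "\<lambda>_. x"] exI[of _ "\<lambda>_. y"]) auto

lemma ideal_mult_zero: "0 \<in> ideal_mult I J"
  unfolding ideal_mult_def
  by (intro CollectI exI[of _ "0::nat"] exI[of _ "\<lambda>_. 0"]) auto

lemma ideal_mult_add:
  assumes "u \<in> ideal_mult I J" "v \<in> ideal_mult I J"
  shows "u + v \<in> ideal_mult I J"
proof -
  obtain m :: nat and x y where u: "u = (\<Sum>i<m. x i * y i)" "\<forall>i<m. x i \<in> I \<and> y i \<in> J"
    using assms(1) unfolding ideal_mult_def by blast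
  obtain m' :: nat and x' y' where v: "v = (\<Sum>i<m'. x' i * y' i)" "\<forall>i<m'. x' i \<in> I \<and> y' i \<in> J"
    using assms(2) unfolding ideal_mult_def by blast
  let ?x = "\<lambda>i. if i < m then x i else x' (i - m)" and ?y = "\<lambda>i. if i < m then y i else y' (i - m)"
  have "(\<Sum>i<m + k. ?x i * ?y i) = u + (\<Sum>i<k. x' i * y' i)" for k
    by (induction k) (auto simp: u add.assoc)
  then have "u + v = (\<Sum>i<m + m'. ?x i * ?y i)" unfolding v by simp
  moreover have "\<forall>i<m + m'. ?x i \<in> I \<and> ?y i \<in> J" using u v by auto
  ultimately show ?thesis unfolding ideal_mult_def
    by (intro CollectI exI[of _ "m + m'"] exI[of _ ?x] exI[of _ ?y] conjI)
qed

lemma ideal_mult_least: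
  assumes "0 \<in> K" "\<And>x y. x \<in> K \<Longrightarrow> y \<in> K \<Longrightarrow> x + y \<in> K" "\<And>x y. x \<in> I \<Longrightarrow> y \<in> J \<Longrightarrow> x * y \<in> K"
    and "u \<in> ideal_mult I J"
  shows "u \<in> K"
proof -
  obtain m :: nat and x y where u: "u = (\<Sum>i<m. x i * y i)" "\<forall>i<m. x i \<in> I \<and> y i \<in> J"
    using assms(4) unfolding ideal_mult_def by blast
  have "(\<Sum>i<k. x i * y i) \<in> K" if "k \<le> m" for k
    using that by (induction k) (use u assms in auto)
  then show ?thesis using u by blast
qed

lemma fractional_ideal_mult:
  fixes I J :: "'a::field_char_0 set"
  assumes I: "fractional_ideal I" and J: "fractional_ideal J"
  shows "fractional_ideal (ideal_mult I J)"
proof -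
  obtain x where x: "x \<in> I" "x \<noteq> 0" using fractional_idealD(5)[OF I] by blast
  obtain y where y: "y \<in> J" "y \<noteq> 0" using fractional_idealD(5)[OF J] by blast
  obtain r where r: "algebraic_int r" "r \<noteq> 0" "\<And>x. x \<in> I \<Longrightarrow> algebraic_int (r * x)"
    using fractional_idealD(6)[OF I] by blast
  obtain s where s: "algebraic_int s" "s \<noteq> 0" "\<And>x. x \<in> J \<Longrightarrow> algebraic_int (s * x)"
    using fractional_idealD(6)[OF J] by blast
  show ?thesis
  proof (rule fractional_idealI[of _ "x * y" "r * s"])
    fix t u :: 'a assume t: "algebraic_int t" and u: "u \<in> ideal_mult I J"
    show "t * u \<in> ideal_mult I J"
    proof (rule ideal_mult_least[OF _ _ _ u, where K = "{u. t * u \<in> ideal_mult I J}", simplified])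
      show "t * (a * b) \<in> ideal_mult I J" if "a \<in> I" "b \<in> J" for a b
        using ideal_mult_mem[OF fractional_idealD(3)[OF I t that(1)] that(2)] by (simp add: mult.assoc)
    qed (auto simp: ideal_mult_zero distrib_left intro: ideal_mult_add)
  next
    fix u assume u: "u \<in> ideal_mult I J"
    show "algebraic_int (r * s * u)"
    proof (rule ideal_mult_least[OF _ _ _ u, where K = "{u. algebraic_int (r * s * u)}", simplified])
      show "algebraic_int (r * s * (a * b))" if "a \<in> I" "b \<in> J" for a b
      proof -
        have "algebraic_int ((r * a) * (s * b))" by (rule algebraic_int_add_mult(2)[OF r(3)[OF that(1)] s(3)[OF that(2)]])
        then show ?thesis by (simp only: mult_ac)
      qed
    qed (auto simp: distrib_left intro: algebraic_int_add_mult)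
  qed (use x y r s in \<open>auto simp: ideal_mult_zero intro: ideal_mult_add ideal_mult_mem algebraic_int_add_mult\<close>)
qed

lemma ideal_mult_assoc: "ideal_mult (ideal_mult I J) K = ideal_mult I (ideal_mult J K)"
proof (intro equalityI subsetI)
  fix u assume "u \<in> ideal_mult (ideal_mult I J) K"
  then show "u \<in> ideal_mult I (ideal_mult J K)"
  proof (rule ideal_mult_least[OF ideal_mult_zero ideal_mult_add, rotated -1])
    fix x z assume x: "x \<in> ideal_mult I J" and z: "z \<in> K"
    show "x * z \<in> ideal_mult I (ideal_mult J K)"
    proof (rule ideal_mult_least[OF _ _ _ x, where K = "{x. x * z \<in> ideal_mult I (ideal_mult J K)}", simplified])
      show "a * b * z \<in> ideal_mult I (ideal_mult J K)" if "a \<in> I" "b \<in> J" for a b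
        using that z unfolding mult.assoc by (intro ideal_mult_mem)
    qed (auto simp: ideal_mult_zero distrib_right intro: ideal_mult_add)
  qed
next
  fix u assume "u \<in> ideal_mult I (ideal_mult J K)"
  then show "u \<in> ideal_mult (ideal_mult I J) K"
  proof (rule ideal_mult_least[OF ideal_mult_zero ideal_mult_add, rotated -1])
    fix z x assume x: "x \<in> ideal_mult J K" and z: "z \<in> I"
    show "z * x \<in> ideal_mult (ideal_mult I J) K"
    proof (rule ideal_mult_least[OF _ _ _ x, where K = "{x. z * x \<in> ideal_mult (ideal_mult I J) K}", simplified])
      show "z * (a * b) \<in> ideal_mult (ideal_mult I J) K" if "a \<in> J" "b \<in> K" for a b
        using that z unfolding mult.assoc[symmetric] by (intro ideal_mult_mem)
    qed (auto simp: ideal_mult_zero distrib_left intro: ideal_mult_add)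
  qed
qed

lemma ideal_mult_ring_of_integers:
  assumes J: "fractional_ideal J"
  shows "ideal_mult ring_of_integers J = J"
proof (intro equalityI subsetI)
  show "u \<in> J" if "u \<in> ideal_mult ring_of_integers J" for u
    using that by (rule ideal_mult_least[rotated -1]) (auto intro: fractional_idealD(1-3)[OF J])
  show "u \<in> ideal_mult ring_of_integers J" if "u \<in> J" for u
    using ideal_mult_mem[of 1 ring_of_integers u J] that by simp
qed

primrec ideal_power :: "'a::field_char_0 set \<Rightarrow> nat \<Rightarrow> 'a set" where
  "ideal_power J 0 = ring_of_integers"
| "ideal_power J (Suc m) = ideal_mult J (ideal_power J m)"

lemma fractional_ideal_power: "fractional_ideal J \<Longrightarrow> fractional_ideal (ideal_power J m)"
  by (induction m) (auto intro: fractional_ideal_ring_of_integers fractional_ideal_mult)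

lemma ideal_power_add:
  "fractional_ideal J \<Longrightarrow> ideal_power J (m + k) = ideal_mult (ideal_power J m) (ideal_power J k)"
  by (induction m) (auto simp: ideal_mult_ring_of_integers fractional_ideal_power ideal_mult_assoc)

lemma fractional_ideal_inverse:
  fixes J :: "'a::field_char_0 set"
  assumes J: "fractional_ideal J"
  shows "fractional_ideal (ideal_inverse J)"
proof -
  obtain x where x: "x \<in> J" "x \<noteq> 0" using fractional_idealD(5)[OF J] by blast
  obtain r where r: "algebraic_int r" "r \<noteq> 0" "\<And>x. x \<in> J \<Longrightarrow> algebraic_int (r * x)"
    using fractional_idealD(6)[OF J] by blast
  show ?thesis
  proof (rule fractional_idealI[of _ r "r * x"])
    show "r * s \<in> ideal_inverse J" if "algebraic_int r" "s \<in> ideal_inverse J" for r s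
      using that unfolding ideal_inverse_def by (auto simp: mult.assoc intro: algebraic_int_add_mult)
    show "algebraic_int (r * x * s)" if "s \<in> ideal_inverse J" for s
    proof -
      have "algebraic_int (s * x)" using that x unfolding ideal_inverse_def by auto
      then have "algebraic_int (r * (s * x))" by (rule algebraic_int_add_mult(2)[OF r(1)])
      then show ?thesis by (simp only: mult_ac)
    qed
  qed (use x r in \<open>auto simp: ideal_inverse_def distrib_right intro: algebraic_int_add_mult\<close>)
qed

lemma fractional_ideal_multiplier:
  fixes J :: "'a::field_char_0 set"
  assumes J: "fractional_ideal J" and d: "\<exists>d::int. d > 0 \<and> algebraic_int (of_int d * x)"
  shows "\<exists>r. algebraic_int r \<and> r \<noteq> 0 \<and> r * x \<in> J"
proof -
  obtain d :: int where d: "d > 0" "algebraic_int (of_int d * x)" using assms(2) by blast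
  obtain y where y: "y \<in> J" "y \<noteq> 0" using fractional_idealD(5)[OF J] by blast
  obtain r where r: "algebraic_int r" "r \<noteq> 0" "\<And>x. x \<in> J \<Longrightarrow> algebraic_int (r * x)"
    using fractional_idealD(6)[OF J] by blast
  have "algebraic_int (r * y)" using r y by blast
  have "r * (of_int d * x) * y \<in> J"
    by (rule fractional_idealD(3)[OF J _ y(1)]) (intro algebraic_int_add_mult r d)
  then have "(r * y * of_int d) * x \<in> J" by (simp only: mult_ac)
  moreover have "algebraic_int (r * y * of_int d)"
    using algebraic_int_add_mult(2)[OF \<open>algebraic_int (r * y)\<close>] by simp
  ultimately show ?thesis using r y d by (intro exI[of _ "r * y * of_int d"]) auto
qed

context totally_real_field begin

lemma fractional_ideal_generators:
  fixes J :: "'a set"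
  assumes J: "fractional_ideal J"
  shows "\<exists>G \<subseteq> J. finite G \<and> (\<exists>g\<in>G. g \<noteq> 0) \<and> (\<forall>x\<in>J. \<exists>m. x = (\<Sum>g\<in>G. of_int (m g) * g))"
proof -
  obtain \<beta> where be: "rat_basis \<beta>" "\<And>i. algebraic_int (\<beta> i)" using integral_basis_exists by blast
  obtain y where y: "y \<in> J" "y \<noteq> 0" using fractional_idealD(5)[OF J] by blast
  obtain r where r: "algebraic_int r" "r \<noteq> 0" "\<And>x. x \<in> J \<Longrightarrow> algebraic_int (r * x)"
    using fractional_idealD(6)[OF J] by blast
  define b where "b = (\<lambda>i. y * \<beta> i)"
  have "rat_basis (\<lambda>i. y * (of_rat 1 * \<beta> i))" by (rule rat_basis_scale[OF be(1)]) (use y in auto)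
  then have b: "rat_basis b" unfolding b_def by simp
  have bJ: "b i \<in> J" for i unfolding b_def using y be(2) by (intro fractional_idealD(4)[OF J])
  obtain \<phi> :: "'a \<Rightarrow> 'n \<Rightarrow> int" where phi: "finite (range \<phi>)"
    "\<And>x y. algebraic_int (r * x) \<Longrightarrow> algebraic_int (r * y) \<Longrightarrow> \<phi> x = \<phi> y \<Longrightarrow> x - y \<in> int_span b"
    using finite_residues[OF b r(2)] by blast
  define R where "R = (\<lambda>c. SOME x. x \<in> J \<and> \<phi> x = c) ` (\<phi> ` J)"
  have rep: "\<exists>x'\<in>R. x' \<in> J \<and> \<phi> x' = \<phi> x" if "x \<in> J" for x
  proof -
    have "(SOME z. z \<in> J \<and> \<phi> z = \<phi> x) \<in> J \<and> \<phi> (SOME z. z \<in> J \<and> \<phi> z = \<phi> x) = \<phi> x"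
      by (rule someI[of "\<lambda>z. z \<in> J \<and> \<phi> z = \<phi> x" x]) (use that in simp)
    then show ?thesis unfolding R_def using that by blast
  qed
  have "finite (\<phi> ` J)" by (rule finite_subset[OF _ phi(1)]) auto
  then have fR: "finite R" unfolding R_def by simp
  have RJ: "R \<subseteq> J"
  proof
    fix z assume "z \<in> R"
    then obtain x where x: "x \<in> J" "z = (SOME z. z \<in> J \<and> \<phi> z = \<phi> x)" unfolding R_def by blast
    have "z \<in> J \<and> \<phi> z = \<phi> x"
      unfolding x(2) by (rule someI[of "\<lambda>z. z \<in> J \<and> \<phi> z = \<phi> x" x]) (use x in simp)
    then show "z \<in> J" ..
  qed
  define G where "G = R \<union> range b"
  define A where "A = {x. \<exists>m. x = (\<Sum>g\<in>G. of_int (m g) * g)}"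
  have fG: "finite G" unfolding G_def using fR by simp
  have GA: "g \<in> A" if "g \<in> G" for g
  proof -
    have "(\<Sum>h\<in>G. of_int (if h = g then 1 else 0) * h) = (\<Sum>h\<in>G. if h = g then g else 0)"
      by (intro sum.cong) auto
    then have "g = (\<Sum>h\<in>G. of_int (if h = g then 1 else 0) * h)" using fG that by simp
    then show ?thesis unfolding A_def by (intro CollectI exI[of _ "\<lambda>h. if h = g then 1 else 0"])
  qed
  have A_add: "u + v \<in> A" if uv: "u \<in> A" "v \<in> A" for u v
  proof -
    obtain m m' where "u = (\<Sum>g\<in>G. of_int (m g) * g)" "v = (\<Sum>g\<in>G. of_int (m' g) * g)"
      using uv unfolding A_def by auto
    then have "u + v = (\<Sum>g\<in>G. of_int (m g + m' g) * g)" by (simp add: distrib_right sum.distrib)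
    then show ?thesis unfolding A_def by (intro CollectI exI[of _ "\<lambda>g. m g + m' g"])
  qed
  have A_mult: "of_int k * u \<in> A" if u: "u \<in> A" for k u
  proof -
    obtain m where "u = (\<Sum>g\<in>G. of_int (m g) * g)" using u unfolding A_def by auto
    then have "of_int k * u = (\<Sum>g\<in>G. of_int (k * m g) * g)" by (simp add: sum_distrib_left mult.assoc)
    then show ?thesis unfolding A_def by (intro CollectI exI[of _ "\<lambda>g. k * m g"])
  qed
  have A_0: "0 \<in> A" unfolding A_def by (intro CollectI exI[of _ "\<lambda>_. 0"]) simp
  have "x \<in> A" if x: "x \<in> J" for x
  proof -
    obtain x' where x': "x' \<in> R" "x' \<in> J" "\<phi> x = \<phi> x'" using rep[OF x] by force
    have "x - x' \<in> int_span b" using phi(2)[OF r(3) r(3)] x x' by blast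
    then obtain m where m: "x - x' = (\<Sum>i\<in>UNIV. of_int (m i) * b i)" unfolding int_span_def by blast
    have bA: "b i \<in> A" for i by (rule GA) (simp add: G_def)
    have "(\<Sum>i\<in>S. of_int (m i) * b i) \<in> A" for S
      by (induction S rule: infinite_finite_induct) (simp_all add: A_0 A_add A_mult bA)
    then have "x - x' \<in> A" unfolding m .
    moreover have "x' \<in> A" using x'(1) by (intro GA) (simp add: G_def)
    ultimately have "(x - x') + x' \<in> A" by (rule A_add)
    then show ?thesis by simp
  qed
  moreover have "G \<subseteq> J" using RJ bJ unfolding G_def by blast
  moreover have "\<exists>g\<in>G. g \<noteq> 0"
  proof -
    obtain i :: 'n where True by blast
    have "b i \<noteq> 0"
    proof
      assume "b i = 0"
      have "(\<Sum>k\<in>UNIV. (if k = i then 1 else 0) * emb j (b k)) = 0" for j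
        by (rule sum.neutral) (auto simp: \<open>b i = 0\<close>)
      then have "(if i = i then 1 else 0 :: real) = 0"
        by (rule rat_basis_independent[OF b, of "\<lambda>k. if k = i then 1 else 0"])
      then show False by simp
    qed
    then show ?thesis unfolding G_def by blast
  qed
  moreover have "x \<in> A \<Longrightarrow> \<exists>m. x = (\<Sum>g\<in>G. of_int (m g) * g)" for x unfolding A_def by simp
  ultimately show ?thesis using fG by (intro exI[of _ G] conjI ballI) simp_all
qed

lemma multiplier_algebraic_int:
  fixes J :: "'a set"
  assumes J: "fractional_ideal J" and x: "\<And>y. y \<in> J \<Longrightarrow> x * y \<in> J"
  shows "algebraic_int x"
proof -
  obtain G where G0: "G \<subseteq> J \<and> finite G \<and> (\<exists>g\<in>G. g \<noteq> 0) \<and> (\<forall>x\<in>J. \<exists>m. x = (\<Sum>g\<in>G. of_int (m g) * g))"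
    using fractional_ideal_generators[OF J] by (rule exE)
  then have G: "G \<subseteq> J" "finite G" "\<exists>g\<in>G. g \<noteq> 0" "\<And>x. x \<in> J \<Longrightarrow> \<exists>m. x = (\<Sum>g\<in>G. of_int (m g) * g)"
    by simp_all
  have "\<exists>m. g \<in> G \<longrightarrow> x * g = (\<Sum>h\<in>G. of_int (m h) * h)" for g
  proof (cases "g \<in> G")
    case True
    then have "x * g \<in> J" using G(1) x by auto
    from G(4)[OF this] show ?thesis using True by simp
  qed simp
  then have "\<forall>g. \<exists>m. g \<in> G \<longrightarrow> x * g = (\<Sum>h\<in>G. of_int (m h) * h)" by (rule allI)
  from choice[OF this] obtain m
    where m0: "\<forall>g. g \<in> G \<longrightarrow> x * g = (\<Sum>h\<in>G. of_int (m g h) * h)" by (rule exE)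
  then have m: "x * g = (\<Sum>h\<in>G. of_int (m g h) * h)" if "g \<in> G" for g using that by simp
  have act: "int_matrix_action x G (\<lambda>g. g)" unfolding int_matrix_action_def
  proof (intro exI[of _ "\<lambda>g h. of_int (m g h)"] conjI allI ballI)
    show "x * g = (\<Sum>h\<in>G. of_int (m g h) * h)" if "g \<in> G" for g using that by (rule m)
  qed simp
  from G(3) obtain g where g: "g \<in> G" "g \<noteq> 0" by (rule bexE)
  show ?thesis using int_matrix_action_imp_algebraic_int[OF act G(2) g] .
qed

lemma ideal_absorbs_imp_one:
  fixes C B :: "'a set"
  assumes C: "fractional_ideal C" "C \<subseteq> ring_of_integers" and B: "fractional_ideal B"
    and BCB: "B \<subseteq> ideal_mult C B"
  shows "1 \<in> C"
proof -
  obtain G where G0: "G \<subseteq> B \<and> finite G \<and> (\<exists>g\<in>G. g \<noteq> 0) \<and> (\<forall>x\<in>B. \<exists>m. x = (\<Sum>g\<in>G. of_int (m g) * g))"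
    using fractional_ideal_generators[OF B] by (rule exE)
  then have G: "G \<subseteq> B" "finite G" "\<exists>g\<in>G. g \<noteq> 0" "\<And>x. x \<in> B \<Longrightarrow> \<exists>m. x = (\<Sum>g\<in>G. of_int (m g) * g)"
    by simp_all
  define A where "A = {x. \<exists>c. (\<forall>g. c g \<in> C) \<and> x = (\<Sum>g\<in>G. c g * g)}"
  have "x \<in> A" if "x \<in> ideal_mult C B" for x
  proof (rule ideal_mult_least[OF _ _ _ that])
    show "0 \<in> A" unfolding A_def using fractional_idealD(1)[OF C(1)]
      by (intro CollectI exI[of _ "\<lambda>_. 0"]) simp
    fix u v assume "u \<in> A" "v \<in> A"
    then obtain c d where "\<forall>g. c g \<in> C" "u = (\<Sum>g\<in>G. c g * g)" "\<forall>g. d g \<in> C" "v = (\<Sum>g\<in>G. d g * g)"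
      unfolding A_def by auto
    then show "u + v \<in> A" unfolding A_def using fractional_idealD(2)[OF C(1)]
      by (intro CollectI exI[of _ "\<lambda>g. c g + d g"]) (simp add: distrib_right sum.distrib)
  next
    fix c y assume c: "c \<in> C" and y: "y \<in> B"
    obtain m where m: "y = (\<Sum>g\<in>G. of_int (m g) * g)" using G(4)[OF y] by (rule exE)
    have "c * of_int (m g) \<in> C" for g by (rule fractional_idealD(4)[OF C(1) _ c]) simp
    moreover have "c * y = (\<Sum>g\<in>G. (c * of_int (m g)) * g)" unfolding m by (simp add: sum_distrib_left mult.assoc)
    ultimately show "c * y \<in> A" unfolding A_def by (intro CollectI exI[of _ "\<lambda>g. c * of_int (m g)"]) simp
  qed
  then have "h \<in> G \<Longrightarrow> h \<in> A" for h using G(1) BCB by auto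
  then have "\<exists>c. h \<in> G \<longrightarrow> (\<forall>g. c g \<in> C) \<and> h = (\<Sum>g\<in>G. c g * g)" for h
    unfolding A_def by (cases "h \<in> G") simp_all
  then have "\<forall>h. \<exists>c. h \<in> G \<longrightarrow> (\<forall>g. c g \<in> C) \<and> h = (\<Sum>g\<in>G. c g * g)" by (rule allI)
  from choice[OF this] obtain c
    where c0: "\<forall>h. h \<in> G \<longrightarrow> (\<forall>g. c h g \<in> C) \<and> h = (\<Sum>g\<in>G. c h g * g)" by (rule exE)
  have c1: "(\<forall>g. c h g \<in> C) \<and> h = (\<Sum>g\<in>G. c h g * g)" if "h \<in> G" for h
    by (rule mp[OF spec[OF c0] that])
  note c = conjunct1[OF c1, THEN spec] conjunct2[OF c1]
  let ?U = "\<lambda>_::nat. {u. u - 1 \<in> C}" and ?C = "\<lambda>_::nat. C"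
  have CC: "b * d \<in> C" if "b \<in> C" "d \<in> C" for b d
    using that C(2) by (intro fractional_idealD(3)[OF C(1)]) auto
  have "\<exists>e. \<exists>w\<in>?U e. \<forall>g\<in>G. w * g = 0"
  proof (rule linear_system_elimination[where C = ?C and u = 1 and c = c and d = 0, OF _ _ _ _ _ G(2)])
    show "u - b \<in> {u. u - 1 \<in> C}" if "u \<in> {u. u - 1 \<in> C}" "b \<in> C" for u b
      using fractional_idealD(8)[OF C(1), of "u - 1" b] that by (simp add: algebra_simps)
    have uc: "u * b \<in> C" if "u - 1 \<in> C" "b \<in> C" for u b
      using fractional_idealD(2)[OF C(1) CC[OF that] that(2)] by (simp add: algebra_simps)
    then show "u * b \<in> C" if "u \<in> {u. u - 1 \<in> C}" "b \<in> C" for u b using that by simp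
    show "u * w \<in> {u. u - 1 \<in> C}" if "u \<in> {u. u - 1 \<in> C}" "w \<in> {u. u - 1 \<in> C}" for u w
      using fractional_idealD(2)[OF C(1) uc[of u "w - 1"], of "u - 1"] that by (simp add: algebra_simps)
    show "1 * g = (\<Sum>h\<in>G. c g h * h)" if "g \<in> G" for g unfolding mult_1 by (rule c(2)[OF that])
  qed (use CC c(1) fractional_idealD(1,2)[OF C(1)] in auto)
  then obtain w where w: "w - 1 \<in> C" "\<forall>g\<in>G. w * g = 0" by blast
  then have "w = 0" using G(3) by auto
  then show ?thesis using w(1) fractional_idealD(7)[OF C(1), of "- 1"] by simp
qed

lemma totally_positive_nonzero: "totally_positive emb \<xi> \<Longrightarrow> \<xi> \<noteq> 0"
  unfolding totally_positive_def using emb_simps(1) by (metis less_irrefl)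

lemma integer_multiple: "\<exists>d::int. d > 0 \<and> algebraic_int (of_int d * (x :: 'a))"
  by (rule algebraic_imp_int_multiple[OF algebraic_field])

lemma fractional_ideal_scale':
  fixes J :: "'a set"
  assumes J: "fractional_ideal J" "x \<noteq> 0"
  shows "fractional_ideal (ideal_scale x J)"
proof -
  obtain d :: int where d: "d > 0" "algebraic_int (of_int d * x)" using integer_multiple[of x] by blast
  then show ?thesis using fractional_ideal_scale[OF J, of "of_int d"] by simp
qed

lemma ideal_power_classes:
  fixes J :: "'a set"
  assumes reps: "strict_class_reps emb h I" and J: "fractional_ideal J"
  shows "\<exists>d j \<xi>. \<xi> \<noteq> 0 \<and> ideal_power J (Suc d + j) = ideal_scale \<xi> (ideal_power J j)"
proof -
  have "\<forall>m. \<exists>l \<xi>. l \<in> {1..h} \<and> totally_positive emb \<xi> \<and> ideal_power J m = ideal_scale \<xi> (I l)"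
    using reps fractional_ideal_power[OF J] unfolding strict_class_reps_def by blast
  from choice[OF this] obtain l where l: "\<And>m. \<exists>\<xi>. l m \<in> {1..h} \<and> totally_positive emb \<xi> \<and> ideal_power J m = ideal_scale \<xi> (I (l m))"
    by blast
  have "\<not> inj_on l {..h}"
  proof
    assume "inj_on l {..h}"
    then have "card {..h} \<le> card {1..h}" using l by (intro card_inj_on_le[of l]) auto
    then show False by simp
  qed
  then obtain j i where ij: "j < i" "l i = l j" unfolding inj_on_def by (metis nat_neq_iff)
  obtain \<xi> \<eta> where x: "totally_positive emb \<xi>" "ideal_power J i = ideal_scale \<xi> (I (l j))"
    "totally_positive emb \<eta>" "ideal_power J j = ideal_scale \<eta> (I (l j))"
    using l[of i] l[of j] ij(2) by auto
  have "ideal_power J i = ideal_scale (\<xi> / \<eta>) (ideal_power J j)"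
    unfolding x(2,4) ideal_scale_def image_image using totally_positive_nonzero[OF x(3)] by simp
  moreover have "i = Suc (i - j - 1) + j" using ij by simp
  moreover have "\<xi> / \<eta> \<noteq> 0" using x(1,3) totally_positive_nonzero by simp
  ultimately show ?thesis by (intro exI[of _ "i - j - 1"] exI[of _ j] exI[of _ "\<xi> / \<eta>"]) simp
qed

text \<open>Finitely many ideal classes make two powers of \<open>J\<close> proportional, and an ideal that is absorbed by a fractional ideal contains \<open>1\<close> by the determinant trick.\<close>

lemma ideal_mult_inverse:
  fixes J :: "'a set"
  assumes reps: "strict_class_reps emb h I" and J: "fractional_ideal J"
  shows "1 \<in> ideal_mult J (ideal_inverse J)"
proof -
  obtain d j \<xi> where x: "\<xi> \<noteq> 0" "ideal_power J (Suc d + j) = ideal_scale \<xi> (ideal_power J j)"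
    using ideal_power_classes[OF assms] by blast
  define B where "B = ideal_power J j"
  define C where "C = ideal_scale (1 / \<xi>) (ideal_power J (Suc d))"
  have B: "fractional_ideal B" unfolding B_def using J by (rule fractional_ideal_power)
  have C: "fractional_ideal C" unfolding C_def using J x(1) by (intro fractional_ideal_scale' fractional_ideal_power) auto
  have eq: "ideal_mult (ideal_power J (Suc d)) B = ideal_scale \<xi> B"
    using x(2) unfolding B_def ideal_power_add[OF J] .
  have CB: "c * b \<in> B" if cb: "c \<in> C" "b \<in> B" for c b
  proof -
    obtain p where p: "c = 1 / \<xi> * p" "p \<in> ideal_power J (Suc d)" using cb(1) unfolding C_def ideal_scale_def by blast
    have "p * b \<in> ideal_scale \<xi> B" using ideal_mult_mem[OF p(2) cb(2)] unfolding eq .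
    then obtain b' where "p * b = \<xi> * b'" "b' \<in> B" unfolding ideal_scale_def by blast
    then show ?thesis using x(1) unfolding p(1) by (simp add: field_simps)
  qed
  have CO: "algebraic_int c" if "c \<in> C" for c
    by (rule multiplier_algebraic_int[OF B CB[OF that]])
  have "B \<subseteq> ideal_mult C B"
  proof
    fix b assume "b \<in> B"
    then have "\<xi> * b \<in> ideal_mult (ideal_power J (Suc d)) B" unfolding eq by (rule ideal_scale_mem)
    then have "\<xi> * b \<in> {u. u / \<xi> \<in> ideal_mult C B}"
    proof (rule ideal_mult_least[rotated -1])
      fix u v assume u: "u \<in> ideal_power J (Suc d)" "v \<in> B"
      from u(1) have "1 / \<xi> * u \<in> C" unfolding C_def by (rule ideal_scale_mem)
      then have "1 / \<xi> * u * v \<in> ideal_mult C B" using u(2) by (rule ideal_mult_mem)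
      then show "u * v \<in> {u. u / \<xi> \<in> ideal_mult C B}" by simp
    qed (auto simp: ideal_mult_zero add_divide_distrib intro: ideal_mult_add)
    then show "b \<in> ideal_mult C B" using x(1) by simp
  qed
  moreover have "C \<subseteq> ring_of_integers" using CO by (intro subsetI) simp
  ultimately have "1 \<in> C" by (intro ideal_absorbs_imp_one[OF C _ B])
  then have "\<xi> \<in> ideal_mult J (ideal_power J d)" unfolding C_def ideal_scale_def using x(1) by (auto simp: field_simps)
  then have "\<xi> \<in> {u. u / \<xi> \<in> ideal_mult J (ideal_inverse J)}"
  proof (rule ideal_mult_least[rotated -1])
    fix u v assume u: "u \<in> J" "v \<in> ideal_power J d"
    have "v / \<xi> \<in> ideal_inverse J" unfolding ideal_inverse_def
    proof (intro CollectI ballI)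
      fix y assume "y \<in> J"
      then have "y * v \<in> ideal_power J (Suc d)" using u(2) by (auto intro: ideal_mult_mem)
      then have "1 / \<xi> * (y * v) \<in> C" unfolding C_def by (rule ideal_scale_mem)
      then have "algebraic_int (1 / \<xi> * (y * v))" by (rule CO)
      moreover have "1 / \<xi> * (y * v) = v / \<xi> * y" by simp
      ultimately show "v / \<xi> * y \<in> ring_of_integers" by (simp only: mem_ring_of_integers)
    qed
    then have "u * (v / \<xi>) \<in> ideal_mult J (ideal_inverse J)" by (rule ideal_mult_mem[OF u(1)])
    then show "u * v \<in> {u. u / \<xi> \<in> ideal_mult J (ideal_inverse J)}" by simp
  qed (auto simp: ideal_mult_zero add_divide_distrib intro: ideal_mult_add)
  then show ?thesis using x(1) by simp
qed

lemma ideal_inverse_inverse: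
  fixes J :: "'a set"
  assumes reps: "strict_class_reps emb h I" and J: "fractional_ideal J"
  shows "ideal_inverse (ideal_inverse J) = J"
proof (intro equalityI subsetI)
  fix x assume x: "x \<in> ideal_inverse (ideal_inverse J)"
  have "1 \<in> {u. x * u \<in> J}"
  proof (rule ideal_mult_least[OF _ _ _ ideal_mult_inverse[OF assms]])
    fix a b assume ab: "a \<in> J" "b \<in> ideal_inverse J"
    then have "algebraic_int (x * b)" using x unfolding ideal_inverse_def by auto
    then have "x * b * a \<in> J" using ab by (intro fractional_idealD(3)[OF J])
    then show "a * b \<in> {u. x * u \<in> J}" by (simp add: mult_ac)
  qed (auto simp: distrib_left intro: fractional_idealD(1,2)[OF J])
  then show "x \<in> J" by simp
qed (auto simp: ideal_inverse_def mult.commute)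

section \<open>Trace duals\<close>

definition trace_dual :: "'a set \<Rightarrow> 'a set" where
  "trace_dual P = {x. \<forall>y\<in>P. tr (x * y) \<in> \<int>}"

lemma trace_dualD: "x \<in> trace_dual P \<Longrightarrow> y \<in> P \<Longrightarrow> tr (x * y) \<in> \<int>"
  unfolding trace_dual_def by simp

lemma trace_dual_ring_of_integers_bounded:
  "\<exists>D::int. D > 0 \<and> (\<forall>x\<in>trace_dual ring_of_integers. algebraic_int (of_int D * x))"
proof -
  obtain \<beta> where be: "rat_basis \<beta>" "\<And>i. algebraic_int (\<beta> i)" using integral_basis_exists by blast
  obtain \<gamma> where ga: "\<And>i l. tr (\<gamma> i * \<beta> l) = (if i = l then 1 else 0)"
    using dual_basis_exists[OF be(1)] by blast
  obtain D :: int where D: "D > 0" "\<And>i. of_int D * \<gamma> i \<in> int_span \<beta>"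
    using common_denominator[OF be(1), of "range \<gamma>"] by auto
  have int: "algebraic_int z" if "z \<in> int_span \<beta>" for z
    using that be(2) unfolding int_span_def by (auto intro!: algebraic_int_sum algebraic_int_add_mult)
  have "algebraic_int (of_int D * x)" if x: "x \<in> trace_dual ring_of_integers" for x
  proof -
    have "tr (x * \<beta> l) = of_int \<lfloor>tr (x * \<beta> l)\<rfloor>" for l
    proof -
      have "tr (x * \<beta> l) \<in> \<int>" using x be(2) unfolding trace_dual_def by simp
      then show ?thesis by (auto elim!: Ints_cases)
    qed
    then have "x = (\<Sum>i\<in>UNIV. of_int \<lfloor>tr (x * \<beta> i)\<rfloor> * \<gamma> i)" by (rule dual_basis_expansion[OF be(1) ga])
    then have "of_int D * x = of_int D * (\<Sum>i\<in>UNIV. of_int \<lfloor>tr (x * \<beta> i)\<rfloor> * \<gamma> i)" by (rule arg_cong)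
    also have "\<dots> = (\<Sum>i\<in>UNIV. of_int \<lfloor>tr (x * \<beta> i)\<rfloor> * (of_int D * \<gamma> i))"
      by (simp add: sum_distrib_left mult_ac)
    also have "algebraic_int \<dots>"
      by (intro algebraic_int_sum algebraic_int_add_mult(2)[OF _ int[OF D(2)]]) simp
    finally show ?thesis .
  qed
  then show ?thesis using D(1) by blast
qed

lemma fractional_ideal_trace_dual:
  assumes P: "fractional_ideal P"
  shows "fractional_ideal (trace_dual P)"
proof -
  obtain y where y: "y \<in> P" "y \<noteq> 0" using fractional_idealD(5)[OF P] by blast
  obtain r where r: "algebraic_int r" "r \<noteq> 0" "\<And>x. x \<in> P \<Longrightarrow> algebraic_int (r * x)"
    using fractional_idealD(6)[OF P] by blast
  obtain D :: int where D: "D > 0" "\<And>x. x \<in> trace_dual ring_of_integers \<Longrightarrow> algebraic_int (of_int D * x)"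
    using trace_dual_ring_of_integers_bounded by blast
  show ?thesis
  proof (rule fractional_idealI[of _ r "of_int D * (r * y)"])
    show "s * x \<in> trace_dual P" if "algebraic_int s" "x \<in> trace_dual P" for s x
      unfolding trace_dual_def
    proof (intro CollectI ballI)
      fix z assume "z \<in> P"
      then have "s * z \<in> P" by (rule fractional_idealD(3)[OF P that(1)])
      then have "tr (x * (s * z)) \<in> \<int>" by (rule trace_dualD[OF that(2)])
      then show "tr (s * x * z) \<in> \<int>" by (simp only: mult_ac)
    qed
    show "r \<in> trace_dual P" unfolding trace_dual_def by (auto intro!: tr_nm_algebraic_int(1) r(3))
    show "algebraic_int (of_int D * (r * y))"
      by (rule algebraic_int_add_mult(2)[OF _ r(3)[OF y(1)]]) simp
    show "algebraic_int (of_int D * (r * y) * x)" if x: "x \<in> trace_dual P" for x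
    proof -
      have "x * y \<in> trace_dual ring_of_integers" unfolding trace_dual_def
      proof (intro CollectI ballI)
        fix s :: 'a assume "s \<in> ring_of_integers"
        then have "y * s \<in> P" using fractional_idealD(4)[OF P _ y(1)] by simp
        then have "tr (x * (y * s)) \<in> \<int>" by (rule trace_dualD[OF x])
        then show "tr (x * y * s) \<in> \<int>" by (simp only: mult_ac)
      qed
      then have "algebraic_int (r * (of_int D * (x * y)))" by (rule algebraic_int_add_mult(2)[OF r(1) D(2)])
      then show ?thesis by (simp only: mult_ac)
    qed
  qed (use y r D in \<open>auto simp: trace_dual_def distrib_right\<close>)
qed

lemma different_eq: "different emb = ideal_inverse (trace_dual ring_of_integers)"
  unfolding different_def trace_dual_def tr_def ..

text \<open>The translations in the congruence subgroup are dual under the trace form to the frequencies, which is where the different enters.\<close>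

lemma translation_lattice:
  assumes reps: "strict_class_reps emb h I" and J: "fractional_ideal J"
  defines "P \<equiv> ideal_mult (ideal_inverse J) (ideal_inverse (different emb))"
  shows "fractional_ideal P" "trace_dual P = J"
proof -
  let ?C = "trace_dual ring_of_integers"
  have C: "fractional_ideal ?C" by (intro fractional_ideal_trace_dual fractional_ideal_ring_of_integers)
  have P: "P = ideal_mult (ideal_inverse J) ?C"
    unfolding P_def different_eq ideal_inverse_inverse[OF reps C] ..
  show "fractional_ideal P" unfolding P by (intro fractional_ideal_mult fractional_ideal_inverse C J)
  show "trace_dual P = J"
  proof (intro equalityI subsetI)
    fix x assume x: "x \<in> trace_dual P"
    have "algebraic_int (x * y)" if y: "y \<in> ideal_inverse J" for y
    proof (rule multiplier_algebraic_int[OF C])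
      fix z assume z: "z \<in> ?C"
      show "x * y * z \<in> ?C" unfolding trace_dual_def
      proof (intro CollectI ballI)
        fix r :: 'a assume "r \<in> ring_of_integers"
        then have "z * r \<in> ?C" using fractional_idealD(4)[OF C _ z] by simp
        then have "y * (z * r) \<in> P" unfolding P using y by (intro ideal_mult_mem)
        then have "tr (x * (y * (z * r))) \<in> \<int>" by (rule trace_dualD[OF x])
        then show "tr (x * y * z * r) \<in> \<int>" by (simp only: mult_ac)
      qed
    qed
    then have "x \<in> ideal_inverse (ideal_inverse J)" unfolding ideal_inverse_def[of "ideal_inverse J"] by simp
    then show "x \<in> J" using ideal_inverse_inverse[OF reps J] by simp
  next
    fix x assume x: "x \<in> J"
    have "tr (x * u) \<in> \<int>" if u: "u \<in> P" for u
    proof -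
      have "u \<in> {u. tr (x * u) \<in> \<int>}"
      proof (rule ideal_mult_least[OF _ _ _ u[unfolded P]])
        fix a b assume ab: "a \<in> ideal_inverse J" "b \<in> ?C"
        have "algebraic_int (a * x)" using ab(1) x unfolding ideal_inverse_def by auto
        then have "tr (b * (a * x)) \<in> \<int>" by (intro trace_dualD[OF ab(2)]) simp
        then show "a * b \<in> {u. tr (x * u) \<in> \<int>}" by (simp add: mult_ac)
      qed (auto simp: distrib_left)
      then show ?thesis by simp
    qed
    then show "x \<in> trace_dual P" unfolding trace_dual_def by blast
  qed
qed


section \<open>Units\<close>

text \<open>Pigeonhole: among the integers in a box that is long in one direction, two lie close together in all other directions, while the norm of their difference stays bounded.\<close>

lemma small_elements:
  fixes j :: 'n
  shows "\<exists>C. \<forall>\<delta>>0. \<exists>x. algebraic_int x \<and> x \<noteq> 0 \<and> (\<forall>i. i \<noteq> j \<longrightarrow> \<bar>emb i x\<bar> \<le> \<delta>) \<and> \<bar>nm x\<bar> \<le> C"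
proof -
  obtain \<beta> where be: "rat_basis \<beta>" "\<And>i. algebraic_int (\<beta> i)" using integral_basis_exists by blast
  define B where "B = 1 + (\<Sum>i\<in>UNIV. \<Sum>l\<in>UNIV. \<bar>emb i (\<beta> l)\<bar>)"
  have B1: "B \<ge> 1" unfolding B_def by (auto intro!: sum_nonneg)
  have B_row: "(\<Sum>l\<in>UNIV. \<bar>emb i (\<beta> l)\<bar>) \<le> B" for i
    unfolding B_def using member_le_sum[of i UNIV "\<lambda>i. \<Sum>l\<in>UNIV. \<bar>emb i (\<beta> l)\<bar>"] by (simp add: sum_nonneg)
  define pt where "pt m = (\<Sum>l\<in>UNIV. of_int (m l) * \<beta> l)" for m :: "'n \<Rightarrow> int"
  have emb_pt: "\<bar>emb i (pt m)\<bar> \<le> B * Q" if "\<And>l. \<bar>real_of_int (m l)\<bar> \<le> Q" for i m Q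
  proof -
    have "0 \<le> Q" using that[of j] by linarith
    have "\<bar>emb i (pt m)\<bar> \<le> (\<Sum>l\<in>UNIV. \<bar>real_of_int (m l) * emb i (\<beta> l)\<bar>)"
      unfolding pt_def by (simp add: sum_abs)
    also have "\<dots> \<le> (\<Sum>l\<in>UNIV. Q * \<bar>emb i (\<beta> l)\<bar>)"
      by (intro sum_mono) (simp add: abs_mult mult_right_mono that)
    also have "\<dots> = Q * (\<Sum>l\<in>UNIV. \<bar>emb i (\<beta> l)\<bar>)" by (simp add: sum_distrib_left)
    also have "\<dots> \<le> Q * B" using B_row \<open>0 \<le> Q\<close> by (intro mult_left_mono)
    finally show ?thesis by (simp add: mult.commute)
  qed
  define n where "n = CARD('n)"
  have n: "n \<ge> 1" unfolding n_def by (simp add: Suc_leI)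
  have card_rest: "card (UNIV - {j} :: 'n set) = n - 1" unfolding n_def by (simp add: card_Diff_singleton)
  define C where "C = 4 ^ (n - 1) * B ^ n"
  show ?thesis
  proof (intro exI[of _ C] allI impI)
    fix \<delta> :: real assume d: "\<delta> > 0"
    obtain p0 :: nat where "B / \<delta> < real p0" using reals_Archimedean2[of "B / \<delta>"] by (rule exE)
    define p where "p = Suc p0"
    have p: "p \<ge> 1" "B / real p \<le> \<delta>"
    proof -
      have "B / \<delta> < real p" using \<open>B / \<delta> < real p0\<close> unfolding p_def by simp
      then show "B / real p \<le> \<delta>" using d by (simp add: p_def field_simps)
    qed (simp add: p_def)
    define Q where "Q = (4 * p) ^ (n - 1)"
    define K where "K = 4 ^ (n - 1) * p ^ n"
    have K1: "K \<ge> 1" unfolding K_def using p by simp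
    have QK: "Q * p = K" unfolding Q_def K_def using n by (cases n) (auto simp: power_mult_distrib)
    have H: "4 * K = (4 * p) ^ n" unfolding K_def using n by (cases n) (auto simp: power_mult_distrib)
    define w where "w = B / real p"
    have w: "w > 0" unfolding w_def using B1 p by simp
    define S where "S = (UNIV :: 'n set) \<rightarrow>\<^sub>E {0..int Q}"
    define T where "T = (UNIV - {j} :: 'n set) \<rightarrow>\<^sub>E {- int K..int K}"
    define F where "F m = (\<lambda>i\<in>UNIV - {j}. \<lfloor>emb i (pt m) / w\<rfloor>)" for m
    have cS: "card S = (Q + 1) ^ n" unfolding S_def n_def by (simp add: card_PiE nat_add_distrib)
    have cT: "card T = (2 * K + 1) ^ (n - 1)"
      unfolding T_def n_def by (simp add: card_PiE nat_add_distrib nat_mult_distrib)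
    have "F m \<in> T" if "m \<in> S" for m
    proof -
      have "\<bar>real_of_int (m l)\<bar> \<le> real Q" for l
        using that unfolding S_def by (auto simp: PiE_iff dest!: spec[of _ l])
      then have b: "\<bar>emb i (pt m)\<bar> \<le> B * real Q" for i by (rule emb_pt)
      have "\<lfloor>emb i (pt m) / w\<rfloor> \<in> {- int K..int K}" for i
      proof -
        have "B * real Q = real K * w" unfolding QK[symmetric] w_def using p by simp
        then have "- real K * w \<le> emb i (pt m)" "emb i (pt m) \<le> real K * w" using b[of i] by linarith+
        then have "- real K \<le> emb i (pt m) / w" "emb i (pt m) / w \<le> real K"
          using w by (simp_all add: field_simps)
        then show ?thesis by (auto simp: le_floor_iff floor_le_iff)
      qed
      then show ?thesis unfolding F_def T_def by auto
    qed
    then have "F ` S \<subseteq> T" by blast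
    moreover have "card T < card S"
    proof -
      have "(2 * K + 1) ^ (n - 1) \<le> (4 * K) ^ (n - 1)" using K1 by (intro power_mono) auto
      also have "\<dots> = Q ^ n" unfolding H Q_def by (simp only: power_mult[symmetric] mult.commute)
      also have "\<dots> < (Q + 1) ^ n" using n by (intro power_strict_mono) auto
      finally show ?thesis unfolding cS cT .
    qed
    moreover have "finite T" unfolding T_def by (simp add: finite_PiE)
    ultimately have "\<not> inj_on F S" by (meson card_inj_on_le not_le)
    then obtain m m' where m: "m \<in> S" "m' \<in> S" "m \<noteq> m'" "F m = F m'" unfolding inj_on_def by blast
    define x where "x = pt (\<lambda>l. m l - m' l)"
    have x_diff: "x = pt m - pt m'" unfolding x_def pt_def by (simp add: left_diff_distrib sum_subtractf)
    have alg: "algebraic_int x" unfolding x_def pt_def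
      by (intro algebraic_int_sum algebraic_int_add_mult(2)[OF algebraic_int_of_int be(2)])
    have x0: "x \<noteq> 0"
    proof
      assume "x = 0"
      have "(\<Sum>l\<in>UNIV. real_of_int (m l - m' l) * emb i (\<beta> l)) = emb i x" for i
        unfolding x_def pt_def by simp
      then have "real_of_int (m l - m' l) = 0" for l
        by (intro rat_basis_independent[OF be(1), of "\<lambda>l. real_of_int (m l - m' l)"]) (simp add: \<open>x = 0\<close>)
      then have "m = m'" by (intro ext) simp
      then show False using m(3) by blast
    qed
    have small: "\<bar>emb i x\<bar> \<le> w" if "i \<noteq> j" for i
    proof -
      have "\<lfloor>emb i (pt m) / w\<rfloor> = \<lfloor>emb i (pt m') / w\<rfloor>"
        using fun_cong[OF m(4), of i] that by (simp add: F_def)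
      then have "\<bar>emb i (pt m) / w - emb i (pt m') / w\<bar> < 1" by linarith
      then have "\<bar>emb i x / w\<bar> < 1" unfolding x_diff by (simp add: diff_divide_distrib)
      then show ?thesis using w by (simp add: field_simps)
    qed
    have large: "\<bar>emb j x\<bar> \<le> B * real Q"
    proof -
      have "\<bar>real_of_int (m l - m' l)\<bar> \<le> real Q" for l
      proof -
        have "m l \<in> {0..int Q}" "m' l \<in> {0..int Q}" using m(1,2) unfolding S_def by (auto simp: PiE_iff)
        then show ?thesis by auto
      qed
      then show ?thesis unfolding x_def by (rule emb_pt)
    qed
    have "\<bar>nm x\<bar> = \<bar>emb j x\<bar> * (\<Prod>i\<in>UNIV - {j}. \<bar>emb i x\<bar>)"
      unfolding nm_def by (subst prod.remove[of UNIV j]) (auto simp: abs_mult abs_prod)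
    also have "\<dots> \<le> (B * real Q) * (\<Prod>i\<in>UNIV - {j}. w)"
      using large small B1 by (intro mult_mono prod_mono prod_nonneg) auto
    also have "(\<Prod>i\<in>UNIV - {j}. w) = w ^ (n - 1)" by (simp add: card_rest)
    also have "(B * real Q) * w ^ (n - 1) = B * B ^ (n - 1) * 4 ^ (n - 1)"
      unfolding Q_def w_def using p by (simp add: power_mult_distrib power_divide)
    also have "\<dots> = C" unfolding C_def using n by (simp add: power_eq_if[of _ n])
    finally have "\<bar>nm x\<bar> \<le> C" .
    moreover have "\<bar>emb i x\<bar> \<le> \<delta>" if "i \<noteq> j" for i using small[OF that] p(2) unfolding w_def by linarith
    ultimately show "\<exists>x. algebraic_int x \<and> x \<noteq> 0 \<and> (\<forall>i. i \<noteq> j \<longrightarrow> \<bar>emb i x\<bar> \<le> \<delta>) \<and> \<bar>nm x\<bar> \<le> C"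
      using alg x0 by blast
  qed
qed

lemma finite_residue_classes:
  assumes "c \<noteq> 0"
  shows "\<exists>\<phi> :: 'a \<Rightarrow> 'n \<Rightarrow> int. finite (range \<phi>) \<and>
     (\<forall>x y. algebraic_int x \<longrightarrow> algebraic_int y \<longrightarrow> \<phi> x = \<phi> y \<longrightarrow> algebraic_int ((x - y) / c))"
proof -
  obtain \<beta> where be: "rat_basis \<beta>" "\<And>i. algebraic_int (\<beta> i)" using integral_basis_exists by blast
  have "rat_basis (\<lambda>i. c * (of_rat 1 * \<beta> i))" by (rule rat_basis_scale[OF be(1)]) (use assms in auto)
  then have b: "rat_basis (\<lambda>i. c * \<beta> i)" by simp
  obtain \<phi> :: "'a \<Rightarrow> 'n \<Rightarrow> int" where phi: "finite (range \<phi>)"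
    "\<And>x y. algebraic_int (1 * x) \<Longrightarrow> algebraic_int (1 * y) \<Longrightarrow> \<phi> x = \<phi> y \<Longrightarrow> x - y \<in> int_span (\<lambda>i. c * \<beta> i)"
    using finite_residues[OF b, of 1] by auto
  have "algebraic_int ((x - y) / c)" if xy: "algebraic_int x" "algebraic_int y" "\<phi> x = \<phi> y" for x y
  proof -
    obtain m where m: "x - y = (\<Sum>i\<in>UNIV. of_int (m i) * (c * \<beta> i))"
      using phi(2)[of x y] xy unfolding int_span_def by auto
    have "(x - y) / c = (\<Sum>i\<in>UNIV. of_int (m i) * \<beta> i)"
      unfolding m using assms by (simp add: sum_divide_distrib)
    also have "algebraic_int \<dots>" by (intro algebraic_int_sum algebraic_int_add_mult be(2)) simp
    finally show ?thesis .
  qed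
  then show ?thesis using phi(1) by blast
qed

lemma nm_algebraic_int_nonzero:
  assumes "algebraic_int x" "x \<noteq> 0"
  shows "\<exists>c::int. c \<noteq> 0 \<and> nm x = of_int c" "\<bar>nm x\<bar> \<ge> 1"
proof -
  obtain c where c: "nm x = of_int c" using tr_nm_algebraic_int(2)[OF assms(1)] by (auto elim: Ints_cases)
  then have "c \<noteq> 0" using assms(2) nm_eq_0_iff[of x] by auto
  then show "\<exists>c::int. c \<noteq> 0 \<and> nm x = of_int c" "\<bar>nm x\<bar> \<ge> 1" using c by auto
qed

lemma nm_unit:
  assumes "algebraic_int u" "algebraic_int (inverse u)" "u \<noteq> 0"
  shows "\<bar>nm u\<bar> = 1"
proof -
  have "\<bar>nm u\<bar> \<ge> 1" "\<bar>inverse (nm u)\<bar> \<ge> 1"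
    using nm_algebraic_int_nonzero(2)[of u] nm_algebraic_int_nonzero(2)[of "inverse u"] assms by auto
  moreover have "\<bar>nm u\<bar> * \<bar>inverse (nm u)\<bar> = 1" using assms(3) by (simp flip: abs_mult)
  ultimately have "\<bar>nm u\<bar> * 1 \<le> 1" by (metis abs_ge_zero mult_left_mono)
  then show ?thesis using \<open>\<bar>nm u\<bar> \<ge> 1\<close> by simp
qed

lemma unit_large_away:
  fixes j :: 'n
  shows "\<exists>u. algebraic_int u \<and> algebraic_int (inverse u) \<and> u \<noteq> 0 \<and> (\<forall>i. i \<noteq> j \<longrightarrow> \<bar>emb i u\<bar> > 1)"
proof -
  obtain C where C: "\<forall>\<delta>>0. \<exists>x. algebraic_int x \<and> x \<noteq> 0 \<and> (\<forall>i. i \<noteq> j \<longrightarrow> \<bar>emb i x\<bar> \<le> \<delta>) \<and> \<bar>nm x\<bar> \<le> C"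
    by (rule exE[OF small_elements[of j]])
  have "\<forall>k::nat. \<exists>x. algebraic_int x \<and> x \<noteq> 0 \<and> (\<forall>i. i \<noteq> j \<longrightarrow> \<bar>emb i x\<bar> \<le> 1 / real (Suc k)) \<and> \<bar>nm x\<bar> \<le> C"
    by (intro allI C[rule_format]) simp
  from choice[OF this] obtain x where x0: "\<forall>k. algebraic_int (x k) \<and> x k \<noteq> 0 \<and>
    (\<forall>i. i \<noteq> j \<longrightarrow> \<bar>emb i (x k)\<bar> \<le> 1 / real (Suc k)) \<and> \<bar>nm (x k)\<bar> \<le> C" by (rule exE)
  then have x: "\<And>k. algebraic_int (x k)" "\<And>k. x k \<noteq> 0"
    "\<And>k i. i \<noteq> j \<Longrightarrow> \<bar>emb i (x k)\<bar> \<le> 1 / real (Suc k)" "\<And>k. \<bar>nm (x k)\<bar> \<le> C" by simp_all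
  have "\<forall>k. \<exists>c::int. c \<noteq> 0 \<and> nm (x k) = of_int c"
    by (intro allI nm_algebraic_int_nonzero(1) x(1,2))
  from choice[OF this] obtain c where "\<forall>k. c k \<noteq> 0 \<and> nm (x k) = of_int (c k)" by (rule exE)
  then have c: "\<And>k. c k \<noteq> 0" "\<And>k. nm (x k) = of_int (c k)" by simp_all
  have "\<forall>d::int. \<exists>\<phi> :: 'a \<Rightarrow> 'n \<Rightarrow> int. d \<noteq> 0 \<longrightarrow> finite (range \<phi>) \<and>
     (\<forall>x y. algebraic_int x \<longrightarrow> algebraic_int y \<longrightarrow> \<phi> x = \<phi> y \<longrightarrow> algebraic_int ((x - y) / of_int d))"
  proof
    fix d :: int
    show "\<exists>\<phi> :: 'a \<Rightarrow> 'n \<Rightarrow> int. d \<noteq> 0 \<longrightarrow> finite (range \<phi>) \<and>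
     (\<forall>x y. algebraic_int x \<longrightarrow> algebraic_int y \<longrightarrow> \<phi> x = \<phi> y \<longrightarrow> algebraic_int ((x - y) / of_int d))"
      using finite_residue_classes[of "of_int d"] by (cases "d = 0") auto
  qed
  from choice[OF this] obtain \<phi> :: "int \<Rightarrow> 'a \<Rightarrow> 'n \<Rightarrow> int"
    where "\<forall>d. d \<noteq> 0 \<longrightarrow> finite (range (\<phi> d)) \<and>
     (\<forall>x y. algebraic_int x \<longrightarrow> algebraic_int y \<longrightarrow> \<phi> d x = \<phi> d y \<longrightarrow> algebraic_int ((x - y) / of_int d))"
    by (rule exE)
  then have phi: "\<And>d. d \<noteq> 0 \<Longrightarrow> finite (range (\<phi> d))"
    "\<And>d x y. d \<noteq> 0 \<Longrightarrow> algebraic_int x \<Longrightarrow> algebraic_int y \<Longrightarrow> \<phi> d x = \<phi> d y \<Longrightarrow> algebraic_int ((x - y) / of_int d)"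
    by simp_all
  define col where "col k = (c k, \<phi> (c k) (x k))" for k
  define Z where "Z = {z::int. z \<noteq> 0 \<and> \<bar>z\<bar> \<le> \<lfloor>C\<rfloor>}"
  have fZ: "finite Z" unfolding Z_def by (rule finite_subset[of _ "{- \<lfloor>C\<rfloor>..\<lfloor>C\<rfloor>}"]) auto
  have "c k \<in> Z" for k
  proof -
    have "real_of_int \<bar>c k\<bar> \<le> C" using x(4)[of k] c(2)[of k] by simp
    then show ?thesis unfolding Z_def using c(1) by (simp add: le_floor_iff)
  qed
  then have "range col \<subseteq> (SIGMA d:Z. range (\<phi> d))" unfolding col_def by auto
  moreover have "finite (SIGMA d:Z. range (\<phi> d))" using fZ phi(1) unfolding Z_def by (intro finite_SigmaI) auto
  ultimately have "finite (range col)" by (rule finite_subset)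
  then obtain a where a: "infinite {k. col k = col a}"
    using pigeonhole_infinite[of "UNIV :: nat set" col] by auto
  define \<mu> where "\<mu> = Min ((\<lambda>i. \<bar>emb i (x a)\<bar>) ` UNIV)"
  have mu: "\<mu> > 0" "\<And>i. \<mu> \<le> \<bar>emb i (x a)\<bar>" unfolding \<mu>_def using x(2) by (auto simp: Min_gr_iff)
  obtain k0 :: nat where k0: "1 / \<mu> < real k0" using reals_Archimedean2[of "1 / \<mu>"] by (rule exE)
  obtain k where k: "k > k0" "col k = col a"
    using spec[OF a[unfolded infinite_nat_iff_unbounded], of k0] by auto
  have ck: "c k = c a" "\<phi> (c a) (x k) = \<phi> (c a) (x a)" using k(2) unfolding col_def by auto
  define d where "d = c a"
  define z where "z = (x a - x k) / of_int d"
  have d0: "d \<noteq> 0" unfolding d_def by (rule c(1))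
  have z: "algebraic_int z" unfolding z_def using phi(2)[OF d0 x(1) x(1)] ck(2) unfolding d_def by simp
  have da: "algebraic_int (of_int d / x a)" "algebraic_int (of_int d / x k)"
    using nm_dvd[OF x(1) c(2), of a] nm_dvd[OF x(1) c(2), of k] ck(1) unfolding d_def by simp_all
  define u where "u = x a / x k"
  have ua: "u = 1 + z * (of_int d / x k)" unfolding u_def z_def using d0 x(2)[of k] by (simp add: field_simps)
  have "algebraic_int u" unfolding ua by (intro algebraic_int_add_mult algebraic_int_1 z da)
  moreover have ui: "inverse u = 1 + (- z) * (of_int d / x a)"
    unfolding u_def z_def using d0 x(2)[of k] x(2)[of a] by (simp add: field_simps)
  have "algebraic_int (inverse u)"
    unfolding ui by (intro algebraic_int_add_mult algebraic_int_1 algebraic_int_minus z da)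
  moreover have "\<bar>emb i u\<bar> > 1" if "i \<noteq> j" for i
  proof -
    have "1 / \<mu> < real (Suc k)" using k0 k(1) by linarith
    then have "1 / real (Suc k) < \<mu>" using mu(1) by (simp add: field_simps)
    then have "\<bar>emb i (x k)\<bar> < \<bar>emb i (x a)\<bar>" using x(3)[OF that, of k] mu(2)[of i] by linarith
    moreover have "\<bar>emb i (x k)\<bar> > 0" using x(2) by simp
    ultimately show ?thesis unfolding u_def by (simp add: abs_divide)
  qed
  moreover have "u \<noteq> 0" unfolding u_def using x(2) by simp
  ultimately show ?thesis by blast
qed

text \<open>A unit that is large away from one embedding is small there because its norm is \<open>1\<close> in absolute value; its inverse has the roles exchanged, and a power of it is congruent to \<open>1\<close> modulo \<open>r\<close> since there are finitely many residue classes.\<close>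

lemma dominant_unit:
  fixes j :: 'n
  assumes n: "CARD('n) \<ge> 2" and r: "r \<noteq> 0"
  shows "\<exists>v. algebraic_int v \<and> algebraic_int (inverse v) \<and> v \<noteq> 0 \<and> algebraic_int ((v - 1) / r) \<and>
     \<bar>emb j v\<bar> > 1 \<and> (\<forall>i. i \<noteq> j \<longrightarrow> \<bar>emb i v\<bar> < 1)"
proof -
  obtain u where "algebraic_int u \<and> algebraic_int (inverse u) \<and> u \<noteq> 0 \<and> (\<forall>i. i \<noteq> j \<longrightarrow> \<bar>emb i u\<bar> > 1)"
    using unit_large_away[of j] by (rule exE)
  then have u: "algebraic_int u" "algebraic_int (inverse u)" "u \<noteq> 0" "\<And>i. i \<noteq> j \<Longrightarrow> \<bar>emb i u\<bar> > 1"
    by simp_all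
  define v where "v = inverse u"
  have v: "algebraic_int v" "algebraic_int (inverse v)" "v \<noteq> 0" unfolding v_def using u by auto
  have vi: "\<bar>emb i v\<bar> < 1" if "i \<noteq> j" for i
    unfolding v_def using u(4)[OF that] by (simp add: abs_inverse inverse_less_1_iff)
  have vj: "\<bar>emb j v\<bar> > 1"
  proof (rule ccontr)
    assume "\<not> \<bar>emb j v\<bar> > 1"
    then have le: "\<bar>emb i v\<bar> \<le> 1" for i using vi[of i] by (cases "i = j") auto
    have "\<exists>i0. i0 \<noteq> j"
    proof (rule ccontr)
      assume "\<not> (\<exists>i0. i0 \<noteq> j)"
      then have "(UNIV :: 'n set) = {j}" by auto
      then have "CARD('n) = card {j}" by (simp only:)
      then show False using n by simp
    qed
    then obtain i0 where i0: "i0 \<noteq> j" by (rule exE)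
    have "\<bar>nm v\<bar> = \<bar>emb i0 v\<bar> * (\<Prod>i\<in>UNIV - {i0}. \<bar>emb i v\<bar>)"
      unfolding nm_def by (subst prod.remove[of UNIV i0]) (auto simp: abs_mult abs_prod)
    also have "\<dots> \<le> \<bar>emb i0 v\<bar> * 1" using le by (intro mult_left_mono prod_le_1) auto
    also have "\<dots> < 1" using vi[OF i0] by simp
    finally show False using nm_unit[OF v] by simp
  qed
  obtain \<phi> :: "'a \<Rightarrow> 'n \<Rightarrow> int" where "finite (range \<phi>) \<and>
     (\<forall>x y. algebraic_int x \<longrightarrow> algebraic_int y \<longrightarrow> \<phi> x = \<phi> y \<longrightarrow> algebraic_int ((x - y) / r))"
    using finite_residue_classes[OF r] by (rule exE)
  then have phi: "finite (range \<phi>)"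
    "\<And>x y. algebraic_int x \<Longrightarrow> algebraic_int y \<Longrightarrow> \<phi> x = \<phi> y \<Longrightarrow> algebraic_int ((x - y) / r)"
    by simp_all
  have "finite (range (\<lambda>k::nat. \<phi> (v ^ k)))" by (rule finite_subset[OF _ phi(1)]) auto
  then have "\<not> inj (\<lambda>k::nat. \<phi> (v ^ k))"
    using finite_imageD[of "\<lambda>k::nat. \<phi> (v ^ k)" UNIV] infinite_UNIV_nat by auto
  then obtain a' b' :: nat where "\<phi> (v ^ a') = \<phi> (v ^ b')" "a' \<noteq> b'" unfolding inj_def by auto
  then obtain a b :: nat where ab: "a < b" "\<phi> (v ^ a) = \<phi> (v ^ b)"
    using that[of a' b'] that[of b' a'] by (cases "a' < b'") auto
  define s where "s = b - a"
  have s: "s > 0" "b = a + s" unfolding s_def using ab by auto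
  have "algebraic_int ((v ^ b - v ^ a) / r)"
    using phi(2)[of "v ^ b" "v ^ a"] ab(2) algebraic_int_power[OF v(1)] by simp
  then have "algebraic_int (inverse v ^ a * ((v ^ b - v ^ a) / r))"
    by (intro algebraic_int_add_mult algebraic_int_power v)
  also have "inverse v ^ a * ((v ^ b - v ^ a) / r) = (v ^ s - 1) / r"
  proof -
    have "v ^ b - v ^ a = v ^ a * (v ^ s - 1)" unfolding s(2) by (simp add: power_add right_diff_distrib)
    then show ?thesis using v(3) by (simp add: power_inverse)
  qed
  finally have "algebraic_int ((v ^ s - 1) / r)" .
  moreover have "algebraic_int (v ^ s)" "algebraic_int (inverse (v ^ s))"
    using algebraic_int_power[OF v(1)] algebraic_int_power[OF v(2), of s] by (auto simp: power_inverse)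
  moreover have "\<bar>emb j (v ^ s)\<bar> > 1" using vj s(1) by (simp add: power_abs one_less_power)
  moreover have "\<bar>emb i (v ^ s)\<bar> < 1" if "i \<noteq> j" for i
    using vi[OF that] s(1) by (simp add: power_abs power_less_one_iff)
  ultimately show ?thesis using v(3) by (intro exI[of _ "v ^ s"]) auto
qed

end

section \<open>Norms of ideals\<close>

lemma emeasure_lborel_shift:
  fixes S :: "'e::euclidean_space set"
  assumes "S \<in> sets borel"
  shows "emeasure lborel ((+) a -` S) = emeasure lborel S"
proof -
  have "emeasure lborel S = emeasure (distr lborel borel ((+) a)) S" by (simp add: lborel_distr_plus)
  also have "\<dots> = emeasure lborel ((+) a -` S)" using assms by (subst emeasure_distr) auto
  finally show ?thesis by simp
qed

text \<open>Disjoint translates of a small box must fit into the union of translates of a large one; comparing volumes bounds the number of residue classes without a formula for the covolume.\<close>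

lemma packing_le_covering:
  fixes X Y L :: "'e::euclidean_space set"
  assumes L: "countable L" and X: "X \<in> sets borel" and Y: "Y \<in> sets borel"
    and packing: "\<And>x x' a b. x \<in> X \<Longrightarrow> x' \<in> X \<Longrightarrow> a \<in> L \<Longrightarrow> b \<in> L \<Longrightarrow> x - a = x' - b \<Longrightarrow> a = b"
    and covering: "\<And>x. \<exists>a\<in>L. x - a \<in> Y"
  shows "emeasure lborel X \<le> emeasure lborel Y"
proof -
  have "L \<noteq> {}" using covering by blast
  define e where "e = from_nat_into L"
  have eL: "e n \<in> L" for n unfolding e_def by (rule from_nat_into[OF \<open>L \<noteq> {}\<close>])
  have eS: "\<exists>n. e n = a" if "a \<in> L" for a
    unfolding e_def using from_nat_into_surj[OF L that] .
  define A where "A n = X \<inter> {x. x - e n \<in> Y}" for n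
  define D where "D = disjointed A"
  define D' where "D' n = (+) (e n) -` D n" for n
  have "(\<lambda>x. x - e n) -` Y \<inter> space borel \<in> sets borel" for n
    by (rule measurable_sets[OF _ Y]) simp
  then have A: "A n \<in> sets borel" for n
    unfolding A_def using X by (auto simp: vimage_def)
  then have D: "D n \<in> sets borel" for n unfolding D_def disjointed_def by auto
  have "(+) (e n) -` D n \<inter> space borel \<in> sets borel" for n
    by (rule measurable_sets[OF _ D]) simp
  then have D': "D' n \<in> sets borel" for n unfolding D'_def by simp
  have DX: "D n \<subseteq> A n" for n unfolding D_def disjointed_def by blast
  have "X = (\<Union>n. A n)"
  proof (intro equalityI subsetI)
    fix x assume "x \<in> X"
    obtain a where "a \<in> L" "x - a \<in> Y" using covering[of x] by blast
    then obtain n where "e n = a" using eS by blast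
    then show "x \<in> (\<Union>n. A n)" using \<open>x \<in> X\<close> \<open>x - a \<in> Y\<close> unfolding A_def by blast
  qed (auto simp: A_def)
  then have "X = (\<Union>n. D n)" unfolding D_def UN_disjointed_eq .
  then have "emeasure lborel X = (\<Sum>n. emeasure lborel (D n))"
    using D disjoint_family_disjointed[of A] unfolding D_def[symmetric]
    by (subst suminf_emeasure) auto
  also have "\<dots> = (\<Sum>n. emeasure lborel (D' n))"
    unfolding D'_def by (simp add: emeasure_lborel_shift D)
  also have "\<dots> = emeasure lborel (\<Union>n. D' n)"
  proof (rule suminf_emeasure)
    show "disjoint_family D'" unfolding disjoint_family_on_def
    proof (intro ballI impI)
      fix m n :: nat assume "m \<noteq> n"
      show "D' m \<inter> D' n = {}"
      proof (rule ccontr)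
        assume "D' m \<inter> D' n \<noteq> {}"
        then obtain y where y: "e m + y \<in> D m" "e n + y \<in> D n" unfolding D'_def by auto
        then have "e m + y \<in> X" "e n + y \<in> X" using DX unfolding A_def by blast+
        then have "e m = e n" using packing[of "e m + y" "e n + y" "e m" "e n"] eL by simp
        then have "e m + y \<in> D m \<inter> D n" using y by simp
        then show False using \<open>m \<noteq> n\<close> disjoint_family_disjointed[of A]
          unfolding D_def disjoint_family_on_def by blast
      qed
    qed
  qed (use D' in auto)
  also have "\<dots> \<le> emeasure lborel Y"
  proof (rule emeasure_mono)
    show "(\<Union>n. D' n) \<subseteq> Y" using DX unfolding D'_def A_def by fastforce
  qed (use Y in simp)
  finally show ?thesis .
qed

lemma emeasure_cbox_cart:
  fixes a b :: "real^'n"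
  assumes "\<And>i. a $ i \<le> b $ i"
  shows "emeasure lborel (cbox a b) = ennreal (\<Prod>i\<in>UNIV. b $ i - a $ i)"
proof -
  have "cbox a b \<noteq> {}" using assms by (auto simp: interval_ne_empty_cart)
  then have "measure lborel (cbox a b) = (\<Prod>i\<in>UNIV. b $ i - a $ i)" by (rule content_cbox_cart)
  moreover have "emeasure lborel (cbox a b) = ennreal (measure lborel (cbox a b))"
    by (rule emeasure_eq_ennreal_measure) (use emeasure_lborel_cbox_finite[of a b] in auto)
  ultimately show ?thesis by simp
qed

context totally_real_field begin

definition emb_vec :: "'a \<Rightarrow> real^'n" where "emb_vec x = (\<chi> j. emb j x)"

lemma emb_vec_nth [simp]: "emb_vec x $ j = emb j x" by (simp add: emb_vec_def)

lemma emb_vec_diff: "emb_vec (x - y) = emb_vec x - emb_vec y" by (simp add: vec_eq_iff)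

lemma emb_vec_eq_iff [simp]: "emb_vec x = emb_vec y \<longleftrightarrow> x = y" by (auto simp: vec_eq_iff)

lemma countable_field: "countable (A :: 'a set)"
proof -
  obtain \<beta> where be: "rat_basis \<beta>" using rat_basis_exists by blast
  have "range (\<lambda>q::'n \<Rightarrow> rat. \<Sum>i\<in>UNIV. of_rat (q i) * \<beta> i) = UNIV"
  proof (intro equalityI subsetI)
    fix x :: 'a
    obtain q :: "'n \<Rightarrow> rat" where "x = (\<Sum>i\<in>UNIV. of_rat (q i) * \<beta> i)"
      using spec[OF conjunct1[OF be[unfolded rat_basis_def]], of x] by (rule exE)
    then show "x \<in> range (\<lambda>q::'n \<Rightarrow> rat. \<Sum>i\<in>UNIV. of_rat (q i) * \<beta> i)" by (intro image_eqI[of _ _ q]) simp_all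
  qed simp
  moreover have "countable (range (\<lambda>q::'n \<Rightarrow> rat. \<Sum>i\<in>UNIV. of_rat (q i) * \<beta> i))"
    by (intro countable_image countableI_type)
  ultimately have "countable (UNIV :: 'a set)" by (simp only:)
  then show ?thesis by (rule countable_subset[OF subset_UNIV])
qed

lemma fractional_ideal_discrete:
  assumes J: "fractional_ideal (J :: 'a set)"
  shows "\<exists>\<rho>>0. \<forall>x\<in>J. x \<noteq> 0 \<longrightarrow> (\<exists>j. \<bar>emb j x\<bar> \<ge> \<rho>)"
proof -
  obtain r where r: "algebraic_int r" "r \<noteq> 0" "\<And>x. x \<in> J \<Longrightarrow> algebraic_int (r * x)"
    using fractional_idealD(6)[OF J] by blast
  define B where "B = 1 + (\<Sum>j\<in>UNIV. \<bar>emb j r\<bar>)"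
  have B: "B > 0" "\<And>j. \<bar>emb j r\<bar> \<le> B"
  proof -
    have s: "(\<Sum>j\<in>UNIV. \<bar>emb j r\<bar>) \<ge> 0" by (intro sum_nonneg) auto
    then show "B > 0" unfolding B_def by linarith
    fix j
    have "\<bar>emb j r\<bar> \<le> (\<Sum>j\<in>UNIV. \<bar>emb j r\<bar>)" by (rule member_le_sum) auto
    then show "\<bar>emb j r\<bar> \<le> B" unfolding B_def by linarith
  qed
  have "\<exists>j. \<bar>emb j x\<bar> \<ge> 1 / B" if x: "x \<in> J" "x \<noteq> 0" for x
  proof (rule ccontr)
    assume "\<not> (\<exists>j. \<bar>emb j x\<bar> \<ge> 1 / B)"
    then have l: "\<bar>emb j x\<bar> < 1 / B" for j by (simp add: not_le)
    have lt: "\<bar>emb j (r * x)\<bar> < 1" for j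
    proof -
      have "\<bar>emb j (r * x)\<bar> = \<bar>emb j r\<bar> * \<bar>emb j x\<bar>" by (simp add: abs_mult)
      also have "\<dots> \<le> B * \<bar>emb j x\<bar>" using B(2) by (intro mult_right_mono) auto
      also have "\<dots> < B * (1 / B)" using l B(1) by (intro mult_strict_left_mono) auto
      finally show ?thesis using B(1) by simp
    qed
    have le: "\<bar>emb j (r * x)\<bar> \<le> 1" for j using lt[of j] by linarith
    obtain j :: 'n where True by blast
    have "(\<Prod>j\<in>UNIV. \<bar>emb j (r * x)\<bar>) = \<bar>emb j (r * x)\<bar> * (\<Prod>i\<in>UNIV - {j}. \<bar>emb i (r * x)\<bar>)"
      by (subst prod.remove[of UNIV j]) auto
    also have "\<dots> \<le> \<bar>emb j (r * x)\<bar> * 1" using le by (intro mult_left_mono prod_le_1) auto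
    also have "\<dots> < 1" using lt[of j] by simp
    finally have "(\<Prod>j\<in>UNIV. \<bar>emb j (r * x)\<bar>) < 1" .
    then have "\<bar>nm (r * x)\<bar> < 1" by (simp add: nm_def abs_prod abs_mult)
    then show False using nm_algebraic_int_nonzero(2)[OF r(3)[OF x(1)]] x(2) r(2) by simp
  qed
  then show ?thesis using B(1) by (intro exI[of _ "1 / B"]) auto
qed

lemma rat_basis_real_expansion:
  assumes b: "rat_basis b"
  shows "\<exists>t::'n \<Rightarrow> real. \<forall>j. v j = (\<Sum>i\<in>UNIV. t i * emb j (b i))"
proof -
  define E :: "real^'n^'n" where "E = (\<chi> j i. emb j (b i))"
  have E: "(E *v w) $ j = (\<Sum>i\<in>UNIV. w $ i * emb j (b i))" for w j
    by (simp add: E_def matrix_vector_mult_def mult.commute)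
  have "\<forall>w. E *v w = 0 \<longrightarrow> w = 0"
  proof (intro allI impI)
    fix w assume w: "E *v w = 0"
    have "(\<Sum>i\<in>UNIV. w $ i * emb j (b i)) = 0" for j unfolding E[symmetric] w by simp
    then have "w $ i = 0" for i by (rule rat_basis_independent[OF b])
    then show "w = 0" by (simp add: vec_eq_iff)
  qed
  from iffD2[OF matrix_left_invertible_ker this] obtain F where F: "F ** E = mat 1" by (rule exE)
  then have EF: "E ** F = mat 1" by (rule matrix_left_right_inverse1)
  define w where "w = F *v (\<chi> j. v j)"
  have "E *v w = (\<chi> j. v j)" unfolding w_def by (simp add: matrix_vector_mul_assoc EF)
  then have "v j = (\<Sum>i\<in>UNIV. w $ i * emb j (b i))" for j unfolding E[symmetric] by simp
  then show ?thesis by (intro exI[of _ "\<lambda>i. w $ i"]) simp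
qed

lemma fractional_ideal_relatively_dense:
  assumes J: "fractional_ideal (J :: 'a set)"
  shows "\<exists>R>0. \<forall>v::'n \<Rightarrow> real. \<exists>x\<in>J. \<forall>j. \<bar>v j - emb j x\<bar> \<le> R"
proof -
  obtain \<beta> where be: "rat_basis \<beta>" "\<And>i. algebraic_int (\<beta> i)" using integral_basis_exists by blast
  obtain y where y: "y \<in> J" "y \<noteq> 0" using fractional_idealD(5)[OF J] by blast
  have "rat_basis (\<lambda>i. y * (of_rat 1 * \<beta> i))" by (rule rat_basis_scale[OF be(1)]) (use y in auto)
  then have b: "rat_basis (\<lambda>i. y * \<beta> i)" by simp
  have bJ: "y * \<beta> i \<in> J" for i using y be(2) by (intro fractional_idealD(4)[OF J])
  define R where "R = 1 + (\<Sum>j\<in>UNIV. \<Sum>i\<in>UNIV. \<bar>emb j (y * \<beta> i)\<bar>)"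
  have row: "(\<Sum>i\<in>UNIV. \<bar>emb j (y * \<beta> i)\<bar>) \<le> R" for j
    unfolding R_def using member_le_sum[of j UNIV "\<lambda>j. \<Sum>i\<in>UNIV. \<bar>emb j (y * \<beta> i)\<bar>"] by (simp add: sum_nonneg)
  have R: "R > 0" unfolding R_def by (intro add_pos_nonneg sum_nonneg) auto
  have "\<exists>x\<in>J. \<forall>j. \<bar>v j - emb j x\<bar> \<le> R" for v :: "'n \<Rightarrow> real"
  proof -
    obtain t where t: "\<forall>j. v j = (\<Sum>i\<in>UNIV. t i * emb j (y * \<beta> i))"
      using rat_basis_real_expansion[OF b] by (rule exE)
    define x where "x = (\<Sum>i\<in>UNIV. of_int \<lfloor>t i\<rfloor> * (y * \<beta> i))"
    have "x \<in> J" unfolding x_def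
      by (rule fractional_ideal_sum[OF J]) (intro fractional_idealD(3)[OF J] bJ, simp)
    moreover have "\<bar>v j - emb j x\<bar> \<le> R" for j
    proof -
      have "emb j x = (\<Sum>i\<in>UNIV. of_int \<lfloor>t i\<rfloor> * emb j (y * \<beta> i))" unfolding x_def by simp
      then have "v j - emb j x = (\<Sum>i\<in>UNIV. (t i - of_int \<lfloor>t i\<rfloor>) * emb j (y * \<beta> i))"
        using t by (simp add: left_diff_distrib sum_subtractf)
      also have "\<bar>\<dots>\<bar> \<le> (\<Sum>i\<in>UNIV. \<bar>(t i - of_int \<lfloor>t i\<rfloor>) * emb j (y * \<beta> i)\<bar>)" by (rule sum_abs)
      also have "\<dots> \<le> (\<Sum>i\<in>UNIV. \<bar>emb j (y * \<beta> i)\<bar>)"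
      proof (rule sum_mono)
        fix i
        have "\<bar>t i - of_int \<lfloor>t i\<rfloor>\<bar> \<le> 1" by linarith
        then show "\<bar>(t i - of_int \<lfloor>t i\<rfloor>) * emb j (y * \<beta> i)\<bar> \<le> \<bar>emb j (y * \<beta> i)\<bar>"
          by (simp only: abs_mult mult_left_le_one_le abs_ge_zero)
      qed
      also have "\<dots> \<le> R" by (rule row)
      finally show ?thesis .
    qed
    ultimately show ?thesis by blast
  qed
  then show ?thesis using R by blast
qed

abbreviation residue_rel :: "'a set \<Rightarrow> ('a \<times> 'a) set" where
  "residue_rel m \<equiv> {(x, y). x \<in> ring_of_integers \<and> y \<in> ring_of_integers \<and> x - y \<in> m}"

lemma residue_class_rep:
  assumes m: "fractional_ideal m" and q: "q \<in> ring_of_integers // residue_rel m"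
  defines "r \<equiv> SOME x. x \<in> q"
  shows "algebraic_int r" "q = residue_rel m `` {r}"
proof -
  obtain x where x: "algebraic_int x" "q = residue_rel m `` {x}" using q by (auto elim: quotientE)
  have "x \<in> q" using x fractional_idealD(1)[OF m] by auto
  then have "r \<in> q" unfolding r_def by (rule someI)
  then have r: "algebraic_int r" "x - r \<in> m" using x by auto
  then show "algebraic_int r" by simp
  have "x - y \<in> m \<longleftrightarrow> r - y \<in> m" for y
  proof
    assume "x - y \<in> m"
    then have "(x - y) - (x - r) \<in> m" using r(2) by (rule fractional_idealD(8)[OF m])
    then show "r - y \<in> m" by (simp add: algebra_simps)
  next
    assume "r - y \<in> m"
    then have "(r - y) + (x - r) \<in> m" using r(2) by (rule fractional_idealD(2)[OF m])
    then show "x - y \<in> m" by (simp add: algebra_simps)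
  qed
  then show "q = residue_rel m `` {r}" unfolding x(2) using r(1) x(1) by auto
qed

text \<open>Packing and covering of a box by translates give both bounds, because multiplication by \<open>\<xi>\<close> scales volumes by the norm.\<close>

lemma ideal_norm_bounds:
  assumes J: "fractional_ideal J"
  shows "\<exists>c1>0. \<exists>c2>0. \<forall>\<xi>. \<xi> \<noteq> 0 \<longrightarrow> ideal_scale \<xi> J \<subseteq> ring_of_integers \<longrightarrow>
     c1 * \<bar>nm \<xi>\<bar> \<le> real (ideal_norm (ideal_scale \<xi> J)) \<and> real (ideal_norm (ideal_scale \<xi> J)) \<le> c2 * \<bar>nm \<xi>\<bar>"
proof -
  have O: "fractional_ideal (ring_of_integers :: 'a set)" by (rule fractional_ideal_ring_of_integers)
  obtain \<rho> where rho: "\<rho> > 0" "\<forall>x\<in>ring_of_integers. x \<noteq> 0 \<longrightarrow> (\<exists>j. \<bar>emb j x\<bar> \<ge> \<rho>)"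
    using fractional_ideal_discrete[OF O] by (elim exE conjE)
  obtain R where R: "R > 0" "\<forall>v::'n \<Rightarrow> real. \<exists>x\<in>ring_of_integers. \<forall>j. \<bar>v j - emb j x\<bar> \<le> R"
    using fractional_ideal_relatively_dense[OF O] by (elim exE conjE)
  obtain \<rho>' where rho': "\<rho>' > 0" "\<forall>x\<in>J. x \<noteq> 0 \<longrightarrow> (\<exists>j. \<bar>emb j x\<bar> \<ge> \<rho>')"
    using fractional_ideal_discrete[OF J] by (elim exE conjE)
  obtain R' where R': "R' > 0" "\<forall>v::'n \<Rightarrow> real. \<exists>x\<in>J. \<forall>j. \<bar>v j - emb j x\<bar> \<le> R'"
    using fractional_ideal_relatively_dense[OF J] by (elim exE conjE)
  define n where "n = CARD('n)"
  define c1 where "c1 = (\<rho>' / 2) ^ n / (2 * R) ^ n"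
  define c2 where "c2 = (2 * R') ^ n / (\<rho> / 2) ^ n"
  have c: "c1 > 0" "c2 > 0" unfolding c1_def c2_def using rho rho' R R' by simp_all
  have main: "c1 * \<bar>nm \<xi>\<bar> \<le> real (ideal_norm (ideal_scale \<xi> J)) \<and> real (ideal_norm (ideal_scale \<xi> J)) \<le> c2 * \<bar>nm \<xi>\<bar>"
    if xi: "\<xi> \<noteq> 0" and int: "ideal_scale \<xi> J \<subseteq> ring_of_integers" for \<xi>
  proof -
    define m where "m = ideal_scale \<xi> J"
    have m: "fractional_ideal m" unfolding m_def by (rule fractional_ideal_scale'[OF J xi])
    define Qt where "Qt = ring_of_integers // residue_rel m"
    define r where "r q = (SOME x. x \<in> q)" for q :: "'a set"
    have r: "algebraic_int (r q)" "q = residue_rel m `` {r q}" if "q \<in> Qt" for q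
      using residue_class_rep[OF m that[unfolded Qt_def]] unfolding r_def by auto
    have mem: "y \<in> q \<longleftrightarrow> algebraic_int y \<and> r q - y \<in> m" if q: "q \<in> Qt" for q y
    proof -
      have "(y \<in> q) = (y \<in> residue_rel m `` {r q})"
        by (rule arg_cong[OF r(2)[OF q], of "\<lambda>S. y \<in> S"])
      then show ?thesis using r(1)[OF q] by simp
    qed
    have r_eq: "q = q'" if q: "q \<in> Qt" "q' \<in> Qt" "r q - r q' \<in> m" for q q'
    proof (rule set_eqI)
      fix y
      have "r q - y \<in> m \<longleftrightarrow> r q' - y \<in> m"
        using fractional_idealD(2)[OF m, of "r q' - y" "r q - r q'"]
          fractional_idealD(8)[OF m, of "r q - y" "r q - r q'"] q(3) by auto
      then show "y \<in> q \<longleftrightarrow> y \<in> q'" unfolding mem[OF q(1)] mem[OF q(2)] by simp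
    qed
    define L where "L = emb_vec ` m"
    have L: "countable L" unfolding L_def by (intro countable_image countable_field)
    have xi_abs: "\<bar>emb j \<xi>\<bar> > 0" for j using xi by simp
    have nm_abs: "(\<Prod>j\<in>UNIV. C * \<bar>emb j \<xi>\<bar>) = C ^ n * \<bar>nm \<xi>\<bar>" for C
      by (simp add: prod.distrib nm_def abs_prod n_def)
    \<comment> \<open>packing and covering sets of the sublattice\<close>
    define X0 :: "(real^'n) set" where "X0 = cbox 0 (\<chi> j. \<rho>' / 2 * \<bar>emb j \<xi>\<bar>)"
    define Y0 :: "(real^'n) set" where "Y0 = cbox (\<chi> j. - (R' * \<bar>emb j \<xi>\<bar>)) (\<chi> j. R' * \<bar>emb j \<xi>\<bar>)"
    have mX0: "emeasure lborel X0 = ennreal ((\<rho>' / 2) ^ n * \<bar>nm \<xi>\<bar>)"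
      unfolding X0_def using rho' by (subst emeasure_cbox_cart) (simp_all add: nm_abs[of "\<rho>' / 2", simplified])
    have mY0: "emeasure lborel Y0 = ennreal ((2 * R') ^ n * \<bar>nm \<xi>\<bar>)"
    proof -
      have "emeasure lborel Y0 = ennreal (\<Prod>j\<in>(UNIV::'n set). 2 * R' * \<bar>emb j \<xi>\<bar>)"
        unfolding Y0_def using R' by (subst emeasure_cbox_cart) (auto simp: algebra_simps intro: order_trans[of _ 0])
      then show ?thesis by (simp only: nm_abs)
    qed
    have X0: "x = 0" if x: "x \<in> m" "\<And>j. \<bar>emb j x\<bar> \<le> \<rho>' / 2 * \<bar>emb j \<xi>\<bar>" for x
    proof (rule ccontr)
      assume "x \<noteq> 0"
      obtain y where y: "x = \<xi> * y" "y \<in> J" using x(1) unfolding m_def ideal_scale_def by auto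
      have "y \<noteq> 0" using \<open>x \<noteq> 0\<close> y(1) by auto
      from mp[OF bspec[OF rho'(2) y(2)] this] obtain j where "\<bar>emb j y\<bar> \<ge> \<rho>'" by (rule exE)
      moreover have "\<bar>emb j y\<bar> \<le> \<rho>' / 2" using x(2)[of j] xi_abs[of j] unfolding y(1) by (simp add: abs_mult)
      ultimately show False using rho'(1) by linarith
    qed
    have Y0: "\<exists>a\<in>L. v - a \<in> Y0" for v
    proof -
      obtain y where y: "y \<in> J" "\<forall>j. \<bar>v $ j / emb j \<xi> - emb j y\<bar> \<le> R'"
        using spec[OF R'(2), of "\<lambda>j. v $ j / emb j \<xi>"] by (rule bexE)
      have "\<bar>v $ j - emb j (\<xi> * y)\<bar> \<le> R' * \<bar>emb j \<xi>\<bar>" for j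
      proof -
        have "v $ j - emb j (\<xi> * y) = (v $ j / emb j \<xi> - emb j y) * emb j \<xi>"
          using xi by (simp add: field_simps)
        then show ?thesis using y(2) by (simp add: abs_mult mult_right_mono)
      qed
      then have "v - emb_vec (\<xi> * y) \<in> Y0" unfolding Y0_def by (auto simp: mem_box_cart abs_le_iff) (smt (verit))+
      moreover have "emb_vec (\<xi> * y) \<in> L" unfolding L_def m_def by (intro imageI ideal_scale_mem y(1))
      ultimately show ?thesis by blast
    qed
    \<comment> \<open>the same for the full ring\<close>
    have diffs: "\<bar>emb j x - emb j x'\<bar> \<le> C"
      if "u - emb_vec x \<in> cbox 0 (\<chi> j. C)" "u - emb_vec x' \<in> cbox 0 (\<chi> j. C)" for u x x' j C
    proof -
      have "0 \<le> u $ j - emb j x" "u $ j - emb j x \<le> C" "0 \<le> u $ j - emb j x'" "u $ j - emb j x' \<le> C"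
        using that by (auto simp: mem_box_cart dest!: spec[of _ j])
      then show ?thesis by linarith
    qed
    define X1 :: "'a set \<Rightarrow> (real^'n) set" where "X1 q = {v. v - emb_vec (r q) \<in> cbox 0 (\<chi> j. \<rho> / 2)}" for q
    define Y1 :: "'a set \<Rightarrow> (real^'n) set" where "Y1 q = {v. v - emb_vec (r q) \<in> cbox (\<chi> j. - R) (\<chi> j. R)}" for q
    have vim: "{v. v - a \<in> S} = (+) (- a) -` S" for a :: "real^'n" and S by auto
    have X1m: "X1 q \<in> sets borel" "emeasure lborel (X1 q) = ennreal ((\<rho> / 2) ^ n)" for q
    proof -
      have "(+) (- emb_vec (r q)) -` cbox 0 (\<chi> j. \<rho> / 2) \<inter> space borel \<in> sets (borel :: (real^'n) measure)"
        by (rule measurable_sets[where A = borel]) auto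
      then show "X1 q \<in> sets borel" unfolding X1_def vim by simp
      show "emeasure lborel (X1 q) = ennreal ((\<rho> / 2) ^ n)"
        unfolding X1_def vim using rho(1)
        by (subst emeasure_lborel_shift, simp, subst emeasure_cbox_cart) (simp_all add: n_def)
    qed
    have Y1m: "Y1 q \<in> sets borel" "emeasure lborel (Y1 q) = ennreal ((2 * R) ^ n)" for q
    proof -
      have "(+) (- emb_vec (r q)) -` cbox (\<chi> j. - R) (\<chi> j. R) \<inter> space borel \<in> sets (borel :: (real^'n) measure)"
        by (rule measurable_sets[where A = borel]) auto
      then show "Y1 q \<in> sets borel" unfolding Y1_def vim by simp
      show "emeasure lborel (Y1 q) = ennreal ((2 * R) ^ n)"
        unfolding Y1_def vim using R(1)
        by (subst emeasure_lborel_shift, simp, subst emeasure_cbox_cart) (simp_all add: n_def)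
    qed
    have X1: "x = x'" if "algebraic_int x" "algebraic_int x'"
      "u - emb_vec x \<in> cbox 0 (\<chi> j. \<rho> / 2)" "u - emb_vec x' \<in> cbox 0 (\<chi> j. \<rho> / 2)" for u x x'
    proof (rule ccontr)
      assume "x \<noteq> x'"
      then have d: "x - x' \<noteq> 0" by simp
      have "x - x' \<in> ring_of_integers" using algebraic_int_diff[OF that(1,2)] by simp
      from mp[OF bspec[OF rho(2) this] d] obtain j where "\<bar>emb j (x - x')\<bar> \<ge> \<rho>" by (rule exE)
      moreover have "\<bar>emb j x - emb j x'\<bar> \<le> \<rho> / 2" by (rule diffs[OF that(3,4)])
      ultimately show False using rho(1) by simp
    qed
    have upper: "real (card F) \<le> c2 * \<bar>nm \<xi>\<bar>" if F: "F \<subseteq> Qt" "finite F" for F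
    proof -
      have disj: "disjoint_family_on X1 F" unfolding disjoint_family_on_def
      proof (intro ballI impI)
        fix q q' assume q: "q \<in> F" "q' \<in> F" "q \<noteq> q'"
        have qQ: "q \<in> Qt" "q' \<in> Qt" using q(1,2) F(1) by auto
        have "r q \<noteq> r q'"
        proof
          assume "r q = r q'"
          then have "r q - r q' \<in> m" using fractional_idealD(1)[OF m] by simp
          then show False using r_eq[OF qQ] q(3) by simp
        qed
        show "X1 q \<inter> X1 q' = {}"
        proof (rule equals0I)
          fix v assume v: "v \<in> X1 q \<inter> X1 q'"
          have "r q = r q'"
          proof (rule X1)
            show "algebraic_int (r q)" "algebraic_int (r q')" using r(1) qQ by simp_all
            show "v - emb_vec (r q) \<in> cbox 0 (\<chi> j. \<rho> / 2)" "v - emb_vec (r q') \<in> cbox 0 (\<chi> j. \<rho> / 2)"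
              using v unfolding X1_def by simp_all
          qed
          then show False using \<open>r q \<noteq> r q'\<close> by simp
        qed
      qed
      have "emeasure lborel (\<Union>q\<in>F. X1 q) = (\<Sum>q\<in>F. emeasure lborel (X1 q))"
        using F(2) disj X1m(1) by (intro sum_emeasure[symmetric]) auto
      also have "\<dots> = ennreal (real (card F) * (\<rho> / 2) ^ n)"
        using rho(1) by (simp add: X1m(2) ennreal_mult' ennreal_of_nat_eq_real_of_nat)
      finally have "ennreal (real (card F) * (\<rho> / 2) ^ n) = emeasure lborel (\<Union>q\<in>F. X1 q)" by simp
      also have "\<dots> \<le> emeasure lborel Y0"
      proof (rule packing_le_covering[OF L])
        show "(\<Union>q\<in>F. X1 q) \<in> sets borel" using F(2) X1m(1) by auto
        show "Y0 \<in> sets borel" unfolding Y0_def by simp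
        fix x x' a b assume xx: "x \<in> (\<Union>q\<in>F. X1 q)" "x' \<in> (\<Union>q\<in>F. X1 q)" "a \<in> L" "b \<in> L" "x - a = x' - b"
        obtain q where q0: "q \<in> F" "x \<in> X1 q" using xx(1) by (rule UN_E)
        obtain q' where q': "q' \<in> F" "x' \<in> X1 q'" using xx(2) by (rule UN_E)
        note q = q0 q'
        obtain s where s: "a = emb_vec s" "s \<in> m" using xx(3) unfolding L_def by (rule imageE)
      obtain t where t: "b = emb_vec t" "t \<in> m" using xx(4) unfolding L_def by (rule imageE)
      note st = s t
        have mO: "algebraic_int z" if "z \<in> m" for z using that int unfolding m_def by auto
        have "(x - a) - emb_vec (r q - s) \<in> cbox 0 (\<chi> j. \<rho> / 2)"
          using q(2) unfolding X1_def st(1) by (simp add: emb_vec_diff)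
        moreover have "(x - a) - emb_vec (r q' - t) \<in> cbox 0 (\<chi> j. \<rho> / 2)"
          using q(4) unfolding X1_def xx(5) st(3) by (simp add: emb_vec_diff)
        moreover have "algebraic_int (r q - s)" "algebraic_int (r q' - t)"
          using q F(1) r(1) mO st by (auto intro!: algebraic_int_diff)
        ultimately have e: "r q - s = r q' - t" by (intro X1[of "r q - s" "r q' - t" "x - a"])
        then have "r q - r q' = s - t" by (simp add: algebra_simps)
        then have "r q - r q' \<in> m" using fractional_idealD(8)[OF m st(2,4)] by simp
        then have "q = q'" using q F(1) by (intro r_eq) auto
        then show "a = b" using e st by simp
      qed (rule Y0)
      finally have "real (card F) * (\<rho> / 2) ^ n \<le> (2 * R') ^ n * \<bar>nm \<xi>\<bar>"
        unfolding mY0 using R'(1) by (subst (asm) ennreal_le_iff) auto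
      then show ?thesis unfolding c2_def using rho(1) by (simp add: field_simps)
    qed
    have fin: "finite Qt"
    proof (rule ccontr)
      assume inf: "infinite Qt"
      obtain k :: nat where k: "c2 * \<bar>nm \<xi>\<bar> < real k" using reals_Archimedean2[of "c2 * \<bar>nm \<xi>\<bar>"] by (rule exE)
      obtain F where "finite F \<and> card F = k \<and> F \<subseteq> Qt"
        using infinite_arbitrarily_large[OF inf, of k] by (rule exE)
      then show False using upper[of F] k by simp
    qed
    have "emeasure lborel X0 \<le> emeasure lborel (\<Union>q\<in>Qt. Y1 q)"
    proof (rule packing_le_covering[OF L])
      show "X0 \<in> sets borel" unfolding X0_def by simp
      show "(\<Union>q\<in>Qt. Y1 q) \<in> sets borel" using fin Y1m(1) by auto
      fix x x' a b assume xx: "x \<in> X0" "x' \<in> X0" "a \<in> L" "b \<in> L" "x - a = x' - b"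
      obtain s where s: "a = emb_vec s" "s \<in> m" using xx(3) unfolding L_def by (rule imageE)
      obtain t where t: "b = emb_vec t" "t \<in> m" using xx(4) unfolding L_def by (rule imageE)
      note st = s t
      have "\<bar>emb j (s - t)\<bar> \<le> \<rho>' / 2 * \<bar>emb j \<xi>\<bar>" for j
      proof -
        have "0 \<le> x $ j" "x $ j \<le> \<rho>' / 2 * \<bar>emb j \<xi>\<bar>" "0 \<le> x' $ j" "x' $ j \<le> \<rho>' / 2 * \<bar>emb j \<xi>\<bar>"
          using xx(1,2) unfolding X0_def by (auto simp: mem_box_cart dest!: spec[of _ j])
        moreover have "(x - a) $ j = (x' - b) $ j" using xx(5) by simp
        then have "x $ j - emb j s = x' $ j - emb j t" unfolding st by simp
        then have e: "emb j (s - t) = x $ j - x' $ j" by simp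
        ultimately show ?thesis unfolding e by linarith
      qed
      then have "s - t = 0" by (rule X0[OF fractional_idealD(8)[OF m st(2,4)]])
      then show "a = b" using st by simp
    next
      fix v :: "real^'n"
      obtain x where x: "x \<in> ring_of_integers" "\<forall>j. \<bar>v $ j - emb j x\<bar> \<le> R"
        using spec[OF R(2), of "\<lambda>j. v $ j"] by (rule bexE)
      define q where "q = residue_rel m `` {x}"
      have q: "q \<in> Qt" unfolding Qt_def q_def using x(1) by (rule quotientI)
      have "x \<in> q" unfolding q_def using x(1) fractional_idealD(1)[OF m] by simp
      then have "r q - x \<in> m" unfolding mem[OF q] by simp
      then have "x - r q \<in> m" using fractional_idealD(7)[OF m, of "r q - x"] by simp
      then have "emb_vec (x - r q) \<in> L" unfolding L_def by (rule imageI)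
      moreover have "v - emb_vec (x - r q) - emb_vec (r q) \<in> cbox (\<chi> j. - R) (\<chi> j. R)"
        using x(2) by (auto simp: mem_box_cart abs_le_iff) (smt (verit))+
      then have "v - emb_vec (x - r q) \<in> (\<Union>q\<in>Qt. Y1 q)" using q unfolding Y1_def by blast
      ultimately show "\<exists>a\<in>L. v - a \<in> (\<Union>q\<in>Qt. Y1 q)" by blast
    qed
    also have "\<dots> \<le> (\<Sum>q\<in>Qt. emeasure lborel (Y1 q))"
      using fin Y1m(1) by (intro emeasure_subadditive_finite) auto
    also have "\<dots> = ennreal (real (card Qt) * (2 * R) ^ n)"
      using R(1) by (simp add: Y1m(2) ennreal_mult' ennreal_of_nat_eq_real_of_nat)
    finally have "(\<rho>' / 2) ^ n * \<bar>nm \<xi>\<bar> \<le> real (card Qt) * (2 * R) ^ n"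
      unfolding mX0 using R(1) by (subst (asm) ennreal_le_iff) auto
    then have lower: "c1 * \<bar>nm \<xi>\<bar> \<le> real (card Qt)" unfolding c1_def using R(1) by (simp add: field_simps)
    have "ideal_norm (ideal_scale \<xi> J) = card Qt" unfolding ideal_norm_def Qt_def m_def ..
    then show ?thesis using lower upper[OF order_refl fin] by simp
  qed
  show ?thesis
    by (rule exI[where x = c1], rule conjI[OF c(1)], rule exI[where x = c2], rule conjI[OF c(2)])
      (intro allI impI main)
qed

end


section \<open>Mean values over the torus\<close>

definition unit_uniform :: "real measure" where
  "unit_uniform = density lborel (\<lambda>t. ennreal (indicator {0..1} t))"

definition torus :: "('n::finite \<Rightarrow> real) measure" where
  "torus = Pi\<^sub>M UNIV (\<lambda>_. unit_uniform)"

definition tmean :: "(real^'n::finite \<Rightarrow> complex) \<Rightarrow> complex" where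
  "tmean F = (\<integral>x. F (\<chi> i. x i) \<partial>torus)"

lemma sets_unit_uniform [simp]: "sets unit_uniform = sets borel"
  by (simp add: unit_uniform_def)

lemma space_unit_uniform [simp]: "space unit_uniform = UNIV"
  by (simp add: unit_uniform_def)

lemma emeasure_unit_uniform:
  "A \<in> sets borel \<Longrightarrow> emeasure unit_uniform A = emeasure lborel (A \<inter> {0..1})"
proof -
  assume A: "A \<in> sets borel"
  have "emeasure unit_uniform A = (\<integral>\<^sup>+t. ennreal (indicator {0..1} t) * indicator A t \<partial>lborel)"
    unfolding unit_uniform_def using A by (subst emeasure_density) auto
  also have "\<dots> = (\<integral>\<^sup>+t. indicator (A \<inter> {0..1}) t \<partial>lborel)"
    by (intro nn_integral_cong) (auto simp: indicator_def)
  also have "\<dots> = emeasure lborel (A \<inter> {0..1})" using A by (subst nn_integral_indicator) auto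
  finally show ?thesis .
qed

lemma prob_space_unit_uniform: "emeasure unit_uniform UNIV = 1"
  by (subst emeasure_unit_uniform) auto

lemma integral_unit_uniform:
  fixes f :: "real \<Rightarrow> complex"
  assumes "continuous_on UNIV f"
  shows "(\<integral>t. f t \<partial>unit_uniform) = integral {0..1} f"
proof -
  have "(\<integral>t. f t \<partial>unit_uniform) = (LINT t:{0..1}|lborel. f t)"
    unfolding unit_uniform_def set_lebesgue_integral_def using assms
    by (subst integral_density) (auto intro!: borel_measurable_continuous_onI)
  also have "\<dots> = integral {0..1} f"
    using assms by (intro set_borel_integral_eq_integral borel_integrable_compact)
      (auto simp: set_integrable_def intro!: borel_integrable_compact continuous_on_subset[OF assms])
  finally show ?thesis .
qed

interpretation unit_product: product_sigma_finite "\<lambda>_::'i. unit_uniform"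
  by (intro product_sigma_finite.intro finite_measure.axioms(1) finite_measureI)
    (simp add: prob_space_unit_uniform)

lemma sets_torus: "sets (torus :: ('n::finite \<Rightarrow> real) measure) = sets borel"
proof -
  have "sets (torus :: ('n \<Rightarrow> real) measure) = sets (Pi\<^sub>M (UNIV::'n set) (\<lambda>_. borel :: real measure))"
    unfolding torus_def by (rule sets_PiM_cong) auto
  then show ?thesis by (simp add: sets_PiM_equal_borel)
qed

lemma space_torus [simp]: "space torus = UNIV"
  using sets_eq_imp_space_eq[OF sets_torus] by simp

lemma emeasure_torus_box:
  fixes A :: "'n::finite \<Rightarrow> real set"
  assumes "\<And>i. A i \<in> sets borel"
  shows "emeasure torus {x. \<forall>i. x i \<in> A i} = (\<Prod>i\<in>UNIV. emeasure unit_uniform (A i))"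
proof -
  have "{x. \<forall>i. x i \<in> A i} = Pi\<^sub>E UNIV A" by (auto simp: PiE_iff)
  then show ?thesis unfolding torus_def using assms by (subst unit_product.emeasure_PiM[symmetric]) auto
qed

lemma emeasure_torus_space: "emeasure (torus :: ('n::finite \<Rightarrow> real) measure) UNIV = 1"
  using emeasure_torus_box[of "\<lambda>_::'n. UNIV"] by (simp add: prob_space_unit_uniform)

lemma finite_measure_torus: "finite_measure (torus :: ('n::finite \<Rightarrow> real) measure)"
  by (intro finite_measureI) (simp add: emeasure_torus_space)

lemma measure_torus: "measure (torus :: ('n::finite \<Rightarrow> real) measure) UNIV = 1"
  by (simp add: measure_def emeasure_torus_space)

lemma AE_torus: "AE x in (torus :: ('n::finite \<Rightarrow> real) measure). \<forall>i. x i \<in> {0..1}"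
proof -
  have "AE x in (torus :: ('n \<Rightarrow> real) measure). x i \<in> {0..1}" for i
  proof (rule AE_I)
    let ?A = "\<lambda>k. if k = i then - {0..1} else UNIV :: real set"
    have set_eq: "{x :: 'n \<Rightarrow> real. \<forall>k. x k \<in> ?A k} = {x. x i \<notin> {0..1}}"
    proof (intro equalityI subsetI CollectI)
      fix x :: "'n \<Rightarrow> real" assume "x \<in> {x. \<forall>k. x k \<in> ?A k}"
      then have "x i \<in> ?A i" by blast
      then show "x i \<notin> {0..1}" by simp
    qed auto
    have "emeasure (torus :: ('n \<Rightarrow> real) measure) {x. \<forall>k. x k \<in> ?A k} = (\<Prod>k\<in>UNIV. emeasure unit_uniform (?A k))"
      by (rule emeasure_torus_box) auto
    also have "emeasure unit_uniform (- {0..1}) = 0" by (subst emeasure_unit_uniform) auto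
    then have "(\<Prod>k\<in>UNIV. emeasure unit_uniform (?A k)) = 0" by (intro prod_zero bexI[of _ i]) auto
    finally show "emeasure (torus :: ('n \<Rightarrow> real) measure) {x. x i \<notin> {0..1}} = 0"
      unfolding set_eq .
    have "(\<lambda>x::'n \<Rightarrow> real. x i) \<in> borel_measurable borel"
      by (intro borel_measurable_continuous_onI continuous_on_product_coordinates)
    then have "(\<lambda>x::'n \<Rightarrow> real. x i) -` (- {0..1}) \<inter> space borel \<in> sets borel"
      by (rule measurable_sets) auto
    then show "{x. x i \<notin> {0..1}} \<in> sets (torus :: ('n \<Rightarrow> real) measure)"
      unfolding sets_torus by (simp add: vimage_def)
  qed auto
  then show ?thesis by (intro AE_all_countable[THEN iffD2]) auto
qed

lemma continuous_on_vec_of_fun: "continuous_on UNIV (\<lambda>x::'n::finite \<Rightarrow> real. \<chi> i. x i)"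
  by (intro continuous_on_vec_lambda continuous_on_product_coordinates)

lemma measurable_torus:
  fixes F :: "real^'n::finite \<Rightarrow> 'b::topological_space"
  assumes "continuous_on UNIV F"
  shows "(\<lambda>x. F (\<chi> i. x i)) \<in> borel_measurable torus"
proof -
  have "continuous_on UNIV (\<lambda>x::'n \<Rightarrow> real. F (\<chi> i. x i))"
    by (rule continuous_on_compose2[OF assms continuous_on_vec_of_fun]) auto
  then have "(\<lambda>x. F (\<chi> i. x i)) \<in> borel_measurable borel" by (rule borel_measurable_continuous_onI)
  then show ?thesis by (subst measurable_cong_sets[OF sets_torus refl])
qed

lemma integrable_torus:
  fixes F :: "real^'n::finite \<Rightarrow> 'b::{banach, second_countable_topology}"
  assumes "continuous_on UNIV F" "\<And>x. norm (F x) \<le> B"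
  shows "integrable torus (\<lambda>x. F (\<chi> i. x i))"
  by (rule finite_measure.integrable_const_bound[OF finite_measure_torus, of _ B])
    (use assms measurable_torus in auto)

text \<open>Functions to which the mean value applies.\<close>

definition bcont :: "(real^'n::finite \<Rightarrow> complex) \<Rightarrow> bool" where
  "bcont F \<longleftrightarrow> continuous_on UNIV F \<and> (\<exists>B. \<forall>x. norm (F x) \<le> B)"

lemma bcont_integrable: "bcont F \<Longrightarrow> integrable torus (\<lambda>x. F (\<chi> i. x i))"
  unfolding bcont_def using integrable_torus by blast

lemma bcont_mult: "bcont F \<Longrightarrow> bcont G \<Longrightarrow> bcont (\<lambda>x. F x * G x)"
proof -
  assume "bcont F" "bcont G"
  then obtain B C where BC: "continuous_on UNIV F" "continuous_on UNIV G" "\<And>x. norm (F x) \<le> B" "\<And>x. norm (G x) \<le> C"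
    unfolding bcont_def by auto
  have "norm (F x * G x) \<le> B * C" for x
    unfolding norm_mult using BC(3,4) by (intro mult_mono) (auto intro: order_trans[OF norm_ge_zero])
  then show ?thesis unfolding bcont_def using BC by (auto intro!: continuous_intros)
qed

lemma bcont_add: "bcont F \<Longrightarrow> bcont G \<Longrightarrow> bcont (\<lambda>x. F x + G x)"
proof -
  assume "bcont F" "bcont G"
  then obtain B C where BC: "continuous_on UNIV F" "continuous_on UNIV G" "\<And>x. norm (F x) \<le> B" "\<And>x. norm (G x) \<le> C"
    unfolding bcont_def by auto
  have "norm (F x + G x) \<le> B + C" for x using BC(3,4)[of x] by (intro norm_triangle_mono)
  then show ?thesis unfolding bcont_def using BC by (auto intro!: continuous_intros)
qed

lemma bcont_const: "bcont (\<lambda>_. c)" unfolding bcont_def by auto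

lemma bcont_diff:
  assumes "bcont F" "bcont G"
  shows "bcont (\<lambda>x. F x - G x)"
proof -
  have "bcont (\<lambda>x. - 1 * G x)" by (intro bcont_mult bcont_const assms)
  from bcont_add[OF assms(1) this] show ?thesis by simp
qed

lemma bcont_sum: "(\<And>i. i \<in> A \<Longrightarrow> bcont (F i)) \<Longrightarrow> bcont (\<lambda>x. \<Sum>i\<in>A. F i x)"
  by (induction A rule: infinite_finite_induct) (auto intro: bcont_const bcont_add)

lemma tmean_add: "bcont F \<Longrightarrow> bcont G \<Longrightarrow> tmean (\<lambda>x. F x + G x) = tmean F + tmean G"
  unfolding tmean_def by (intro Bochner_Integration.integral_add bcont_integrable)

lemma tmean_diff: "bcont F \<Longrightarrow> bcont G \<Longrightarrow> tmean (\<lambda>x. F x - G x) = tmean F - tmean G"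
  unfolding tmean_def by (intro Bochner_Integration.integral_diff bcont_integrable)

lemma tmean_cmult: "tmean (\<lambda>x. c * F x) = c * tmean F"
  unfolding tmean_def by simp

lemma tmean_sum: "(\<And>i. i \<in> A \<Longrightarrow> bcont (F i)) \<Longrightarrow> tmean (\<lambda>x. \<Sum>i\<in>A. F i x) = (\<Sum>i\<in>A. tmean (F i))"
  unfolding tmean_def by (intro Bochner_Integration.integral_sum bcont_integrable)

lemma tmean_bound:
  fixes F :: "real^'n::finite \<Rightarrow> complex"
  assumes "bcont F" "\<And>x. norm (F x) \<le> B"
  shows "norm (tmean F) \<le> B"
proof -
  have "norm (tmean F) \<le> (\<integral>x. norm (F (\<chi> i. x i)) \<partial>torus)"
    unfolding tmean_def by (rule integral_norm_bound)
  also have "\<dots> \<le> (\<integral>x. B \<partial>(torus :: ('n \<Rightarrow> real) measure))"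
    using assms by (intro integral_mono integrable_norm bcont_integrable) (auto intro: finite_measure.integrable_const[OF finite_measure_torus])
  also have "\<dots> = B" by (simp add: measure_torus)
  finally show ?thesis .
qed

lemma tmean_coordinate:
  fixes F G :: "real^'n::finite \<Rightarrow> complex"
  assumes F: "bcont F" and G: "bcont G"
    and eq: "\<And>v. integral {0..1} (\<lambda>t. F (v + axis i t)) = integral {0..1} (\<lambda>t. G (v + axis i t))"
  shows "tmean F = tmean G"
proof -
  have upd: "(\<chi> k. (x(i := t)) k) = (\<chi> k. (x(i := 0)) k) + axis i t" for x :: "'n \<Rightarrow> real" and t
    by (simp add: vec_eq_iff axis_def)
  have *: "tmean H = (\<integral>x. integral {0..1} (\<lambda>t. H ((\<chi> k. (x(i := 0)) k) + axis i t)) \<partial>Pi\<^sub>M (UNIV - {i}) (\<lambda>_. unit_uniform))"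
    if H: "bcont H" for H :: "real^'n \<Rightarrow> complex"
  proof -
    have U: "(UNIV :: 'n set) = insert i (UNIV - {i})" by auto
    have int: "integrable (Pi\<^sub>M (insert i (UNIV - {i})) (\<lambda>_. unit_uniform)) (\<lambda>x. H (\<chi> k. x k))"
      using bcont_integrable[OF H] unfolding torus_def U[symmetric] .
    have c: "continuous_on UNIV (\<lambda>t. H (v + axis i t))" for v
    proof -
      have "continuous_on UNIV (\<lambda>t. v + axis i t :: real^'n)"
      proof -
        have e: "v + axis i t = (\<chi> k. v $ k + (if k = i then t else 0))" for t
          by (simp add: vec_eq_iff axis_def)
        have "continuous_on UNIV (\<lambda>t::real. v $ k + (if k = i then t else 0))" for k
          by (cases "k = i") (auto intro!: continuous_intros)
        then show ?thesis unfolding e by (intro continuous_on_vec_lambda)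
      qed
      then show ?thesis using H unfolding bcont_def by (auto intro: continuous_on_compose2)
    qed
    have step: "(\<integral>t. H (\<chi> k. (x(i := t)) k) \<partial>unit_uniform)
        = integral {0..1} (\<lambda>t. H ((\<chi> k. (x(i := 0)) k) + axis i t))" for x
    proof -
      have "(\<lambda>t. H (\<chi> k. (x(i := t)) k)) = (\<lambda>t. H ((\<chi> k. (x(i := 0)) k) + axis i t))"
        by (intro ext arg_cong[of _ _ H] upd)
      then show ?thesis using integral_unit_uniform[OF c, of "\<chi> k. (x(i := 0)) k"] by (simp only:)
    qed
    have "tmean H = (\<integral>x. H (\<chi> k. x k) \<partial>Pi\<^sub>M (insert i (UNIV - {i})) (\<lambda>_. unit_uniform))"
      unfolding tmean_def torus_def U[symmetric] ..
    also have "\<dots> = (\<integral>x. (\<integral>t. H (\<chi> k. (x(i := t)) k) \<partial>unit_uniform) \<partial>Pi\<^sub>M (UNIV - {i}) (\<lambda>_. unit_uniform))"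
      by (rule unit_product.product_integral_insert[OF _ _ int]) auto
    also have "\<dots> = (\<integral>x. integral {0..1} (\<lambda>t. H ((\<chi> k. (x(i := 0)) k) + axis i t)) \<partial>Pi\<^sub>M (UNIV - {i}) (\<lambda>_. unit_uniform))"
      unfolding step ..
    finally show ?thesis .
  qed
  show ?thesis unfolding *[OF F] *[OF G] eq ..
qed

section \<open>Uniqueness of Fourier coefficients\<close>

definition ex :: "('n::finite \<Rightarrow> int) \<Rightarrow> complex^'n \<Rightarrow> complex" where
  "ex m z = exp (2 * of_real pi * \<i> * (\<Sum>k\<in>UNIV. of_int (m k) * z $ k))"

definition rv :: "real^'n \<Rightarrow> complex^'n::finite" where
  "rv x = (\<chi> k. of_real (x $ k))"

lemma ex_add: "ex m (z + w) = ex m z * ex m w"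
  by (simp add: ex_def distrib_left sum.distrib exp_add)

lemma ex_add_freq: "ex (\<lambda>k. m k + l k) z = ex m z * ex l z"
  by (simp add: ex_def distrib_right distrib_left sum.distrib exp_add)

lemma ex_zero: "ex (\<lambda>_. 0) z = 1" by (simp add: ex_def)

lemma ex_minus: "ex (\<lambda>k. - m k) z * ex m z = 1"
  using ex_add_freq[of "\<lambda>k. - m k" m z] by (simp add: ex_zero)

lemma norm_ex: "norm (ex m z) = exp (- 2 * pi * (\<Sum>k\<in>UNIV. of_int (m k) * Im (z $ k)))"
  by (simp add: ex_def Im_sum)

lemma norm_ex_rv [simp]: "norm (ex m (rv x)) = 1"
  by (simp add: norm_ex rv_def)

lemma rv_add: "rv (x + y) = rv x + rv y" by (simp add: rv_def vec_eq_iff)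

lemma continuous_on_ex_rv: "continuous_on UNIV (\<lambda>x. ex m (rv x))"
  unfolding ex_def rv_def by (simp, intro continuous_intros)

lemma bcont_ex: "bcont (\<lambda>x. ex m (rv x))"
  unfolding bcont_def using continuous_on_ex_rv by (auto intro: exI[of _ 1])

lemma ex_axis: "ex m (axis i w) = exp (2 * of_real pi * \<i> * (of_int (m i) * w))"
proof -
  have "(\<Sum>k\<in>UNIV. of_int (m k) * axis i w $ k) = (\<Sum>k\<in>UNIV. if k = i then of_int (m i) * w else 0)"
    by (intro sum.cong) (auto simp: axis_def)
  then show ?thesis by (simp add: ex_def)
qed

lemma rv_axis: "rv (axis i t) = axis i (of_real t)"
  by (simp add: rv_def vec_eq_iff axis_def)

lemma integral_exp_int:
  assumes "l \<noteq> (0::int)"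
  shows "integral {0..1} (\<lambda>t. exp (2 * of_real pi * \<i> * (of_int l * of_real t))) = 0"
proof -
  define c where "c = 2 * of_real pi * \<i> * (of_int l :: complex)"
  have c: "c \<noteq> 0" using assms by (simp add: c_def)
  have d: "((\<lambda>t. exp (c * of_real t) / c) has_vector_derivative exp (c * of_real t)) (at t within {0..1})" for t :: real
  proof -
    have "((\<lambda>z. exp (c * z) / c) has_field_derivative exp (c * of_real t)) (at (of_real t))"
      using c by (auto intro!: derivative_eq_intros)
    then show ?thesis by (rule has_vector_derivative_real_field[THEN has_vector_derivative_at_within])
  qed
  have "((\<lambda>t. exp (c * of_real t)) has_integral exp (c * of_real 1) / c - exp (c * of_real 0) / c) {0..1}"
    by (rule fundamental_theorem_of_calculus) (use d in auto)
  moreover have "exp (c * of_real 1) = 1"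
    using exp_integer_2pi[of "of_int l"] by (simp add: c_def mult_ac)
  ultimately show ?thesis by (simp add: c_def mult.assoc integral_unique)
qed

lemma tmean_ex:
  fixes m :: "'n::finite \<Rightarrow> int"
  shows "tmean (\<lambda>x. ex m (rv x)) = (if m = (\<lambda>_. 0) then 1 else 0)"
proof (cases "m = (\<lambda>_. 0)")
  case True
  then show ?thesis by (simp add: ex_zero tmean_def measure_torus)
next
  case False
  then obtain i where i: "m i \<noteq> 0" by auto
  have "tmean (\<lambda>x. ex m (rv x)) = tmean (\<lambda>_::real^'n. 0)"
  proof (rule tmean_coordinate[OF bcont_ex bcont_const])
    fix v
    have "integral {0..1} (\<lambda>t. ex m (rv (v + axis i t))) = ex m (rv v) * 0"
      unfolding rv_add ex_add rv_axis ex_axis integral_exp_int[OF i, symmetric] by (rule integral_mult_right)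
    then show "integral {0..1} (\<lambda>t. ex m (rv (v + axis i t))) = integral {0..1} (\<lambda>t. 0)" by simp
  qed
  then show ?thesis using False by (simp add: tmean_def)
qed

lemma torus_coefficient:
  fixes m :: "'k \<Rightarrow> 'n::finite \<Rightarrow> int"
  assumes sum: "\<And>x::real^'n. ((\<lambda>k. a k * ex (m k) (rv x)) has_sum F x) K"
    and F: "bcont F" and inj: "inj_on m K" and k0: "k0 \<in> K"
  shows "tmean (\<lambda>x. F x * ex (\<lambda>i. - m k0 i) (rv x)) = a k0"
proof -
  let ?e = "\<lambda>x. ex (\<lambda>i. - m k0 i) (rv x)"
  have "(\<lambda>k. a k * ex (m k) (rv 0)) summable_on K" using sum by (rule has_sum_imp_summable)
  then have "(\<lambda>k. norm (a k * ex (m k) (rv 0))) summable_on K"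
    by (simp only: summable_on_iff_abs_summable_on_complex)
  then have abs: "(\<lambda>k. norm (a k)) summable_on K" by (simp add: norm_mult)
  define A where "A = infsum (\<lambda>k. norm (a k)) K"
  have A: "((\<lambda>k. norm (a k)) has_sum A) K" unfolding A_def using abs by (rule has_sum_infsum)
  have "norm (tmean (\<lambda>x. F x * ?e x) - a k0) \<le> \<epsilon>" if eps: "\<epsilon> > 0" for \<epsilon>
  proof -
    have "eventually (\<lambda>S. dist (\<Sum>k\<in>S. norm (a k)) A < \<epsilon>) (finite_subsets_at_top K)"
      using A eps unfolding has_sum_def by (rule tendstoD)
    then obtain S0 where S0: "finite S0" "S0 \<subseteq> K"
      "\<And>S. finite S \<Longrightarrow> S0 \<subseteq> S \<Longrightarrow> S \<subseteq> K \<Longrightarrow> dist (\<Sum>k\<in>S. norm (a k)) A < \<epsilon>"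
      unfolding eventually_finite_subsets_at_top by auto
    define S where "S = insert k0 S0"
    have S: "finite S" "S \<subseteq> K" "k0 \<in> S" using S0 k0 by (auto simp: S_def)
    have "dist (\<Sum>k\<in>S. norm (a k)) A < \<epsilon>" by (rule S0(3)) (use S in \<open>auto simp: S_def\<close>)
    then have tail: "A - (\<Sum>k\<in>S. norm (a k)) \<le> \<epsilon>" by (simp add: dist_norm)
    have "norm (F x - (\<Sum>k\<in>S. a k * ex (m k) (rv x))) \<le> \<epsilon>" for x
    proof -
      have h1: "((\<lambda>k. a k * ex (m k) (rv x)) has_sum (F x - (\<Sum>k\<in>S. a k * ex (m k) (rv x)))) (K - S)"
        using S by (intro has_sum_Diff sum has_sum_finite) auto
      have "((\<lambda>k. norm (a k)) has_sum (A - (\<Sum>k\<in>S. norm (a k)))) (K - S)"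
        using S by (intro has_sum_Diff A has_sum_finite) auto
      then have "((\<lambda>k. norm (a k * ex (m k) (rv x))) has_sum (A - (\<Sum>k\<in>S. norm (a k)))) (K - S)"
        by (simp add: norm_mult)
      from norm_has_sum_bound[OF this h1] tail show ?thesis by linarith
    qed
    then have b: "norm ((F x - (\<Sum>k\<in>S. a k * ex (m k) (rv x))) * ?e x) \<le> \<epsilon>" for x by (simp add: norm_mult)
    have bS: "bcont (\<lambda>x. a k * ex (m k) (rv x))" for k by (intro bcont_mult bcont_const bcont_ex)
    have "norm (tmean (\<lambda>x. (F x - (\<Sum>k\<in>S. a k * ex (m k) (rv x))) * ?e x)) \<le> \<epsilon>"
      by (rule tmean_bound[OF _ b]) (intro bcont_mult bcont_diff F bcont_sum bS bcont_ex)
    also have "(\<lambda>x. (F x - (\<Sum>k\<in>S. a k * ex (m k) (rv x))) * ?e x)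
        = (\<lambda>x. F x * ?e x - (\<Sum>k\<in>S. a k * ex (\<lambda>i. m k i + - m k0 i) (rv x)))"
      unfolding ex_add_freq by (simp add: left_diff_distrib sum_distrib_right mult.assoc)
    also have "tmean \<dots> = tmean (\<lambda>x. F x * ?e x) - tmean (\<lambda>x. \<Sum>k\<in>S. a k * ex (\<lambda>i. m k i + - m k0 i) (rv x))"
      by (intro tmean_diff bcont_mult F bcont_ex bcont_sum bcont_const)
    also have "tmean (\<lambda>x. \<Sum>k\<in>S. a k * ex (\<lambda>i. m k i + - m k0 i) (rv x))
        = (\<Sum>k\<in>S. a k * (if (\<lambda>i. m k i + - m k0 i) = (\<lambda>_. 0) then 1 else 0))"
      by (subst tmean_sum) (simp_all only: bcont_mult[OF bcont_const bcont_ex] tmean_cmult tmean_ex)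
    also have "\<dots> = (\<Sum>k\<in>S. if k = k0 then a k0 else 0)"
    proof (rule sum.cong)
      fix k assume k: "k \<in> S"
      have "((\<lambda>i. m k i + - m k0 i) = (\<lambda>_. 0)) \<longleftrightarrow> m k = m k0" by (auto simp: fun_eq_iff)
      also have "\<dots> \<longleftrightarrow> k = k0" using inj k S(2) k0 by (auto simp: inj_on_def)
      finally show "a k * (if (\<lambda>i. m k i + - m k0 i) = (\<lambda>_. 0) then 1 else 0) = (if k = k0 then a k0 else 0)" by simp
    qed simp
    also have "\<dots> = a k0" using S by simp
    finally show ?thesis .
  qed
  then have "norm (tmean (\<lambda>x. F x * ?e x) - a k0) \<le> 0" by (rule field_le_epsilon[of _ 0, simplified])
  then show ?thesis by simp
qed

section \<open>A continuous function with vanishing Fourier coefficients\<close>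

definition peak :: "'n::finite \<Rightarrow> real^'n \<Rightarrow> complex" where
  "peak i x = of_real ((sin (pi * x $ i))\<^sup>2)"

lemma peak_eq_ex:
  "peak i x = (2 - ex (\<lambda>k. if k = i then 1 else 0) (rv x) - ex (\<lambda>k. if k = i then - 1 else 0) (rv x)) / 4"
proof -
  have s: "ex (\<lambda>k. if k = i then c else 0) (rv x) = exp (2 * of_real pi * \<i> * (of_int c * of_real (x $ i)))" for c
  proof -
    have "(\<Sum>k\<in>UNIV. of_int (if k = i then c else 0) * rv x $ k) = (\<Sum>k\<in>UNIV. if k = i then of_int c * of_real (x $ i) else (0::complex))"
      by (intro sum.cong) (auto simp: rv_def)
    then show ?thesis by (simp add: ex_def)
  qed
  define t where "t = 2 * pi * x $ i"
  have e1: "ex (\<lambda>k. if k = i then 1 else 0) (rv x) = cis t"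
    unfolding s t_def cis_conv_exp by (simp add: mult_ac)
  have e2: "ex (\<lambda>k. if k = i then - 1 else 0) (rv x) = cis (- t)"
    unfolding s t_def cis_conv_exp by (simp add: mult_ac)
  have "cos t = 1 - 2 * (sin (pi * x $ i))\<^sup>2"
    using cos_double_sin[of "pi * x $ i"] unfolding t_def by (simp add: mult.assoc)
  then show ?thesis unfolding e1 e2 peak_def by (simp add: complex_eq_iff)
qed

lemma bcont_peak: "bcont (peak i)"
  unfolding bcont_def peak_def
  by (intro conjI exI[of _ 1] allI continuous_intros) (auto simp: norm_power abs_square_le_1)

text \<open>A power of a product of squared sines concentrates at the centre of the cube. Its mean against the function vanishes, yet it would be bounded away from zero if the function were not zero at the centre.\<close>

lemma vanishing_coefficients_imp_zero:
  fixes F :: "real^'n::finite \<Rightarrow> complex"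
  assumes F: "bcont F" and zero: "\<And>m. tmean (\<lambda>x. F x * ex m (rv x)) = 0"
  shows "F (\<chi> i. 1 / 2) = 0"
proof (rule ccontr)
  let ?c = "(\<chi> i. 1 / 2) :: real^'n"
  assume Fc: "F ?c \<noteq> 0"
  define ann where "ann H \<longleftrightarrow> bcont H \<and> (\<forall>m. tmean (\<lambda>x. F x * H x * ex m (rv x)) = 0)" for H
  have ann_1: "ann (\<lambda>_. 1)" unfolding ann_def using zero bcont_const by simp
  have ann_peak: "ann (\<lambda>x. peak i x * H x)" if H: "ann H" for i H
    unfolding ann_def
  proof (intro conjI allI)
    have bH: "bcont H" using H by (simp add: ann_def)
    show "bcont (\<lambda>x. peak i x * H x)" by (intro bcont_mult bcont_peak bH)
    fix m
    let ?p = "\<lambda>k. if k = i then 1 else 0 :: int" and ?q = "\<lambda>k. if k = i then - 1 else 0 :: int"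
    let ?E = "\<lambda>m x. F x * H x * ex m (rv x)"
    have bE: "bcont (?E m)" for m by (intro bcont_mult F bH bcont_ex)
    have "F x * (peak i x * H x) * ex m (rv x)
        = (1/4) * (2 * ?E m x - ?E (\<lambda>k. ?p k + m k) x - ?E (\<lambda>k. ?q k + m k) x)" for x
      unfolding peak_eq_ex ex_add_freq by (simp add: field_simps)
    then have "tmean (\<lambda>x. F x * (peak i x * H x) * ex m (rv x))
        = (1/4) * tmean (\<lambda>x. 2 * ?E m x - ?E (\<lambda>k. ?p k + m k) x - ?E (\<lambda>k. ?q k + m k) x)"
      by (simp only: tmean_cmult)
    also have "tmean (\<lambda>x. 2 * ?E m x - ?E (\<lambda>k. ?p k + m k) x - ?E (\<lambda>k. ?q k + m k) x)
        = 2 * tmean (?E m) - tmean (?E (\<lambda>k. ?p k + m k)) - tmean (?E (\<lambda>k. ?q k + m k))"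
      by (subst tmean_diff[OF bcont_diff[OF bcont_mult[OF bcont_const bE] bE] bE],
          subst tmean_diff[OF bcont_mult[OF bcont_const bE] bE], subst tmean_cmult) (rule refl)
    also have "\<dots> = 0" using H unfolding ann_def by simp
    finally show "tmean (\<lambda>x. F x * (peak i x * H x) * ex m (rv x)) = 0" by simp
  qed
  have ann_prod: "ann (\<lambda>x. (\<Prod>i\<in>S. peak i x) * H x)" if "finite S" "ann H" for S H
    using that
  proof (induction S rule: finite_induct)
    case (insert i S)
    then show ?case using ann_peak[of "\<lambda>x. (\<Prod>i\<in>S. peak i x) * H x" i] by (simp add: mult.assoc)
  qed simp
  define P :: "real^'n \<Rightarrow> real" where "P x = (\<Prod>i\<in>UNIV. (sin (pi * x $ i))\<^sup>2)" for x
  have ann_pow: "ann (\<lambda>x. of_real (P x) ^ N)" for N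
  proof (induction N)
    case (Suc N)
    show ?case using ann_prod[OF finite Suc] by (simp add: P_def peak_def)
  qed (simp add: ann_1)
  have z: "tmean (\<lambda>x. F x * of_real (P x) ^ N) = 0" for N
  proof -
    have "tmean (\<lambda>x. F x * of_real (P x) ^ N * ex (\<lambda>_. 0) (rv x)) = 0"
      using ann_pow[of N] unfolding ann_def by blast
    then show ?thesis by (simp add: ex_zero)
  qed
  define h where "h x = Re (F x * cnj (F ?c))" for x
  define \<kappa> where "\<kappa> = (norm (F ?c))\<^sup>2 / 2"
  have kappa: "\<kappa> > 0" using Fc by (simp add: \<kappa>_def)
  have contF: "continuous_on UNIV F" using F by (simp add: bcont_def)
  obtain B where B: "\<And>x. norm (F x) \<le> B" using F unfolding bcont_def by blast
  have cont_h: "continuous_on UNIV h" unfolding h_def by (intro continuous_intros contF)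
  have P01: "0 \<le> P x" "P x \<le> 1" for x
    unfolding P_def by (auto intro!: prod_nonneg prod_le_1 simp: abs_square_le_1)
  have cont_P: "continuous_on UNIV P" unfolding P_def by (intro continuous_intros)
  define M where "M = B * B"
  have h_le: "\<bar>h x\<bar> \<le> M" for x
  proof -
    have "\<bar>h x\<bar> \<le> norm (F x) * norm (F ?c)"
      unfolding h_def using abs_Re_le_cmod[of "F x * cnj (F ?c)"] by (simp add: norm_mult)
    also have "\<dots> \<le> B * B" using B by (intro mult_mono) (auto intro: order_trans[OF norm_ge_zero])
    finally show ?thesis by (simp add: M_def)
  qed
  have M0: "M \<ge> 0" using h_le[of ?c] by linarith
  have z_real: "(\<integral>x. h (\<chi> i. x i) * P (\<chi> i. x i) ^ N \<partial>torus) = 0" for N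
  proof -
    have b: "bcont (\<lambda>x. F x * of_real (P x) ^ N * cnj (F ?c))"
      using ann_pow[of N] F bcont_const unfolding ann_def by (intro bcont_mult) auto
    have "(\<integral>x. h (\<chi> i. x i) * P (\<chi> i. x i) ^ N \<partial>torus)
        = (\<integral>x. Re (F (\<chi> i. x i) * of_real (P (\<chi> i. x i)) ^ N * cnj (F ?c)) \<partial>torus)"
      by (intro Bochner_Integration.integral_cong) (simp_all add: h_def algebra_simps flip: of_real_power)
    also have "\<dots> = Re (\<integral>x. F (\<chi> i. x i) * of_real (P (\<chi> i. x i)) ^ N * cnj (F ?c) \<partial>torus)"
      by (rule integral_Re[OF bcont_integrable[OF b]])
    also have "(\<integral>x. F (\<chi> i. x i) * of_real (P (\<chi> i. x i)) ^ N * cnj (F ?c) \<partial>torus) = 0"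
      using z[of N] unfolding tmean_def by simp
    finally show ?thesis by simp
  qed
  \<comment> \<open>on a small box around the peak the function is bounded below\<close>
  have hc: "h ?c = 2 * \<kappa>" unfolding h_def \<kappa>_def by (simp add: complex_mult_cnj cmod_power2)
  have "\<exists>d>0. \<forall>x. dist x ?c < d \<longrightarrow> dist (h x) (h ?c) < \<kappa>"
    using cont_h kappa unfolding continuous_on_iff by blast
  then obtain d where d: "d > 0" "\<And>x. dist x ?c < d \<Longrightarrow> dist (h x) (h ?c) < \<kappa>" by blast
  define n where "n = real CARD('n)"
  have n: "n \<ge> 1" unfolding n_def by (simp add: Suc_leI)
  define r where "r = min (1/4) (d / (2 * n))"
  have r: "0 < r" "r \<le> 1/4" using d n unfolding r_def by auto
  have h_box: "h x \<ge> \<kappa>" if "\<And>i. \<bar>x $ i - 1/2\<bar> \<le> r" for x :: "real^'n"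
  proof -
    have "dist x ?c \<le> (\<Sum>i\<in>UNIV. \<bar>(x - ?c) $ i\<bar>)" unfolding dist_norm by (rule norm_le_l1_cart)
    also have "\<dots> \<le> (\<Sum>i\<in>(UNIV::'n set). r)" using that by (intro sum_mono) simp
    also have "\<dots> = n * r" by (simp add: n_def)
    also have "\<dots> \<le> n * (d / (2 * n))" using n unfolding r_def by (intro mult_left_mono) auto
    also have "\<dots> < d" using d(1) n by simp
    finally have "dist (h x) (h ?c) < \<kappa>" by (rule d(2))
    then show ?thesis unfolding hc dist_real_def by linarith
  qed
  have sin_cos: "(sin (pi * t))\<^sup>2 = (cos (pi * (t - 1/2)))\<^sup>2" for t
  proof -
    have "sin (pi * t) = cos (pi * (t - 1/2))"
      by (simp add: sin_cos_eq right_diff_distrib) (metis cos_minus minus_diff_eq)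
    then show ?thesis by simp
  qed
  have cos_pi_abs: "cos (pi * \<bar>u\<bar>) = cos (pi * u)" for u :: real by (cases "u \<ge> 0") auto
  define \<rho>' where "\<rho>' = (cos (pi * r))\<^sup>2"
  define s where "s = r / 2"
  have cos_gt: "cos (pi * r) > 0" "cos (pi * r) < 1"
  proof -
    show "cos (pi * r) > 0" using r by (intro cos_gt_zero) auto
    have "cos (pi * r) < cos 0" using r by (intro cos_monotone_0_pi) (auto simp: mult_le_cancel_left2)
    then show "cos (pi * r) < 1" by simp
  qed
  have out: "P x \<le> \<rho>'" if "\<And>i. x $ i \<in> {0..1}" "\<bar>x $ k - 1/2\<bar> > r" for x :: "real^'n" and k
  proof -
    have "P x = (sin (pi * x $ k))\<^sup>2 * (\<Prod>i\<in>UNIV - {k}. (sin (pi * x $ i))\<^sup>2)"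
      unfolding P_def by (subst prod.remove[of UNIV k]) auto
    also have "\<dots> \<le> (sin (pi * x $ k))\<^sup>2 * 1"
      by (intro mult_left_mono prod_le_1) (auto simp: abs_square_le_1)
    also have "\<dots> = (cos (pi * \<bar>x $ k - 1/2\<bar>))\<^sup>2"       unfolding sin_cos cos_pi_abs by simp
    also have "\<dots> \<le> \<rho>'" unfolding \<rho>'_def
    proof (rule power_mono)
      have "0 \<le> x $ k" "x $ k \<le> 1" using that(1)[of k] by auto
      then have le: "\<bar>x $ k - 1/2\<bar> \<le> 1/2" unfolding abs_le_iff by linarith
      show "cos (pi * \<bar>x $ k - 1/2\<bar>) \<le> cos (pi * r)"
        using that(2) le r by (intro cos_monotone_0_pi_le) (auto intro: mult_left_mono)
      show "0 \<le> cos (pi * \<bar>x $ k - 1/2\<bar>)"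
        using le by (intro cos_ge_zero) (auto intro: order_trans[of _ 0])
    qed
    finally show ?thesis .
  qed
  obtain \<delta> where del: "0 < \<delta>" "\<delta> \<le> r" "\<And>x :: real^'n. (\<And>i. \<bar>x $ i - 1/2\<bar> \<le> \<delta>) \<Longrightarrow> P x \<ge> (1 + \<rho>') / 2"
  proof -
    have Pc: "P ?c = 1" by (simp add: P_def)
    have rho1: "\<rho>' < 1" unfolding \<rho>'_def using cos_gt by (simp add: power_less_one_iff)
    have pos: "0 < (1 - \<rho>') / 2" using rho1 by simp
    obtain e where "e > 0 \<and> (\<forall>x\<in>UNIV. dist x ?c < e \<longrightarrow> dist (P x) (P ?c) < (1 - \<rho>') / 2)"
      using mp[OF spec[OF bspec[OF cont_P[unfolded continuous_on_iff] UNIV_I]] pos] by (rule exE)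
    then have e: "e > 0" "\<And>x. dist x ?c < e \<Longrightarrow> dist (P x) (P ?c) < (1 - \<rho>') / 2" by blast+
    have "P x \<ge> (1 + \<rho>') / 2" if "\<And>i. \<bar>x $ i - 1/2\<bar> \<le> min r (e / (2 * n))" for x :: "real^'n"
    proof -
      have "dist x ?c \<le> (\<Sum>i\<in>UNIV. \<bar>(x - ?c) $ i\<bar>)" unfolding dist_norm by (rule norm_le_l1_cart)
      also have "\<dots> \<le> (\<Sum>i\<in>(UNIV::'n set). e / (2 * n))" using that by (intro sum_mono) simp
      also have "\<dots> = n * (e / (2 * n))" by (simp add: n_def)
      also have "\<dots> < e" using e(1) n by simp
      finally have "dist (P x) (P ?c) < (1 - \<rho>') / 2" by (rule e(2))
      then show ?thesis unfolding Pc dist_real_def by argo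
    qed
    then show thesis using e(1) n r by (intro that[of "min r (e / (2 * n))"]) auto
  qed
  define \<rho> where "\<rho> = (1 + \<rho>') / 2"
  have rho: "0 \<le> \<rho>'" "\<rho>' < \<rho>" "0 < \<rho>"
  proof -
    show "0 \<le> \<rho>'" unfolding \<rho>'_def by simp
    then show "0 < \<rho>" unfolding \<rho>_def by simp
    have "\<rho>' < 1" unfolding \<rho>'_def using cos_gt by (simp add: power_less_one_iff)
    then show "\<rho>' < \<rho>" unfolding \<rho>_def by simp
  qed
  define box where "box = {x :: 'n \<Rightarrow> real. \<forall>i. x i \<in> {1/2 - \<delta>..1/2 + \<delta>}}"
  have "emeasure torus box = (\<Prod>i\<in>(UNIV::'n set). ennreal (2 * \<delta>))"
  proof -
    have "{1/2 - \<delta>..1/2 + \<delta>} \<inter> {0..1} = {1/2 - \<delta>..1/2 + \<delta>}" using del r by auto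
    then have "emeasure unit_uniform {1/2 - \<delta>..1/2 + \<delta>} = ennreal (2 * \<delta>)"
      using del by (subst emeasure_unit_uniform) auto
    then show ?thesis unfolding box_def by (subst emeasure_torus_box) auto
  qed
  then have "emeasure torus box = ennreal ((2 * \<delta>) ^ CARD('n))" using del by (simp add: ennreal_power)
  then have mu: "measure torus box = (2 * \<delta>) ^ CARD('n)" using del by (simp add: measure_def)
  have box_sets: "box \<in> sets torus"
  proof -
    have "(\<lambda>x::'n \<Rightarrow> real. x i) -` {1/2 - \<delta>..1/2 + \<delta>} \<inter> space borel \<in> sets borel" for i
      by (rule measurable_sets[where A = borel])
        (auto intro!: borel_measurable_continuous_onI continuous_on_product_coordinates)
    then have "(\<Inter>i. (\<lambda>x::'n \<Rightarrow> real. x i) -` {1/2 - \<delta>..1/2 + \<delta>}) \<in> sets borel"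
      by (intro sets.countable_INT'') auto
    then show ?thesis unfolding sets_torus box_def by (simp add: vimage_def Inter_eq)
  qed
  define \<mu> where "\<mu> = measure torus box"
  have mu0: "\<mu> > 0" unfolding \<mu>_def mu using del by simp
  have ineq: "\<kappa> * \<rho> ^ N * \<mu> \<le> M * \<rho>' ^ N" for N
  proof -
    have intbox: "integrable torus (\<lambda>x. \<kappa> * \<rho> ^ N * indicator box x)"
      using box_sets finite_measure.emeasure_finite[OF finite_measure_torus]
      by (intro integrable_mult_right integrable_real_indicator) (auto simp: top.not_eq_extremum)
    have "(\<integral>x. \<kappa> * \<rho> ^ N * indicator box x - M * \<rho>' ^ N \<partial>torus) \<le> (\<integral>x. h (\<chi> i. x i) * P (\<chi> i. x i) ^ N \<partial>torus)"
    proof (rule integral_mono_AE)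
      show "integrable torus (\<lambda>x. \<kappa> * \<rho> ^ N * indicator box x - M * \<rho>' ^ N)"
        using intbox finite_measure.integrable_const[OF finite_measure_torus] by (intro Bochner_Integration.integrable_diff)
      show "integrable torus (\<lambda>x. h (\<chi> i. x i) * P (\<chi> i. x i) ^ N)"
      proof (rule integrable_torus[where B = M])
        show "continuous_on UNIV (\<lambda>x. h x * P x ^ N)" by (intro continuous_intros cont_h cont_P)
        fix x
        have "\<bar>h x\<bar> * P x ^ N \<le> M * 1" using h_le P01 M0 by (intro mult_mono power_le_one) auto
        then show "norm (h x * P x ^ N) \<le> M" using P01 by (simp add: abs_mult)
      qed
      show "AE x in torus. \<kappa> * \<rho> ^ N * indicator box x - M * \<rho>' ^ N \<le> h (\<chi> i. x i) * P (\<chi> i. x i) ^ N"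
        using AE_torus
      proof (rule AE_mp, intro AE_I2 impI)
        fix x :: "'n \<Rightarrow> real" assume x: "\<forall>i. x i \<in> {0..1}"
        let ?x = "\<chi> i. x i"
        have Mr: "0 \<le> M * \<rho>' ^ N" using M0 rho by simp
        show "\<kappa> * \<rho> ^ N * indicator box x - M * \<rho>' ^ N \<le> h ?x * P ?x ^ N"
        proof (cases "x \<in> box")
          case True
          have xi: "\<bar>?x $ i - 1/2\<bar> \<le> \<delta>" for i
          proof -
            have "x i \<in> {1/2 - \<delta>..1/2 + \<delta>}" using True unfolding box_def by blast
            then show ?thesis unfolding vec_lambda_beta abs_le_iff atLeastAtMost_iff by linarith
          qed
          have "\<kappa> \<le> h ?x" using xi del(2) by (intro h_box) (meson order_trans)
          moreover have "\<rho> \<le> P ?x" unfolding \<rho>_def by (rule del(3)[OF xi])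
          ultimately have "\<kappa> * \<rho> ^ N \<le> h ?x * P ?x ^ N" using kappa rho by (intro mult_mono power_mono) auto
          then show ?thesis using True Mr by simp
        next
          case False
          show ?thesis
          proof (cases "\<forall>i. \<bar>?x $ i - 1/2\<bar> \<le> r")
            case True
            then have "h ?x \<ge> 0" using h_box[of ?x] kappa by simp
            then have "0 \<le> h ?x * P ?x ^ N" using P01 by simp
            then show ?thesis using False Mr by simp
          next
            case f2: False
            then obtain k where "\<bar>?x $ k - 1/2\<bar> > r" by (auto simp: not_le)
            then have "P ?x \<le> \<rho>'" using x by (intro out[of ?x k]) auto
            then have "\<bar>h ?x\<bar> * P ?x ^ N \<le> M * \<rho>' ^ N" using h_le P01 M0 by (intro mult_mono power_mono) auto
            moreover have "- (\<bar>h ?x\<bar> * P ?x ^ N) \<le> h ?x * P ?x ^ N"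
            proof -
              have "- \<bar>h ?x\<bar> * P ?x ^ N \<le> h ?x * P ?x ^ N" using P01 by (intro mult_right_mono) auto
              then show ?thesis by simp
            qed
            ultimately show ?thesis using False by simp
          qed
        qed
      qed
    qed
    also have "\<dots> = 0" by (rule z_real)
    also have "(\<integral>x. \<kappa> * \<rho> ^ N * indicator box x - M * \<rho>' ^ N \<partial>torus)
        = (\<integral>x. \<kappa> * \<rho> ^ N * indicator box x \<partial>torus) - (\<integral>x. M * \<rho>' ^ N \<partial>(torus :: ('n \<Rightarrow> real) measure))"
      by (intro Bochner_Integration.integral_diff intbox finite_measure.integrable_const[OF finite_measure_torus])
    also have "\<dots> = \<kappa> * \<rho> ^ N * \<mu> - M * \<rho>' ^ N"
      using box_sets by (simp add: measure_torus \<mu>_def)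
    finally show ?thesis by simp
  qed
  have "(\<lambda>N. M * (\<rho>' / \<rho>) ^ N) \<longlonglongrightarrow> M * 0"
    using rho by (intro tendsto_mult tendsto_const LIMSEQ_power_zero) auto
  then have "eventually (\<lambda>N. M * (\<rho>' / \<rho>) ^ N < \<kappa> * \<mu>) sequentially"
    by (rule order_tendstoD) (use kappa mu0 in simp)
  then obtain N where "M * (\<rho>' / \<rho>) ^ N < \<kappa> * \<mu>" by (auto simp: eventually_sequentially)
  then have "M * \<rho>' ^ N < \<kappa> * \<mu> * \<rho> ^ N" using rho by (simp add: power_divide field_simps)
  then show False using ineq[of N] by (simp add: mult_ac)
qed


section \<open>Fourier expansions on tubes\<close>

text \<open>A primitive changes by a constant under the period, and this constant is the integral.\<close>

lemma periodic_integral_shift: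
  fixes f :: "complex \<Rightarrow> complex"
  assumes S: "open S" "convex S" and shift: "\<And>w t. w \<in> S \<Longrightarrow> w + of_real t \<in> S"
    and f: "f holomorphic_on S" and per: "\<And>w. w \<in> S \<Longrightarrow> f (w + 1) = f w"
    and w: "w \<in> S" "w' \<in> S"
  shows "integral {0..1} (\<lambda>t. f (w + of_real t)) = integral {0..1} (\<lambda>t. f (w' + of_real t))"
proof -
  obtain g where g': "\<And>x. x \<in> S \<Longrightarrow> (g has_field_derivative f x) (at x within S)"
    using holomorphic_convex_primitive'[OF S(2,1) f] by blast
  have g: "(g has_field_derivative f x) (at x)" if "x \<in> S" for x
    using g'[OF that] at_within_open[OF that S(1)] by simp
  have int: "integral {0..1} (\<lambda>t. f (w + of_real t)) = g (w + 1) - g w" if "w \<in> S" for w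
  proof -
    have "((\<lambda>t. g (w + of_real t)) has_vector_derivative f (w + of_real t)) (at t within {0..1})" for t :: real
    proof -
      have "(g has_field_derivative f (w + of_real t)) (at (of_real t + w))"
        using g[OF shift[OF that, of t]] by (simp add: add.commute)
      from iffD1[OF DERIV_shift this]
      have "((\<lambda>z. g (w + z)) has_field_derivative f (w + of_real t)) (at (of_real t))"
        by (simp add: add.commute)
      then show ?thesis by (rule has_vector_derivative_real_field[THEN has_vector_derivative_at_within])
    qed
    then have "((\<lambda>t. f (w + of_real t)) has_integral g (w + of_real 1) - g (w + of_real 0)) {0..1}"
      by (intro fundamental_theorem_of_calculus) auto
    then show ?thesis by (simp add: integral_unique)
  qed
  have "((\<lambda>x. g (x + 1) - g x) has_field_derivative 0) (at x within S)" if "x \<in> S" for x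
  proof -
    have "(g has_field_derivative f (x + 1)) (at (x + 1))" using g[of "x + 1"] shift[OF that, of 1] by simp
    then have "((\<lambda>x. g (x + 1)) has_field_derivative f (x + 1)) (at x)" by (rule iffD1[OF DERIV_shift])
    then have "((\<lambda>x. g (x + 1) - g x) has_field_derivative f (x + 1) - f x) (at x)"
      using g[OF that] by (intro DERIV_diff)
    then show ?thesis using per[OF that] by (auto intro: has_field_derivative_at_within)
  qed
  then obtain c where "\<And>x. x \<in> S \<Longrightarrow> g (x + 1) - g x = c"
    using has_field_derivative_zero_constant[OF S(2), of "\<lambda>x. g (x + 1) - g x"] by auto
  then show ?thesis using int w by simp
qed

definition is_tube :: "(complex^'n::finite) set \<Rightarrow> bool" where
  "is_tube T \<longleftrightarrow> open T \<and> convex T \<and> (\<forall>z\<in>T. \<forall>x. z + rv x \<in> T)"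

text \<open>Continuous, periodic under the integer lattice and holomorphic in each variable.\<close>

definition tube_form :: "(complex^'n::finite) set \<Rightarrow> (complex^'n \<Rightarrow> complex) \<Rightarrow> bool" where
  "tube_form T G \<longleftrightarrow> continuous_on T G \<and> (\<forall>z\<in>T. \<forall>i. G (z + axis i 1) = G z) \<and>
     (\<forall>z\<in>T. \<forall>i. (\<lambda>w. G (z + axis i w)) field_differentiable (at 0))"

lemma axis_add: "axis i (a + b :: complex) = axis i a + axis i b"
  by (simp add: vec_eq_iff axis_def)

lemma continuous_on_axis: "continuous_on S (\<lambda>w::complex. z + axis i w)"
proof -
  have e: "z + axis i w = (\<chi> k. z $ k + (if k = i then w else 0))" for w
    by (simp add: vec_eq_iff axis_def)
  have "continuous_on S (\<lambda>w::complex. z $ k + (if k = i then w else 0))" for k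
    by (cases "k = i") (auto intro!: continuous_intros)
  then show ?thesis unfolding e by (intro continuous_on_vec_lambda)
qed

lemma continuous_on_rv: "continuous_on S rv"
  unfolding rv_def by (intro continuous_on_vec_lambda continuous_intros)

lemma continuous_on_ex: "continuous_on S (ex m)"
  unfolding ex_def by (intro continuous_intros)

lemma tube_form_periodic:
  fixes T :: "(complex^'n::finite) set"
  assumes T: "is_tube T" and G: "tube_form T G" and z: "z \<in> T"
  shows "G (z + rv (\<chi> k. of_int (m k))) = G z"
proof -
  have shift: "z + rv x \<in> T" if "z \<in> T" for z x using T that by (simp add: is_tube_def)
  have ax: "z + axis i (of_real t) \<in> T" if "z \<in> T" for z i t
    using shift[OF that, of "axis i t"] by (simp add: rv_axis)
  have one: "G (z + axis i 1) = G z" if "z \<in> T" for z i using G that by (simp add: tube_form_def)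
  have nat: "G (z + axis i (of_nat n)) = G z" if "z \<in> T" for z i n
  proof (induction n)
    case 0
    have "axis i 0 = (0 :: complex^'n)" by (simp add: vec_eq_iff axis_def)
    then show ?case by (simp only: of_nat_0 add_0_right)
  next
    case (Suc n)
    have e: "z + axis i (of_nat (Suc n)) = (z + axis i (of_real (of_nat n))) + axis i 1"
      by (simp add: axis_add add_ac)
    show ?case unfolding e using one[OF ax[OF that, of i "of_nat n"], of i] Suc by simp
  qed
  have int: "G (z + axis i (of_int l)) = G z" if z: "z \<in> T" for z i l
  proof (cases l rule: int_cases2)
    case (nonneg n)
    then show ?thesis using nat[OF z] by simp
  next
    case (nonpos n)
    have e: "z + axis i (of_int l) + axis i (of_nat n) = z"
      unfolding nonpos by (simp add: vec_eq_iff axis_def)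
    show ?thesis using nat[OF ax[OF z, of i "of_int l"], of i n] unfolding of_real_of_int_eq e by (rule sym)
  qed
  have "G (z + rv (\<Sum>k\<in>S. axis k (of_int (m k)))) = G z" if "finite S" for S
    using that
  proof (induction S rule: finite_induct)
    case empty
    have "rv 0 = (0 :: complex^'n)" by (simp add: rv_def vec_eq_iff)
    then show ?case by (simp only: sum.empty add_0_right)
  next
    case (insert i S)
    have e: "z + rv (\<Sum>k\<in>insert i S. axis k (of_int (m k))) = (z + rv (\<Sum>k\<in>S. axis k (of_int (m k)))) + axis i (of_int (m i))"
      using insert.hyps by (simp add: rv_add rv_axis add_ac)
    show ?case unfolding e int[OF shift[OF z]] by (rule insert.IH)
  qed
  from this[of UNIV] have "G (z + rv (\<Sum>k\<in>UNIV. axis k (of_int (m k)))) = G z" by simp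
  moreover have "(\<Sum>k\<in>UNIV. axis k (of_int (m k))) = ((\<chi> k. of_int (m k)) :: real^'n)"
    by (simp add: vec_eq_iff axis_def)
  ultimately show ?thesis by simp
qed

lemma tube_neighbourhood:
  fixes T :: "(complex^'n::finite) set"
  assumes T: "is_tube T" and z: "z \<in> T"
  shows "\<exists>\<delta>>0. \<forall>w. (\<forall>k. \<bar>Im (w $ k)\<bar> \<le> \<delta>) \<longrightarrow> z + w \<in> T"
proof -
  obtain e where e: "e > 0" "ball z e \<subseteq> T" using T z unfolding is_tube_def open_contains_ball by auto
  define n where "n = real CARD('n)"
  have n: "n \<ge> 1" unfolding n_def by (simp add: Suc_leI)
  have "z + w \<in> T" if w: "\<forall>k. \<bar>Im (w $ k)\<bar> \<le> e / (2 * n)" for w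
  proof -
    define u where "u = (\<chi> k. \<i> * of_real (Im (w $ k)))"
    have "norm u \<le> (\<Sum>k\<in>UNIV. norm (u $ k))" unfolding norm_vec_def by (rule L2_set_le_sum) simp
    also have "\<dots> \<le> (\<Sum>k\<in>(UNIV::'n set). e / (2 * n))" using w by (intro sum_mono) (simp add: u_def norm_mult)
    also have "\<dots> = n * (e / (2 * n))" by (simp add: n_def)
    also have "\<dots> < e" using e(1) n by simp
    finally have "z + u \<in> ball z e" by (simp add: dist_norm)
    then have "z + u \<in> T" using e(2) by (rule subsetD[rotated])
    then have "z + u + rv (\<chi> k. Re (w $ k)) \<in> T" using T by (simp add: is_tube_def)
    also have "z + u + rv (\<chi> k. Re (w $ k)) = z + w"
      by (simp add: vec_eq_iff u_def rv_def complex_eq_iff)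
    finally show ?thesis .
  qed
  then show ?thesis using e(1) n by (intro exI[of _ "e / (2 * n)"]) auto
qed

lemma tube_form_bounded:
  fixes T :: "(complex^'n::finite) set"
  assumes T: "is_tube T" and G: "tube_form T G" and z: "z \<in> T" and d: "\<delta> \<ge> 0"
    and box: "\<And>w. (\<forall>k. \<bar>Im (w $ k)\<bar> \<le> \<delta>) \<Longrightarrow> z + w \<in> T"
  shows "\<exists>B. \<forall>w. (\<forall>k. \<bar>Im (w $ k)\<bar> \<le> \<delta>) \<longrightarrow> norm (G (z + w)) \<le> B"
proof -
  define \<Phi> where "\<Phi> p = z + (\<chi> k. Complex (fst p $ k) (snd p $ k))" for p :: "(real^'n) \<times> (real^'n)"
  define K where "K = \<Phi> ` (cbox 0 1 \<times> cbox (\<chi> k. - \<delta>) (\<chi> k. \<delta>))"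
  have "continuous_on A \<Phi>" for A
    unfolding \<Phi>_def Complex_eq
    by (intro continuous_on_add continuous_on_const continuous_on_vec_lambda continuous_intros)
  then have "compact K" unfolding K_def by (intro compact_continuous_image compact_Times compact_cbox)
  moreover have KT: "K \<subseteq> T"
  proof
    fix u assume "u \<in> K"
    then obtain p where p: "u = \<Phi> p" "snd p \<in> cbox (\<chi> k. - \<delta>) (\<chi> k. \<delta>)" unfolding K_def by auto
    have "\<bar>Im ((\<chi> k. Complex (fst p $ k) (snd p $ k)) $ k)\<bar> \<le> \<delta>" for k
      using p(2) by (auto simp: mem_box_cart abs_le_iff dest!: spec[of _ k])
    then show "u \<in> T" unfolding p(1) \<Phi>_def by (intro box) simp
  qed
  ultimately have "compact (G ` K)" using G unfolding tube_form_def
    by (intro compact_continuous_image) (auto intro: continuous_on_subset)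
  then obtain B where B: "\<And>u. u \<in> K \<Longrightarrow> norm (G u) \<le> B"
    using compact_imp_bounded[of "G ` K"] unfolding bounded_iff by auto
  have "norm (G (z + w)) \<le> B" if w: "\<forall>k. \<bar>Im (w $ k)\<bar> \<le> \<delta>" for w
  proof -
    define w' where "w' = w - rv (\<chi> k. of_int \<lfloor>Re (w $ k)\<rfloor>)"
    have w'k: "w' $ k = Complex (Re (w $ k) - of_int \<lfloor>Re (w $ k)\<rfloor>) (Im (w $ k))" for k
      by (simp add: w'_def rv_def complex_eq_iff)
    have "z + w' \<in> K"
    proof -
      let ?p = "((\<chi> k. Re (w $ k) - of_int \<lfloor>Re (w $ k)\<rfloor>), (\<chi> k. Im (w $ k)))"
      have "z + w' = \<Phi> ?p" by (simp add: \<Phi>_def vec_eq_iff w'k)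
      moreover have "?p \<in> cbox 0 1 \<times> cbox (\<chi> k. - \<delta>) (\<chi> k. \<delta>)"
      proof -
        have "- \<delta> \<le> Im (w $ k) \<and> Im (w $ k) \<le> \<delta>" for k using w[rule_format, of k] by linarith
        moreover have "0 \<le> Re (w $ k) - of_int \<lfloor>Re (w $ k)\<rfloor> \<and> Re (w $ k) - of_int \<lfloor>Re (w $ k)\<rfloor> \<le> 1" for k
          using floor_correct[of "Re (w $ k)"] by linarith
        ultimately show ?thesis by (simp add: mem_box_cart one_vec_def zero_vec_def)
      qed
      ultimately show ?thesis unfolding K_def by blast
    qed
    then have "norm (G (z + w')) \<le> B" "z + w' \<in> T" using B KT by auto
    note z' = this
    have e: "z + w = (z + w') + rv (\<chi> k. of_int \<lfloor>Re (w $ k)\<rfloor>)" by (simp add: w'_def)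
    show ?thesis unfolding e using tube_form_periodic[OF T G z'(2), of "\<lambda>k. \<lfloor>Re (w $ k)\<rfloor>"] z'(1) by simp
  qed
  then show ?thesis by blast
qed

lemma bcont_tube_form:
  assumes T: "is_tube T" and G: "tube_form T G" and z: "z \<in> T"
  shows "bcont (\<lambda>x. G (z + rv x))"
proof -
  have shift: "z + rv x \<in> T" for x using T z by (simp add: is_tube_def)
  have "z + w \<in> T" if "\<forall>k. \<bar>Im (w $ k)\<bar> \<le> 0" for w
  proof -
    have "w = rv (\<chi> k. Re (w $ k))" using that by (simp add: vec_eq_iff rv_def complex_eq_iff)
    then show ?thesis using shift[of "\<chi> k. Re (w $ k)"] by simp
  qed
  note box = this
  obtain B where B: "\<forall>w. (\<forall>k. \<bar>Im (w $ k)\<bar> \<le> 0) \<longrightarrow> norm (G (z + w)) \<le> B"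
    using tube_form_bounded[OF T G z order_refl box] by (rule exE)
  have "norm (G (z + rv x)) \<le> B" for x using spec[OF B, of "rv x"] by (simp add: rv_def)
  moreover have "continuous_on UNIV (\<lambda>x. G (z + rv x))"
  proof (rule continuous_on_compose2[of T G])
    show "continuous_on T G" using G by (simp add: tube_form_def)
    show "continuous_on UNIV (\<lambda>x. z + rv x)" by (intro continuous_on_add continuous_on_const continuous_on_rv)
    show "range (\<lambda>x. z + rv x) \<subseteq> T" using shift by (rule image_subsetI)
  qed
  ultimately show ?thesis unfolding bcont_def by (intro conjI exI allI)
qed

text \<open>Moving one coordinate at a time within a small polydisc shows that the mean value is locally constant, and a tube is connected.\<close>

lemma tmean_tube_form_const:
  fixes T :: "(complex^'n::finite) set"
  assumes T: "is_tube T" and G: "tube_form T G" and z: "z \<in> T" "z' \<in> T"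
  shows "tmean (\<lambda>x. G (z + rv x)) = tmean (\<lambda>x. G (z' + rv x))"
proof -
  have opT: "open T" and cvT: "convex T" and shift: "\<And>z x. z \<in> T \<Longrightarrow> z + rv x \<in> T"
    using T by (auto simp: is_tube_def)
  have step: "tmean (\<lambda>x. G (z + rv x)) = tmean (\<lambda>x. G (z + axis i w + rv x))"
    if z: "z \<in> T" "z + axis i w \<in> T" for z i w
  proof (rule tmean_coordinate[OF bcont_tube_form[OF T G z(1)] bcont_tube_form[OF T G z(2)]])
    fix v :: "real^'n"
    define \<zeta> where "\<zeta> = z + rv v"
    define S where "S = {s. \<zeta> + axis i s \<in> T}"
    have "open ((\<lambda>s. \<zeta> + axis i s) -` T)" using opT continuous_on_axis by (rule open_vimage)
    then have "open S" by (simp add: S_def vimage_def)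
    moreover have "convex S" unfolding convex_alt
    proof (intro ballI allI impI)
      fix a b u assume ab: "a \<in> S" "b \<in> S" and u: "(0::real) \<le> u \<and> u \<le> 1"
      have "(1 - u) *\<^sub>R (\<zeta> + axis i a) + u *\<^sub>R (\<zeta> + axis i b) \<in> T"
        using cvT ab u unfolding convex_alt S_def by blast
      also have "(1 - u) *\<^sub>R (\<zeta> + axis i a) + u *\<^sub>R (\<zeta> + axis i b) = \<zeta> + axis i ((1 - u) *\<^sub>R a + u *\<^sub>R b)"
        by (simp add: vec_eq_iff axis_def algebra_simps)
      finally show "(1 - u) *\<^sub>R a + u *\<^sub>R b \<in> S" by (simp add: S_def)
    qed
    moreover have "s + of_real t \<in> S" if "s \<in> S" for s t
      using shift[of "\<zeta> + axis i s" "axis i t"] that by (simp add: S_def rv_axis axis_add add_ac)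
    moreover have "(\<lambda>s. G (\<zeta> + axis i s)) holomorphic_on S"
      unfolding holomorphic_on_def
    proof
      fix s assume s: "s \<in> S"
      have "(\<lambda>w. G (\<zeta> + axis i s + axis i w)) field_differentiable (at 0)"
        using G s unfolding tube_form_def S_def by blast
      then obtain D where "((\<lambda>w. G (\<zeta> + axis i (s + w))) has_field_derivative D) (at 0)"
        unfolding field_differentiable_def by (auto simp: axis_add add_ac)
      then have "((\<lambda>w. G (\<zeta> + axis i w)) has_field_derivative D) (at s)"
        using DERIV_shift[of "\<lambda>w. G (\<zeta> + axis i w)" D 0 s] by (simp add: add.commute)
      then show "(\<lambda>s. G (\<zeta> + axis i s)) field_differentiable at s within S"
        unfolding field_differentiable_def using has_field_derivative_at_within by blast
    qed
    moreover have "G (\<zeta> + axis i (s + 1)) = G (\<zeta> + axis i s)" if "s \<in> S" for s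
      using G that unfolding tube_form_def S_def by (simp add: axis_add add.assoc[symmetric])
    moreover have "0 \<in> S"
    proof -
      have e: "\<zeta> + axis i 0 = \<zeta>" by (simp add: vec_eq_iff axis_def)
      show ?thesis unfolding S_def mem_Collect_eq e unfolding \<zeta>_def by (rule shift[OF z(1)])
    qed
    moreover have "w \<in> S" using shift[OF z(2), of v] by (simp add: S_def \<zeta>_def add_ac)
    ultimately have "integral {0..1} (\<lambda>t. G (\<zeta> + axis i (0 + of_real t))) = integral {0..1} (\<lambda>t. G (\<zeta> + axis i (w + of_real t)))"
      by (rule periodic_integral_shift)
    then show "integral {0..1} (\<lambda>t. G (z + rv (v + axis i t))) = integral {0..1} (\<lambda>t. G (z + axis i w + rv (v + axis i t)))"
      by (simp add: \<zeta>_def rv_add rv_axis axis_add add_ac)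
  qed
  have local: "tmean (\<lambda>x. G (z + rv x)) = tmean (\<lambda>x. G (z + w + rv x))"
    if z: "z \<in> T" and d: "\<And>w. (\<forall>k. \<bar>Im (w $ k)\<bar> \<le> \<delta>) \<Longrightarrow> z + w \<in> T" "\<delta> > 0"
      and w: "\<forall>k. \<bar>Im (w $ k)\<bar> \<le> \<delta>" for z w \<delta>
  proof -
    have "tmean (\<lambda>x. G (z + rv x)) = tmean (\<lambda>x. G (z + (\<Sum>k\<in>S. axis k (w $ k)) + rv x))" if "finite S" for S
      using that
    proof (induction S rule: finite_induct)
      case (insert i S)
      have inT: "z + (\<Sum>k\<in>A. axis k (w $ k)) \<in> T" if "finite A" for A
      proof (rule d(1), intro allI)
        fix l
        have "(\<Sum>k\<in>A. axis k (w $ k)) $ l = (if l \<in> A then w $ l else 0)"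
          using that by (simp add: axis_def sum.delta)
        then show "\<bar>Im ((\<Sum>k\<in>A. axis k (w $ k)) $ l)\<bar> \<le> \<delta>" using w d(2) by simp
      qed
      have eq: "z + (\<Sum>k\<in>S. axis k (w $ k)) + axis i (w $ i) = z + (\<Sum>k\<in>insert i S. axis k (w $ k))"
        using insert.hyps by (simp add: add_ac)
      have "z + (\<Sum>k\<in>S. axis k (w $ k)) + axis i (w $ i) \<in> T" unfolding eq using insert.hyps by (intro inT) simp
      from step[OF inT[OF insert.hyps(1)] this] show ?case unfolding insert.IH eq .
    qed simp
    moreover have e: "(\<Sum>k\<in>UNIV. axis k (w $ k)) = w" by (simp add: vec_eq_iff axis_def)
    ultimately show ?thesis using finite[of UNIV] e by metis
  qed
  have "(\<lambda>z. tmean (\<lambda>x. G (z + rv x))) z = (\<lambda>z. tmean (\<lambda>x. G (z + rv x))) z'"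
  proof (rule connected_local_const[OF convex_connected[OF cvT] z])
    show "\<forall>a\<in>T. \<forall>\<^sub>F b in at a within T. tmean (\<lambda>x. G (a + rv x)) = tmean (\<lambda>x. G (b + rv x))"
    proof
      fix a assume a: "a \<in> T"
      obtain \<delta> where d: "\<delta> > 0" "\<And>w. (\<forall>k. \<bar>Im (w $ k)\<bar> \<le> \<delta>) \<Longrightarrow> a + w \<in> T"
        using tube_neighbourhood[OF T a] by auto
      have "tmean (\<lambda>x. G (a + rv x)) = tmean (\<lambda>x. G (b + rv x))" if "dist b a < \<delta>" for b
      proof -
        have "\<bar>Im ((b - a) $ k)\<bar> \<le> \<delta>" for k
        proof -
          have "\<bar>Im ((b - a) $ k)\<bar> \<le> norm ((b - a) $ k)" by (rule abs_Im_le_cmod)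
          also have "\<dots> \<le> norm (b - a)" by (rule Finite_Cartesian_Product.norm_nth_le)
          finally show ?thesis using that by (simp add: dist_norm)
        qed
        then show ?thesis using local[OF a d(2) d(1), of "b - a"] by simp
      qed
      then show "\<forall>\<^sub>F b in at a within T. tmean (\<lambda>x. G (a + rv x)) = tmean (\<lambda>x. G (b + rv x))"
        unfolding eventually_at using d(1) by blast
    qed
  qed
  then show ?thesis by simp
qed

lemma summable_geometric_lattice:
  fixes q :: real
  assumes q: "0 < q" "q < 1"
  shows "(\<lambda>m::'n::finite \<Rightarrow> int. \<Prod>k\<in>UNIV. q ^ nat \<bar>m k\<bar>) summable_on UNIV"
    and "infsum (\<lambda>m::'n \<Rightarrow> int. \<Prod>k\<in>UNIV. q ^ nat \<bar>m k\<bar>) UNIV \<le> (2 / (1 - q)) ^ CARD('n)"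
proof -
  let ?f = "\<lambda>l::int. q ^ nat \<bar>l\<bar>"
  have geo: "((\<lambda>n. q ^ n) has_sum (1 / (1 - q))) UNIV"
    using q by (intro norm_summable_imp_has_sum geometric_sums) (auto simp: summable_geometric)
  have h1: "(?f has_sum (1 / (1 - q))) (range int)"
    using geo by (subst has_sum_reindex) (auto simp: o_def)
  have inj: "inj (\<lambda>n. - int n - 1)" by (auto simp: inj_def)
  have "((\<lambda>n. q * q ^ n) has_sum (q * (1 / (1 - q)))) UNIV" using geo by (rule has_sum_cmult_right)
  moreover have "nat \<bar>- int n - 1\<bar> = Suc n" for n by simp
  ultimately have h2: "(?f has_sum (q * (1 / (1 - q)))) (range (\<lambda>n. - int n - 1))"
    by (subst has_sum_reindex[OF inj]) (simp add: o_def)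
  have U: "(UNIV :: int set) = range int \<union> range (\<lambda>n. - int n - 1)"
  proof -
    have "l \<in> range int \<union> range (\<lambda>n. - int n - 1)" for l :: int
    proof (cases "l \<ge> 0")
      case True
      then show ?thesis by (intro UnI1 image_eqI[of _ _ "nat l"]) auto
    next
      case False
      then show ?thesis by (intro UnI2 image_eqI[of _ _ "nat (- l - 1)"]) auto
    qed
    then show ?thesis by blast
  qed
  have h: "(?f has_sum (1 / (1 - q) + q * (1 / (1 - q)))) UNIV"
    unfolding U by (intro has_sum_Un_disjoint h1 h2) auto
  then have summ: "?f summable_on UNIV" by (rule has_sum_imp_summable)
  have inf: "infsum ?f UNIV \<le> 2 / (1 - q)"
  proof -
    have "infsum ?f UNIV = (1 + q) / (1 - q)" using infsumI[OF h] by (simp add: add_divide_distrib)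
    then show ?thesis using q by (simp add: divide_right_mono)
  qed
  have abs: "(\<lambda>l. norm (?f l)) summable_on UNIV" using summ q by simp
  have P: "(UNIV :: ('n \<Rightarrow> int) set) = (\<Pi>\<^sub>E k\<in>UNIV. UNIV)" by (auto simp: PiE_def)
  have "Infinite_Set_Sum.abs_summable_on (\<lambda>m::'n \<Rightarrow> int. \<Prod>k\<in>UNIV. ?f (m k)) (\<Pi>\<^sub>E k\<in>UNIV. UNIV)"
    using summ q by (intro abs_summable_on_prod_PiE) (auto simp: abs_summable_equivalent[symmetric])
  then show s: "(\<lambda>m::'n \<Rightarrow> int. \<Prod>k\<in>UNIV. ?f (m k)) summable_on UNIV"
    unfolding P abs_summable_equivalent[symmetric] by (rule abs_summable_summable)
  have "infsum (\<lambda>m::'n \<Rightarrow> int. \<Prod>k\<in>UNIV. ?f (m k)) UNIV = (\<Prod>k\<in>(UNIV::'n set). infsum ?f UNIV)"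
    unfolding P by (rule infsum_prod_PiE_abs) (use abs in auto)
  also have "\<dots> \<le> (2 / (1 - q)) ^ CARD('n)"
    using inf q by (auto intro!: power_mono infsum_nonneg)
  finally show "infsum (\<lambda>m::'n \<Rightarrow> int. \<Prod>k\<in>UNIV. ?f (m k)) UNIV \<le> (2 / (1 - q)) ^ CARD('n)" .
qed

text \<open>Evaluating the coefficient integral at a point whose imaginary part is moved against the frequency makes the coefficients decay geometrically; uniqueness identifies the sum of the series.\<close>

theorem tube_fourier_expansion:
  fixes T :: "(complex^'n::finite) set"
  assumes T: "is_tube T" and G: "tube_form T G"
  shows "\<exists>a. (\<forall>z\<in>T. ((\<lambda>m. a m * ex m z) has_sum G z) UNIV) \<and>
     (\<forall>z\<in>T. \<forall>m B. (\<forall>x. norm (G (z + rv x)) \<le> B) \<longrightarrow> norm (a m * ex m z) \<le> B)"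
proof (cases "T = {}")
  case False
  then obtain z0 where z0: "z0 \<in> T" by blast
  have opT: "open T" and cvT: "convex T" and shift: "\<And>z x. z \<in> T \<Longrightarrow> z + rv x \<in> T"
    using T by (auto simp: is_tube_def)
  define P where "P m z = G z * ex (\<lambda>k. - m k) z" for m z
  have P: "tube_form T (P m)" for m
    unfolding tube_form_def
  proof (intro conjI ballI allI)
    show "continuous_on T (P m)" unfolding P_def
      using G by (intro continuous_on_mult continuous_on_ex) (auto simp: tube_form_def)
    fix z i assume z: "z \<in> T"
    have "ex (\<lambda>k. - m k) (axis i 1) = 1"
      using exp_integer_2pi[of "- of_int (m i)"] by (simp add: ex_axis mult_ac)
    then show "P m (z + axis i 1) = P m z" using G z by (simp add: P_def ex_add tube_form_def)
    have "(\<lambda>w. G (z + axis i w)) field_differentiable (at 0)" using G z by (simp add: tube_form_def)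
    moreover have "(\<lambda>w. ex (\<lambda>k. - m k) (z + axis i w)) field_differentiable (at 0)"
    proof -
      have "((\<lambda>w. ex (\<lambda>k. - m k) z * exp (2 * of_real pi * \<i> * (of_int (- m i) * w))) has_field_derivative
          ex (\<lambda>k. - m k) z * (exp (2 * of_real pi * \<i> * (of_int (- m i) * 0)) * (2 * of_real pi * \<i> * of_int (- m i)))) (at 0)"
        by (auto intro!: derivative_eq_intros)
      then show ?thesis unfolding ex_add ex_axis field_differentiable_def by blast
    qed
    ultimately show "(\<lambda>w. P m (z + axis i w)) field_differentiable (at 0)"
      unfolding P_def by (rule field_differentiable_mult)
  qed
  define a where "a m = tmean (\<lambda>x. P m (z0 + rv x))" for m
  have a_eq: "a m * ex m z = tmean (\<lambda>x. G (z + rv x) * ex (\<lambda>k. - m k) (rv x))" if z: "z \<in> T" for m z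
  proof -
    have "a m = tmean (\<lambda>x. P m (z + rv x))" unfolding a_def by (rule tmean_tube_form_const[OF T P z0 z])
    also have "\<dots> = tmean (\<lambda>x. ex (\<lambda>k. - m k) z * (G (z + rv x) * ex (\<lambda>k. - m k) (rv x)))"
      by (simp add: P_def ex_add mult_ac)
    finally have "a m * ex m z = (ex (\<lambda>k. - m k) z * ex m z) * tmean (\<lambda>x. G (z + rv x) * ex (\<lambda>k. - m k) (rv x))"
      by (simp add: tmean_cmult)
    then show ?thesis by (simp add: ex_minus)
  qed
  have bc: "bcont (\<lambda>x. G (z + rv x))" if "z \<in> T" for z by (rule bcont_tube_form[OF T G that])
  have bound: "norm (a m * ex m z) \<le> B" if z: "z \<in> T" and B: "\<forall>x. norm (G (z + rv x)) \<le> B" for z m B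
    unfolding a_eq[OF z] using B by (intro tmean_bound bcont_mult bc z bcont_ex) (simp add: norm_mult)
  have decay: "\<exists>B q. 0 < q \<and> q < 1 \<and> (\<forall>m. norm (a m * ex m z) \<le> B * (\<Prod>k\<in>UNIV. q ^ nat \<bar>m k\<bar>))" if z: "z \<in> T" for z
  proof -
    obtain \<delta> where d: "\<delta> > 0" "\<And>w. (\<forall>k. \<bar>Im (w $ k)\<bar> \<le> \<delta>) \<Longrightarrow> z + w \<in> T"
      using tube_neighbourhood[OF T z] by auto
    obtain B where B: "\<And>w. (\<forall>k. \<bar>Im (w $ k)\<bar> \<le> \<delta>) \<Longrightarrow> norm (G (z + w)) \<le> B"
      using tube_form_bounded[OF T G z less_imp_le[OF d(1)] d(2)] by auto
    define q where "q = exp (- 2 * pi * \<delta>)"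
    have "norm (a m * ex m z) \<le> B * (\<Prod>k\<in>UNIV. q ^ nat \<bar>m k\<bar>)" for m
    proof -
      define w where "w = (\<chi> k. Complex 0 (- \<delta> * of_int (sgn (m k))))"
      have wk: "\<bar>Im (w $ k)\<bar> \<le> \<delta>" for k using d(1) by (simp add: w_def abs_mult sgn_if)
      have "norm (G (z + w + rv x)) \<le> B" for x
      proof -
        have "norm (G (z + (w + rv x))) \<le> B" by (rule B) (use wk in \<open>simp add: rv_def\<close>)
        then show ?thesis by (simp add: add.assoc)
      qed
      then have le: "norm (a m * ex m (z + w)) \<le> B" using d(2) wk by (intro bound) auto
      have "(\<Sum>k\<in>UNIV. real_of_int (m k) * Im (w $ k)) = - \<delta> * (\<Sum>k\<in>UNIV. real_of_int \<bar>m k\<bar>)"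
      proof -
        have "real_of_int (m k) * Im (w $ k) = - \<delta> * real_of_int \<bar>m k\<bar>" for k
          by (simp add: w_def sgn_if abs_if)
        then show ?thesis by (simp only: sum_distrib_left)
      qed
      then have nw: "norm (ex m w) = exp (2 * pi * \<delta> * (\<Sum>k\<in>UNIV. real_of_int \<bar>m k\<bar>))" by (simp add: norm_ex)
      have qp: "(\<Prod>k\<in>UNIV. q ^ nat \<bar>m k\<bar>) = exp (- (2 * pi * \<delta> * (\<Sum>k\<in>UNIV. real_of_int \<bar>m k\<bar>)))"
      proof -
        have "q ^ nat \<bar>m k\<bar> = exp (- (2 * pi * \<delta> * real_of_int \<bar>m k\<bar>))" for k
          unfolding q_def exp_of_nat_mult[symmetric] by (simp add: mult_ac)
        then have "(\<Prod>k\<in>UNIV. q ^ nat \<bar>m k\<bar>) = exp (\<Sum>k\<in>UNIV. - (2 * pi * \<delta> * real_of_int \<bar>m k\<bar>))"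
          by (simp only: exp_sum[OF finite])
        then show ?thesis by (simp add: sum_negf sum_distrib_left)
      qed
      have "norm (ex m w) * (\<Prod>k\<in>UNIV. q ^ nat \<bar>m k\<bar>) = 1" unfolding nw qp by (simp flip: exp_add)
      then have "norm (a m * ex m z) = norm (a m * ex m (z + w)) * (\<Prod>k\<in>UNIV. q ^ nat \<bar>m k\<bar>)"
        by (simp add: ex_add norm_mult mult.assoc)
      also have "\<dots> \<le> B * (\<Prod>k\<in>UNIV. q ^ nat \<bar>m k\<bar>)"
        using le by (intro mult_right_mono prod_nonneg) (auto simp: q_def)
      finally show ?thesis .
    qed
    moreover have "0 < q" "q < 1" unfolding q_def using d(1) by auto
    ultimately show ?thesis by blast
  qed
  have sum: "((\<lambda>m. a m * ex m z) has_sum G z) UNIV" if z: "z \<in> T" for z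
  proof -
    define c where "c = rv ((\<chi> k. 1 / 2) :: real^'n)"
    define z' where "z' = z + rv (- (\<chi> k. 1 / 2))"
    have z': "z' \<in> T" unfolding z'_def using z by (rule shift)
    have zc: "z' + c = z" unfolding z'_def c_def by (simp add: vec_eq_iff rv_def)
    obtain B q where Bq: "0 < q" "q < 1" "\<And>m. norm (a m * ex m z') \<le> B * (\<Prod>k\<in>UNIV. q ^ nat \<bar>m k\<bar>)"
      using decay[OF z'] by blast
    have Ms: "(\<lambda>m::'n \<Rightarrow> int. B * (\<Prod>k\<in>UNIV. q ^ nat \<bar>m k\<bar>)) summable_on UNIV"
      by (intro summable_on_cmult_right summable_geometric_lattice(1) Bq)
    define b where "b m = a m * ex m z'" for m
    have le: "norm (b m * ex m (rv x)) \<le> B * (\<Prod>k\<in>UNIV. q ^ nat \<bar>m k\<bar>)" for m x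
      using Bq(3)[of m] by (simp add: b_def norm_mult)
    define S where "S x = (\<Sum>\<^sub>\<infinity>m. b m * ex m (rv x))" for x
    have summ: "(\<lambda>m. b m * ex m (rv x)) summable_on UNIV" for x
      by (rule abs_summable_summable, rule summable_on_comparison_test[OF Ms]) (use le in auto)
    then have S: "((\<lambda>m. b m * ex m (rv x)) has_sum S x) UNIV" for x
      unfolding S_def by (rule has_sum_infsum)
    have "uniform_limit UNIV (\<lambda>X x. \<Sum>m\<in>X. b m * ex m (rv x)) S (finite_subsets_at_top UNIV)"
      unfolding S_def by (rule Weierstrass_m_test_general[OF le Ms])
    then have contS: "continuous_on UNIV S"
      by (rule uniform_limit_theorem[rotated])
        (auto intro!: always_eventually continuous_on_sum continuous_on_mult continuous_on_const continuous_on_ex_rv)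
    have S_le: "norm (S x) \<le> infsum (\<lambda>m::'n \<Rightarrow> int. B * (\<Prod>k\<in>UNIV. q ^ nat \<bar>m k\<bar>)) UNIV" for x
      by (rule norm_infsum_le[OF S has_sum_infsum[OF Ms]]) (rule le)
    have bS: "bcont S" unfolding bcont_def by (intro conjI contS exI allI) (rule S_le)
    define D where "D x = G (z' + rv x) - S x" for x
    have "D (\<chi> k. 1 / 2) = 0"
    proof (rule vanishing_coefficients_imp_zero)
      show "bcont D" unfolding D_def by (intro bcont_diff bc z' bS)
      fix m :: "'n \<Rightarrow> int"
      define m' where "m' = (\<lambda>k. - m k)"
      have mm: "m = (\<lambda>k. - m' k)" by (simp add: m'_def fun_eq_iff)
      have "tmean (\<lambda>x. D x * ex m (rv x)) = tmean (\<lambda>x. G (z' + rv x) * ex m (rv x)) - tmean (\<lambda>x. S x * ex m (rv x))"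
        unfolding D_def left_diff_distrib by (intro tmean_diff bcont_mult bc z' bS bcont_ex)
      also have "tmean (\<lambda>x. G (z' + rv x) * ex m (rv x)) = b m'"
        unfolding b_def a_eq[OF z'] mm ..
      also have "tmean (\<lambda>x. S x * ex m (rv x)) = b m'"
        unfolding mm by (rule torus_coefficient[OF S bS, of m']) auto
      finally show "tmean (\<lambda>x. D x * ex m (rv x)) = 0" by simp
    qed
    then have "S (\<chi> k. 1 / 2) = G z" by (simp add: D_def zc[unfolded c_def])
    moreover have "b m * ex m (rv (\<chi> k. 1 / 2)) = a m * ex m z" for m
      unfolding b_def zc[symmetric] ex_add c_def by (simp add: mult.assoc)
    ultimately show ?thesis using S[of "\<chi> k. 1 / 2"] by simp
  qed
  show ?thesis using sum bound by (intro exI[of _ a]) auto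
qed auto

section \<open>Fourier expansions over fractional ideals\<close>

text \<open>Holomorphy in the weak form in which it passes to Fourier expansions: continuous, and holomorphic along complex lines.\<close>

definition line_holomorphic :: "(complex^'n::finite \<Rightarrow> complex) \<Rightarrow> bool" where
  "line_holomorphic F \<longleftrightarrow> continuous_on upper_half_space F \<and>
     (\<forall>\<tau>\<in>upper_half_space. \<forall>v. (\<lambda>w. F (\<tau> + w *s v)) field_differentiable (at 0))"

lemma upper_half_space_rv [simp]: "\<tau> + rv x \<in> upper_half_space \<longleftrightarrow> \<tau> \<in> upper_half_space"
  by (simp add: upper_half_space_def rv_def)

lemma smult_vec_nth: "(w *s v) $ j = w * v $ j" for v :: "complex^'n"
  by simp

context totally_real_field
begin

definition chr :: "'a \<Rightarrow> complex^'n \<Rightarrow> complex" where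
  "chr \<xi> \<tau> = exp (2 * of_real pi * \<i> * (\<Sum>j\<in>UNIV. of_real (emb j \<xi>) * \<tau> $ j))"

definition tpos_in :: "'a set \<Rightarrow> 'a set" where
  "tpos_in L = {\<xi> \<in> L. totally_positive emb \<xi>}"

lemma has_fourier_expansion_chr:
  "has_fourier_expansion emb L F a \<longleftrightarrow>
     (\<forall>\<tau>\<in>upper_half_space. ((\<lambda>\<xi>. a \<xi> * chr \<xi> \<tau>) has_sum (F \<tau> - a 0)) (tpos_in L))"
  by (simp add: has_fourier_expansion_def chr_def tpos_in_def)

lemma norm_chr: "norm (chr \<xi> \<tau>) = exp (- 2 * pi * (\<Sum>j\<in>UNIV. emb j \<xi> * Im (\<tau> $ j)))"
proof -
  have "Re (2 * of_real pi * \<i> * (\<Sum>j\<in>UNIV. of_real (emb j \<xi>) * \<tau> $ j)) =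
      - 2 * pi * (\<Sum>j\<in>UNIV. emb j \<xi> * Im (\<tau> $ j))"
    by simp
  then show ?thesis unfolding chr_def norm_exp_eq_Re by (rule arg_cong)
qed

lemma chr_zero [simp]: "chr 0 \<tau> = 1" by (simp add: chr_def)

definition frame :: "('n \<Rightarrow> 'a) \<Rightarrow> complex^'n \<Rightarrow> complex^'n" where
  "frame \<gamma> z = (\<chi> j. \<Sum>i\<in>UNIV. of_real (emb j (\<gamma> i)) * z $ i)"

lemma frame_add: "frame \<gamma> (z + w) = frame \<gamma> z + frame \<gamma> w"
  by (simp add: frame_def vec_eq_iff distrib_left sum.distrib)

lemma frame_scaleR: "frame \<gamma> (t *\<^sub>R z) = t *\<^sub>R frame \<gamma> z"
  by (simp add: frame_def vec_eq_iff scaleR_sum_right)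

lemma frame_axis: "frame \<gamma> (axis i w) = w *s rv (emb_vec (\<gamma> i))"
proof -
  have "(\<Sum>l\<in>UNIV. of_real (emb j (\<gamma> l)) * (if l = i then w else 0)) = of_real (emb j (\<gamma> i)) * w" for j
    by (subst sum.remove[of _ i]) auto
  then show ?thesis by (simp add: frame_def vec_eq_iff axis_def rv_def mult.commute)
qed

lemma frame_rv: "frame \<gamma> (rv x) = rv (\<chi> j. \<Sum>i\<in>UNIV. emb j (\<gamma> i) * x $ i)"
  by (simp add: frame_def vec_eq_iff rv_def)

lemma frame_surj:
  assumes "rat_basis \<gamma>"
  obtains z where "frame \<gamma> z = \<tau>"
proof -
  obtain s :: "'n \<Rightarrow> real" where s: "\<forall>j. Re (\<tau> $ j) = (\<Sum>i\<in>UNIV. s i * emb j (\<gamma> i))"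
    using rat_basis_real_expansion[OF assms, of "\<lambda>j. Re (\<tau> $ j)"] by (rule exE)
  obtain t :: "'n \<Rightarrow> real" where t: "\<forall>j. Im (\<tau> $ j) = (\<Sum>i\<in>UNIV. t i * emb j (\<gamma> i))"
    using rat_basis_real_expansion[OF assms, of "\<lambda>j. Im (\<tau> $ j)"] by (rule exE)
  have "frame \<gamma> (\<chi> i. Complex (s i) (t i)) = \<tau>"
    using s t by (simp add: frame_def vec_eq_iff complex_eq_iff mult.commute)
  then show thesis by (rule that)
qed

lemma frame_rv_surj:
  assumes "rat_basis \<gamma>"
  obtains y where "frame \<gamma> (rv y) = rv x"
proof -
  obtain s :: "'n \<Rightarrow> real" where s: "\<forall>j. x $ j = (\<Sum>i\<in>UNIV. s i * emb j (\<gamma> i))"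
    using rat_basis_real_expansion[OF assms, of "\<lambda>j. x $ j"] by (rule exE)
  have "frame \<gamma> (rv (\<chi> i. s i)) = rv x"
    unfolding frame_rv using s by (simp add: vec_eq_iff mult.commute rv_def)
  then show thesis by (rule that)
qed

lemma continuous_on_frame: "continuous_on S (frame \<gamma>)"
  unfolding frame_def by (intro continuous_on_vec_lambda continuous_intros)

lemma is_tube_frame: "is_tube {z. frame \<gamma> z \<in> upper_half_space}" (is "is_tube ?T")
  unfolding is_tube_def
proof (intro conjI ballI allI)
  have T: "?T = (\<Inter>j\<in>UNIV. {z. 0 < Im (frame \<gamma> z $ j)})" by (auto simp: upper_half_space_def)
  have "open {z. 0 < Im (frame \<gamma> z $ j)}" for j
  proof (rule open_Collect_less)
    show "continuous_on UNIV (\<lambda>z. Im (frame \<gamma> z $ j))"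
      by (intro continuous_intros continuous_on_component continuous_on_frame)
  qed auto
  then show "open ?T" unfolding T by (intro open_INT) auto
  show "convex ?T"
  proof (rule convexI)
    fix x y :: "complex^'n" and u v :: real
    assume x: "x \<in> ?T" and y: "y \<in> ?T" and uv: "0 \<le> u" "0 \<le> v" "u + v = 1"
    have "0 < u * Im (frame \<gamma> x $ j) + v * Im (frame \<gamma> y $ j)" for j
    proof -
      have p: "0 < Im (frame \<gamma> x $ j)" "0 < Im (frame \<gamma> y $ j)" using x y by (auto simp: upper_half_space_def)
      show ?thesis
      proof (cases "u = 0")
        case True
        then show ?thesis using uv p by simp
      next
        case False
        then have "0 < u * Im (frame \<gamma> x $ j)" "0 \<le> v * Im (frame \<gamma> y $ j)" using uv p by auto
        then show ?thesis by linarith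
      qed
    qed
    then show "u *\<^sub>R x + v *\<^sub>R y \<in> ?T" by (simp add: upper_half_space_def frame_add frame_scaleR)
  qed
  fix z x assume "z \<in> ?T"
  then show "z + rv x \<in> ?T" by (simp add: frame_add frame_rv)
qed

lemma tube_form_frame:
  assumes hol: "line_holomorphic F"
    and per: "\<And>\<tau> i. \<tau> \<in> upper_half_space \<Longrightarrow> F (\<tau> + rv (emb_vec (\<gamma> i))) = F \<tau>"
  shows "tube_form {z. frame \<gamma> z \<in> upper_half_space} (\<lambda>z. F (frame \<gamma> z))"
  unfolding tube_form_def
proof (intro conjI ballI allI)
  show "continuous_on {z. frame \<gamma> z \<in> upper_half_space} (\<lambda>z. F (frame \<gamma> z))"
  proof (rule continuous_on_compose2[of upper_half_space F])
    show "continuous_on upper_half_space F" using hol by (simp add: line_holomorphic_def)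
    show "frame \<gamma> ` {z. frame \<gamma> z \<in> upper_half_space} \<subseteq> upper_half_space" by (rule image_subsetI) simp
  qed (rule continuous_on_frame)
  fix z i assume z: "z \<in> {z. frame \<gamma> z \<in> upper_half_space}"
  have "1 *s rv (emb_vec (\<gamma> i)) = rv (emb_vec (\<gamma> i))" by (simp add: vec_eq_iff)
  then show "F (frame \<gamma> (z + axis i 1)) = F (frame \<gamma> z)"
    unfolding frame_add frame_axis using per[of "frame \<gamma> z" i] z by simp
  show "(\<lambda>w. F (frame \<gamma> (z + axis i w))) field_differentiable at 0"
    unfolding frame_add frame_axis using hol z unfolding line_holomorphic_def by blast
qed

lemma chr_frame:
  assumes "\<And>i. tr (\<xi> * \<gamma> i) = of_int (m i)"
  shows "chr \<xi> (frame \<gamma> z) = ex m z"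
proof -
  have "(\<Sum>j\<in>UNIV. of_real (emb j \<xi>) * frame \<gamma> z $ j) = (\<Sum>j\<in>UNIV. \<Sum>i\<in>UNIV. of_real (emb j (\<xi> * \<gamma> i)) * z $ i)"
    by (simp add: frame_def sum_distrib_left mult.assoc)
  also have "\<dots> = (\<Sum>i\<in>UNIV. \<Sum>j\<in>UNIV. of_real (emb j (\<xi> * \<gamma> i)) * z $ i)" by (rule sum.swap)
  also have "\<dots> = (\<Sum>i\<in>UNIV. of_int (m i) * z $ i)"
  proof (rule sum.cong[OF refl])
    fix i
    have "(\<Sum>j\<in>UNIV. complex_of_real (emb j (\<xi> * \<gamma> i))) = of_real (tr (\<xi> * \<gamma> i))"
      unfolding tr_def by (rule of_real_sum[symmetric])
    also have "\<dots> = of_int (m i)" by (simp add: assms)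
    finally have "(\<Sum>j\<in>UNIV. complex_of_real (emb j (\<xi> * \<gamma> i))) = of_int (m i)" .
    then show "(\<Sum>j\<in>UNIV. of_real (emb j (\<xi> * \<gamma> i)) * z $ i) = of_int (m i) * z $ i"
      by (simp only: sum_distrib_right[symmetric])
  qed
  finally show ?thesis by (simp add: chr_def ex_def)
qed

lemma chr_add: "chr \<xi> (\<tau> + \<tau>') = chr \<xi> \<tau> * chr \<xi> \<tau>'"
  by (simp add: chr_def distrib_left sum.distrib exp_add)

lemma chr_emb_vec: "chr \<xi> (rv (emb_vec b)) = exp (2 * of_real pi * \<i> * of_real (tr (\<xi> * b)))"
  by (simp add: chr_def rv_def tr_def)

lemma fractional_ideal_rat_basis:
  assumes "fractional_ideal (P :: 'a set)"
  shows "\<exists>\<gamma>. rat_basis \<gamma> \<and> (\<forall>i. \<gamma> i \<in> P)"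
proof -
  obtain \<beta> where be: "rat_basis \<beta>" "\<And>i. algebraic_int (\<beta> i)" using integral_basis_exists by blast
  obtain y where y: "y \<in> P" "y \<noteq> 0" using fractional_idealD(5)[OF assms] by blast
  have "rat_basis (\<lambda>i. y * (of_rat 1 * \<beta> i))" by (rule rat_basis_scale[OF be(1)]) (use y in auto)
  then have b: "rat_basis (\<lambda>i. y * \<beta> i)" by simp
  show ?thesis by (intro exI[of _ "\<lambda>i. y * \<beta> i"] conjI allI b) (rule fractional_idealD(4)[OF assms be(2) y(1)])
qed

text \<open>An adapted basis of the lattice turns the function into a periodic function on a tube. Further periods restrict the frequencies to the trace dual, and the smallness hypothesis removes those that are not totally positive.\<close>

theorem fourier_expansion:
  assumes P: "fractional_ideal (P :: 'a set)" and hol: "line_holomorphic F"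
    and per: "\<And>\<tau> b. \<tau> \<in> upper_half_space \<Longrightarrow> b \<in> P \<Longrightarrow> F (\<tau> + rv (emb_vec b)) = F \<tau>"
    and small: "\<And>\<xi> e. \<xi> \<noteq> 0 \<Longrightarrow> \<not> totally_positive emb \<xi> \<Longrightarrow> e > 0 \<Longrightarrow>
      \<exists>\<tau>\<in>upper_half_space. \<exists>B. (\<forall>x. norm (F (\<tau> + rv x)) \<le> B) \<and> B < e * norm (chr \<xi> \<tau>)"
  shows "\<exists>a. has_fourier_expansion emb (trace_dual P) F a"
proof -
  obtain \<gamma> where "rat_basis \<gamma> \<and> (\<forall>i. \<gamma> i \<in> P)" using fractional_ideal_rat_basis[OF P] by (rule exE)
  then have ga: "rat_basis \<gamma>" "\<And>i. \<gamma> i \<in> P" by simp_all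
  obtain \<eta> where eta: "\<forall>i l. tr (\<eta> i * \<gamma> l) = (if i = l then 1 else 0)"
    using dual_basis_exists[OF ga(1)] by (rule exE)
  define T where "T = {z. frame \<gamma> z \<in> upper_half_space}"
  define G where "G z = F (frame \<gamma> z)" for z
  have T: "is_tube T" unfolding T_def by (rule is_tube_frame)
  have G: "tube_form T G" unfolding T_def G_def using per[OF _ ga(2)] by (intro tube_form_frame hol)
  obtain a where a: "\<forall>z\<in>T. ((\<lambda>m. a m * ex m z) has_sum G z) UNIV"
    "\<forall>z\<in>T. \<forall>m B. (\<forall>x. norm (G (z + rv x)) \<le> B) \<longrightarrow> norm (a m * ex m z) \<le> B"
    using tube_fourier_expansion[OF T G] by (elim exE conjE)
  define fr where "fr m = (\<Sum>i\<in>UNIV. of_int (m i) * \<eta> i)" for m :: "'n \<Rightarrow> int"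
  have tr_fr: "tr (fr m * \<gamma> l) = of_int (m l)" for m l
  proof -
    have "tr (fr m * \<gamma> l) = (\<Sum>i\<in>UNIV. of_int (m i) * tr (\<eta> i * \<gamma> l))"
      by (simp add: fr_def sum_distrib_right tr_sum mult.assoc tr_of_int_mult)
    also have "\<dots> = (\<Sum>i\<in>UNIV. if i = l then of_int (m i) else 0)"
      using eta by (intro sum.cong) auto
    finally show ?thesis by simp
  qed
  have chr_fr: "chr (fr m) (frame \<gamma> z) = ex m z" for m z by (rule chr_frame[OF tr_fr])
  have tubeT: "z + rv x \<in> T" if "z \<in> T" for z x using T that by (simp add: is_tube_def)
  have supp: "fr m \<in> trace_dual P" if am: "a m \<noteq> 0" for m
  proof -
    obtain z0 where "frame \<gamma> z0 = (\<chi> j. \<i>)" by (rule frame_surj[OF ga(1)])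
    then have z0: "z0 \<in> T" by (simp add: T_def upper_half_space_def)
    have "tr (fr m * b) \<in> \<int>" if b: "b \<in> P" for b
    proof -
      obtain c where c: "frame \<gamma> (rv c) = rv (emb_vec b)" by (rule frame_rv_surj[OF ga(1)])
      have s1: "((\<lambda>m. (a m * ex m z0) * ex m (rv x)) has_sum G (z0 + rv x)) UNIV" for x
        using bspec[OF a(1) tubeT[OF z0, of x]] by (simp add: ex_add mult.assoc)
      have s2: "((\<lambda>m. (a m * ex m z0 * ex m (rv c)) * ex m (rv x)) has_sum G (z0 + rv x)) UNIV" for x
      proof -
        have "G (z0 + rv x + rv c) = G (z0 + rv x)"
          unfolding G_def frame_add c using per[OF _ b, of "frame \<gamma> z0 + frame \<gamma> (rv x)"] tubeT[OF z0, of x]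
          by (simp add: T_def frame_add)
        then show ?thesis
          using bspec[OF a(1) tubeT[OF tubeT[OF z0, of x], of c]] by (simp add: ex_add mult_ac)
      qed
      have bc: "bcont (\<lambda>x. G (z0 + rv x))" by (rule bcont_tube_form[OF T G z0])
      have inj: "inj_on (\<lambda>m::'n \<Rightarrow> int. m) UNIV" by simp
      have "a m * ex m z0 = a m * ex m z0 * ex m (rv c)"
        using torus_coefficient[OF s1 bc inj, of m] torus_coefficient[OF s2 bc inj, of m] by simp
      moreover have "a m * ex m z0 \<noteq> 0" using am by (simp add: ex_def)
      ultimately have "ex m (rv c) = 1" by simp
      then have "exp (2 * of_real pi * \<i> * of_real (tr (fr m * b))) = (1 :: complex)"
        using chr_fr[of m "rv c"] c chr_emb_vec[of "fr m" b] by simp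
      then obtain l :: int where "2 * pi * tr (fr m * b) = of_int (2 * l) * pi"
        unfolding exp_eq_1 by auto
      then have "tr (fr m * b) = of_int l" by simp
      then show ?thesis by simp
    qed
    then show ?thesis by (simp add: trace_dual_def)
  qed
  have pos: "totally_positive emb (fr m)" if nz: "fr m \<noteq> 0" "a m \<noteq> 0" for m
  proof (rule ccontr)
    assume np: "\<not> totally_positive emb (fr m)"
    obtain \<tau> B where t: "\<tau> \<in> upper_half_space" "\<forall>x. norm (F (\<tau> + rv x)) \<le> B" "B < norm (a m) * norm (chr (fr m) \<tau>)"
      using small[OF nz(1) np, of "norm (a m)"] nz(2) by auto
    obtain z where z: "frame \<gamma> z = \<tau>" by (rule frame_surj[OF ga(1)])
    have "norm (G (z + rv x)) \<le> B" for x
      unfolding G_def frame_add z frame_rv using t(2) by blast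
    moreover have "z \<in> T" using t(1) z by (simp add: T_def)
    ultimately have "norm (a m * ex m z) \<le> B" using a(2) by blast
    then show False using t(3) chr_fr[of m z] z by (simp add: norm_mult)
  qed
  define a' where "a' \<xi> = a (\<lambda>i. \<lfloor>tr (\<xi> * \<gamma> i)\<rfloor>)" for \<xi>
  have a'_fr: "a' (fr m) = a m" for m by (simp add: a'_def tr_fr)
  have inj: "inj_on fr A" for A
  proof (rule inj_onI)
    fix m m' assume "fr m = fr m'"
    then have "real_of_int (m l) = of_int (m' l)" for l using tr_fr[of m l] tr_fr[of m' l] by simp
    then show "m = m'" by (simp add: fun_eq_iff)
  qed
  let ?S = "insert 0 (tpos_in (trace_dual P))"
  have fr0: "fr (\<lambda>_. 0) = 0" by (simp add: fr_def)
  have surj: "?S \<subseteq> range fr"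
  proof
    fix \<xi> assume "\<xi> \<in> ?S"
    then have "\<xi> = 0 \<or> \<xi> \<in> trace_dual P" by (auto simp: tpos_in_def)
    then have "\<xi> \<in> trace_dual P"
      using fractional_idealD(1)[OF fractional_ideal_trace_dual[OF P]] by blast
    then have "tr (\<xi> * \<gamma> l) \<in> \<int>" for l using ga(2) by (rule trace_dualD)
    then have "tr (\<xi> * \<gamma> l) = of_int \<lfloor>tr (\<xi> * \<gamma> l)\<rfloor>" for l by (simp add: of_int_floor)
    then have e: "\<xi> = fr (\<lambda>i. \<lfloor>tr (\<xi> * \<gamma> i)\<rfloor>)"
      unfolding fr_def using eta by (intro dual_basis_expansion[OF ga(1)]) auto
    show "\<xi> \<in> range fr" by (subst e) (rule rangeI)
  qed
  have "((\<lambda>\<xi>. a' \<xi> * chr \<xi> \<tau>) has_sum (F \<tau> - a' 0)) (tpos_in (trace_dual P))" if tau: "\<tau> \<in> upper_half_space" for \<tau>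
  proof -
    obtain z where z: "frame \<gamma> z = \<tau>" by (rule frame_surj[OF ga(1)])
    then have "z \<in> T" using tau by (simp add: T_def)
    then have "((\<lambda>m. a' (fr m) * chr (fr m) \<tau>) has_sum F \<tau>) UNIV"
      using a(1) unfolding a'_fr z[symmetric] chr_fr G_def by blast
    then have "((\<lambda>\<xi>. a' \<xi> * chr \<xi> \<tau>) has_sum F \<tau>) (range fr)"
      by (subst has_sum_reindex[OF inj]) (simp add: o_def)
    moreover have "a' \<xi> * chr \<xi> \<tau> = 0" if "\<xi> \<in> range fr - ?S" for \<xi>
    proof -
      obtain m where m: "\<xi> = fr m" "fr m \<notin> ?S" using \<open>\<xi> \<in> range fr - ?S\<close> by auto
      have "a m = 0" using m(2) supp[of m] pos[of m] by (auto simp: tpos_in_def)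
      then show ?thesis by (simp add: m(1) a'_fr)
    qed
    ultimately have h: "((\<lambda>\<xi>. a' \<xi> * chr \<xi> \<tau>) has_sum F \<tau>) ?S"
      using surj has_sum_cong_neutral[of "range fr" ?S "\<lambda>\<xi>. a' \<xi> * chr \<xi> \<tau>" "\<lambda>\<xi>. a' \<xi> * chr \<xi> \<tau>"] by blast
    have "0 \<notin> tpos_in (trace_dual P)" by (auto simp: tpos_in_def totally_positive_def)
    then have "?S - {0} = tpos_in (trace_dual P)" by auto
    moreover have "((\<lambda>\<xi>. a' \<xi> * chr \<xi> \<tau>) has_sum (F \<tau> - a' 0 * chr 0 \<tau>)) (?S - {0})"
    proof (rule has_sum_Diff[OF h])
      show "((\<lambda>\<xi>. a' \<xi> * chr \<xi> \<tau>) has_sum (a' 0 * chr 0 \<tau>)) {0}" by (rule has_sum_finiteI) auto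
    qed simp
    ultimately show ?thesis by simp
  qed
  then show ?thesis unfolding has_fourier_expansion_chr by (intro exI[of _ a'] ballI)
qed

lemma fourier_expansion_summable:
  assumes "has_fourier_expansion emb L F a" "\<tau> \<in> upper_half_space"
  shows "(\<lambda>\<xi>. norm (a \<xi> * chr \<xi> \<tau>)) summable_on tpos_in L"
    and "norm (F \<tau>) \<le> norm (a 0) + (\<Sum>\<^sub>\<infinity>\<xi>\<in>tpos_in L. norm (a \<xi> * chr \<xi> \<tau>))"
    and "norm (F \<tau> - a 0) \<le> (\<Sum>\<^sub>\<infinity>\<xi>\<in>tpos_in L. norm (a \<xi> * chr \<xi> \<tau>))"
proof -
  have h: "((\<lambda>\<xi>. a \<xi> * chr \<xi> \<tau>) has_sum (F \<tau> - a 0)) (tpos_in L)"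
    using assms unfolding has_fourier_expansion_chr by blast
  then show s: "(\<lambda>\<xi>. norm (a \<xi> * chr \<xi> \<tau>)) summable_on tpos_in L"
    by (intro iffD1[OF summable_on_iff_abs_summable_on_complex] has_sum_imp_summable)
  show "norm (F \<tau> - a 0) \<le> (\<Sum>\<^sub>\<infinity>\<xi>\<in>tpos_in L. norm (a \<xi> * chr \<xi> \<tau>))"
    by (rule norm_has_sum_bound[OF has_sum_infsum[OF s] h])
  then show "norm (F \<tau>) \<le> norm (a 0) + (\<Sum>\<^sub>\<infinity>\<xi>\<in>tpos_in L. norm (a \<xi> * chr \<xi> \<tau>))"
    using norm_triangle_sub[of "F \<tau>" "a 0"] by linarith
qed

text \<open>Raising the imaginary part shrinks every term of an expansion.\<close>

lemma norm_chr_mono: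
  assumes "totally_positive emb \<xi>" "\<And>j. Im (\<tau> $ j) \<le> Im (\<tau>' $ j)"
  shows "norm (chr \<xi> \<tau>') \<le> norm (chr \<xi> \<tau>)"
proof -
  have "(\<Sum>j\<in>UNIV. emb j \<xi> * Im (\<tau> $ j)) \<le> (\<Sum>j\<in>UNIV. emb j \<xi> * Im (\<tau>' $ j))"
    using assms by (intro sum_mono mult_left_mono) (auto simp: totally_positive_def less_imp_le)
  then show ?thesis unfolding norm_chr by simp
qed

lemma fourier_expansion_bounded:
  assumes e: "has_fourier_expansion emb L F a" and t0: "\<tau> \<in> upper_half_space"
  shows "\<exists>B. \<forall>\<tau>'. (\<forall>j. Im (\<tau> $ j) \<le> Im (\<tau>' $ j)) \<longrightarrow> norm (F \<tau>') \<le> B"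
proof -
  have "norm (F \<tau>') \<le> norm (a 0) + (\<Sum>\<^sub>\<infinity>\<xi>\<in>tpos_in L. norm (a \<xi> * chr \<xi> \<tau>))"
    if le: "\<forall>j. Im (\<tau> $ j) \<le> Im (\<tau>' $ j)" for \<tau>'
  proof -
    have "0 < Im (\<tau>' $ j)" for j using t0 le[rule_format, of j] by (auto simp: upper_half_space_def intro: less_le_trans)
    then have t: "\<tau>' \<in> upper_half_space" by (simp add: upper_half_space_def)
    have "(\<Sum>\<^sub>\<infinity>\<xi>\<in>tpos_in L. norm (a \<xi> * chr \<xi> \<tau>')) \<le> (\<Sum>\<^sub>\<infinity>\<xi>\<in>tpos_in L. norm (a \<xi> * chr \<xi> \<tau>))"
    proof (rule infsum_mono[OF fourier_expansion_summable(1)[OF e t] fourier_expansion_summable(1)[OF e t0]])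
      fix \<xi> assume "\<xi> \<in> tpos_in L"
      then have "norm (chr \<xi> \<tau>') \<le> norm (chr \<xi> \<tau>)"
        using le by (intro norm_chr_mono) (auto simp: tpos_in_def)
      then show "norm (a \<xi> * chr \<xi> \<tau>') \<le> norm (a \<xi> * chr \<xi> \<tau>)"
        unfolding norm_mult by (rule mult_left_mono) simp
    qed
    then show ?thesis using fourier_expansion_summable(2)[OF e t] by linarith
  qed
  then show ?thesis by (intro exI allI impI)
qed

lemma fourier_expansion_unique:
  assumes L: "fractional_ideal (L :: 'a set)" and hol: "continuous_on upper_half_space F"
    and a: "has_fourier_expansion emb L F a" and b: "has_fourier_expansion emb L F b"
    and xi: "\<xi> \<in> tpos_in L"
  shows "a \<xi> = b \<xi>"
proof -
  obtain \<gamma> where "rat_basis \<gamma> \<and> (\<forall>i. \<gamma> i \<in> trace_dual L)"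
    using fractional_ideal_rat_basis[OF fractional_ideal_trace_dual[OF L]] by (rule exE)
  then have ga: "rat_basis \<gamma>" "\<And>i. \<gamma> i \<in> trace_dual L" by simp_all
  define \<tau>0 :: "complex^'n" where "\<tau>0 = (\<chi> j. \<i>)"
  have t0: "\<tau>0 \<in> upper_half_space" by (simp add: \<tau>0_def upper_half_space_def)
  define K where "K = insert 0 (tpos_in L)"
  define m where "m \<xi> = (\<lambda>i. \<lfloor>tr (\<xi> * \<gamma> i)\<rfloor>)" for \<xi>
  have KL: "x \<in> L" if "x \<in> K" for x
    using that fractional_idealD(1)[OF L] by (auto simp: K_def tpos_in_def)
  have m: "tr (x * \<gamma> i) = of_int (m x i)" if "x \<in> K" for x i
  proof -
    have "tr (\<gamma> i * x) \<in> \<int>" by (rule trace_dualD[OF ga(2) KL[OF that]])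
    then show ?thesis by (simp add: m_def of_int_floor mult.commute)
  qed
  have inj: "inj_on m K"
  proof (rule inj_onI)
    fix x y assume xy: "x \<in> K" "y \<in> K" "m x = m y"
    have "tr ((x - y) * \<gamma> i) = 0" for i
      using m[OF xy(1), of i] m[OF xy(2), of i] xy(3) by (simp add: left_diff_distrib)
    then have "x - y = 0" by (rule tr_nondegenerate[OF ga(1)])
    then show "x = y" by simp
  qed
  define F' where "F' x = F (\<tau>0 + frame \<gamma> (rv x))" for x
  have tx: "\<tau>0 + frame \<gamma> (rv x) \<in> upper_half_space" for x unfolding frame_rv using t0 by simp
  have sum: "((\<lambda>\<xi>. (c \<xi> * chr \<xi> \<tau>0) * ex (m \<xi>) (rv x)) has_sum F' x) K"
    if c: "has_fourier_expansion emb L F c" for c x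
  proof -
    have "((\<lambda>\<xi>. c \<xi> * chr \<xi> (\<tau>0 + frame \<gamma> (rv x))) has_sum (F' x - c 0)) (tpos_in L)"
      using c tx unfolding has_fourier_expansion_chr F'_def by blast
    moreover have "0 \<notin> tpos_in L" by (auto simp: tpos_in_def totally_positive_def)
    ultimately have "((\<lambda>\<xi>. c \<xi> * chr \<xi> (\<tau>0 + frame \<gamma> (rv x))) has_sum
        (c 0 * chr 0 (\<tau>0 + frame \<gamma> (rv x)) + (F' x - c 0))) K"
      unfolding K_def by (intro has_sum_insert)
    then have "((\<lambda>\<xi>. c \<xi> * chr \<xi> (\<tau>0 + frame \<gamma> (rv x))) has_sum F' x) K" by simp
    moreover have "c \<xi> * chr \<xi> (\<tau>0 + frame \<gamma> (rv x)) = (c \<xi> * chr \<xi> \<tau>0) * ex (m \<xi>) (rv x)" if "\<xi> \<in> K" for \<xi>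
      unfolding chr_add using chr_frame[OF m[OF that], where z = "rv x"] by (simp add: mult.assoc)
    ultimately show ?thesis by (rule iffD1[OF has_sum_cong, rotated])
  qed
  have bc: "bcont F'" unfolding bcont_def
  proof
    show "continuous_on UNIV F'" unfolding F'_def
    proof (rule continuous_on_compose2[OF hol])
      show "continuous_on UNIV (\<lambda>x. \<tau>0 + frame \<gamma> (rv x))"
        by (intro continuous_on_add continuous_on_const
          continuous_on_compose2[where f = rv, OF continuous_on_frame continuous_on_rv subset_UNIV])
      show "range (\<lambda>x. \<tau>0 + frame \<gamma> (rv x)) \<subseteq> upper_half_space" using tx by (rule image_subsetI)
    qed
    obtain B where B: "\<forall>\<tau>'. (\<forall>j. Im (\<tau>0 $ j) \<le> Im (\<tau>' $ j)) \<longrightarrow> norm (F \<tau>') \<le> B"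
      using fourier_expansion_bounded[OF a t0] by (rule exE)
    have "norm (F' x) \<le> B" for x unfolding F'_def
      using B[rule_format, of "\<tau>0 + frame \<gamma> (rv x)"] unfolding frame_rv by (simp add: rv_def)
    then show "\<exists>B. \<forall>x. norm (F' x) \<le> B" by (intro exI allI)
  qed
  have xK: "\<xi> \<in> K" using xi by (simp add: K_def)
  have "a \<xi> * chr \<xi> \<tau>0 = b \<xi> * chr \<xi> \<tau>0"
    by (rule trans[OF torus_coefficient[OF sum[OF a] bc inj xK, symmetric] torus_coefficient[OF sum[OF b] bc inj xK]])
  then show ?thesis by (simp add: chr_def)
qed

end

section \<open>The slash action\<close>

lemma real_moebius:
  fixes a b c d :: real and t :: complex
  assumes D: "a * d - b * c > 0" and t: "Im t > 0"
  shows "of_real c * t + of_real d \<noteq> 0"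
    and "Im ((of_real a * t + of_real b) / (of_real c * t + of_real d)) = (a * d - b * c) * Im t / (cmod (of_real c * t + of_real d))\<^sup>2"
proof -
  show "of_real c * t + of_real d \<noteq> 0"
  proof
    assume "of_real c * t + of_real d = 0"
    then have e: "c * Re t + d = 0" "c * Im t = 0" by (simp_all add: complex_eq_iff)
    then have "c = 0" "d = 0" using t by auto
    then show False using D by simp
  qed
  have "Im (of_real a * t + of_real b) * Re (of_real c * t + of_real d) -
      Re (of_real a * t + of_real b) * Im (of_real c * t + of_real d) = (a * d - b * c) * Im t"
    by (simp add: algebra_simps)
  then show "Im ((of_real a * t + of_real b) / (of_real c * t + of_real d)) = (a * d - b * c) * Im t / (cmod (of_real c * t + of_real d))\<^sup>2"
    unfolding Im_divide cmod_power2 by simp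
qed

lemma prod_powi: "(\<Prod>i\<in>A. x i powi n) = (\<Prod>i\<in>A. x i :: 'b::field) powi n"
  by (induction A rule: infinite_finite_induct) (simp_all add: power_int_mult_distrib)

lemma field_differentiable_prod:
  fixes f :: "'i \<Rightarrow> complex \<Rightarrow> complex"
  assumes "\<And>i. i \<in> A \<Longrightarrow> f i field_differentiable (at z)"
  shows "(\<lambda>w. \<Prod>i\<in>A. f i w) field_differentiable (at z)"
  using assms by (induction A rule: infinite_finite_induct) (auto intro: field_differentiable_mult field_differentiable_const)

lemma has_derivative_vec_lambda:
  fixes f :: "'n::finite \<Rightarrow> complex \<Rightarrow> complex"
  assumes "\<And>j. (f j has_field_derivative u j) (at z)"
  shows "((\<lambda>w. \<chi> j. f j w) has_derivative (\<lambda>h. h *s (\<chi> j. u j))) (at z)"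
  unfolding has_derivative_componentwise_within[of "\<lambda>w. \<chi> j. f j w"]
proof
  fix i :: "complex^'n" assume "i \<in> Basis"
  then obtain j c where i: "i = axis j c" by (auto simp: Basis_vec_def)
  have "((\<lambda>w. f j w \<bullet> c) has_derivative (\<lambda>h. (u j * h) \<bullet> c)) (at z)"
    using assms[of j] unfolding has_field_derivative_def by (rule has_derivative_inner_left)
  then show "((\<lambda>w. (\<chi> j. f j w) \<bullet> i) has_derivative (\<lambda>h. (h *s (\<chi> j. u j)) \<bullet> i)) (at z)"
    unfolding i inner_axis by (simp add: mult.commute)
qed

lemma matrix_mult_nth_2:
  "(A ** B) $ i $ k = A $ i $ 1 * B $ 1 $ k + A $ i $ 2 * (B :: 'b::semiring_1^2^2) $ 2 $ k"
  by (simp add: matrix_matrix_mult_def sum_2)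

context totally_real_field
begin

definition jf :: "'a^2^2 \<Rightarrow> complex^'n \<Rightarrow> 'n \<Rightarrow> complex" where
  "jf A \<tau> j = of_real (emb j (A $ 2 $ 1)) * \<tau> $ j + of_real (emb j (A $ 2 $ 2))"

lemma slash_alt:
  "slash emb k g A \<tau> = of_real (nm (det A) powr (of_int k / 2)) * (\<Prod>j\<in>UNIV. jf A \<tau> j) powi (- k) * g (moebius emb A \<tau>)"
  by (simp add: slash_def nm_def jf_def prod_powi)

lemma det_emb: "emb j (det (A :: 'a^2^2)) = emb j (A $ 1 $ 1) * emb j (A $ 2 $ 2) - emb j (A $ 1 $ 2) * emb j (A $ 2 $ 1)"
  by (simp add: det_2)

lemma half_space_action:
  assumes A: "A \<in> GL2_plus emb" and t: "\<tau> \<in> upper_half_space"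
  shows jf_nonzero: "jf A \<tau> j \<noteq> 0"
    and Im_moebius: "Im (moebius emb A \<tau> $ j) = emb j (det A) * Im (\<tau> $ j) / (cmod (jf A \<tau> j))\<^sup>2"
    and moebius_upper: "moebius emb A \<tau> \<in> upper_half_space"
proof -
  have D: "emb j (A $ 1 $ 1) * emb j (A $ 2 $ 2) - emb j (A $ 1 $ 2) * emb j (A $ 2 $ 1) > 0" for j
    using A unfolding GL2_plus_def totally_positive_def det_emb by blast
  have I: "Im (\<tau> $ j) > 0" for j using t by (simp add: upper_half_space_def)
  have j0: "jf A \<tau> j \<noteq> 0" for j unfolding jf_def by (rule real_moebius(1)[OF D I])
  then show "jf A \<tau> j \<noteq> 0" .
  have im: "Im (moebius emb A \<tau> $ j) = emb j (det A) * Im (\<tau> $ j) / (cmod (jf A \<tau> j))\<^sup>2" for j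
    unfolding jf_def moebius_def det_emb vec_lambda_beta by (rule real_moebius(2)[OF D I])
  then show "Im (moebius emb A \<tau> $ j) = emb j (det A) * Im (\<tau> $ j) / (cmod (jf A \<tau> j))\<^sup>2" .
  have "0 < Im (moebius emb A \<tau> $ j)" for j
    unfolding im det_emb using D[of j] I[of j] j0[of j] by simp
  then show "moebius emb A \<tau> \<in> upper_half_space" by (simp add: upper_half_space_def)
qed

lemma moebius_nth:
  "moebius emb A \<tau> $ j = (of_real (emb j (A $ 1 $ 1)) * \<tau> $ j + of_real (emb j (A $ 1 $ 2))) / jf A \<tau> j"
  by (simp add: moebius_def jf_def)

lemma half_space_cocycle:
  assumes B: "B \<in> GL2_plus emb" and t: "\<tau> \<in> upper_half_space"
  shows jf_mult: "jf (A ** B) \<tau> j = jf A (moebius emb B \<tau>) j * jf B \<tau> j"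
    and moebius_mult: "moebius emb (A ** B) \<tau> = moebius emb A (moebius emb B \<tau>)"
proof -
  have B0: "jf B \<tau> j \<noteq> 0" for j by (rule jf_nonzero[OF B t])
  let ?n = "\<lambda>j. of_real (emb j (B $ 1 $ 1)) * \<tau> $ j + of_real (emb j (B $ 1 $ 2))"
  have row: "of_real (emb j ((A ** B) $ i $ 1)) * \<tau> $ j + of_real (emb j ((A ** B) $ i $ 2)) =
      (of_real (emb j (A $ i $ 1)) * (?n j / jf B \<tau> j) + of_real (emb j (A $ i $ 2))) * jf B \<tau> j" for i j
  proof -
    have "of_real (emb j ((A ** B) $ i $ 1)) * \<tau> $ j + of_real (emb j ((A ** B) $ i $ 2)) =
        of_real (emb j (A $ i $ 1)) * ?n j + of_real (emb j (A $ i $ 2)) * jf B \<tau> j"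
      by (simp add: matrix_mult_nth_2 jf_def algebra_simps)
    also have "\<dots> = (of_real (emb j (A $ i $ 1)) * (?n j / jf B \<tau> j) + of_real (emb j (A $ i $ 2))) * jf B \<tau> j"
      using B0[of j] by (simp add: distrib_right)
    finally show ?thesis .
  qed
  show j: "jf (A ** B) \<tau> j = jf A (moebius emb B \<tau>) j * jf B \<tau> j" for j
    using row[of j 2] unfolding jf_def[of "A ** B"] jf_def[of A] moebius_nth .
  show "moebius emb (A ** B) \<tau> = moebius emb A (moebius emb B \<tau>)"
    unfolding vec_eq_iff
  proof
    fix j
    show "moebius emb (A ** B) \<tau> $ j = moebius emb A (moebius emb B \<tau>) $ j"
      unfolding moebius_nth[of "A ** B"] row[of j 1] j moebius_nth[of A] moebius_nth[of B] using B0[of j] by simp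
  qed
qed

lemma GL2_plus_mult: "A \<in> GL2_plus emb \<Longrightarrow> B \<in> GL2_plus emb \<Longrightarrow> A ** B \<in> GL2_plus emb"
  by (simp add: GL2_plus_def totally_positive_def det_mul)

lemma nm_det_pos: "A \<in> GL2_plus emb \<Longrightarrow> nm (det A) > 0"
  unfolding GL2_plus_def totally_positive_def nm_def by (simp add: prod_pos)

lemma slash_mult:
  assumes A: "A \<in> GL2_plus emb" and B: "B \<in> GL2_plus emb" and t: "\<tau> \<in> upper_half_space"
  shows "slash emb k (slash emb k g A) B \<tau> = slash emb k g (A ** B) \<tau>"
proof -
  have "nm (det (A ** B)) powr (of_int k / 2) = nm (det A) powr (of_int k / 2) * nm (det B) powr (of_int k / 2)"
    using nm_det_pos[OF A] nm_det_pos[OF B] by (simp add: det_mul powr_mult)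
  then show ?thesis
    unfolding slash_alt moebius_mult[OF B t] jf_mult[OF B t] prod.distrib power_int_mult_distrib of_real_mult
    by (simp add: mult_ac)
qed

lemma slash_cong:
  assumes "\<And>\<tau>. \<tau> \<in> upper_half_space \<Longrightarrow> g \<tau> = g' \<tau>" and A: "A \<in> GL2_plus emb" and t: "\<tau> \<in> upper_half_space"
  shows "slash emb k g A \<tau> = slash emb k g' A \<tau>"
  unfolding slash_alt using assms(1)[OF moebius_upper[OF A t]] by simp

lemma continuous_on_jf: "continuous_on S (\<lambda>\<tau>. jf A \<tau> j)"
  unfolding jf_def by (intro continuous_intros)

lemma line_holomorphic_slash:
  assumes g: "holomorphic_on_upper_half_space g" and A: "A \<in> GL2_plus emb"
  shows "line_holomorphic (slash emb k g A)"
  unfolding line_holomorphic_def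
proof (intro conjI ballI allI)
  have "isCont g \<tau>" if tau: "\<tau> \<in> upper_half_space" for \<tau>
    using bspec[OF g[unfolded holomorphic_on_upper_half_space_def] tau] has_derivative_continuous by blast
  then have gc: "continuous_on upper_half_space g" by (intro continuous_at_imp_continuous_on) blast
  have mc: "continuous_on upper_half_space (moebius emb A)"
  proof -
    have "continuous_on upper_half_space (\<lambda>\<tau>. \<chi> j. (of_real (emb j (A $ 1 $ 1)) * \<tau> $ j + of_real (emb j (A $ 1 $ 2))) / jf A \<tau> j)"
      by (intro continuous_on_vec_lambda continuous_on_divide continuous_on_jf continuous_intros)
        (use jf_nonzero[OF A] in auto)
    moreover have "moebius emb A = (\<lambda>\<tau>. \<chi> j. (of_real (emb j (A $ 1 $ 1)) * \<tau> $ j + of_real (emb j (A $ 1 $ 2))) / jf A \<tau> j)"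
      by (simp add: moebius_def jf_def fun_eq_iff)
    ultimately show ?thesis by simp
  qed
  have "continuous_on upper_half_space (\<lambda>\<tau>. g (moebius emb A \<tau>))"
    by (rule continuous_on_compose2[OF gc mc]) (use moebius_upper[OF A] in auto)
  moreover have "continuous_on upper_half_space (\<lambda>\<tau>. (\<Prod>j\<in>UNIV. jf A \<tau> j) powi (- k))"
    by (intro continuous_on_power_int continuous_on_prod continuous_on_jf) (use jf_nonzero[OF A] in auto)
  ultimately show "continuous_on upper_half_space (slash emb k g A)"
    unfolding slash_alt by (intro continuous_on_mult continuous_on_const)
  fix \<tau> v :: "complex^'n" assume t: "\<tau> \<in> upper_half_space"
  obtain D where D: "(g has_derivative D) (at (moebius emb A \<tau>))" "\<And>c v. D (c *s v) = c * D v"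
    using bspec[OF g[unfolded holomorphic_on_upper_half_space_def] moebius_upper[OF A t]] by blast
  have t0: "\<tau> + 0 *s v = \<tau>" by (simp add: vec_eq_iff)
  have j0: "jf A (\<tau> + 0 *s v) j \<noteq> 0" for j unfolding t0 by (rule jf_nonzero[OF A t])
  have jd: "(\<lambda>w. jf A (\<tau> + w *s v) j) field_differentiable (at 0)" for j
    unfolding jf_def vector_add_component smult_vec_nth
    by (intro field_differentiable_add field_differentiable_mult field_differentiable_const field_differentiable_ident)
  define m where "m j w = moebius emb A (\<tau> + w *s v) $ j" for j w
  have "m j field_differentiable (at 0)" for j
    unfolding m_def moebius_nth
    by (rule field_differentiable_divide[OF _ jd j0], unfold vector_add_component smult_vec_nth,
      intro field_differentiable_add field_differentiable_mult field_differentiable_const field_differentiable_ident)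
  then have "(m j has_field_derivative deriv (m j) 0) (at 0)" for j by (rule field_differentiable_derivI)
  from has_derivative_vec_lambda[of m, OF this]
  have "((\<lambda>w. moebius emb A (\<tau> + w *s v)) has_derivative (\<lambda>h. h *s (\<chi> j. deriv (m j) 0))) (at 0)"
    by (simp add: m_def)
  moreover have "(g has_derivative D) (at (moebius emb A (\<tau> + 0 *s v)))" unfolding t0 by (rule D(1))
  ultimately have "((\<lambda>w. g (moebius emb A (\<tau> + w *s v))) has_derivative (\<lambda>h. D (h *s (\<chi> j. deriv (m j) 0)))) (at 0)"
    by (rule has_derivative_compose)
  then have "((\<lambda>w. g (moebius emb A (\<tau> + w *s v))) has_field_derivative D (\<chi> j. deriv (m j) 0)) (at 0)"
    unfolding has_field_derivative_def D(2) by (simp add: mult.commute[of _ "D (\<chi> j. deriv (m j) 0)"])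
  then have gd: "(\<lambda>w. g (moebius emb A (\<tau> + w *s v))) field_differentiable (at 0)"
    unfolding field_differentiable_def by (rule exI)
  have pd: "(\<lambda>w. \<Prod>j\<in>UNIV. jf A (\<tau> + w *s v) j) field_differentiable (at 0)"
    by (rule field_differentiable_prod) (rule jd)
  have "(\<Prod>j\<in>UNIV. jf A (\<tau> + 0 *s v) j) \<noteq> 0" using j0 by simp
  from DERIV_power_int[OF field_differentiable_derivI[OF pd] disjI2, OF this]
  have "(\<lambda>w. (\<Prod>j\<in>UNIV. jf A (\<tau> + w *s v) j) powi (- k)) field_differentiable (at 0)"
    unfolding field_differentiable_def by (rule exI)
  then show "(\<lambda>w. slash emb k g A (\<tau> + w *s v)) field_differentiable at 0"
    unfolding slash_alt by (intro field_differentiable_mult field_differentiable_const gd)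
qed

section \<open>Conjugates of the congruence subgroups\<close>

lemma totally_positive_unitsD:
  assumes "u \<in> totally_positive_units emb"
  shows "totally_positive emb u" "u \<noteq> 0" "algebraic_int u" "algebraic_int (inverse u)" "nm u = 1"
proof -
  obtain v where v: "algebraic_int v" "u * v = 1" and u: "algebraic_int u" "totally_positive emb u"
    using assms unfolding totally_positive_units_def by auto
  show tp: "totally_positive emb u" "algebraic_int u" by (rule u)+
  show u0: "u \<noteq> 0" using v(2) by auto
  have "inverse u = v" using v(2) by (rule inverse_unique)
  then show iu: "algebraic_int (inverse u)" using v(1) by simp
  have "nm u > 0" using tp unfolding totally_positive_def nm_def by (simp add: prod_pos)
  then show "nm u = 1" using nm_unit[OF u(1) iu u0] by simp
qed

lemma one_totally_positive_unit: "1 \<in> totally_positive_units emb"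
  unfolding totally_positive_units_def totally_positive_def by (auto intro!: bexI[of _ 1])

lemma Gamma0_GL2_plus: "A \<in> Gamma0 emb N J \<Longrightarrow> A \<in> GL2_plus emb"
  unfolding Gamma0_def GL2_plus_def using totally_positive_unitsD(1) by blast

lemma fractional_ideal_different: "fractional_ideal (different emb)"
  unfolding different_eq
  by (rule fractional_ideal_inverse[OF fractional_ideal_trace_dual[OF fractional_ideal_ring_of_integers]])

lemma finite_multiplier:
  assumes J: "fractional_ideal (J :: 'a set)" and S: "finite S"
  shows "\<exists>r. algebraic_int r \<and> r \<noteq> 0 \<and> (\<forall>x\<in>S. r * x \<in> J)"
  using S
proof (induction S rule: finite_induct)
  case empty
  show ?case by (intro exI[of _ 1]) simp
next
  case (insert x S)
  obtain r where r: "algebraic_int r" "r \<noteq> 0" "\<forall>x\<in>S. r * x \<in> J" using insert.IH by (elim exE conjE)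
  obtain s where s: "algebraic_int s" "s \<noteq> 0" "s * x \<in> J"
    using fractional_ideal_multiplier[OF J integer_multiple[of x]] by (elim exE conjE)
  have "r * s * y \<in> J" if y: "y \<in> insert x S" for y
  proof (cases "y = x")
    case True
    then show ?thesis using fractional_idealD(3)[OF J r(1) s(3)] by (simp add: mult.assoc)
  next
    case False
    then have "r * y \<in> J" using r(3) y by blast
    from fractional_idealD(3)[OF J s(1) this] show ?thesis by (simp add: mult_ac)
  qed
  then show ?case using r s by (intro exI[of _ "r * s"] conjI ballI algebraic_int_add_mult(2)) auto
qed

text \<open>The entries of the conjugate of a matrix close to the identity are combinations of finitely many fixed elements with small coefficients, so clearing denominators puts them into the required ideals.\<close>

lemma conjugate_congruence:
  assumes A: "A \<in> GL2_plus emb" and N: "fractional_ideal (N :: 'a set)" and J: "fractional_ideal J"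
  shows "\<exists>r. algebraic_int r \<and> r \<noteq> 0 \<and>
    (\<forall>M. det M \<in> totally_positive_units emb \<longrightarrow> algebraic_int ((M $ 1 $ 1 - 1) / r) \<longrightarrow> algebraic_int (M $ 1 $ 2 / r) \<longrightarrow>
      algebraic_int (M $ 2 $ 1 / r) \<longrightarrow> algebraic_int ((M $ 2 $ 2 - 1) / r) \<longrightarrow>
      (\<exists>\<gamma>\<in>Gamma0 emb N J. \<gamma> ** A = A ** M))"
proof -
  define P where "P = ideal_mult (ideal_inverse J) (ideal_inverse (different emb))"
  define Q where "Q = ideal_mult (ideal_mult N J) (different emb)"
  have O: "fractional_ideal (ring_of_integers :: 'a set)" by (rule fractional_ideal_ring_of_integers)
  have P: "fractional_ideal P" unfolding P_def
    by (intro fractional_ideal_mult fractional_ideal_inverse J fractional_ideal_different)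
  have Q: "fractional_ideal Q" unfolding Q_def
    by (intro fractional_ideal_mult N J fractional_ideal_different)
  define \<delta> where "\<delta> = det A"
  have d0: "\<delta> \<noteq> 0" using A totally_positive_nonzero unfolding \<delta>_def GL2_plus_def by blast
  define A' :: "'a^2^2" where "A' = vector [vector [A $ 2 $ 2 / \<delta>, - (A $ 1 $ 2) / \<delta>], vector [- (A $ 2 $ 1) / \<delta>, A $ 1 $ 1 / \<delta>]]"
  have dA: "A $ 1 $ 1 * A $ 2 $ 2 - A $ 1 $ 2 * A $ 2 $ 1 = \<delta>" by (simp add: \<delta>_def det_2)
  have AA: "A ** A' = mat 1" "A' ** A = mat 1"
    unfolding vec_eq_iff forall_2 matrix_mult_nth_2
    using d0 dA by (simp_all add: A'_def mat_def divide_simps algebra_simps)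
  define S where "S = range (\<lambda>(i, l, m, k). A $ i $ l * A' $ m $ k)"
  have S: "finite S" "A $ i $ l * A' $ m $ k \<in> S" for i l m k
  proof -
    show "finite S" unfolding S_def by simp
    have "(\<lambda>(i, l, m, k). A $ i $ l * A' $ m $ k) (i, l, m, k) \<in> S" unfolding S_def by (rule rangeI)
    then show "A $ i $ l * A' $ m $ k \<in> S" by simp
  qed
  obtain r1 where r1: "algebraic_int r1" "r1 \<noteq> 0" "\<forall>x\<in>S. r1 * x \<in> ring_of_integers"
    using finite_multiplier[OF O S(1)] by (elim exE conjE)
  obtain r2 where r2: "algebraic_int r2" "r2 \<noteq> 0" "\<forall>x\<in>S. r2 * x \<in> P"
    using finite_multiplier[OF P S(1)] by (elim exE conjE)
  obtain r3 where r3: "algebraic_int r3" "r3 \<noteq> 0" "\<forall>x\<in>S. r3 * x \<in> Q"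
    using finite_multiplier[OF Q S(1)] by (elim exE conjE)
  define r where "r = r1 * r2 * r3"
  have rS: "r * x \<in> ring_of_integers" "r * x \<in> P" "r * x \<in> Q" if x: "x \<in> S" for x
  proof -
    have "(r2 * r3) * (r1 * x) \<in> ring_of_integers"
      by (rule fractional_idealD(3)[OF O algebraic_int_add_mult(2)[OF r2(1) r3(1)] bspec[OF r1(3) x]])
    then show "r * x \<in> ring_of_integers" unfolding r_def by (simp add: mult_ac)
    have "(r1 * r3) * (r2 * x) \<in> P"
      by (rule fractional_idealD(3)[OF P algebraic_int_add_mult(2)[OF r1(1) r3(1)] bspec[OF r2(3) x]])
    then show "r * x \<in> P" unfolding r_def by (simp add: mult_ac)
    have "(r1 * r2) * (r3 * x) \<in> Q"
      by (rule fractional_idealD(3)[OF Q algebraic_int_add_mult(2)[OF r1(1) r2(1)] bspec[OF r3(3) x]])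
    then show "r * x \<in> Q" unfolding r_def by (simp add: mult_ac)
  qed
  have r: "algebraic_int r" "r \<noteq> 0" unfolding r_def using r1 r2 r3 by (auto intro!: algebraic_int_add_mult(2))
  have "\<exists>\<gamma>\<in>Gamma0 emb N J. \<gamma> ** A = A ** M"
    if M: "det M \<in> totally_positive_units emb" "algebraic_int ((M $ 1 $ 1 - 1) / r)" "algebraic_int (M $ 1 $ 2 / r)"
      "algebraic_int (M $ 2 $ 1 / r)" "algebraic_int ((M $ 2 $ 2 - 1) / r)" for M
  proof (rule bexI)
    show "(A ** M ** A') ** A = A ** M" by (simp add: matrix_mul_assoc[symmetric] AA)
    have cancel: "x / r * (r * y) = x * y" for x y using r(2) by simp
    have ent: "(A ** M ** A') $ i $ k = (A ** A') $ i $ k +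
       ((M $ 1 $ 1 - 1) / r * (r * (A $ i $ 1 * A' $ 1 $ k)) + M $ 1 $ 2 / r * (r * (A $ i $ 1 * A' $ 2 $ k)) +
       (M $ 2 $ 1 / r * (r * (A $ i $ 2 * A' $ 1 $ k)) + (M $ 2 $ 2 - 1) / r * (r * (A $ i $ 2 * A' $ 2 $ k))))" for i k
      unfolding cancel by (simp add: matrix_mult_nth_2 algebra_simps)
    have mem: "(M $ 1 $ 1 - 1) / r * (r * (A $ i $ 1 * A' $ 1 $ k)) + M $ 1 $ 2 / r * (r * (A $ i $ 1 * A' $ 2 $ k)) +
       (M $ 2 $ 1 / r * (r * (A $ i $ 2 * A' $ 1 $ k)) + (M $ 2 $ 2 - 1) / r * (r * (A $ i $ 2 * A' $ 2 $ k))) \<in> X"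
      if X: "fractional_ideal X" "\<And>x. x \<in> S \<Longrightarrow> r * x \<in> X" for X i k
      by (intro fractional_idealD(2)[OF X(1)] fractional_idealD(3)[OF X(1)] M X(2) S(2))
    have "(A ** M ** A') $ i $ k \<in> ring_of_integers" for i k
      unfolding ent by (intro fractional_idealD(2)[OF O] mem[OF O] rS(1)) (simp_all add: AA mat_def)
    moreover have "(A ** M ** A') $ 1 $ 2 \<in> P"
      unfolding ent using mem[OF P rS(2), of 1 2] by (simp add: AA mat_def)
    moreover have "(A ** M ** A') $ 2 $ 1 \<in> Q"
      unfolding ent using mem[OF Q rS(3), of 2 1] by (simp add: AA mat_def)
    moreover have "det (A ** M ** A') = det M"
    proof -
      have "det (A ** M ** A') = det M * det (A ** A')" by (simp add: det_mul mult_ac)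
      then show ?thesis by (simp add: AA)
    qed
    ultimately show "A ** M ** A' \<in> Gamma0 emb N J" using M(1) unfolding Gamma0_def P_def Q_def by simp
  qed
  then show ?thesis using r by (intro exI[of _ r]) blast
qed

definition square_scale :: "'a \<Rightarrow> complex^'n \<Rightarrow> complex^'n" where
  "square_scale u \<tau> = (\<chi> j. of_real ((emb j u)\<^sup>2) * \<tau> $ j)"

lemma slash_translation_matrix:
  "slash emb k F (vector [vector [1, b], vector [0, 1]]) \<tau> = F (\<tau> + rv (emb_vec b))"
proof -
  have "moebius emb (vector [vector [1, b], vector [0, 1]]) \<tau> = \<tau> + rv (emb_vec b)"
    by (simp add: moebius_def vec_eq_iff rv_def)
  moreover have "jf (vector [vector [1, b], vector [0, 1]]) \<tau> j = 1" for j by (simp add: jf_def)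
  ultimately show ?thesis unfolding slash_alt by (simp add: det_2)
qed

lemma slash_unit_matrix:
  assumes u: "algebraic_int u" "algebraic_int (inverse u)" "u \<noteq> 0"
  shows "norm (slash emb k F (vector [vector [u, 0], vector [0, inverse u]]) \<tau>) = norm (F (square_scale u \<tau>))"
proof -
  have "moebius emb (vector [vector [u, 0], vector [0, inverse u]]) \<tau> = square_scale u \<tau>"
    using u(3) by (simp add: moebius_def square_scale_def vec_eq_iff power2_eq_square divide_inverse mult_ac)
  moreover have "(\<Prod>j\<in>UNIV. jf (vector [vector [u, 0], vector [0, inverse u]]) \<tau> j) = of_real (nm (inverse u))"
    by (simp add: jf_def nm_def)
  moreover have "\<bar>nm (inverse u)\<bar> = 1" using nm_unit[OF u(2)] u by simp
  ultimately show ?thesis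
    unfolding slash_alt norm_mult norm_power_int using u(3) by (simp add: det_2 norm_of_real del: nm_inverse)
qed

lemma slash_symmetries:
  assumes g: "\<And>\<gamma> \<tau>. \<gamma> \<in> Gamma0 emb N J \<Longrightarrow> \<tau> \<in> upper_half_space \<Longrightarrow> slash emb k g \<gamma> \<tau> = g \<tau>"
    and N: "fractional_ideal N" and J: "fractional_ideal J" and A: "A \<in> GL2_plus emb"
  shows "\<exists>r. algebraic_int r \<and> r \<noteq> 0 \<and>
    (\<forall>b\<in>ideal_scale r ring_of_integers. \<forall>\<tau>\<in>upper_half_space. slash emb k g A (\<tau> + rv (emb_vec b)) = slash emb k g A \<tau>) \<and>
    (\<forall>u. algebraic_int u \<longrightarrow> algebraic_int (inverse u) \<longrightarrow> u \<noteq> 0 \<longrightarrow> algebraic_int ((u - 1) / r) \<longrightarrow>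
      (\<forall>\<tau>\<in>upper_half_space. norm (slash emb k g A (square_scale u \<tau>)) = norm (slash emb k g A \<tau>)))"
proof -
  obtain r where r: "algebraic_int r" "r \<noteq> 0" and
    conj: "\<forall>M. det M \<in> totally_positive_units emb \<longrightarrow> algebraic_int ((M $ 1 $ 1 - 1) / r) \<longrightarrow> algebraic_int (M $ 1 $ 2 / r) \<longrightarrow>
      algebraic_int (M $ 2 $ 1 / r) \<longrightarrow> algebraic_int ((M $ 2 $ 2 - 1) / r) \<longrightarrow> (\<exists>\<gamma>\<in>Gamma0 emb N J. \<gamma> ** A = A ** M)"
    using conjugate_congruence[OF A N J] by (elim exE conjE)
  have inv: "slash emb k (slash emb k g A) M \<tau> = slash emb k g A \<tau>"
    if det: "det M = 1" and ex: "\<exists>\<gamma>\<in>Gamma0 emb N J. \<gamma> ** A = A ** M" and t: "\<tau> \<in> upper_half_space" for M \<tau>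
  proof -
    obtain \<gamma> where ga: "\<gamma> \<in> Gamma0 emb N J" "\<gamma> ** A = A ** M" using ex by (rule bexE)
    have "M \<in> GL2_plus emb" using det by (simp add: GL2_plus_def totally_positive_def)
    then have "slash emb k (slash emb k g A) M \<tau> = slash emb k g (\<gamma> ** A) \<tau>"
      unfolding ga(2) by (intro slash_mult A t)
    also have "\<dots> = slash emb k (slash emb k g \<gamma>) A \<tau>"
      by (rule slash_mult[OF Gamma0_GL2_plus[OF ga(1)] A t, symmetric])
    also have "\<dots> = slash emb k g A \<tau>" by (rule slash_cong[OF g[OF ga(1)] A t])
    finally show ?thesis .
  qed
  have "slash emb k g A (\<tau> + rv (emb_vec b)) = slash emb k g A \<tau>"
    if b: "b \<in> ideal_scale r ring_of_integers" and t: "\<tau> \<in> upper_half_space" for b \<tau>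
  proof -
    obtain x where x: "algebraic_int x" "b = r * x" using b unfolding ideal_scale_def by auto
    let ?M = "vector [vector [1, b], vector [0, 1]] :: 'a^2^2"
    have d: "det ?M = 1" by (simp add: det_2)
    have "\<exists>\<gamma>\<in>Gamma0 emb N J. \<gamma> ** A = A ** ?M"
      by (rule conj[rule_format]) (use d x r one_totally_positive_unit in simp_all)
    from inv[OF d this t] show ?thesis unfolding slash_translation_matrix .
  qed
  moreover have "norm (slash emb k g A (square_scale u \<tau>)) = norm (slash emb k g A \<tau>)"
    if u: "algebraic_int u" "algebraic_int (inverse u)" "u \<noteq> 0" "algebraic_int ((u - 1) / r)"
      and t: "\<tau> \<in> upper_half_space" for u \<tau>
  proof -
    let ?M = "vector [vector [u, 0], vector [0, inverse u]] :: 'a^2^2"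
    have d: "det ?M = 1" using u(3) by (simp add: det_2)
    have "algebraic_int (- inverse u * ((u - 1) / r))" using u by (intro algebraic_int_add_mult(2)) auto
    also have "- inverse u * ((u - 1) / r) = (inverse u - 1) / r" using u(3) r(2) by (simp add: field_simps)
    finally have iu: "algebraic_int ((inverse u - 1) / r)" .
    have "\<exists>\<gamma>\<in>Gamma0 emb N J. \<gamma> ** A = A ** ?M"
      by (rule conj[rule_format]) (use d u iu one_totally_positive_unit in simp_all)
    from inv[OF d this t] slash_unit_matrix[OF u(1-3), of k "slash emb k g A" \<tau>] show ?thesis by simp
  qed
  ultimately show ?thesis using r by (intro exI[of _ r]) blast
qed


section \<open>Expansions at the cusps\<close>

definition imaginary_unit_point :: "complex^'n" where
  "imaginary_unit_point = (\<chi> j. \<i>)"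

lemma imaginary_unit_point_simps [simp]:
  "imaginary_unit_point \<in> upper_half_space" "imaginary_unit_point $ j = \<i>"
  by (simp_all add: imaginary_unit_point_def upper_half_space_def)

lemma modular_formsD:
  assumes "g \<in> modular_forms emb k \<Gamma>"
  shows "holomorphic_on_upper_half_space g"
    "\<And>A \<tau>. A \<in> \<Gamma> \<Longrightarrow> \<tau> \<in> upper_half_space \<Longrightarrow> slash emb k g A \<tau> = g \<tau>"
    "\<And>A. CARD('n) = 1 \<Longrightarrow> A \<in> GL2_plus emb \<Longrightarrow>
      \<exists>L a. fractional_ideal L \<and> has_fourier_expansion emb L (slash emb k g A) a"
  using assms unfolding modular_forms_def by simp_all

lemma modular_form_symmetries:
  assumes g: "g \<in> modular_forms emb k (Gamma0 emb N J)"
    and N: "fractional_ideal N" and J: "fractional_ideal J" and A: "A \<in> GL2_plus emb"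
  shows "\<exists>r. algebraic_int r \<and> r \<noteq> 0 \<and>
    (\<forall>b\<in>ideal_scale r ring_of_integers. \<forall>\<tau>\<in>upper_half_space. slash emb k g A (\<tau> + rv (emb_vec b)) = slash emb k g A \<tau>) \<and>
    (\<forall>u. algebraic_int u \<longrightarrow> algebraic_int (inverse u) \<longrightarrow> u \<noteq> 0 \<longrightarrow> algebraic_int ((u - 1) / r) \<longrightarrow>
      (\<forall>\<tau>\<in>upper_half_space. norm (slash emb k g A (square_scale u \<tau>)) = norm (slash emb k g A \<tau>)))"
  by (rule slash_symmetries[OF modular_formsD(2)[OF g] N J A])

lemma periodic_slice_bounded:
  assumes P: "fractional_ideal (P :: 'a set)" and F: "continuous_on upper_half_space F"
    and per: "\<And>\<tau> b. \<tau> \<in> upper_half_space \<Longrightarrow> b \<in> P \<Longrightarrow> F (\<tau> + rv (emb_vec b)) = F \<tau>"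
  shows "\<exists>B. \<forall>x. norm (F (imaginary_unit_point + rv x)) \<le> B"
proof -
  obtain R where R: "R > 0" "\<forall>v::'n \<Rightarrow> real. \<exists>x\<in>P. \<forall>j. \<bar>v j - emb j x\<bar> \<le> R"
    using fractional_ideal_relatively_dense[OF P] by (elim exE conjE)
  define K where "K = (\<lambda>x. imaginary_unit_point + rv x) ` cbox (\<chi> j. - R) (\<chi> j. R)"
  have "compact K" unfolding K_def
    by (intro compact_continuous_image compact_cbox continuous_on_add continuous_on_const continuous_on_rv)
  moreover have "continuous_on K F" unfolding K_def by (rule continuous_on_subset[OF F]) auto
  ultimately have "bounded (F ` K)" by (intro compact_imp_bounded compact_continuous_image)
  then obtain B where B: "\<And>u. u \<in> K \<Longrightarrow> norm (F u) \<le> B" unfolding bounded_iff by auto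
  have "norm (F (imaginary_unit_point + rv x)) \<le> B" for x
  proof -
    obtain b where b: "b \<in> P" "\<forall>j. \<bar>x $ j - emb j b\<bar> \<le> R"
      using spec[OF R(2), of "\<lambda>j. x $ j"] by (rule bexE)
    have "x - emb_vec b \<in> cbox (\<chi> j. - R) (\<chi> j. R)"
    proof -
      have "- R \<le> x $ j - emb j b \<and> x $ j - emb j b \<le> R" for j using spec[OF b(2), of j] by linarith
      then show ?thesis by (simp add: mem_box_cart)
    qed
    then have "imaginary_unit_point + rv (x - emb_vec b) \<in> K" unfolding K_def by (rule imageI)
    then have "norm (F (imaginary_unit_point + rv (x - emb_vec b))) \<le> B" by (rule B)
    moreover have "F (imaginary_unit_point + rv (x - emb_vec b) + rv (emb_vec b)) = F (imaginary_unit_point + rv (x - emb_vec b))"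
      by (rule per[OF _ b(1)]) simp
    moreover have "imaginary_unit_point + rv (x - emb_vec b) + rv (emb_vec b) = imaginary_unit_point + rv x"
      by (simp add: vec_eq_iff rv_def)
    ultimately show ?thesis by simp
  qed
  then show ?thesis by (intro exI allI)
qed

lemma square_scale_rv:
  assumes "u \<noteq> 0"
  shows "square_scale u (\<tau> + rv (\<chi> j. x $ j / (emb j u)\<^sup>2)) = square_scale u \<tau> + rv x"
  using assms by (simp add: square_scale_def rv_def vec_eq_iff distrib_left)

lemma power_congruent_one:
  assumes v: "algebraic_int v" "algebraic_int ((v - 1) / r)"
  shows "algebraic_int ((v ^ m - 1) / (r :: 'a))"
proof (induction m)
  case (Suc m)
  have "algebraic_int (v * ((v ^ m - 1) / r) + (v - 1) / r)"
    by (rule algebraic_int_add_mult(1)[OF algebraic_int_add_mult(2)[OF v(1) Suc.IH] v(2)])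
  also have "v * ((v ^ m - 1) / r) + (v - 1) / r = (v ^ Suc m - 1) / r"
    by (simp add: diff_divide_distrib right_diff_distrib)
  finally show ?case .
qed simp

text \<open>Squares of powers of a dominant unit move the base point towards the boundary at all embeddings except one, where it escapes to infinity. The form stays bounded along this path, but a term with negative frequency at that embedding would grow.\<close>

lemma koecher:
  assumes n: "CARD('n) \<ge> 2" and r: "r \<noteq> 0" and B: "\<And>x. norm (F (imaginary_unit_point + rv x)) \<le> B"
    and unit: "\<And>u \<tau>. algebraic_int u \<Longrightarrow> algebraic_int (inverse u) \<Longrightarrow> u \<noteq> 0 \<Longrightarrow> algebraic_int ((u - 1) / r) \<Longrightarrow>
      \<tau> \<in> upper_half_space \<Longrightarrow> norm (F (square_scale u \<tau>)) = norm (F \<tau>)"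
    and xi: "emb j \<xi> < 0" and e: "e > 0"
  shows "\<exists>\<tau>\<in>upper_half_space. \<exists>B. (\<forall>x. norm (F (\<tau> + rv x)) \<le> B) \<and> B < e * norm (chr \<xi> \<tau>)"
proof -
  obtain v where "algebraic_int v \<and> algebraic_int (inverse v) \<and> v \<noteq> 0 \<and> algebraic_int ((v - 1) / r) \<and>
     \<bar>emb j v\<bar> > 1 \<and> (\<forall>i. i \<noteq> j \<longrightarrow> \<bar>emb i v\<bar> < 1)"
    using dominant_unit[OF n r] by (rule exE)
  then have v: "algebraic_int v" "algebraic_int (inverse v)" "v \<noteq> 0" "algebraic_int ((v - 1) / r)"
    "\<bar>emb j v\<bar> > 1" "\<And>i. i \<noteq> j \<Longrightarrow> \<bar>emb i v\<bar> < 1" by simp_all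
  define c where "c = - emb j \<xi>"
  have c: "c > 0" using xi by (simp add: c_def)
  define S where "S = (\<Sum>i\<in>UNIV. \<bar>emb i \<xi>\<bar>)"
  define t where "t = (emb j v)\<^sup>2"
  have t: "t > 1"
  proof -
    have "1 < \<bar>emb j v\<bar>\<^sup>2" using v(5) by (rule one_less_power) simp
    then show ?thesis by (simp add: t_def)
  qed
  obtain m where m: "(S + \<bar>B\<bar> / e) / c < t ^ m" using real_arch_pow[OF t] by (rule exE)
  define u where "u = v ^ m"
  have u: "algebraic_int u" "algebraic_int (inverse u)" "u \<noteq> 0" "algebraic_int ((u - 1) / r)"
    unfolding u_def power_inverse[symmetric] using v(1-4)
    by (auto intro!: algebraic_int_power power_congruent_one)
  let ?\<tau> = "square_scale u imaginary_unit_point"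
  have Fb: "norm (F (?\<tau> + rv x)) \<le> B" for x
  proof -
    have "norm (F (square_scale u (imaginary_unit_point + rv (\<chi> j. x $ j / (emb j u)\<^sup>2)))) \<le> B"
      by (subst unit[OF u]) (simp_all add: B)
    then show ?thesis by (simp only: square_scale_rv[OF u(3)])
  qed
  have tau: "?\<tau> \<in> upper_half_space" using u(3) by (simp add: upper_half_space_def square_scale_def)
  have "(\<Sum>i\<in>UNIV. emb i \<xi> * Im (?\<tau> $ i)) \<le> - c * t ^ m + S"
  proof -
    have "emb i \<xi> * Im (?\<tau> $ i) \<le> (if i = j then - c * t ^ m else 0) + \<bar>emb i \<xi>\<bar>" for i
    proof (cases "i = j")
      case True
      have "emb j \<xi> * Im (?\<tau> $ j) = - c * t ^ m"
        by (simp add: c_def t_def square_scale_def u_def power_mult[symmetric] mult.commute)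
      then show ?thesis using True by simp
    next
      case False
      have "(emb i u)\<^sup>2 \<le> 1"
        unfolding u_def using v(6)[OF False] by (simp add: power_le_one power_abs abs_square_le_1)
      then have "\<bar>emb i \<xi> * (emb i u)\<^sup>2\<bar> \<le> \<bar>emb i \<xi>\<bar> * 1" unfolding abs_mult by (intro mult_left_mono) auto
      then show ?thesis using False by (simp add: square_scale_def)
    qed
    then have "(\<Sum>i\<in>UNIV. emb i \<xi> * Im (?\<tau> $ i)) \<le> (\<Sum>i\<in>UNIV. (if i = j then - c * t ^ m else 0) + \<bar>emb i \<xi>\<bar>)"
      by (rule sum_mono)
    then show ?thesis by (simp add: sum.distrib S_def)
  qed
  moreover have "c * t ^ m > S + \<bar>B\<bar> / e" using m c by (simp add: divide_less_eq mult.commute)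
  ultimately have sum: "(\<Sum>i\<in>UNIV. emb i \<xi> * Im (?\<tau> $ i)) < - (\<bar>B\<bar> / e)" by linarith
  have "B < e * norm (chr \<xi> ?\<tau>)"
  proof -
    let ?s = "- (\<Sum>i\<in>UNIV. emb i \<xi> * Im (?\<tau> $ i))"
    have s: "\<bar>B\<bar> / e < ?s" using sum by linarith
    have s0: "0 < ?s" using s e by (meson abs_ge_zero divide_nonneg_pos le_less_trans)
    have "1 * ?s \<le> 2 * pi * ?s" using s0 pi_gt3 by (intro mult_right_mono) auto
    also have "\<dots> < exp (2 * pi * ?s)" using exp_ge_add_one_self[of "2 * pi * ?s"] by linarith
    finally have "\<bar>B\<bar> / e < norm (chr \<xi> ?\<tau>)" using s unfolding norm_chr by simp
    then have "\<bar>B\<bar> < e * norm (chr \<xi> ?\<tau>)" using e by (simp add: divide_less_eq mult.commute)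
    then show ?thesis by linarith
  qed
  then show ?thesis using tau Fb by blast
qed

text \<open>In degree one there are no units to use, and boundedness at the cusp takes their place.\<close>

lemma bounded_degree_one:
  assumes n: "CARD('n) = 1" and B: "\<And>\<tau>. (\<And>j. Im (\<tau> $ j) \<ge> 1) \<Longrightarrow> norm (F \<tau>) \<le> B"
    and xi: "emb j \<xi> < 0" and e: "e > 0"
  shows "\<exists>\<tau>\<in>upper_half_space. \<exists>B. (\<forall>x. norm (F (\<tau> + rv x)) \<le> B) \<and> B < e * norm (chr \<xi> \<tau>)"
proof -
  have U: "(UNIV :: 'n set) = {j}" using n by (metis UNIV_I card_1_singletonE singletonD)
  define c where "c = - emb j \<xi>"
  have c: "c > 0" using xi by (simp add: c_def)
  define Y where "Y = 1 + \<bar>B\<bar> / (e * c)"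
  have Y: "Y \<ge> 1" unfolding Y_def using e c by simp
  define \<tau> :: "complex^'n" where "\<tau> = (\<chi> j. \<i> * of_real Y)"
  have "\<tau> \<in> upper_half_space" using Y by (simp add: \<tau>_def upper_half_space_def)
  moreover have "norm (F (\<tau> + rv x)) \<le> B" for x by (rule B) (use Y in \<open>simp add: \<tau>_def rv_def\<close>)
  moreover have "B < e * norm (chr \<xi> \<tau>)"
  proof -
    have s: "(\<Sum>i\<in>UNIV. emb i \<xi> * Im (\<tau> $ i)) = - (c * Y)" unfolding U by (simp add: \<tau>_def c_def)
    have "c * Y = c + \<bar>B\<bar> / e" using c e by (simp add: Y_def distrib_left)
    then have "\<bar>B\<bar> / e < c * Y" using c by linarith
    also have "1 * (c * Y) \<le> 2 * pi * (c * Y)" using c Y pi_gt3 by (intro mult_right_mono) auto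
    also have "\<dots> < exp (2 * pi * (c * Y))" using exp_ge_add_one_self[of "2 * pi * (c * Y)"] by linarith
    also have "\<dots> = norm (chr \<xi> \<tau>)" unfolding norm_chr s by simp
    finally have "\<bar>B\<bar> < e * norm (chr \<xi> \<tau>)" using e by (simp add: divide_less_eq mult.commute)
    then show ?thesis by linarith
  qed
  ultimately show ?thesis by blast
qed

theorem slash_fourier_expansion:
  assumes g: "g \<in> modular_forms emb k (Gamma0 emb N J)" and N: "fractional_ideal N" and J: "fractional_ideal J"
    and A: "A \<in> GL2_plus emb" and P: "fractional_ideal (P :: 'a set)"
    and per: "\<And>\<tau> b. \<tau> \<in> upper_half_space \<Longrightarrow> b \<in> P \<Longrightarrow> slash emb k g A (\<tau> + rv (emb_vec b)) = slash emb k g A \<tau>"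
  shows "\<exists>a. has_fourier_expansion emb (trace_dual P) (slash emb k g A) a"
proof -
  let ?F = "slash emb k g A"
  have hol: "line_holomorphic ?F" by (rule line_holomorphic_slash[OF modular_formsD(1)[OF g] A])
  then have cont: "continuous_on upper_half_space ?F" by (simp add: line_holomorphic_def)
  have small: "\<exists>\<tau>\<in>upper_half_space. \<exists>B. (\<forall>x. norm (?F (\<tau> + rv x)) \<le> B) \<and> B < e * norm (chr \<xi> \<tau>)"
    if xi: "\<xi> \<noteq> 0" "\<not> totally_positive emb \<xi>" and e: "e > 0" for \<xi> e
  proof -
    obtain j where "\<not> emb j \<xi> > 0" using xi(2) by (auto simp: totally_positive_def)
    moreover have "emb j \<xi> \<noteq> 0" using xi(1) by simp
    ultimately have neg: "emb j \<xi> < 0" by linarith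
    show ?thesis
    proof (cases "CARD('n) = 1")
      case True
      obtain L a where a: "has_fourier_expansion emb L ?F a"
        using modular_formsD(3)[OF g True A] by (elim exE conjE)
      obtain B where B: "\<forall>\<tau>'. (\<forall>j. Im (imaginary_unit_point $ j) \<le> Im (\<tau>' $ j)) \<longrightarrow> norm (?F \<tau>') \<le> B"
        using fourier_expansion_bounded[OF a imaginary_unit_point_simps(1)] by (rule exE)
      show ?thesis by (rule bounded_degree_one[OF True _ neg e, where B = B]) (use B in simp)
    next
      case False
      then have n: "CARD('n) \<ge> 2" by (metis One_nat_def Suc_leI le_neq_implies_less numeral_2_eq_2 one_le_card_finite)
      obtain r where "algebraic_int r" and r: "r \<noteq> 0" and "\<forall>b\<in>ideal_scale r ring_of_integers. \<forall>\<tau>\<in>upper_half_space.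
          ?F (\<tau> + rv (emb_vec b)) = ?F \<tau>" and unit: "\<forall>u. algebraic_int u \<longrightarrow> algebraic_int (inverse u) \<longrightarrow> u \<noteq> 0 \<longrightarrow> algebraic_int ((u - 1) / r) \<longrightarrow>
         (\<forall>\<tau>\<in>upper_half_space. norm (?F (square_scale u \<tau>)) = norm (?F \<tau>))"
        using modular_form_symmetries[OF g N J A] by (elim exE conjE)
      obtain B where B: "\<forall>x. norm (?F (imaginary_unit_point + rv x)) \<le> B"
        by (rule exE[OF periodic_slice_bounded[OF P cont per]])
      show ?thesis by (rule koecher[OF n r _ _ neg e, where B = B]) (use B unit in simp_all)
    qed
  qed
  show ?thesis by (rule fourier_expansion[OF P hol per small])
qed

lemma slash_one: "slash emb k g (mat 1) \<tau> = g \<tau>"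
proof -
  have e: "(mat 1 :: 'a^2^2) = vector [vector [1, 0], vector [0, 1]]"
    by (simp add: vec_eq_iff forall_2 mat_def)
  have z: "\<tau> + rv (emb_vec 0) = \<tau>" by (simp add: rv_def vec_eq_iff)
  show ?thesis unfolding e slash_translation_matrix z ..
qed

section \<open>The Fourier coefficients of an adelic form\<close>

lemma form_fourier_expansion:
  assumes reps: "strict_class_reps emb h I" and l: "l \<in> {1..h}" and N: "fractional_ideal N"
    and g: "g \<in> modular_forms emb k (Gamma0 emb N (I l))"
  shows "has_fourier_expansion emb (I l) g (fourier_coeff emb (I l) g)"
proof -
  have J: "fractional_ideal (I l)" using reps l by (simp add: strict_class_reps_def)
  define P where "P = ideal_mult (ideal_inverse (I l)) (ideal_inverse (different emb))"
  have P: "fractional_ideal P" "trace_dual P = I l" unfolding P_def by (rule translation_lattice[OF reps J])+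
  have one: "(mat 1 :: 'a^2^2) \<in> GL2_plus emb" by (simp add: GL2_plus_def totally_positive_def)
  have sl: "slash emb k g (mat 1) = g" by (rule ext) (rule slash_one)
  have per: "g (\<tau> + rv (emb_vec b)) = g \<tau>" if "\<tau> \<in> upper_half_space" "b \<in> P" for \<tau> b
  proof -
    have "vector [vector [1, b], vector [0, 1]] \<in> Gamma0 emb N (I l)"
      using that(2) one_totally_positive_unit by (simp add: Gamma0_def P_def det_2 ideal_mult_zero)
    from modular_formsD(2)[OF g this that(1)] show ?thesis by (simp only: slash_translation_matrix)
  qed
  have "\<exists>a. has_fourier_expansion emb (I l) g a"
    using slash_fourier_expansion[OF g N J one P(1)] per unfolding sl P(2) by simp
  then show ?thesis unfolding fourier_coeff_def by (rule someI_ex)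
qed

text \<open>Diagonal matrices with a totally positive unit lie in the congruence subgroup, and expansions are unique.\<close>

lemma fourier_coefficient_unit:
  assumes L: "fractional_ideal (L :: 'a set)" and g: "g \<in> modular_forms emb k (Gamma0 emb N J)"
    and a: "has_fourier_expansion emb L g a" and u: "u \<in> totally_positive_units emb" and xi: "\<xi> \<in> tpos_in L"
  shows "a (u * \<xi>) = a \<xi>"
proof -
  note U = totally_positive_unitsD[OF u]
  have up: "emb j u > 0" for j using U(1) by (simp add: totally_positive_def)
  define s where "s \<tau> = (\<chi> j. of_real (emb j u) * \<tau> $ j)" for \<tau> :: "complex^'n"
  have gs: "g (s \<tau>) = g \<tau>" if t: "\<tau> \<in> upper_half_space" for \<tau>
  proof -
    let ?M = "vector [vector [u, 0], vector [0, 1]] :: 'a^2^2"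
    have "?M \<in> Gamma0 emb N J" using u U(3) by (simp add: Gamma0_def det_2 ideal_mult_zero)
    from modular_formsD(2)[OF g this t] have "slash emb k g ?M \<tau> = g \<tau>" .
    moreover have "moebius emb ?M \<tau> = s \<tau>" by (simp add: moebius_def s_def)
    moreover have "jf ?M \<tau> j = 1" for j by (simp add: jf_def)
    ultimately show ?thesis unfolding slash_alt by (simp add: det_2 U(5))
  qed
  have su: "s \<tau> \<in> upper_half_space" if "\<tau> \<in> upper_half_space" for \<tau>
    using that up by (simp add: s_def upper_half_space_def)
  have bij: "bij_betw (\<lambda>\<eta>. u * \<eta>) (tpos_in L) (tpos_in L)"
  proof (rule bij_betw_byWitness[of _ "\<lambda>\<eta>. inverse u * \<eta>"])
    show "(\<lambda>\<eta>. u * \<eta>) ` tpos_in L \<subseteq> tpos_in L" "(\<lambda>\<eta>. inverse u * \<eta>) ` tpos_in L \<subseteq> tpos_in L"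
      using fractional_idealD(3)[OF L U(3)] fractional_idealD(3)[OF L U(4)] up
      by (auto simp: tpos_in_def totally_positive_def)
  qed (use U(2) in \<open>auto simp: mult.assoc[symmetric]\<close>)
  define b where "b \<eta> = a (inverse u * \<eta>)" for \<eta>
  have "has_fourier_expansion emb L g b" unfolding has_fourier_expansion_chr
  proof
    fix \<tau> :: "complex^'n" assume t: "\<tau> \<in> upper_half_space"
    have "((\<lambda>\<eta>. a \<eta> * chr \<eta> (s \<tau>)) has_sum (g \<tau> - a 0)) (tpos_in L)"
      using bspec[OF a[unfolded has_fourier_expansion_chr] su[OF t]] unfolding gs[OF t] .
    moreover have "b (u * \<eta>) * chr (u * \<eta>) \<tau> = a \<eta> * chr \<eta> (s \<tau>)" for \<eta>
    proof -
      have "inverse u * (u * \<eta>) = \<eta>" using U(2) by simp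
      moreover have "chr (u * \<eta>) \<tau> = chr \<eta> (s \<tau>)" by (simp add: chr_def s_def mult_ac)
      ultimately show ?thesis by (simp only: b_def)
    qed
    ultimately have "((\<lambda>\<eta>. b (u * \<eta>) * chr (u * \<eta>) \<tau>) has_sum (g \<tau> - b 0)) (tpos_in L)" by (simp add: b_def)
    then show "((\<lambda>\<eta>. b \<eta> * chr \<eta> \<tau>) has_sum (g \<tau> - b 0)) (tpos_in L)"
      by (simp only: has_sum_reindex_bij_betw[OF bij, of "\<lambda>\<eta>. b \<eta> * chr \<eta> \<tau>"])
  qed
  moreover have "continuous_on upper_half_space g"
  proof -
    have "isCont g \<tau>" if tau: "\<tau> \<in> upper_half_space" for \<tau>
      using bspec[OF modular_formsD(1)[OF g, unfolded holomorphic_on_upper_half_space_def] tau] has_derivative_continuous by blast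
    then show ?thesis by (intro continuous_at_imp_continuous_on) blast
  qed
  moreover have "u * \<xi> \<in> tpos_in L" using bij_betwE[OF bij] xi by blast
  ultimately have "a (u * \<xi>) = b (u * \<xi>)" by (intro fourier_expansion_unique[OF L _ a])
  moreover have "inverse u * (u * \<xi>) = \<xi>" using U(2) by simp
  ultimately show ?thesis by (simp only: b_def)
qed

lemma ideal_inverse_scale:
  assumes "(x :: 'a) \<noteq> 0"
  shows "ideal_inverse (ideal_scale x J) = ideal_scale (inverse x) (ideal_inverse J)"
proof (intro equalityI subsetI)
  fix y assume y: "y \<in> ideal_inverse (ideal_scale x J)"
  have "x * y \<in> ideal_inverse J" unfolding ideal_inverse_def
  proof (intro CollectI ballI)
    fix z assume "z \<in> J"
    then have "y * (x * z) \<in> ring_of_integers" using y ideal_scale_mem unfolding ideal_inverse_def by blast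
    then show "x * y * z \<in> ring_of_integers" by (simp add: mult_ac)
  qed
  then have "inverse x * (x * y) \<in> ideal_scale (inverse x) (ideal_inverse J)" by (rule ideal_scale_mem)
  then show "y \<in> ideal_scale (inverse x) (ideal_inverse J)" using assms by (simp add: mult.assoc[symmetric])
next
  fix y assume "y \<in> ideal_scale (inverse x) (ideal_inverse J)"
  then obtain w where w: "w \<in> ideal_inverse J" "y = inverse x * w" unfolding ideal_scale_def by (rule imageE)
  show "y \<in> ideal_inverse (ideal_scale x J)" unfolding ideal_inverse_def
  proof (intro CollectI ballI)
    fix z assume "z \<in> ideal_scale x J"
    then obtain t where t: "t \<in> J" "z = x * t" unfolding ideal_scale_def by (rule imageE)
    have "w * t \<in> ring_of_integers" using w(1) t(1) unfolding ideal_inverse_def by blast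
    moreover have "y * z = w * t" using assms by (simp add: w(2) t(2))
    ultimately show "y * z \<in> ring_of_integers" by simp
  qed
qed

lemma ideal_scale_eq_unit:
  assumes X: "fractional_ideal (X :: 'a set)" and eq: "ideal_scale x X = ideal_scale y X" and y: "y \<noteq> 0"
  shows "algebraic_int (x / y)"
proof (rule multiplier_algebraic_int[OF X])
  fix z assume "z \<in> X"
  then have "x * z \<in> ideal_scale y X" unfolding eq[symmetric] by (rule ideal_scale_mem)
  then obtain w where w: "w \<in> X" "x * z = y * w" unfolding ideal_scale_def by (rule imageE)
  have "x / y * z = w" using w(2) y by (simp add: field_simps)
  then show "x / y * z \<in> X" using w(1) by simp
qed

text \<open>The ideal determines the strict class, because fractional ideals are invertible, and its generator up to a totally positive unit, under which the coefficient and the norm are invariant.\<close>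

lemma adelic_fourier_coeff_eq:
  assumes reps: "strict_class_reps emb h I" and l: "l \<in> {1..h}" and xi: "\<xi> \<in> tpos_in (I l)"
    and g: "f l \<in> modular_forms emb k (Gamma0 emb N (I l))" and N: "fractional_ideal N"
  defines "m \<equiv> ideal_scale \<xi> (ideal_inverse (I l))"
  shows "norm (adelic_fourier_coeff emb h I k m f) =
    real (ideal_norm m) powr (of_int k / 2) * norm (fourier_coeff emb (I l) (f l) \<xi>) * nm \<xi> powr (- (of_int k / 2))"
proof -
  define rep where "rep l \<xi> \<longleftrightarrow> \<xi> \<in> I l \<and> totally_positive emb \<xi> \<and> m = ideal_scale \<xi> (ideal_inverse (I l))" for l \<xi>
  have J: "fractional_ideal (I l)" if "l \<in> {1..h}" for l using reps that by (simp add: strict_class_reps_def)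
  have tp: "totally_positive emb \<xi>" "\<xi> \<in> I l" using xi by (auto simp: tpos_in_def)
  have x0: "\<xi> \<noteq> 0" by (rule totally_positive_nonzero[OF tp(1)])
  have rep: "rep l \<xi>" unfolding rep_def m_def using tp by simp
  have inv: "ideal_inverse m = ideal_scale (inverse \<eta>) (I i)" if "rep i \<eta>" "i \<in> {1..h}" for i \<eta>
    using that totally_positive_nonzero[of \<eta>] unfolding rep_def
    by (simp add: ideal_inverse_scale ideal_inverse_inverse[OF reps J])
  have tpi: "totally_positive emb (inverse \<eta>)" if "totally_positive emb \<eta>" for \<eta>
    using that by (simp add: totally_positive_def)
  have mi: "fractional_ideal (ideal_inverse m)"
    unfolding inv[OF rep l] by (rule fractional_ideal_scale'[OF J[OF l]]) (use x0 in simp)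
  have ex1: "\<exists>!i. i \<in> {1..h} \<and> (\<exists>\<xi>. totally_positive emb \<xi> \<and> ideal_inverse m = ideal_scale \<xi> (I i))"
    using reps mi unfolding strict_class_reps_def by blast
  have the: "(THE i. i \<in> {1..h} \<and> (\<exists>\<xi>. rep i \<xi>)) = l"
  proof (rule the_equality)
    show "l \<in> {1..h} \<and> (\<exists>\<xi>. rep l \<xi>)" using l rep by blast
    fix i assume i: "i \<in> {1..h} \<and> (\<exists>\<xi>. rep i \<xi>)"
    then obtain \<eta> where eta: "rep i \<eta>" "i \<in> {1..h}" by blast
    have "totally_positive emb (inverse \<eta>)" using eta(1) tpi unfolding rep_def by simp
    then have "i \<in> {1..h} \<and> (\<exists>\<xi>. totally_positive emb \<xi> \<and> ideal_inverse m = ideal_scale \<xi> (I i))"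
      using inv[OF eta] eta(2) by blast
    moreover have "l \<in> {1..h} \<and> (\<exists>\<xi>. totally_positive emb \<xi> \<and> ideal_inverse m = ideal_scale \<xi> (I l))"
      using inv[OF rep l] l tpi[OF tp(1)] by blast
    ultimately show "i = l" using ex1 by (elim ex1E) (metis (no_types, lifting))
  qed
  define \<xi>0 where "\<xi>0 = (SOME \<eta>. rep l \<eta>)"
  have "rep l \<xi>0" unfolding \<xi>0_def by (rule someI[of "rep l", OF rep])
  then have x1: "totally_positive emb \<xi>0" "ideal_scale \<xi>0 (ideal_inverse (I l)) = ideal_scale \<xi> (ideal_inverse (I l))"
    using rep unfolding rep_def by simp_all
  have x10: "\<xi>0 \<noteq> 0" by (rule totally_positive_nonzero[OF x1(1)])
  have X: "fractional_ideal (ideal_inverse (I l))" by (rule fractional_ideal_inverse[OF J[OF l]])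
  have u: "\<xi>0 / \<xi> \<in> totally_positive_units emb"
    unfolding totally_positive_units_def
  proof (intro CollectI conjI bexI[of _ "\<xi> / \<xi>0"])
    show "\<xi>0 / \<xi> \<in> ring_of_integers" using ideal_scale_eq_unit[OF X x1(2) x0] by simp
    show "\<xi> / \<xi>0 \<in> ring_of_integers" using ideal_scale_eq_unit[OF X x1(2)[symmetric] x10] by simp
    show "\<xi>0 / \<xi> * (\<xi> / \<xi>0) = 1" using x0 x10 by simp
    show "totally_positive emb (\<xi>0 / \<xi>)" using x1(1) tp(1) by (simp add: totally_positive_def)
  qed
  have c: "fourier_coeff emb (I l) (f l) \<xi>0 = fourier_coeff emb (I l) (f l) \<xi>"
    using fourier_coefficient_unit[OF J[OF l] g form_fourier_expansion[OF reps l N g] u xi] x0 by simp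
  have n: "nm \<xi>0 = nm \<xi>"
    using totally_positive_unitsD(5)[OF u] x0 by (simp add: divide_eq_1_iff)
  have "adelic_fourier_coeff emb h I k m f =
    of_real (real (ideal_norm m) powr (of_int k / 2)) * fourier_coeff emb (I l) (f l) \<xi>0 * of_real (nm \<xi>0 powr (- (of_int k / 2)))"
    unfolding adelic_fourier_coeff_def Let_def rep_def[symmetric] the \<xi>0_def nm_def ..
  then show ?thesis unfolding c n by (simp add: norm_mult)
qed

lemma powr_comparable:
  fixes p :: real
  assumes "0 < c1" "0 < c2" "0 < x" "c1 * x \<le> y" "y \<le> c2 * x"
  shows "y powr p \<le> (c1 powr p + c2 powr p) * x powr p"
proof (cases "p \<ge> 0")
  case True
  have "0 < y" using assms by (meson less_le_trans mult_pos_pos)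
  then have "y powr p \<le> (c2 * x) powr p" using True assms by (intro powr_mono2) auto
  also have "\<dots> = c2 powr p * x powr p" using assms by (simp add: powr_mult)
  also have "\<dots> \<le> (c1 powr p + c2 powr p) * x powr p" by (intro mult_right_mono) auto
  finally show ?thesis .
next
  case False
  then have "y powr p \<le> (c1 * x) powr p" using assms by (intro powr_mono2') auto
  also have "\<dots> = c1 powr p * x powr p" using assms by (simp add: powr_mult)
  also have "\<dots> \<le> (c1 powr p + c2 powr p) * x powr p" by (intro mult_right_mono) auto
  finally show ?thesis .
qed

lemma fourier_coefficient_bound:
  assumes reps: "strict_class_reps emb h I" and l: "l \<in> {1..h}"
    and g: "f l \<in> modular_forms emb k (Gamma0 emb N (I l))" and N: "fractional_ideal N"
    and c: "c > 0" "\<And>m. nonzero_integral_ideal m \<Longrightarrow>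
      norm (adelic_fourier_coeff emb h I k m f) \<le> c * real (ideal_norm m) powr s"
  shows "\<exists>C\<ge>0. \<forall>\<xi>\<in>tpos_in (I l). norm (fourier_coeff emb (I l) (f l) \<xi>) \<le> C * nm \<xi> powr s"
proof -
  have J: "fractional_ideal (I l)" using reps l by (simp add: strict_class_reps_def)
  let ?X = "ideal_inverse (I l)"
  have X: "fractional_ideal ?X" by (rule fractional_ideal_inverse[OF J])
  obtain c1 c2 where cc: "c1 > 0" "c2 > 0" "\<forall>\<xi>. \<xi> \<noteq> 0 \<longrightarrow> ideal_scale \<xi> ?X \<subseteq> ring_of_integers \<longrightarrow>
     c1 * \<bar>nm \<xi>\<bar> \<le> real (ideal_norm (ideal_scale \<xi> ?X)) \<and> real (ideal_norm (ideal_scale \<xi> ?X)) \<le> c2 * \<bar>nm \<xi>\<bar>"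
    using ideal_norm_bounds[OF X] by (elim exE conjE)
  define p where "p = s - of_int k / 2"
  define C where "C = c * (c1 powr p + c2 powr p)"
  have "norm (fourier_coeff emb (I l) (f l) \<xi>) \<le> C * nm \<xi> powr s" if xi: "\<xi> \<in> tpos_in (I l)" for \<xi>
  proof -
    have tp: "totally_positive emb \<xi>" "\<xi> \<in> I l" using xi by (auto simp: tpos_in_def)
    have x0: "\<xi> \<noteq> 0" by (rule totally_positive_nonzero[OF tp(1)])
    have nx: "nm \<xi> > 0" using tp(1) unfolding totally_positive_def nm_def by (simp add: prod_pos)
    define m where "m = ideal_scale \<xi> ?X"
    define n where "n = real (ideal_norm m)"
    have mO: "m \<subseteq> ring_of_integers"
    proof
      fix y assume "y \<in> m"
      then obtain z where z: "z \<in> ?X" "y = \<xi> * z" unfolding m_def ideal_scale_def by (rule imageE)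
      have "z * \<xi> \<in> ring_of_integers" using z(1) tp(2) unfolding ideal_inverse_def by blast
      then show "y \<in> ring_of_integers" by (simp add: z(2) mult.commute)
    qed
    have int: "nonzero_integral_ideal m"
      unfolding nonzero_integral_ideal_def using mO fractional_ideal_scale'[OF X x0] by (simp add: m_def)
    have nb: "c1 * nm \<xi> \<le> n" "n \<le> c2 * nm \<xi>"
      using cc(3)[rule_format, OF x0] mO nx unfolding m_def[symmetric] n_def by simp_all
    have n0: "n > 0" using nb(1) cc(1) nx by (meson less_le_trans mult_pos_pos)
    let ?a = "norm (fourier_coeff emb (I l) (f l) \<xi>)"
    have "n powr (of_int k / 2) * ?a * nm \<xi> powr (- (of_int k / 2)) \<le> c * n powr s"
      using c(2)[OF int] adelic_fourier_coeff_eq[where f = f and I = I and l = l and \<xi> = \<xi>, OF reps l xi g N] unfolding m_def n_def by simp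
    then have "(n powr (of_int k / 2) * ?a * nm \<xi> powr (- (of_int k / 2))) * (n powr (- (of_int k / 2)) * nm \<xi> powr (of_int k / 2))
        \<le> (c * n powr s) * (n powr (- (of_int k / 2)) * nm \<xi> powr (of_int k / 2))"
      by (rule mult_right_mono) simp
    also have "(n powr (of_int k / 2) * ?a * nm \<xi> powr (- (of_int k / 2))) * (n powr (- (of_int k / 2)) * nm \<xi> powr (of_int k / 2)) = ?a"
      using n0 nx x0 by (simp add: powr_minus field_simps)
    also have "(c * n powr s) * (n powr (- (of_int k / 2)) * nm \<xi> powr (of_int k / 2)) = c * (n powr p * nm \<xi> powr (of_int k / 2))"
    proof -
      have "n powr p = n powr s * n powr (- (of_int k / 2))" by (simp add: p_def flip: powr_add)
      then show ?thesis by (simp only: mult_ac)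
    qed
    also have "\<dots> \<le> c * ((c1 powr p + c2 powr p) * nm \<xi> powr p * nm \<xi> powr (of_int k / 2))"
      using c(1) powr_comparable[OF cc(1,2) nx nb, of p] by (intro mult_left_mono mult_right_mono) auto
    also have "\<dots> = C * nm \<xi> powr s"
      using nx by (simp add: C_def p_def powr_add[symmetric] mult.assoc)
    finally show ?thesis .
  qed
  moreover have "C \<ge> 0" unfolding C_def using c(1) by (simp add: add_nonneg_nonneg)
  ultimately show ?thesis by (intro exI[of _ C]) blast
qed

end

section \<open>Growth at the boundary\<close>

lemma powr_le_exp:
  fixes x s :: real
  assumes "s > 0" "x > 0"
  shows "x powr s \<le> exp (s * ln s - s) * exp x"
proof -
  have "ln (x / s) \<le> x / s - 1" using assms by (intro ln_le_minus_one) auto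
  then have "s * (ln x - ln s) \<le> s * (x / s - 1)" using assms by (intro mult_left_mono) (auto simp: ln_div)
  then have "s * ln x \<le> (s * ln s - s) + x" using assms by (simp add: algebra_simps)
  then show ?thesis using assms by (simp add: powr_def exp_add[symmetric])
qed

context totally_real_field
begin

lemma nm_powr:
  assumes "totally_positive emb \<xi>"
  shows "nm \<xi> powr s = (\<Prod>j\<in>UNIV. emb j \<xi> powr s)"
  unfolding nm_def by (rule prod_powr_distrib)

text \<open>The pairings of a frequency with a dual lattice basis are integers bounded by a multiple of its trace, so the sum is dominated by a product of geometric series.\<close>

lemma exponential_trace_sum:
  assumes L: "fractional_ideal (L :: 'a set)"
  shows "\<exists>C>0. \<forall>\<delta>. 0 < \<delta> \<longrightarrow> \<delta> \<le> 1 \<longrightarrow>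
    (\<lambda>\<xi>. exp (- (\<delta> * tr \<xi>))) summable_on tpos_in L \<and>
    (\<Sum>\<^sub>\<infinity>\<xi>\<in>tpos_in L. exp (- (\<delta> * tr \<xi>))) \<le> (C / \<delta>) ^ CARD('n)"
proof -
  obtain \<gamma> where "rat_basis \<gamma> \<and> (\<forall>i. \<gamma> i \<in> trace_dual L)"
    using fractional_ideal_rat_basis[OF fractional_ideal_trace_dual[OF L]] by (rule exE)
  then have ga: "rat_basis \<gamma>" "\<And>i. \<gamma> i \<in> trace_dual L" by simp_all
  define m where "m \<xi> = (\<lambda>i. \<lfloor>tr (\<xi> * \<gamma> i)\<rfloor>)" for \<xi>
  have m: "tr (x * \<gamma> i) = of_int (m x i)" if "x \<in> L" for x i
  proof -
    have "tr (\<gamma> i * x) \<in> \<int>" by (rule trace_dualD[OF ga(2) that])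
    then show ?thesis by (simp add: m_def of_int_floor mult.commute)
  qed
  have inj: "inj_on m (tpos_in L)"
  proof (rule inj_onI)
    fix x y assume xy: "x \<in> tpos_in L" "y \<in> tpos_in L" "m x = m y"
    then have L: "x \<in> L" "y \<in> L" by (auto simp: tpos_in_def)
    have "tr ((x - y) * \<gamma> i) = 0" for i
      using m[OF L(1), of i] m[OF L(2), of i] xy(3) by (simp add: left_diff_distrib)
    then have "x - y = 0" by (rule tr_nondegenerate[OF ga(1)])
    then show "x = y" by simp
  qed
  define n where "n = real CARD('n)"
  have n: "n \<ge> 1" unfolding n_def by (simp add: Suc_leI)
  define D where "D = 1 + (\<Sum>i\<in>UNIV. \<Sum>j\<in>UNIV. \<bar>emb j (\<gamma> i)\<bar>)"
  have D1: "D \<ge> 1" unfolding D_def by (simp add: sum_nonneg)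
  have Dle: "\<bar>emb j (\<gamma> i)\<bar> \<le> D" for i j
  proof -
    have "\<bar>emb j (\<gamma> i)\<bar> \<le> (\<Sum>j\<in>UNIV. \<bar>emb j (\<gamma> i)\<bar>)" by (rule member_le_sum) auto
    also have "\<dots> \<le> (\<Sum>i\<in>UNIV. \<Sum>j\<in>UNIV. \<bar>emb j (\<gamma> i)\<bar>)"
      by (rule member_le_sum[of i UNIV "\<lambda>i. \<Sum>j\<in>UNIV. \<bar>emb j (\<gamma> i)\<bar>"]) (auto intro: sum_nonneg)
    finally show ?thesis by (simp add: D_def)
  qed
  have nz: "n \<noteq> 0" "D \<noteq> 0" using n D1 by auto
  have nD: "n * D \<ge> 1" using mult_mono[OF n D1] n by simp
  have mle: "(\<Sum>i\<in>UNIV. \<bar>real_of_int (m \<xi> i)\<bar>) \<le> n * D * tr \<xi>" if xi: "\<xi> \<in> tpos_in L" for \<xi>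
  proof -
    have x: "\<xi> \<in> L" "\<And>j. emb j \<xi> > 0" using xi by (auto simp: tpos_in_def totally_positive_def)
    have "\<bar>real_of_int (m \<xi> i)\<bar> \<le> D * tr \<xi>" for i
    proof -
      have "\<bar>real_of_int (m \<xi> i)\<bar> = \<bar>\<Sum>j\<in>UNIV. emb j (\<xi> * \<gamma> i)\<bar>" by (simp only: m[OF x(1), symmetric] tr_def)
      also have "\<dots> \<le> (\<Sum>j\<in>UNIV. \<bar>emb j (\<xi> * \<gamma> i)\<bar>)" by (rule sum_abs)
      also have "\<dots> \<le> (\<Sum>j\<in>UNIV. D * emb j \<xi>)"
      proof (rule sum_mono)
        fix j
        have "\<bar>emb j (\<xi> * \<gamma> i)\<bar> = \<bar>emb j (\<gamma> i)\<bar> * emb j \<xi>" using x(2)[of j] by (simp add: abs_mult mult.commute)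
        also have "\<dots> \<le> D * emb j \<xi>" using x(2)[of j] by (intro mult_right_mono Dle) simp
        finally show "\<bar>emb j (\<xi> * \<gamma> i)\<bar> \<le> D * emb j \<xi>" .
      qed
      finally show ?thesis by (simp add: tr_def sum_distrib_left)
    qed
    then have "(\<Sum>i\<in>UNIV. \<bar>real_of_int (m \<xi> i)\<bar>) \<le> (\<Sum>i\<in>(UNIV::'n set). D * tr \<xi>)" by (rule sum_mono)
    then show ?thesis by (simp add: n_def mult.assoc)
  qed
  have main: "(\<lambda>\<xi>. exp (- (\<delta> * tr \<xi>))) summable_on tpos_in L \<and>
    (\<Sum>\<^sub>\<infinity>\<xi>\<in>tpos_in L. exp (- (\<delta> * tr \<xi>))) \<le> (4 * n * D / \<delta>) ^ CARD('n)" if d: "0 < \<delta>" "\<delta> \<le> 1" for \<delta>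
  proof -
    define x where "x = \<delta> / (n * D)"
    have x: "0 < x" "x \<le> 1" unfolding x_def using d nD by (auto simp: divide_le_eq)
    define q where "q = exp (- x)"
    have q: "0 < q" "q < 1" unfolding q_def using x by auto
    let ?p = "\<lambda>l::'n \<Rightarrow> int. \<Prod>k\<in>UNIV. q ^ nat \<bar>l k\<bar>"
    have pp: "?p l = exp (- (x * (\<Sum>i\<in>UNIV. \<bar>real_of_int (l i)\<bar>)))" for l
    proof -
      have "q ^ nat \<bar>l k\<bar> = exp (- (x * \<bar>real_of_int (l k)\<bar>))" for k
        unfolding q_def exp_of_nat_mult[symmetric] by (simp add: mult_ac)
      then have "?p l = exp (\<Sum>k\<in>UNIV. - (x * \<bar>real_of_int (l k)\<bar>))" by (simp only: exp_sum[OF finite])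
      then show ?thesis by (simp add: sum_negf sum_distrib_left)
    qed
    have le: "exp (- (\<delta> * tr \<xi>)) \<le> ?p (m \<xi>)" if "\<xi> \<in> tpos_in L" for \<xi>
    proof -
      have "x * (\<Sum>i\<in>UNIV. \<bar>real_of_int (m \<xi> i)\<bar>) \<le> x * (n * D * tr \<xi>)"
        using x mle[OF that] by (intro mult_left_mono) auto
      also have "\<dots> = \<delta> * tr \<xi>" using nz by (simp add: x_def)
      finally show ?thesis unfolding pp by simp
    qed
    have sU: "?p summable_on UNIV" by (rule summable_geometric_lattice(1)[OF q])
    have sI: "?p summable_on (m ` tpos_in L)" by (rule summable_on_subset_banach[OF sU subset_UNIV])
    then have sm: "(\<lambda>\<xi>. ?p (m \<xi>)) summable_on tpos_in L" by (simp add: summable_on_reindex[OF inj] o_def)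
    have p0: "?p l \<ge> 0" for l unfolding pp by simp
    have s: "(\<lambda>\<xi>. exp (- (\<delta> * tr \<xi>))) summable_on tpos_in L"
      by (rule summable_on_comparison_test[OF sm le]) simp_all
    have "(\<Sum>\<^sub>\<infinity>\<xi>\<in>tpos_in L. exp (- (\<delta> * tr \<xi>))) \<le> (\<Sum>\<^sub>\<infinity>\<xi>\<in>tpos_in L. ?p (m \<xi>))"
      by (rule infsum_mono[OF s sm le])
    also have "\<dots> = infsum ?p (m ` tpos_in L)" by (simp add: infsum_reindex[OF inj] o_def)
    also have "\<dots> \<le> infsum ?p UNIV" by (rule infsum_mono_neutral[OF sI sU]) (use p0 in auto)
    also have "\<dots> \<le> (2 / (1 - q)) ^ CARD('n)" by (rule summable_geometric_lattice(2)[OF q])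
    also have "\<dots> \<le> (4 * n * D / \<delta>) ^ CARD('n)"
    proof (rule power_mono)
      have "q \<le> 1 / (1 + x)" unfolding q_def exp_minus inverse_eq_divide
        using x exp_ge_add_one_self[of x] by (intro divide_left_mono) auto
      also have "\<dots> \<le> 1 - x / 2" using x by (simp add: field_simps power2_eq_square)
      finally have "x / 2 \<le> 1 - q" by linarith
      then have "2 / (1 - q) \<le> 2 / (x / 2)" using x q by (intro divide_left_mono) auto
      also have "\<dots> = 4 * n * D / \<delta>" using d nz by (simp add: x_def)
      finally show "2 / (1 - q) \<le> 4 * n * D / \<delta>" .
      show "0 \<le> 2 / (1 - q)" using q by simp
    qed
    finally show ?thesis using s by blast
  qed
  have "4 * n * D > 0" using n D1 by simp
  then show ?thesis using main by (intro exI[of _ "4 * n * D"]) blast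
qed

text \<open>Half of the exponential decay absorbs the polynomial growth of the coefficients; the other half sums over the lattice.\<close>

lemma growth_of_expansion:
  assumes L: "fractional_ideal (L :: 'a set)" and e: "has_fourier_expansion emb L F a"
    and s: "s > 0" and C: "C \<ge> 0" "\<And>\<xi>. \<xi> \<in> tpos_in L \<Longrightarrow> norm (a \<xi>) \<le> C * nm \<xi> powr s"
  shows "\<exists>K>0. \<forall>\<delta> \<tau>. 0 < \<delta> \<longrightarrow> \<delta> \<le> 1 \<longrightarrow> (\<forall>j. \<delta> \<le> Im (\<tau> $ j)) \<longrightarrow>
    norm (F \<tau>) \<le> K * (\<delta> powr (- (s + 1))) ^ CARD('n)"
proof -
  obtain C2 where C2: "C2 > 0" "\<forall>\<delta>. 0 < \<delta> \<longrightarrow> \<delta> \<le> 1 \<longrightarrow>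
    (\<lambda>\<xi>. exp (- (\<delta> * tr \<xi>))) summable_on tpos_in L \<and>
    (\<Sum>\<^sub>\<infinity>\<xi>\<in>tpos_in L. exp (- (\<delta> * tr \<xi>))) \<le> (C2 / \<delta>) ^ CARD('n)"
    using exponential_trace_sum[OF L] by (elim exE conjE)
  define K1 where "K1 = exp (s * ln s - s)"
  define K where "K = 1 + norm (a 0) + C * (K1 * C2) ^ CARD('n)"
  have K1: "K1 > 0" by (simp add: K1_def)
  have K: "K > 0" unfolding K_def using C(1) K1 C2(1) by (intro add_pos_nonneg) auto
  have main: "norm (F \<tau>) \<le> K * (\<delta> powr (- (s + 1))) ^ CARD('n)"
    if d: "0 < \<delta>" "\<delta> \<le> 1" and im: "\<forall>j. \<delta> \<le> Im (\<tau> $ j)" for \<delta> \<tau>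
  proof -
    let ?n = "CARD('n)"
    have t: "\<tau> \<in> upper_half_space" using d im by (auto simp: upper_half_space_def intro: less_le_trans)
    define E where "E = \<delta> powr (- (s + 1))"
    have "\<delta> powr 0 \<le> E" unfolding E_def using d s by (intro powr_mono') auto
    then have E1: "E \<ge> 1" using d by simp
    have Ed: "E = \<delta> powr (- s) / \<delta>" unfolding E_def using d by (simp add: powr_diff)
    define H where "H = C * (K1 * \<delta> powr (- s)) ^ ?n"
    have H0: "H \<ge> 0" unfolding H_def using C(1) K1 by simp
    have term_le: "norm (a \<xi> * chr \<xi> \<tau>) \<le> H * exp (- (\<delta> * tr \<xi>))" if xi: "\<xi> \<in> tpos_in L" for \<xi>
    proof -
      have x: "totally_positive emb \<xi>" "\<And>j. emb j \<xi> > 0" using xi by (auto simp: tpos_in_def totally_positive_def)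
      have "nm \<xi> powr s \<le> (\<Prod>j\<in>UNIV. (K1 * \<delta> powr (- s)) * exp (\<delta> * emb j \<xi>))"
        unfolding nm_powr[OF x(1)]
      proof (rule prod_mono, intro conjI)
        fix j
        have "(\<delta> * emb j \<xi>) powr s \<le> K1 * exp (\<delta> * emb j \<xi>)"
          unfolding K1_def using d x(2) by (intro powr_le_exp s) simp
        then have le: "\<delta> powr (- s) * (\<delta> powr s * emb j \<xi> powr s) \<le> \<delta> powr (- s) * (K1 * exp (\<delta> * emb j \<xi>))"
          using d x(2)[of j] by (intro mult_left_mono) (auto simp: powr_mult less_imp_le)
        have "\<delta> powr (- s) * \<delta> powr s = 1" using d by (simp flip: powr_add)
        then have "emb j \<xi> powr s = \<delta> powr (- s) * (\<delta> powr s * emb j \<xi> powr s)"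
          by (simp only: mult.assoc[symmetric] mult_1_left)
        also note le
        finally show "emb j \<xi> powr s \<le> (K1 * \<delta> powr (- s)) * exp (\<delta> * emb j \<xi>)"
          by (simp only: mult_ac)
      qed simp
      also have "\<dots> = (K1 * \<delta> powr (- s)) ^ ?n * exp (\<delta> * tr \<xi>)"
        by (simp add: prod.distrib exp_sum[symmetric] tr_def sum_distrib_left)
      finally have nmle: "nm \<xi> powr s \<le> (K1 * \<delta> powr (- s)) ^ ?n * exp (\<delta> * tr \<xi>)" .
      have chrle: "norm (chr \<xi> \<tau>) \<le> exp (- (2 * (\<delta> * tr \<xi>)))"
      proof -
        have "\<delta> * tr \<xi> \<le> (\<Sum>j\<in>UNIV. emb j \<xi> * Im (\<tau> $ j))"
          unfolding tr_def sum_distrib_left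
        proof (rule sum_mono)
          fix j
          show "\<delta> * emb j \<xi> \<le> emb j \<xi> * Im (\<tau> $ j)"
            using mult_left_mono[OF spec[OF im, of j] less_imp_le[OF x(2)[of j]]] by (simp add: mult.commute)
        qed
        moreover have "0 \<le> \<delta> * tr \<xi>" unfolding tr_def using d x(2) by (simp add: sum_nonneg less_imp_le)
        ultimately have "2 * (\<delta> * tr \<xi>) \<le> 2 * pi * (\<Sum>j\<in>UNIV. emb j \<xi> * Im (\<tau> $ j))"
          using pi_gt3 by (intro mult_mono) auto
        then show ?thesis unfolding norm_chr by simp
      qed
      have "norm (a \<xi> * chr \<xi> \<tau>) \<le> (C * ((K1 * \<delta> powr (- s)) ^ ?n * exp (\<delta> * tr \<xi>))) * exp (- (2 * (\<delta> * tr \<xi>)))"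
        unfolding norm_mult
      proof (rule mult_mono[OF _ chrle])
        show "norm (a \<xi>) \<le> C * ((K1 * \<delta> powr (- s)) ^ ?n * exp (\<delta> * tr \<xi>))"
          using C(2)[OF xi] mult_left_mono[OF nmle C(1)] by linarith
      qed (use C(1) K1 in auto)
      also have "\<dots> = H * (exp (\<delta> * tr \<xi>) * exp (- (2 * (\<delta> * tr \<xi>))))" by (simp only: H_def mult_ac)
      also have "exp (\<delta> * tr \<xi>) * exp (- (2 * (\<delta> * tr \<xi>))) = exp (- (\<delta> * tr \<xi>))"
        by (simp flip: exp_add)
      finally show ?thesis .
    qed
    note conj = mp[OF mp[OF spec[OF C2(2), of \<delta>] d(1)] d(2)]
    have sm: "(\<lambda>\<xi>. exp (- (\<delta> * tr \<xi>))) summable_on tpos_in L"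
      and si: "(\<Sum>\<^sub>\<infinity>\<xi>\<in>tpos_in L. exp (- (\<delta> * tr \<xi>))) \<le> (C2 / \<delta>) ^ ?n"
      by (rule conjunct1[OF conj], rule conjunct2[OF conj])
    have "(\<Sum>\<^sub>\<infinity>\<xi>\<in>tpos_in L. norm (a \<xi> * chr \<xi> \<tau>)) \<le> (\<Sum>\<^sub>\<infinity>\<xi>\<in>tpos_in L. H * exp (- (\<delta> * tr \<xi>)))"
      by (rule infsum_mono[OF fourier_expansion_summable(1)[OF e t] summable_on_cmult_right[OF sm] term_le])
    also have "\<dots> = H * (\<Sum>\<^sub>\<infinity>\<xi>\<in>tpos_in L. exp (- (\<delta> * tr \<xi>)))" by (rule infsum_cmult_right')
    also have "\<dots> \<le> H * (C2 / \<delta>) ^ ?n" by (rule mult_left_mono[OF si H0])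
    also have "\<dots> = C * (K1 * C2) ^ ?n * E ^ ?n"
    proof -
      have "(K1 * \<delta> powr (- s)) * (C2 / \<delta>) = (K1 * C2) * E" unfolding Ed by simp
      then have "(K1 * \<delta> powr (- s)) ^ ?n * (C2 / \<delta>) ^ ?n = (K1 * C2) ^ ?n * E ^ ?n"
        by (simp only: power_mult_distrib[symmetric])
      then show ?thesis unfolding H_def by (simp only: mult.assoc)
    qed
    finally have "norm (F \<tau>) \<le> norm (a 0) + C * (K1 * C2) ^ ?n * E ^ ?n"
      using fourier_expansion_summable(2)[OF e t] by linarith
    also have "\<dots> \<le> (1 + norm (a 0)) * E ^ ?n + C * (K1 * C2) ^ ?n * E ^ ?n"
    proof -
      have "(1 + norm (a 0)) * 1 \<le> (1 + norm (a 0)) * E ^ ?n"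
        using E1 by (intro mult_left_mono one_le_power) auto
      then show ?thesis by simp
    qed
    also have "\<dots> = K * E ^ ?n" by (simp add: K_def distrib_right)
    finally show ?thesis unfolding E_def .
  qed
  show ?thesis using K main by (intro exI[of _ K]) blast
qed

definition vertical :: "real \<Rightarrow> complex^'n" where
  "vertical Y = (\<chi> j. \<i> * of_real Y)"

text \<open>The point with imaginary parts \<open>Y\<close> goes to one with imaginary parts at least \<open>\<kappa> / Y\<close>, so the growth of the form loses against the automorphy factor by a power of \<open>Y\<close>.\<close>

lemma decay_at_cusp:
  assumes A: "A \<in> GL2_plus emb" and c0: "A $ 2 $ 1 \<noteq> 0" and k: "k \<ge> 0" and eps: "0 < \<epsilon>" "\<epsilon> < of_int k"
    and K: "K > 0" "\<And>\<delta> \<tau>. 0 < \<delta> \<Longrightarrow> \<delta> \<le> 1 \<Longrightarrow> (\<And>j. \<delta> \<le> Im (\<tau> $ j)) \<Longrightarrow>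
      norm (g \<tau>) \<le> K * (\<delta> powr (- (of_int k - \<epsilon>))) ^ CARD('n)"
  shows "\<exists>M. \<forall>Y\<ge>1. norm (slash emb k g A (vertical Y)) \<le> M * (Y powr (- \<epsilon>)) ^ CARD('n)"
proof -
  let ?n = "CARD('n)"
  obtain l where l: "k = int l" using k by (rule nonneg_int_cases)
  define c d where "c j = emb j (A $ 2 $ 1)" and "d j = emb j (A $ 2 $ 2)" for j
  have cj: "c j \<noteq> 0" for j using c0 by (simp add: c_def)
  define D where "D j = emb j (det A)" for j
  have D: "D j > 0" for j using A by (simp add: D_def GL2_plus_def totally_positive_def)
  define \<kappa> where "\<kappa> = Min (insert 1 (range (\<lambda>j. D j / ((c j)\<^sup>2 + (d j)\<^sup>2))))"
  have cd: "(c j)\<^sup>2 + (d j)\<^sup>2 > 0" for j using cj[of j] by (simp add: sum_power2_gt_zero_iff)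
  have ka: "\<kappa> > 0" "\<kappa> \<le> 1" "\<kappa> \<le> D j / ((c j)\<^sup>2 + (d j)\<^sup>2)" for j
  proof -
    show "\<kappa> > 0" unfolding \<kappa>_def using D cd by (subst Min_gr_iff) auto
    show "\<kappa> \<le> 1" unfolding \<kappa>_def by (rule Min_le) auto
    show "\<kappa> \<le> D j / ((c j)\<^sup>2 + (d j)\<^sup>2)" unfolding \<kappa>_def by (rule Min_le) auto
  qed
  define p where "p = of_int k - \<epsilon>"
  define G where "G = (\<Prod>j\<in>UNIV. \<bar>c j\<bar>)"
  have G: "G > 0" unfolding G_def using cj by (intro prod_pos) auto
  define Q where "Q = nm (det A) powr (of_int k / 2)"
  define M where "M = Q * (1 / G ^ l) * (K * (\<kappa> powr (- p)) ^ ?n)"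
  have main: "norm (slash emb k g A (vertical Y)) \<le> M * (Y powr (- \<epsilon>)) ^ ?n" if Y: "Y \<ge> 1" for Y
  proof -
    have v: "vertical Y \<in> upper_half_space" using Y by (simp add: vertical_def upper_half_space_def)
    have jf: "jf A (vertical Y) j = Complex (d j) (c j * Y)" for j
      by (simp add: jf_def vertical_def c_def d_def complex_eq_iff)
    have j1: "\<bar>c j\<bar> * Y \<le> norm (jf A (vertical Y) j)" for j
      using abs_Im_le_cmod[of "jf A (vertical Y) j"] Y unfolding jf by (simp add: abs_mult)
    have "(\<Prod>j\<in>(UNIV::'n set). \<bar>c j\<bar> * Y) \<le> (\<Prod>j\<in>UNIV. norm (jf A (vertical Y) j))"
      using j1 Y by (intro prod_mono) auto
    then have pl: "G * Y ^ ?n \<le> norm (\<Prod>j\<in>UNIV. jf A (vertical Y) j)" by (simp add: G_def prod.distrib prod_norm)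
    have f1: "norm ((\<Prod>j\<in>UNIV. jf A (vertical Y) j) powi (- k)) \<le> 1 / (G * Y ^ ?n) ^ l"
    proof -
      have GY: "0 < G * Y ^ ?n" using G Y by simp
      have "norm ((\<Prod>j\<in>UNIV. jf A (vertical Y) j) powi (- k)) = 1 / norm (\<Prod>j\<in>UNIV. jf A (vertical Y) j) ^ l"
        unfolding l power_int_minus power_int_of_nat norm_inverse norm_power by (rule inverse_eq_divide)
      also have "\<dots> \<le> 1 / (G * Y ^ ?n) ^ l"
        by (rule divide_left_mono[OF power_mono[OF pl less_imp_le[OF GY]] zero_le_one
          mult_pos_pos[OF zero_less_power[OF less_le_trans[OF GY pl]] zero_less_power[OF GY]]])
      finally show ?thesis .
    qed
    have im: "\<kappa> / Y \<le> Im (moebius emb A (vertical Y) $ j)" for j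
    proof -
      have sq: "(cmod (jf A (vertical Y) j))\<^sup>2 = (d j)\<^sup>2 + (c j * Y)\<^sup>2" unfolding jf cmod_power2 by simp
      have "(d j)\<^sup>2 * 1 \<le> (d j)\<^sup>2 * Y\<^sup>2" using Y by (intro mult_left_mono one_le_power) auto
      then have le: "(d j)\<^sup>2 + (c j * Y)\<^sup>2 \<le> ((c j)\<^sup>2 + (d j)\<^sup>2) * Y\<^sup>2" by (simp add: power_mult_distrib distrib_right)
      have pos: "0 < (d j)\<^sup>2 + (c j * Y)\<^sup>2" using cj[of j] Y by (simp add: add_nonneg_pos)
      have "\<kappa> / Y \<le> D j / ((c j)\<^sup>2 + (d j)\<^sup>2) / Y" using ka(3)[of j] Y by (intro divide_right_mono) auto
      also have "\<dots> = D j * Y / (((c j)\<^sup>2 + (d j)\<^sup>2) * Y\<^sup>2)" using Y by (simp add: power2_eq_square)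
      also have "\<dots> \<le> D j * Y / ((d j)\<^sup>2 + (c j * Y)\<^sup>2)"
        using le pos D[of j] Y cd[of j] by (intro divide_left_mono mult_pos_pos) auto
      also have "\<dots> = Im (moebius emb A (vertical Y) $ j)"
        unfolding Im_moebius[OF A v] sq by (simp add: D_def vertical_def)
      finally show ?thesis .
    qed
    have f2: "norm (g (moebius emb A (vertical Y))) \<le> K * (\<kappa> powr (- p)) ^ ?n * (Y powr p) ^ ?n"
    proof -
      have "norm (g (moebius emb A (vertical Y))) \<le> K * ((\<kappa> / Y) powr (- p)) ^ ?n"
        unfolding p_def using ka(1,2) Y by (intro K(2) im) (auto simp: divide_le_eq)
      also have "(\<kappa> / Y) powr (- p) = \<kappa> powr (- p) * Y powr p"
        using ka(1) Y by (simp add: powr_divide powr_minus field_simps)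
      finally show ?thesis by (simp only: power_mult_distrib mult.assoc)
    qed
    have "norm (slash emb k g A (vertical Y)) =
        Q * norm ((\<Prod>j\<in>UNIV. jf A (vertical Y) j) powi (- k)) * norm (g (moebius emb A (vertical Y)))"
      unfolding slash_alt norm_mult by (simp add: Q_def)
    also have "\<dots> \<le> Q * (1 / (G * Y ^ ?n) ^ l) * (K * (\<kappa> powr (- p)) ^ ?n * (Y powr p) ^ ?n)"
    proof (rule mult_mono)
      show "Q * norm ((\<Prod>j\<in>UNIV. jf A (vertical Y) j) powi (- k)) \<le> Q * (1 / (G * Y ^ ?n) ^ l)"
        by (rule mult_left_mono[OF f1]) (simp add: Q_def)
      show "0 \<le> Q * (1 / (G * Y ^ ?n) ^ l)" using G Y by (simp add: Q_def)
    qed (use f2 in simp_all)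
    also have "\<dots> = M * ((1 / Y ^ l) ^ ?n * (Y powr p) ^ ?n)"
      by (simp add: M_def power_mult_distrib power_divide power_mult[symmetric] mult.commute)
    also have "(1 / Y ^ l) ^ ?n * (Y powr p) ^ ?n = (Y powr (- \<epsilon>)) ^ ?n"
    proof -
      have "1 / Y ^ l * Y powr p = Y powr (- real l) * Y powr p"
        using Y by (simp add: powr_minus powr_realpow divide_inverse)
      also have "\<dots> = Y powr (- \<epsilon>)" unfolding powr_add[symmetric] by (simp add: p_def l)
      finally show ?thesis by (simp only: power_mult_distrib[symmetric])
    qed
    finally show ?thesis .
  qed
  show ?thesis using main by (intro exI[of _ M]) blast
qed

text \<open>The nonzero frequencies have trace bounded below, so all terms except the constant one decay exponentially.\<close>

lemma constant_term_zero:
  assumes L: "fractional_ideal (L :: 'a set)" and e: "has_fourier_expansion emb L F a" and eps: "\<epsilon> > 0"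
    and M: "\<And>Y. Y \<ge> 1 \<Longrightarrow> norm (F (vertical Y)) \<le> M * (Y powr (- \<epsilon>)) ^ CARD('n)"
  shows "a 0 = 0"
proof -
  obtain \<rho> where rho: "\<rho> > 0" "\<forall>x\<in>L. x \<noteq> 0 \<longrightarrow> (\<exists>j. \<bar>emb j x\<bar> \<ge> \<rho>)"
    using fractional_ideal_discrete[OF L] by (elim exE conjE)
  have v: "vertical Y \<in> upper_half_space" if "Y \<ge> 1" for Y
    using that by (simp add: vertical_def upper_half_space_def)
  define S where "S = (\<Sum>\<^sub>\<infinity>\<xi>\<in>tpos_in L. norm (a \<xi> * chr \<xi> (vertical 1)))"
  have tr_ge: "tr \<xi> \<ge> \<rho>" if xi: "\<xi> \<in> tpos_in L" for \<xi>
  proof -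
    have x: "totally_positive emb \<xi>" "\<xi> \<in> L" "\<And>j. emb j \<xi> > 0" using xi by (auto simp: tpos_in_def totally_positive_def)
    obtain j where "\<bar>emb j \<xi>\<bar> \<ge> \<rho>" using rho(2) x(2) totally_positive_nonzero[OF x(1)] by blast
    then have "\<rho> \<le> emb j \<xi>" using x(3)[of j] by simp
    also have "\<dots> \<le> tr \<xi>" unfolding tr_def by (rule member_le_sum) (use x(3) in \<open>auto intro: less_imp_le\<close>)
    finally show ?thesis .
  qed
  have bound: "norm (a 0) \<le> M * (real (Suc m) powr (- \<epsilon>)) ^ CARD('n) + S * exp (- (2 * pi * \<rho>)) ^ m" for m
  proof -
    let ?Y = "real (Suc m)"
    have Y: "?Y \<ge> 1" by simp
    have chr: "norm (chr \<xi> (vertical ?Y)) \<le> exp (- (2 * pi * \<rho>)) ^ m * norm (chr \<xi> (vertical 1))"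
      if xi: "\<xi> \<in> tpos_in L" for \<xi>
    proof -
      have e: "norm (chr \<xi> (vertical y)) = exp (- (2 * pi * (y * tr \<xi>)))" for y
        unfolding norm_chr by (simp add: vertical_def tr_def sum_distrib_right mult_ac flip: sum_distrib_left)
      have "2 * pi * (real m * \<rho>) \<le> 2 * pi * (real m * tr \<xi>)"
        using tr_ge[OF xi] by (intro mult_left_mono) auto
      moreover have "- (2 * pi * (?Y * tr \<xi>)) = - (2 * pi * (real m * tr \<xi>)) + - (2 * pi * (1 * tr \<xi>))"
        by (simp add: algebra_simps)
      moreover have "real m * - (2 * pi * \<rho>) = - (2 * pi * (real m * \<rho>))" by simp
      ultimately have "exp (- (2 * pi * (?Y * tr \<xi>))) \<le> exp (real m * - (2 * pi * \<rho>) + - (2 * pi * (1 * tr \<xi>)))"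
        unfolding exp_le_cancel_iff by linarith
      then show ?thesis unfolding e by (simp only: exp_add exp_of_nat_mult)
    qed
    let ?q = "exp (- (2 * pi * \<rho>)) ^ m"
    have "norm (F (vertical ?Y) - a 0) \<le> (\<Sum>\<^sub>\<infinity>\<xi>\<in>tpos_in L. norm (a \<xi> * chr \<xi> (vertical ?Y)))"
      by (rule fourier_expansion_summable(3)[OF e v[OF Y]])
    also have "\<dots> \<le> (\<Sum>\<^sub>\<infinity>\<xi>\<in>tpos_in L. ?q * norm (a \<xi> * chr \<xi> (vertical 1)))"
    proof (rule infsum_mono[OF fourier_expansion_summable(1)[OF e v[OF Y]] summable_on_cmult_right[OF fourier_expansion_summable(1)[OF e v[OF order_refl]]]])
      fix \<xi> assume xi: "\<xi> \<in> tpos_in L"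
      show "norm (a \<xi> * chr \<xi> (vertical ?Y)) \<le> ?q * norm (a \<xi> * chr \<xi> (vertical 1))"
        using mult_left_mono[OF chr[OF xi] norm_ge_zero[of "a \<xi>"]] by (simp only: norm_mult mult_ac)
    qed
    also have "\<dots> = ?q * S" unfolding S_def
      by (rule infsum_cmult_right')
    finally have "norm (a 0) \<le> norm (F (vertical ?Y)) + ?q * S"
      using norm_triangle_sub[of "a 0" "F (vertical ?Y)"] by (simp add: norm_minus_commute)
    then show ?thesis using M[OF Y] by (simp only: mult.commute[of S])
  qed
  have "(\<lambda>m. real (Suc m) powr (- \<epsilon>)) \<longlonglongrightarrow> 0"
    by (rule tendsto_neg_powr) (use eps filterlim_compose[OF filterlim_real_sequentially filterlim_Suc] in auto)
  then have "(\<lambda>m. (real (Suc m) powr (- \<epsilon>)) ^ CARD('n)) \<longlonglongrightarrow> 0" by (rule tendsto_null_power) simp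
  moreover have "(\<lambda>m. exp (- (2 * pi * \<rho>)) ^ m) \<longlonglongrightarrow> 0" using rho(1) by (intro LIMSEQ_power_zero) simp
  ultimately have "(\<lambda>m. M * (real (Suc m) powr (- \<epsilon>)) ^ CARD('n) + S * exp (- (2 * pi * \<rho>)) ^ m) \<longlonglongrightarrow> M * 0 + S * 0"
    by (intro tendsto_add tendsto_mult_left)
  then have "norm (a 0) \<le> M * 0 + S * 0" by (rule LIMSEQ_le_const) (use bound in blast)
  then show ?thesis by simp
qed

section \<open>Vanishing of the constant terms\<close>

text \<open>A lower triangular element of the congruence subgroup with a nonzero entry moves infinity to another cusp.\<close>

lemma move_cusp_from_infinity:
  assumes A: "A \<in> GL2_plus emb" and N: "fractional_ideal N" and J: "fractional_ideal (J :: 'a set)"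
    and g: "g \<in> modular_forms emb k (Gamma0 emb N J)"
  shows "\<exists>A'\<in>GL2_plus emb. A' $ 2 $ 1 \<noteq> 0 \<and> (\<forall>\<tau>\<in>upper_half_space. slash emb k g A \<tau> = slash emb k g A' \<tau>)"
proof (cases "A $ 2 $ 1 = 0")
  case False
  then show ?thesis using A by blast
next
  case True
  have "fractional_ideal (ideal_mult (ideal_mult N J) (different emb))"
    by (intro fractional_ideal_mult N J fractional_ideal_different)
  then obtain c where c: "c \<in> ideal_mult (ideal_mult N J) (different emb)" "c \<noteq> 0"
    using fractional_idealD(5) by blast
  define \<gamma> :: "'a^2^2" where "\<gamma> = vector [vector [1, 0], vector [c, 1]]"
  have ga: "\<gamma> \<in> Gamma0 emb N J"
    using c(1) one_totally_positive_unit by (simp add: \<gamma>_def Gamma0_def det_2 ideal_mult_zero)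
  have "det A \<noteq> 0" using A totally_positive_nonzero unfolding GL2_plus_def by blast
  then have "A $ 1 $ 1 \<noteq> 0" using True by (auto simp: det_2)
  then have "(\<gamma> ** A) $ 2 $ 1 \<noteq> 0" using c(2) True by (simp add: matrix_mult_nth_2 \<gamma>_def)
  moreover have "\<gamma> ** A \<in> GL2_plus emb" by (rule GL2_plus_mult[OF Gamma0_GL2_plus[OF ga] A])
  moreover have "slash emb k g A \<tau> = slash emb k g (\<gamma> ** A) \<tau>" if t: "\<tau> \<in> upper_half_space" for \<tau>
  proof -
    have "slash emb k g (\<gamma> ** A) \<tau> = slash emb k (slash emb k g \<gamma>) A \<tau>"
      by (rule slash_mult[OF Gamma0_GL2_plus[OF ga] A t, symmetric])
    also have "\<dots> = slash emb k g A \<tau>" by (rule slash_cong[OF modular_formsD(2)[OF g ga] A t])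
    finally show ?thesis by simp
  qed
  ultimately show ?thesis by blast
qed

lemma cusp_form_if_moderate_growth:
  assumes g: "g \<in> modular_forms emb k (Gamma0 emb N J)" and N: "fractional_ideal N" and J: "fractional_ideal (J :: 'a set)"
    and k: "k \<ge> 0" and eps: "0 < \<epsilon>" "\<epsilon> < of_int k"
    and K: "K > 0" "\<And>\<delta> \<tau>. 0 < \<delta> \<Longrightarrow> \<delta> \<le> 1 \<Longrightarrow> (\<And>j. \<delta> \<le> Im (\<tau> $ j)) \<Longrightarrow>
      norm (g \<tau>) \<le> K * (\<delta> powr (- (of_int k - \<epsilon>))) ^ CARD('n)"
  shows "g \<in> cusp_forms emb k (Gamma0 emb N J)"
  unfolding cusp_forms_def
proof (intro CollectI conjI ballI g)
  fix A assume A: "A \<in> GL2_plus emb"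
  obtain r where r: "algebraic_int r" "r \<noteq> 0" "\<forall>b\<in>ideal_scale r ring_of_integers. \<forall>\<tau>\<in>upper_half_space.
      slash emb k g A (\<tau> + rv (emb_vec b)) = slash emb k g A \<tau>"
    and "\<forall>u. algebraic_int u \<longrightarrow> algebraic_int (inverse u) \<longrightarrow> u \<noteq> 0 \<longrightarrow> algebraic_int ((u - 1) / r) \<longrightarrow>
      (\<forall>\<tau>\<in>upper_half_space. norm (slash emb k g A (square_scale u \<tau>)) = norm (slash emb k g A \<tau>))"
    using modular_form_symmetries[OF g N J A] by (elim exE conjE)
  define P where "P = ideal_scale r (ring_of_integers :: 'a set)"
  have P: "fractional_ideal P" unfolding P_def
    by (rule fractional_ideal_scale'[OF fractional_ideal_ring_of_integers r(2)])
  have L: "fractional_ideal (trace_dual P)" by (rule fractional_ideal_trace_dual[OF P])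
  obtain a where a: "has_fourier_expansion emb (trace_dual P) (slash emb k g A) a"
    using slash_fourier_expansion[OF g N J A P] r(3) unfolding P_def[symmetric] by blast
  obtain A' where A': "A' \<in> GL2_plus emb" "A' $ 2 $ 1 \<noteq> 0"
    "\<forall>\<tau>\<in>upper_half_space. slash emb k g A \<tau> = slash emb k g A' \<tau>"
    using move_cusp_from_infinity[OF A N J g] by (elim bexE conjE)
  have a': "has_fourier_expansion emb (trace_dual P) (slash emb k g A') a"
    using a A'(3) unfolding has_fourier_expansion_chr by simp
  obtain M where M: "\<forall>Y\<ge>1. norm (slash emb k g A' (vertical Y)) \<le> M * (Y powr (- \<epsilon>)) ^ CARD('n)"
    by (rule exE[OF decay_at_cusp[OF A'(1,2) k eps K]])
  have "a 0 = 0" by (rule constant_term_zero[OF L a' eps(1)]) (use M in blast)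
  then show "\<exists>L a. fractional_ideal L \<and> has_fourier_expansion emb L (slash emb k g A) a \<and> a 0 = 0"
    using L a by blast
qed

end

theorem theorem1p1:
  fixes emb :: "'n::finite \<Rightarrow> 'a::field_char_0 \<Rightarrow> real"
    and N :: "'a set" and k :: int and \<epsilon> :: real
    and h :: nat and I :: "nat \<Rightarrow> 'a set"
    and f :: "nat \<Rightarrow> complex^'n \<Rightarrow> complex"
  assumes "totally_real_number_field emb"
    and "nonzero_integral_ideal N"
    and "k \<ge> 3"
    and "strict_class_reps emb h I"
    and "0 < \<epsilon>" and "\<epsilon> \<le> (5 * of_int k - 7) / 10"
    and "f \<in> adelic_modular_forms emb h I k N"
    and "\<exists>c>0. \<forall>m. nonzero_integral_ideal m \<longrightarrow>
           cmod (adelic_fourier_coeff emb h I k m f)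
             \<le> c * real (ideal_norm m) powr (of_int k - 1 - \<epsilon>)"
  shows "f \<in> adelic_cusp_forms emb h I k N"
proof -
  interpret totally_real_field emb by unfold_locales (rule assms(1))
  have N: "fractional_ideal N" using assms(2) by (simp add: nonzero_integral_ideal_def)
  obtain c where c: "c > 0" "\<And>m. nonzero_integral_ideal m \<Longrightarrow>
      cmod (adelic_fourier_coeff emb h I k m f) \<le> c * real (ideal_norm m) powr (of_int k - 1 - \<epsilon>)"
    using assms(8) by blast
  have k3: "real_of_int k \<ge> 3" using assms(3) by linarith
  have s1: "of_int k - 1 - \<epsilon> > 0" using k3 assms(6) by (simp add: field_simps)
  have s2: "\<epsilon> < of_int k" using s1 by linarith
  note s = s1 s2
  have "f l \<in> cusp_forms emb k (Gamma0 emb N (I l))" if l: "l \<in> {1..h}" for l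
  proof -
    have J: "fractional_ideal (I l)" using assms(4) l by (simp add: strict_class_reps_def)
    have g: "f l \<in> modular_forms emb k (Gamma0 emb N (I l))"
      using assms(7) l unfolding adelic_modular_forms_def by (rule PiE_mem)
    have "\<exists>C\<ge>0. \<forall>\<xi>\<in>tpos_in (I l). norm (fourier_coeff emb (I l) (f l) \<xi>) \<le> C * nm \<xi> powr (of_int k - 1 - \<epsilon>)"
      by (rule fourier_coefficient_bound[where f = f and I = I and l = l, OF assms(4) l g N c])
    then obtain C where C: "C \<ge> 0" "\<forall>\<xi>\<in>tpos_in (I l). norm (fourier_coeff emb (I l) (f l) \<xi>) \<le> C * nm \<xi> powr (of_int k - 1 - \<epsilon>)"
      by (elim exE conjE)
    have "\<exists>K>0. \<forall>\<delta> \<tau>. 0 < \<delta> \<longrightarrow> \<delta> \<le> 1 \<longrightarrow> (\<forall>j. \<delta> \<le> Im (\<tau> $ j)) \<longrightarrow>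
        norm (f l \<tau>) \<le> K * (\<delta> powr (- (of_int k - 1 - \<epsilon> + 1))) ^ CARD('n)"
      by (rule growth_of_expansion[OF J form_fourier_expansion[OF assms(4) l N g] s(1) C(1)]) (rule bspec[OF C(2)])
    then obtain K where K: "K > 0" "\<forall>\<delta> \<tau>. 0 < \<delta> \<longrightarrow> \<delta> \<le> 1 \<longrightarrow> (\<forall>j. \<delta> \<le> Im (\<tau> $ j)) \<longrightarrow>
        norm (f l \<tau>) \<le> K * (\<delta> powr (- (of_int k - 1 - \<epsilon> + 1))) ^ CARD('n)"
      by (elim exE conjE)
    have e: "of_int k - 1 - \<epsilon> + 1 = of_int k - \<epsilon>" by simp
    show ?thesis
      by (rule cusp_form_if_moderate_growth[OF g N J _ assms(5) s(2) K(1)]) (use K(2) assms(3) in \<open>simp_all add: e\<close>)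
  qed
  then show ?thesis using assms(7) unfolding adelic_cusp_forms_def by blast
qed

end
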